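(* Let $(M,g)$ be a closed Kähler manifold of complex dimension $n$. If $n \geq 4$ and the Kähler curvature operator of $(M,g)$ is $\frac{n^2-n+2}{2}$-positive, then $h^{n-1,1}(M)=0$. If $n=3$ and the Kähler curvature operator of $(M,g)$ is $3$-positive, then $h^{2,1}(M)=0$.
   Context: Closed means compact without boundary. $h^{p,q}(M)$ denotes the Hodge number $\dim_{\mathbb{C}} H^{p,q}(M)$, i.e. the complex dimension of the space of harmonic $(p,q)$-forms. Kähler curvature operator: let $(M,g,J)$ be a Kähler manifold of complex dimension $n$. Give $\Lambda^2 TM$ the inner product for which $\{e_i\wedge e_j\}_{i<j}$ is orthonormal whenever $\{e_i\}$ is an orthonormal basis of the (real) tangent space. The Riemannian curvature operator is the self-adjoint operator on $\Lambda^2TM$ defined by $g(\mathcal{R}(X\wedge Y), Z\wedge W)=R(X,Y,Z,W)$, with sign convention such that $g(\mathcal{R}(X\wedge Y),X\wedge Y)$ is the sectional curvature for orthonormal $X,Y$. Let $\Lambda^{1,1}_{\mathbb{R}}TM\subset\Lambda^2TM$ be the subbundle of $J$-invariant real bivectors (of real rank $n^2$); it is identified with $\mathfrak{u}(TM)$, the skew-adjoint endomorphisms commuting with $J$, via $(x\wedge y)z=g(x,z)y-g(y,z)x$. Since $g$ is Kähler, the Riemannian curvature operator vanishes on the orthogonal complement of $\Lambda^{1,1}_{\mathbb{R}}TM$ and preserves $\Lambda^{1,1}_{\mathbb{R}}TM$. The restricted operator $\mathcal{R}\colon\Lambda^{1,1}_{\mathbb{R}}TM\to\Lambda^{1,1}_{\mathbb{R}}TM$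 is the Kähler curvature operator; its eigenvalues at each point are denoted $\lambda_1\leq\ldots\leq\lambda_{n^2}$. For a real number $k$, it is called $k$-positive if at every point $\lambda_1+\ldots+\lambda_{\lfloor k\rfloor}+(k-\lfloor k\rfloor)\lambda_{\lfloor k\rfloor+1}>0$. *)

theory Defs
  imports
    "HOL-Analysis.Analysis"
    "HOL-Library.Extended_Nat"
    "HOL-Library.Function_Algebras"
begin

section \<open>Calculus on open subsets of a Euclidean space\<close>

definition dir_deriv ::
    "('v::real_normed_vector \<Rightarrow> 'b::real_normed_vector) \<Rightarrow> 'v \<Rightarrow> 'v \<Rightarrow> 'b" where
  "dir_deriv f x v = frechet_derivative f (at x) v"

primrec C_k_on ::
    "nat \<Rightarrow> 'v::real_normed_vector set \<Rightarrow> ('v \<Rightarrow> 'b::real_normed_vector) \<Rightarrow> bool" where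
  "C_k_on 0 S f \<longleftrightarrow> continuous_on S f"
| "C_k_on (Suc k) S f \<longleftrightarrow>
     (\<forall>x\<in>S. f differentiable (at x)) \<and> (\<forall>v. C_k_on k S (\<lambda>x. dir_deriv f x v))"

definition smooth_on_open ::
    "'v::real_normed_vector set \<Rightarrow> ('v \<Rightarrow> 'b::real_normed_vector) \<Rightarrow> bool" where
  "smooth_on_open S f \<longleftrightarrow> open S \<and> (\<forall>k. C_k_on k S f)"

definition J :: "complex ^ 'n \<Rightarrow> complex ^ 'n" where
  "J v = \<i> *s v"

definition holomorphic_map_on :: "(complex ^ 'n::finite) set \<Rightarrow> (complex ^ 'n \<Rightarrow> complex ^ 'n) \<Rightarrow> bool" where
  "holomorphic_map_on S f \<longleftrightarrow> open S \<and>
     (\<forall>x\<in>S. \<exists>L. (f has_derivative L) (at x) \<and> (\<forall>c v. L (c *s v) = c *s L v))"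


section \<open>Complex manifolds\<close>

text \<open>
  A chart is a pair \<open>(U, \<phi>)\<close>; the values of \<open>\<phi>\<close> outside \<open>U\<close> are irrelevant. The (real) tangent
  space at a point is represented, in each chart, by \<open>complex ^ 'n\<close> viewed as a real vector space,
  with almost complex structure \<open>J\<close>. A tensor field is represented by the family of its local
  expressions, one for each chart of the atlas, subject to the transformation rule.
\<close>

type_synonym ('a, 'n) chart = "'a set \<times> ('a \<Rightarrow> complex ^ 'n)"

definition chart_image :: "('a, 'n) chart \<Rightarrow> (complex ^ 'n) set" where
  "chart_image c = snd c ` fst c"

definition overlap :: "('a, 'n) chart \<Rightarrow> ('a, 'n) chart \<Rightarrow> (complex ^ 'n) set" where
  "overlap c d = snd c ` (fst c \<inter> fst d)"

definition transition :: "('a, 'n) chart \<Rightarrow> ('a, 'n) chart \<Rightarrow> complex ^ 'n \<Rightarrow> complex ^ 'n" where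
  "transition c d = snd d \<circ> inv_into (fst c) (snd c)"

definition complex_atlas :: "'a topology \<Rightarrow> ('a, 'n::finite) chart set \<Rightarrow> bool" where
  "complex_atlas X \<A> \<longleftrightarrow>
     \<Union> (fst ` \<A>) = topspace X \<and>
     (\<forall>c\<in>\<A>. openin X (fst c) \<and> open (chart_image c) \<and>
        homeomorphic_map (subtopology X (fst c)) (top_of_set (chart_image c)) (snd c)) \<and>
     (\<forall>c\<in>\<A>. \<forall>d\<in>\<A>. holomorphic_map_on (overlap c d) (transition c d))"


section \<open>Differential forms\<close>

text \<open>
  A \<open>k\<close>-covector is a function on lists of tangent vectors that vanishes on lists of length
  different from \<open>k\<close>.
\<close>

definition alternating :: "nat \<Rightarrow> ('v::real_vector list \<Rightarrow> complex) \<Rightarrow> bool" where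
  "alternating k w \<longleftrightarrow>
     (\<forall>vs. length vs \<noteq> k \<longrightarrow> w vs = 0) \<and>
     (\<forall>vs i. length vs = k \<and> i < k \<longrightarrow> linear (\<lambda>v. w (vs[i := v]))) \<and>
     (\<forall>vs i j. length vs = k \<and> i < j \<and> j < k \<and> vs ! i = vs ! j \<longrightarrow> w vs = 0)"

definition wedge_covectors :: "('v \<Rightarrow> complex) list \<Rightarrow> 'v list \<Rightarrow> complex" where
  "wedge_covectors \<alpha>s vs =
     (if length vs = length \<alpha>s
      then \<Sum>\<sigma> | \<sigma> permutes {..<length \<alpha>s}.
             of_int (sign \<sigma>) * (\<Prod>i<length \<alpha>s. (\<alpha>s ! i) (vs ! \<sigma> i))
      else 0)"

definition type_1_0 :: "(complex ^ 'n::finite \<Rightarrow> complex) \<Rightarrow> bool" where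
  "type_1_0 \<alpha> \<longleftrightarrow> (\<forall>u v. \<alpha> (u + v) = \<alpha> u + \<alpha> v) \<and> (\<forall>c v. \<alpha> (c *s v) = c * \<alpha> v)"

definition type_0_1 :: "(complex ^ 'n::finite \<Rightarrow> complex) \<Rightarrow> bool" where
  "type_0_1 \<alpha> \<longleftrightarrow> (\<forall>u v. \<alpha> (u + v) = \<alpha> u + \<alpha> v) \<and> (\<forall>c v. \<alpha> (c *s v) = cnj c * \<alpha> v)"

definition covector_scale :: "complex \<Rightarrow> ('v list \<Rightarrow> complex) \<Rightarrow> 'v list \<Rightarrow> complex" where
  "covector_scale a w = (\<lambda>vs. a * w vs)"

lemma vector_space_covector_scale: "vector_space covector_scale"
  by unfold_locales (auto simp: covector_scale_def fun_eq_iff algebra_simps)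

definition pq_covectors :: "nat \<Rightarrow> nat \<Rightarrow> ((complex ^ 'n::finite) list \<Rightarrow> complex) set" where
  "pq_covectors p q = module.span covector_scale
     {wedge_covectors (\<alpha>s @ \<beta>s) | \<alpha>s \<beta>s. length \<alpha>s = p \<and> length \<beta>s = q \<and>
        (\<forall>\<alpha>\<in>set \<alpha>s. type_1_0 \<alpha>) \<and> (\<forall>\<beta>\<in>set \<beta>s. type_0_1 \<beta>)}"

text \<open>
  The vanishing outside the chart images makes a form determined by its geometric content, so that
  linear independence of families of local expressions is linear independence of forms.
\<close>

type_synonym ('a, 'n) form = "('a, 'n) chart \<Rightarrow> complex ^ 'n \<Rightarrow> (complex ^ 'n) list \<Rightarrow> complex"

definition differential_form :: "('a, 'n::finite) chart set \<Rightarrow> nat \<Rightarrow> ('a, 'n) form \<Rightarrow> bool" where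
  "differential_form \<A> k \<omega> \<longleftrightarrow>
     (\<forall>c\<in>\<A>. \<forall>x\<in>chart_image c. alternating k (\<omega> c x)) \<and>
     (\<forall>c\<in>\<A>. \<forall>vs. smooth_on_open (chart_image c) (\<lambda>x. \<omega> c x vs)) \<and>
     (\<forall>c\<in>\<A>. \<forall>d\<in>\<A>. \<forall>x\<in>overlap c d. \<forall>vs.
        \<omega> c x vs = \<omega> d (transition c d x) (map (dir_deriv (transition c d) x) vs)) \<and>
     (\<forall>c x vs. \<not> (c \<in> \<A> \<and> x \<in> chart_image c) \<longrightarrow> \<omega> c x vs = 0)"

definition pq_form :: "('a, 'n::finite) chart set \<Rightarrow> nat \<Rightarrow> nat \<Rightarrow> ('a, 'n) form \<Rightarrow> bool" where
  "pq_form \<A> p q \<omega> \<longleftrightarrow> differential_form \<A> (p + q) \<omega> \<and>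
     (\<forall>c\<in>\<A>. \<forall>x\<in>chart_image c. \<omega> c x \<in> pq_covectors p q)"

definition ext_deriv ::
    "('v::real_normed_vector \<Rightarrow> 'v list \<Rightarrow> 'b::real_normed_vector) \<Rightarrow> 'v \<Rightarrow> 'v list \<Rightarrow> 'b" where
  "ext_deriv w x vs =
     (\<Sum>i<length vs. (- 1) ^ i *\<^sub>R dir_deriv (\<lambda>y. w y (take i vs @ drop (Suc i) vs)) x (vs ! i))"


section \<open>Kaehler metrics\<close>

type_synonym 'v metric = "'v \<Rightarrow> 'v \<Rightarrow> 'v \<Rightarrow> real"

definition inner_product :: "('v::real_vector \<Rightarrow> 'v \<Rightarrow> real) \<Rightarrow> bool" where
  "inner_product b \<longleftrightarrow>
     (\<forall>u. linear (b u)) \<and> (\<forall>u v. b u v = b v u) \<and> (\<forall>u. u \<noteq> 0 \<longrightarrow> b u u > 0)"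

definition riemannian_metric ::
    "('a, 'n::finite) chart set \<Rightarrow> (('a, 'n) chart \<Rightarrow> (complex ^ 'n) metric) \<Rightarrow> bool" where
  "riemannian_metric \<A> g \<longleftrightarrow>
     (\<forall>c\<in>\<A>. \<forall>x\<in>chart_image c. inner_product (g c x)) \<and>
     (\<forall>c\<in>\<A>. \<forall>u v. smooth_on_open (chart_image c) (\<lambda>x. g c x u v)) \<and>
     (\<forall>c\<in>\<A>. \<forall>d\<in>\<A>. \<forall>x\<in>overlap c d. \<forall>u v.
        g c x u v = g d (transition c d x)
          (dir_deriv (transition c d) x u) (dir_deriv (transition c d) x v))"

definition kahler_form ::
    "(complex ^ 'n) metric \<Rightarrow> complex ^ 'n \<Rightarrow> (complex ^ 'n) list \<Rightarrow> real" where
  "kahler_form g x vs = g x (J (vs ! 0)) (vs ! 1)"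

definition kahler_metric ::
    "('a, 'n::finite) chart set \<Rightarrow> (('a, 'n) chart \<Rightarrow> (complex ^ 'n) metric) \<Rightarrow> bool" where
  "kahler_metric \<A> g \<longleftrightarrow> riemannian_metric \<A> g \<and>
     (\<forall>c\<in>\<A>. \<forall>x\<in>chart_image c. \<forall>u v. g c x (J u) (J v) = g c x u v) \<and>
     (\<forall>c\<in>\<A>. \<forall>x\<in>chart_image c. \<forall>u v w. ext_deriv (kahler_form (g c)) x [u, v, w] = 0)"

definition kahler_manifold ::
    "'a topology \<Rightarrow> ('a, 'n::finite) chart set \<Rightarrow> (('a, 'n) chart \<Rightarrow> (complex ^ 'n) metric) \<Rightarrow> bool" where
  "kahler_manifold X \<A> g \<longleftrightarrow>
     Hausdorff_space X \<and> second_countable X \<and> complex_atlas X \<A> \<and> kahler_metric \<A> g"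

definition closed_kahler_manifold ::
    "'a topology \<Rightarrow> ('a, 'n::finite) chart set \<Rightarrow> (('a, 'n) chart \<Rightarrow> (complex ^ 'n) metric) \<Rightarrow> bool" where
  "closed_kahler_manifold X \<A> g \<longleftrightarrow> kahler_manifold X \<A> g \<and> compact_space X"


section \<open>Levi-Civita connection, curvature and Hodge Laplacian in a chart\<close>

definition sharp :: "('v::real_vector \<Rightarrow> 'v \<Rightarrow> real) \<Rightarrow> ('v \<Rightarrow> real) \<Rightarrow> 'v" where
  "sharp b \<alpha> = (THE z. \<forall>w. b z w = \<alpha> w)"

text \<open>
  For constant vector fields \<open>u, v\<close> in a chart, \<open>christoffel g x u v\<close> is \<open>\<nabla>\<^sub>u v\<close>, given by the Koszul
  formula; hence \<open>\<nabla>\<^sub>u V = D\<^sub>u V + christoffel g x u V\<close> for a general vector field \<open>V\<close>.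
\<close>

definition christoffel :: "'v::euclidean_space metric \<Rightarrow> 'v \<Rightarrow> 'v \<Rightarrow> 'v \<Rightarrow> 'v" where
  "christoffel g x u v = sharp (g x)
     (\<lambda>w. (dir_deriv (\<lambda>y. g y v w) x u + dir_deriv (\<lambda>y. g y u w) x v
            - dir_deriv (\<lambda>y. g y u v) x w) / 2)"

text \<open>\<open>\<nabla>\<^sub>u \<nabla>\<^sub>v w - \<nabla>\<^sub>v \<nabla>\<^sub>u w\<close> for constant (hence commuting) vector fields \<open>u, v, w\<close> in the chart\<close>

definition curvature_endo :: "'v::euclidean_space metric \<Rightarrow> 'v \<Rightarrow> 'v \<Rightarrow> 'v \<Rightarrow> 'v \<Rightarrow> 'v" where
  "curvature_endo g x u v w =
     dir_deriv (\<lambda>y. christoffel g y v w) x u - dir_deriv (\<lambda>y. christoffel g y u w) x v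
     + christoffel g x u (christoffel g x v w) - christoffel g x v (christoffel g x u w)"

text \<open>The sign makes \<open>riem g x u v u v\<close> the sectional curvature for orthonormal \<open>u, v\<close>.\<close>

definition riem :: "'v::euclidean_space metric \<Rightarrow> 'v \<Rightarrow> 'v \<Rightarrow> 'v \<Rightarrow> 'v \<Rightarrow> 'v \<Rightarrow> real" where
  "riem g x u v z w = g x (curvature_endo g x u v w) z"

definition cov_deriv ::
    "'v::euclidean_space metric \<Rightarrow> ('v \<Rightarrow> 'v list \<Rightarrow> complex) \<Rightarrow> 'v \<Rightarrow> 'v \<Rightarrow> 'v list \<Rightarrow> complex" where
  "cov_deriv g w x u vs =
     dir_deriv (\<lambda>y. w y vs) x u - (\<Sum>i<length vs. w x (vs[i := christoffel g x u (vs ! i)]))"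

text \<open>
  The codifferential \<open>- tr\<^sub>g \<nabla>w\<close>, the formal adjoint of \<open>ext_deriv\<close>. The trace with respect to \<open>g\<close>
  pairs each vector \<open>e\<close> of the standard basis with the vector \<open>g\<close>-dual to it.
\<close>

definition codiff ::
    "'v::euclidean_space metric \<Rightarrow> ('v \<Rightarrow> 'v list \<Rightarrow> complex) \<Rightarrow> 'v \<Rightarrow> 'v list \<Rightarrow> complex" where
  "codiff g w x vs = - (\<Sum>e\<in>Basis. cov_deriv g w x e (sharp (g x) (\<lambda>z. e \<bullet> z) # vs))"

definition hodge_laplacian ::
    "'v::euclidean_space metric \<Rightarrow> ('v \<Rightarrow> 'v list \<Rightarrow> complex) \<Rightarrow> 'v \<Rightarrow> 'v list \<Rightarrow> complex" where
  "hodge_laplacian g w x vs = ext_deriv (codiff g w) x vs + codiff g (ext_deriv w) x vs"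


section \<open>Hodge numbers\<close>

definition harmonic_pq_forms ::
    "('a, 'n::finite) chart set \<Rightarrow> (('a, 'n) chart \<Rightarrow> (complex ^ 'n) metric) \<Rightarrow> nat \<Rightarrow> nat
     \<Rightarrow> ('a, 'n) form set" where
  "harmonic_pq_forms \<A> g p q =
     {\<omega>. pq_form \<A> p q \<omega> \<and>
        (\<forall>c\<in>\<A>. \<forall>x\<in>chart_image c. \<forall>vs. hodge_laplacian (g c) (\<omega> c) x vs = 0)}"

definition form_scale :: "complex \<Rightarrow> ('a, 'n) form \<Rightarrow> ('a, 'n) form" where
  "form_scale a \<omega> = (\<lambda>c x vs. a * \<omega> c x vs)"

lemma vector_space_form_scale: "vector_space form_scale"
  by unfold_locales (auto simp: form_scale_def fun_eq_iff algebra_simps)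

text \<open>
  The dimension is taken in \<open>enat\<close>, since \<open>vector_space.dim\<close> assigns \<open>0\<close> to infinite-dimensional
  spaces.
\<close>

definition hodge_number ::
    "('a, 'n::finite) chart set \<Rightarrow> (('a, 'n) chart \<Rightarrow> (complex ^ 'n) metric) \<Rightarrow> nat \<Rightarrow> nat \<Rightarrow> enat" where
  "hodge_number \<A> g p q =
     (SUP B \<in> {B. finite B \<and> B \<subseteq> harmonic_pq_forms \<A> g p q \<and> \<not> module.dependent form_scale B}.
        enat (card B))"


section \<open>The Kaehler curvature operator\<close>

text \<open>
  Bivectors at a point with inner product \<open>b\<close> are represented by the \<open>b\<close>-skew-adjoint endomorphisms,
  where \<open>x \<and> y\<close> corresponds to \<open>z \<mapsto> b x z y - b y z x\<close>. The inner product \<open>- tr (A \<circ> B) / 2\<close> is the one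
  for which the \<open>e\<^sub>i \<and> e\<^sub>j\<close> with \<open>i < j\<close> are orthonormal whenever the \<open>e\<^sub>i\<close> are \<open>b\<close>-orthonormal.
\<close>

definition bivectors :: "('v::euclidean_space \<Rightarrow> 'v \<Rightarrow> real) \<Rightarrow> ('v \<Rightarrow>\<^sub>L 'v) set" where
  "bivectors b = {A. \<forall>u v. b (blinfun_apply A u) v = - b u (blinfun_apply A v)}"

definition wedge ::
    "('v::euclidean_space \<Rightarrow> 'v \<Rightarrow> real) \<Rightarrow> 'v \<Rightarrow> 'v \<Rightarrow> ('v \<Rightarrow>\<^sub>L 'v)" where
  "wedge b x y = Blinfun (\<lambda>z. b x z *\<^sub>R y - b y z *\<^sub>R x)"

definition bivector_inner :: "('v::euclidean_space \<Rightarrow>\<^sub>L 'v) \<Rightarrow> ('v \<Rightarrow>\<^sub>L 'v) \<Rightarrow> real" where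
  "bivector_inner A B = - (\<Sum>e\<in>Basis. blinfun_apply A (blinfun_apply B e) \<bullet> e) / 2"

lemma blinfun_apply_wedge:
  fixes b :: "'v::euclidean_space \<Rightarrow> 'v \<Rightarrow> real"
  assumes "inner_product b"
  shows "blinfun_apply (wedge b x y) z = b x z *\<^sub>R y - b y z *\<^sub>R x"
proof -
  have lin: "linear (b u)" for u
    using assms by (auto simp: inner_product_def)
  have "linear (\<lambda>z. b x z *\<^sub>R y - b y z *\<^sub>R x)"
    by (rule linearI) (simp_all add: linear_add[OF lin] linear_cmul[OF lin] algebra_simps)
  then have "bounded_linear (\<lambda>z. b x z *\<^sub>R y - b y z *\<^sub>R x)"
    by (simp add: linear_conv_bounded_linear)
  then show ?thesis
    by (simp add: wedge_def bounded_linear_Blinfun_apply)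
qed

lemma bivector_inner_wedge:
  fixes b :: "'v::euclidean_space \<Rightarrow> 'v \<Rightarrow> real"
  assumes "inner_product b" and "A \<in> bivectors b"
  shows "bivector_inner A (wedge b x y) = b (blinfun_apply A x) y"
proof -
  have lin: "linear (b u)" for u
    using assms(1) by (auto simp: inner_product_def)
  have sym: "b u v = b v u" for u v
    using assms(1) by (auto simp: inner_product_def)
  have exp: "b u v = (\<Sum>e\<in>Basis. b u e * (v \<bullet> e))" for u v
  proof -
    have "b u v = b u (\<Sum>e\<in>Basis. (v \<bullet> e) *\<^sub>R e)"
      by (simp add: euclidean_representation)
    also have "\<dots> = (\<Sum>e\<in>Basis. b u e * (v \<bullet> e))"
      by (simp add: linear_sum[OF lin] linear_cmul[OF lin] mult.commute)
    finally show ?thesis .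
  qed
  have "(\<Sum>e\<in>Basis. blinfun_apply A (blinfun_apply (wedge b x y) e) \<bullet> e)
      = b x (blinfun_apply A y) - b y (blinfun_apply A x)"
    unfolding exp[of x "blinfun_apply A y"] exp[of y "blinfun_apply A x"]
    by (simp add: blinfun_apply_wedge[OF assms(1)] blinfun.diff_right blinfun.scaleR_right
        inner_diff_left sum_subtractf)
  also have "\<dots> = - 2 * b (blinfun_apply A x) y"
  proof -
    have "b (blinfun_apply A x) y = - b x (blinfun_apply A y)"
      using assms(2) by (simp add: bivectors_def)
    then show ?thesis
      using sym[of y "blinfun_apply A x"] by simp
  qed
  finally show ?thesis
    by (simp add: bivector_inner_def)
qed

definition real_11_bivectors ::
    "(complex ^ 'n::finite \<Rightarrow> complex ^ 'n \<Rightarrow> real) \<Rightarrow> ((complex ^ 'n) \<Rightarrow>\<^sub>L (complex ^ 'n)) set" where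
  "real_11_bivectors b =
     {A \<in> bivectors b. \<forall>v. blinfun_apply A (J v) = J (blinfun_apply A v)}"

text \<open>The defining conditions determine the operator on \<open>bivectors (g x)\<close>, the only place it is used.\<close>

definition curvature_operator ::
    "'v::euclidean_space metric \<Rightarrow> 'v \<Rightarrow> ('v \<Rightarrow>\<^sub>L 'v) \<Rightarrow> ('v \<Rightarrow>\<^sub>L 'v)" where
  "curvature_operator g x = (SOME \<R>. linear \<R> \<and> \<R> ` bivectors (g x) \<subseteq> bivectors (g x) \<and>
     (\<forall>u v z w. bivector_inner (\<R> (wedge (g x) u v)) (wedge (g x) z w) = riem g x u v z w))"

definition kahler_eigenspace ::
    "(complex ^ 'n::finite) metric \<Rightarrow> complex ^ 'n \<Rightarrow> real \<Rightarrow> ((complex ^ 'n) \<Rightarrow>\<^sub>L (complex ^ 'n)) set" where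
  "kahler_eigenspace g x l = {A \<in> real_11_bivectors (g x). curvature_operator g x A = l *\<^sub>R A}"

text \<open>The list \<open>\<lambda>\<^sub>1 \<le> \<lambda>\<^sub>2 \<le> \<dots>\<close> of eigenvalues with multiplicity, indexed from \<open>0\<close>\<close>

definition kahler_eigenvalues :: "(complex ^ 'n::finite) metric \<Rightarrow> complex ^ 'n \<Rightarrow> real list" where
  "kahler_eigenvalues g x =
     (THE ls. sorted ls \<and> (\<forall>l. count_list ls l = dim (kahler_eigenspace g x l)))"

definition kahler_curvature_positive ::
    "('a, 'n::finite) chart set \<Rightarrow> (('a, 'n) chart \<Rightarrow> (complex ^ 'n) metric) \<Rightarrow> real \<Rightarrow> bool" where
  "kahler_curvature_positive \<A> g k \<longleftrightarrow>
     (\<forall>c\<in>\<A>. \<forall>x\<in>chart_image c.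
        (\<Sum>i<nat \<lfloor>k\<rfloor>. kahler_eigenvalues (g c) x ! i)
        + (k - of_int \<lfloor>k\<rfloor>) * kahler_eigenvalues (g c) x ! nat \<lfloor>k\<rfloor> > 0)"

end

theory Submission
  imports Defs
begin

text \<open>
  The Bochner method with the maximum principle in place of integration. Let \<open>w\<close> be a harmonic \<open>(n - 1, 1)\<close>-form. At a
  maximum of \<open>|w|\<^sup>2\<close> the Weitzenboeck formula gives \<open>\<Sum>\<^sub>a \<lambda>\<^sub>a |\<Xi>\<^sub>a \<cdot> w|\<^sup>2 \<le> 0\<close>, where the \<open>\<Xi>\<^sub>a\<close> form an orthonormal
  eigenbasis of the Kaehler curvature operator acting on forms as a derivation. Write \<open>w = H \<cdot> D\<close> with \<open>D\<close> a
  complex volume form and \<open>H\<close> an antilinear endomorphism; then \<open>|\<Xi>\<^sub>a \<cdot> w|\<^sup>2\<close> splits into the contributions of the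
  symmetric and of the skew part of \<open>H\<close>. By the Bianchi identity the weighted sum of each contribution equals
  \<open>\<Sum>\<^sub>a \<lambda>\<^sub>a v\<^sub>a\<close> for suitable \<open>0 \<le> v\<^sub>a \<le> M\<close> with \<open>\<Sum>\<^sub>a v\<^sub>a \<ge> M k\<close>, and such a sum is positive as soon as the
  sum of the \<open>k\<close> lowest eigenvalues is. For the symmetric part, diagonalized by a Takagi frame, the \<open>v\<^sub>a\<close> come from a
  convex combination of quadratic forms whose existence rests on an eigenvalue bound for signless graph Laplacians; for
  the skew part \<open>v\<^sub>a = |H|\<^sup>2 - 2 |H \<Xi>\<^sub>a|\<^sup>2\<close>. Hence \<open>w\<close> vanishes at its maximum, and so everywhere.
\<close>

subsection \<open>Directional derivatives\<close>

text \<open>The two constants come from two different bottlenecks. For the skew part the weights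
  \<open>v\<close> add up to \<open>n * (n - 2)\<close> times their maximum. For the symmetric part
  they have maximum 2 and sum at least \<open>n\<^sup>2 - n + 2\<close>, or 7 if
  \<open>n = 3\<close>. From dimension 4 on the symmetric part is the stricter one and gives
  \<open>(n\<^sup>2 - n + 2) / 2\<close>; in dimension 3 the skew part admits only 3. The obstacle
  is the symmetric part. The trace of an eigenvector enters the diagonal entries, so the norm
  contains products \<open>s a i i * s a j j\<close>, and as a quadratic form in the diagonal it can
  be as large as \<open>n\<close>, far outside [0, 2]. After weighting by eigenvalues the Bianchi
  identity lets such products be traded for squares of off-diagonal entries. How much to trade for
  each pair has to be chosen so that all coefficients become admissible at once and their sum stays
  large. With the maximum principle the representation by \<open>H\<close> and \<open>D\<close> is
  needed at one point only, so \<open>D\<close> need not extend to a form on the manifold.\<close>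

lemma dir_deriv_eq: "(f has_derivative f') (at x) \<Longrightarrow> dir_deriv f x v = f' v"
  by (metis dir_deriv_def frechet_derivative_at)

lemma has_derivative_dir_deriv: "f differentiable (at x) \<Longrightarrow> (f has_derivative dir_deriv f x) (at x)"
  by (metis dir_deriv_def ext frechet_derivative_works)

lemma linear_dir_deriv: "f differentiable (at x) \<Longrightarrow> linear (dir_deriv f x)"
  using has_derivative_dir_deriv has_derivative_linear by blast

lemma dir_deriv_const [simp]: "dir_deriv (\<lambda>x. c) x v = 0"
  by (rule dir_deriv_eq) (rule has_derivative_const)

lemma dir_deriv_add:
  "f differentiable (at x) \<Longrightarrow> g differentiable (at x) \<Longrightarrow>
   dir_deriv (\<lambda>x. f x + g x) x v = dir_deriv f x v + dir_deriv g x v"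
  by (rule dir_deriv_eq) (intro has_derivative_add has_derivative_dir_deriv)

lemma dir_deriv_diff:
  "f differentiable (at x) \<Longrightarrow> g differentiable (at x) \<Longrightarrow>
   dir_deriv (\<lambda>x. f x - g x) x v = dir_deriv f x v - dir_deriv g x v"
  by (rule dir_deriv_eq) (intro has_derivative_diff has_derivative_dir_deriv)

lemma dir_deriv_minus:
  "f differentiable (at x) \<Longrightarrow> dir_deriv (\<lambda>x. - f x) x v = - dir_deriv f x v"
  by (rule dir_deriv_eq) (intro has_derivative_minus has_derivative_dir_deriv)

lemma dir_deriv_sum:
  "(\<And>i. i \<in> I \<Longrightarrow> f i differentiable (at x)) \<Longrightarrow>
   dir_deriv (\<lambda>x. \<Sum>i\<in>I. f i x) x v = (\<Sum>i\<in>I. dir_deriv (f i) x v)"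
  by (rule dir_deriv_eq) (intro has_derivative_sum has_derivative_dir_deriv)

lemma differentiable_sum_fun:
  assumes "\<And>i. i \<in> I \<Longrightarrow> f i differentiable (at x)"
  shows "(\<lambda>x. \<Sum>i\<in>I. f i x) differentiable (at x)"
  unfolding differentiable_def
  by (rule exI, rule has_derivative_sum) (use assms has_derivative_dir_deriv in blast)

lemma bilinear_has_derivative:
  assumes "bounded_bilinear h" "f differentiable (at x)" "g differentiable (at x)"
  shows "((\<lambda>x. h (f x) (g x)) has_derivative
    (\<lambda>v. h (f x) (dir_deriv g x v) + h (dir_deriv f x v) (g x))) (at x)"
  by (rule bounded_bilinear.FDERIV[OF assms(1)]) (use assms(2,3) has_derivative_dir_deriv in auto)

lemma dir_deriv_bilinear:
  assumes "bounded_bilinear h" "f differentiable (at x)" "g differentiable (at x)"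
  shows "dir_deriv (\<lambda>x. h (f x) (g x)) x v = h (f x) (dir_deriv g x v) + h (dir_deriv f x v) (g x)"
  by (rule dir_deriv_eq[OF bilinear_has_derivative[OF assms]])

lemma differentiable_bilinear:
  assumes "bounded_bilinear h" "f differentiable (at x)" "g differentiable (at x)"
  shows "(\<lambda>x. h (f x) (g x)) differentiable (at x)"
  using bilinear_has_derivative[OF assms] differentiable_def by blast

lemma linear_has_derivative:
  assumes "bounded_linear h" "f differentiable (at x)"
  shows "((\<lambda>x. h (f x)) has_derivative (\<lambda>v. h (dir_deriv f x v))) (at x)"
  using bounded_linear.has_derivative[OF assms(1)] assms(2) has_derivative_dir_deriv by blast

lemma dir_deriv_linear:
  assumes "bounded_linear h" "f differentiable (at x)"
  shows "dir_deriv (\<lambda>x. h (f x)) x v = h (dir_deriv f x v)"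
  by (rule dir_deriv_eq[OF linear_has_derivative[OF assms]])

lemma differentiable_linear:
  assumes "bounded_linear h" "f differentiable (at x)"
  shows "(\<lambda>x. h (f x)) differentiable (at x)"
  using linear_has_derivative[OF assms] differentiable_def by blast

lemma has_derivative_cong_open:
  assumes "open S" "x \<in> S" "\<And>y. y \<in> S \<Longrightarrow> f y = g y"
  shows "(f has_derivative L) (at x) \<longleftrightarrow> (g has_derivative L) (at x)"
  by (metis assms has_derivative_transform_within_open)

lemma dir_deriv_cong_open:
  assumes "open S" "x \<in> S" "\<And>y. y \<in> S \<Longrightarrow> f y = g y"
  shows "dir_deriv f x = dir_deriv g x"
  using has_derivative_cong_open[of S x f g] assms
  by (auto simp: dir_deriv_def frechet_derivative_def)

lemma differentiable_cong_open:
  assumes "open S" "x \<in> S" "\<And>y. y \<in> S \<Longrightarrow> f y = g y"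
  shows "f differentiable (at x) \<longleftrightarrow> g differentiable (at x)"
  using has_derivative_cong_open[of S x f g] assms
  by (auto simp: differentiable_def)

lemma differentiable_basis_expansion:
  fixes f :: "'v::real_normed_vector \<Rightarrow> 'e::euclidean_space"
  assumes "\<And>e. e \<in> Basis \<Longrightarrow> (\<lambda>x. f x \<bullet> e) differentiable (at x)"
  shows "f differentiable (at x)"
proof -
  have "f = (\<lambda>x. \<Sum>e\<in>Basis. (f x \<bullet> e) *\<^sub>R e)"
    by (simp add: euclidean_representation)
  moreover have "(\<lambda>x. \<Sum>e\<in>Basis. (f x \<bullet> e) *\<^sub>R e) differentiable (at x)"
    using assms by (intro differentiable_sum_fun differentiable_bilinear[OF bounded_bilinear_scaleR] differentiable_const)
  ultimately show ?thesis by simp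
qed

lemma differentiable_at_continuous:
  "f differentiable (at x) \<Longrightarrow> isCont f x"
  by (rule differentiable_imp_continuous_within)

lemma vector_derivative_line:
  assumes "f differentiable (at (x + t *\<^sub>R u))"
  shows "((\<lambda>t. f (x + t *\<^sub>R u)) has_vector_derivative dir_deriv f (x + t *\<^sub>R u) u) (at t)"
proof -
  have 1: "((\<lambda>t. x + t *\<^sub>R u) has_derivative (\<lambda>s. s *\<^sub>R u)) (at t)"
    by (auto intro!: derivative_eq_intros)
  have "((\<lambda>t. f (x + t *\<^sub>R u)) has_derivative (\<lambda>s. dir_deriv f (x + t *\<^sub>R u) (s *\<^sub>R u))) (at t)"
    using has_derivative_compose[OF 1 has_derivative_dir_deriv[OF assms]] .
  then show ?thesis
    by (simp add: has_vector_derivative_def linear_cmul[OF linear_dir_deriv[OF assms]])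
qed

lemma mean_value_dir:
  fixes f :: "'v::real_normed_vector \<Rightarrow> real"
  assumes "0 < d" "\<And>t. 0 \<le> t \<Longrightarrow> t \<le> d \<Longrightarrow> f differentiable (at (x + t *\<^sub>R u))"
  obtains t where "0 < t" "t < d" "f (x + d *\<^sub>R u) - f x = d * dir_deriv f (x + t *\<^sub>R u) u"
proof -
  have "\<exists>t>0. t < d \<and> f (x + d *\<^sub>R u) - f (x + 0 *\<^sub>R u) = (d - 0) * dir_deriv f (x + t *\<^sub>R u) u"
    using assms vector_derivative_line[of f x _ u]
    by (intro MVT2) (auto simp: has_real_derivative_iff_has_vector_derivative)
  then show ?thesis using that by auto
qed

section \<open>Smooth functions: symmetry of second derivatives and conditions at a maximum\<close>

lemma smooth_on_open_open: "smooth_on_open S f \<Longrightarrow> open S"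
  by (simp add: smooth_on_open_def)

lemma smooth_differentiable: "smooth_on_open S f \<Longrightarrow> x \<in> S \<Longrightarrow> f differentiable (at x)"
  unfolding smooth_on_open_def by (metis C_k_on.simps(2))

lemma smooth_dir_deriv: "smooth_on_open S f \<Longrightarrow> smooth_on_open S (\<lambda>x. dir_deriv f x v)"
  unfolding smooth_on_open_def by (metis C_k_on.simps(2))

lemma smooth_continuous_on: "smooth_on_open S f \<Longrightarrow> continuous_on S f"
  unfolding smooth_on_open_def by (metis C_k_on.simps(1))

text \<open>Two uses of the mean value theorem: one for the increment along \<open>v\<close> as a
  function along \<open>u\<close>, one for the resulting derivative along \<open>v\<close>. The left
  side is symmetric in \<open>u\<close> and \<open>v\<close>, so continuity of second derivatives is
  all that is missing for Schwarz's theorem.\<close>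

lemma second_difference:
  fixes f :: "'v::real_normed_vector \<Rightarrow> real"
  assumes sm: "smooth_on_open S f" and "ball x r \<subseteq> S" and d: "0 < d" "d * (norm u + norm v) < r"
  obtains y where "dist x y < r"
    "f (x + d *\<^sub>R u + d *\<^sub>R v) - f (x + d *\<^sub>R u) - f (x + d *\<^sub>R v) + f x
      = d * d * dir_deriv (\<lambda>y. dir_deriv f y u) y v"
proof -
  have inS: "x + s *\<^sub>R u + t *\<^sub>R v \<in> ball x r" if "0 \<le> s" "s \<le> d" "0 \<le> t" "t \<le> d" for s t
  proof -
    have "norm (s *\<^sub>R u + t *\<^sub>R v) \<le> s * norm u + t * norm v"
      using that by (metis abs_of_nonneg norm_scaleR norm_triangle_ineq)
    also have "\<dots> \<le> d * norm u + d * norm v"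
      using that by (intro add_mono mult_right_mono) auto
    also have "\<dots> < r" using d by (simp add: algebra_simps)
    finally have "norm (s *\<^sub>R u + t *\<^sub>R v) < r" .
    moreover have "dist x (x + s *\<^sub>R u + t *\<^sub>R v) = norm (s *\<^sub>R u + t *\<^sub>R v)"
      by (simp only: dist_norm norm_minus_commute[of x]) (simp add: algebra_simps)
    ultimately show ?thesis by simp
  qed
  have diff: "f differentiable (at (x + s *\<^sub>R u + t *\<^sub>R v))"
    if "0 \<le> s" "s \<le> d" "0 \<le> t" "t \<le> d" for s t
    using smooth_differentiable[OF sm] inS[OF that] assms(2) by blast
  define F where "F = (\<lambda>y. f (y + d *\<^sub>R v) - f y)"
  have comp: "(\<lambda>y. f (y + c)) differentiable (at z)" "dir_deriv (\<lambda>y. f (y + c)) z w = dir_deriv f (z + c) w"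
    if "f differentiable (at (z + c))" for z c w
  proof -
    have 1: "((\<lambda>y. y + c) has_derivative (\<lambda>h. h)) (at z)"
      by (auto intro!: derivative_eq_intros)
    have 2: "((\<lambda>y. f (y + c)) has_derivative dir_deriv f (z + c)) (at z)"
      using has_derivative_compose[OF 1 has_derivative_dir_deriv[OF that]] .
    show "(\<lambda>y. f (y + c)) differentiable (at z)" using 2 differentiable_def by blast
    show "dir_deriv (\<lambda>y. f (y + c)) z w = dir_deriv f (z + c) w" using dir_deriv_eq[OF 2] .
  qed
  have Fd: "F differentiable (at (x + s *\<^sub>R u))"
    "dir_deriv F (x + s *\<^sub>R u) u = dir_deriv f (x + s *\<^sub>R u + d *\<^sub>R v) u - dir_deriv f (x + s *\<^sub>R u) u"
    if "0 \<le> s" "s \<le> d" for s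
    using that diff[of s d] diff[of s 0] d comp[of "x + s *\<^sub>R u" "d *\<^sub>R v"]
    by (auto simp: F_def dir_deriv_diff)
  obtain s where s: "0 < s" "s < d" "F (x + d *\<^sub>R u) - F x = d * dir_deriv F (x + s *\<^sub>R u) u"
    using mean_value_dir[of d F x u] d Fd by (metis less_imp_le)
  have D2: "(\<lambda>y. dir_deriv f y u) differentiable (at ((x + s *\<^sub>R u) + t *\<^sub>R v))"
    if "0 \<le> t" "t \<le> d" for t
    using smooth_differentiable[OF smooth_dir_deriv[OF sm]] inS[of s t] that s assms(2) by auto
  obtain t where t: "0 < t" "t < d"
    "dir_deriv f ((x + s *\<^sub>R u) + d *\<^sub>R v) u - dir_deriv f (x + s *\<^sub>R u) u
      = d * dir_deriv (\<lambda>y. dir_deriv f y u) ((x + s *\<^sub>R u) + t *\<^sub>R v) v"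
    using mean_value_dir[of d "\<lambda>y. dir_deriv f y u" "x + s *\<^sub>R u" v] d D2 by (metis less_imp_le)
  show ?thesis
  proof
    show "dist x (x + s *\<^sub>R u + t *\<^sub>R v) < r" using inS[of s t] s t by simp
    have "f (x + d *\<^sub>R u + d *\<^sub>R v) - f (x + d *\<^sub>R u) - f (x + d *\<^sub>R v) + f x = F (x + d *\<^sub>R u) - F x"
      by (simp add: F_def)
    also have "\<dots> = d * (d * dir_deriv (\<lambda>y. dir_deriv f y u) ((x + s *\<^sub>R u) + t *\<^sub>R v) v)"
      using s t Fd[of s] by simp
    finally show "f (x + d *\<^sub>R u + d *\<^sub>R v) - f (x + d *\<^sub>R u) - f (x + d *\<^sub>R v) + f x
      = d * d * dir_deriv (\<lambda>y. dir_deriv f y u) (x + s *\<^sub>R u + t *\<^sub>R v) v" by simp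
  qed
qed

lemma second_derivative_symmetric_real:
  fixes f :: "'v::real_normed_vector \<Rightarrow> real"
  assumes sm: "smooth_on_open S f" and x: "x \<in> S"
  shows "dir_deriv (\<lambda>y. dir_deriv f y u) x v = dir_deriv (\<lambda>y. dir_deriv f y v) x u"
proof (rule ccontr)
  let ?A = "\<lambda>x. dir_deriv (\<lambda>y. dir_deriv f y u) x v"
  let ?B = "\<lambda>x. dir_deriv (\<lambda>y. dir_deriv f y v) x u"
  assume ne: "?A x \<noteq> ?B x"
  have opS: "open S" using sm smooth_on_open_open by blast
  have "continuous_on S ?A" "continuous_on S ?B"
    using sm smooth_dir_deriv smooth_continuous_on by blast+
  then have cont: "isCont ?A x" "isCont ?B x"
    using opS x continuous_on_eq_continuous_at by blast+
  define \<epsilon> where "\<epsilon> = dist (?A x) (?B x) / 2"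
  have "\<epsilon> > 0" using ne by (simp add: \<epsilon>_def)
  obtain a where a: "a > 0" "\<And>y. dist y x < a \<Longrightarrow> dist (?A y) (?A x) < \<epsilon>"
    using cont(1) \<open>\<epsilon> > 0\<close> unfolding continuous_at_eps_delta by blast
  obtain b where b: "b > 0" "\<And>y. dist y x < b \<Longrightarrow> dist (?B y) (?B x) < \<epsilon>"
    using cont(2) \<open>\<epsilon> > 0\<close> unfolding continuous_at_eps_delta by blast
  obtain c where c: "c > 0" "ball x c \<subseteq> S" using opS x open_contains_ball by blast
  define r where "r = min a (min b c)"
  have r: "r > 0" "ball x r \<subseteq> S" using a b c by (auto simp: r_def)
  \<comment> \<open>The factor 2 leaves room inside the ball; the added 1 covers the case that both
    vectors vanish.\<close>
  define d where "d = r / (2 * (norm u + norm v + 1))"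
  have pos: "norm u + norm v + 1 > 0" by (simp add: add_nonneg_pos)
  have d: "d > 0" using r pos by (simp add: d_def)
  have "d * (norm u + norm v) \<le> d * (norm u + norm v + 1)" using d by simp
  also have "\<dots> = r / 2" using pos by (simp add: d_def field_simps)
  also have "\<dots> < r" using r by simp
  finally have dr: "d * (norm u + norm v) < r" .
  obtain y where y: "dist x y < r" "f (x + d *\<^sub>R u + d *\<^sub>R v) - f (x + d *\<^sub>R u) - f (x + d *\<^sub>R v) + f x = d * d * ?A y"
    using second_difference[OF sm r(2) d dr] by blast
  obtain z where z: "dist x z < r" "f (x + d *\<^sub>R v + d *\<^sub>R u) - f (x + d *\<^sub>R v) - f (x + d *\<^sub>R u) + f x = d * d * ?B z"
    using second_difference[OF sm r(2) d, of v u] dr by (metis add.commute)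
  have "d * d * ?A y = d * d * ?B z" using y(2) z(2) by (simp add: algebra_simps)
  then have eq: "?A y = ?B z" using d by simp
  have "dist (?A y) (?A x) < \<epsilon>" "dist (?B z) (?B x) < \<epsilon>"
    using a(2)[of y] b(2)[of z] y(1) z(1) by (auto simp: r_def dist_commute)
  then have "dist (?A x) (?B x) < 2 * \<epsilon>"
    using eq dist_triangle2[of "?A x" "?B x" "?A y"] by (simp add: dist_commute)
  then show False by (simp add: \<epsilon>_def)
qed

lemma C_k_on_cong:
  "open S \<Longrightarrow> (\<And>x. x \<in> S \<Longrightarrow> f x = g x) \<Longrightarrow> C_k_on k S f \<longleftrightarrow> C_k_on k S g"
proof (induction k arbitrary: f g)
  case 0 then show ?case by (simp cong: continuous_on_cong)
next
  case (Suc k)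
  have "C_k_on k S (\<lambda>x. dir_deriv f x v) \<longleftrightarrow> C_k_on k S (\<lambda>x. dir_deriv g x v)" for v
    using Suc.prems by (intro Suc.IH) (simp_all add: dir_deriv_cong_open[of S _ f g])
  then show ?case using Suc.prems differentiable_cong_open[of S _ f g] by auto
qed

lemma smooth_linear:
  assumes "bounded_linear h" "smooth_on_open S f"
  shows "smooth_on_open S (\<lambda>x. h (f x))"
proof -
  have op: "open S" using assms(2) by (simp add: smooth_on_open_def)
  have "C_k_on k S (\<lambda>x. h (f x))" if "\<And>k. C_k_on k S f" for k f
    using that
  proof (induction k arbitrary: f)
    case 0
    have "continuous_on S f" using 0 by (metis C_k_on.simps(1))
    then show ?case using continuous_on_compose2[OF linear_continuous_on[OF assms(1), of UNIV]] by auto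
  next
    case (Suc k)
    have df: "\<forall>x\<in>S. f differentiable (at x)" "\<And>v k. C_k_on k S (\<lambda>x. dir_deriv f x v)"
      using Suc.prems by (metis C_k_on.simps(2))+
    have "C_k_on k S (\<lambda>x. dir_deriv (\<lambda>x. h (f x)) x v)" for v
      using Suc.IH[OF df(2)] C_k_on_cong[OF op, of "\<lambda>x. dir_deriv (\<lambda>x. h (f x)) x v" "\<lambda>x. h (dir_deriv f x v)"]
        dir_deriv_linear[OF assms(1)] df(1) by blast
    moreover have "(\<lambda>x. h (f x)) differentiable (at x)" if "x \<in> S" for x
      using df(1) that differentiable_linear[OF assms(1)] by blast
    ultimately show ?case by simp
  qed
  then show ?thesis using assms(2) by (simp add: smooth_on_open_def)
qed

lemma second_derivative_symmetric:
  fixes f :: "'v::real_normed_vector \<Rightarrow> 'e::euclidean_space"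
  assumes sm: "smooth_on_open S f" and x: "x \<in> S"
  shows "dir_deriv (\<lambda>y. dir_deriv f y u) x v = dir_deriv (\<lambda>y. dir_deriv f y v) x u"
proof (rule euclidean_eqI)
  fix e :: 'e assume "e \<in> Basis"
  have bl: "bounded_linear (\<lambda>z. z \<bullet> e)" by (rule bounded_linear_inner_left)
  have op: "open S" using sm by (simp add: smooth_on_open_def)
  have sm': "smooth_on_open S (\<lambda>x. f x \<bullet> e)" by (rule smooth_linear[OF bl sm])
  have eq: "dir_deriv (\<lambda>y. dir_deriv f y u) x v \<bullet> e = dir_deriv (\<lambda>y. dir_deriv (\<lambda>x. f x \<bullet> e) y u) x v" for u v
  proof -
    have "dir_deriv (\<lambda>y. dir_deriv (\<lambda>x. f x \<bullet> e) y u) x = dir_deriv (\<lambda>y. dir_deriv f y u \<bullet> e) x"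
      using dir_deriv_linear[OF bl] smooth_differentiable[OF sm]
      by (intro dir_deriv_cong_open[OF op x]) auto
    then show ?thesis
      using dir_deriv_linear[OF bl smooth_differentiable[OF smooth_dir_deriv[OF sm] x]] by simp
  qed
  show "dir_deriv (\<lambda>y. dir_deriv f y u) x v \<bullet> e = dir_deriv (\<lambda>y. dir_deriv f y v) x u \<bullet> e"
    unfolding eq by (rule second_derivative_symmetric_real[OF sm' x])
qed

text \<open>A positive second derivative would make the first derivative positive just beyond
  \<open>x\<close>, and the mean value theorem would produce a larger value. The regularity assumed
  is low on purpose: the function is the squared norm of a tensor field, and Christoffel symbols are
  only shown to be differentiable once.\<close>

lemma local_max_derivatives:
  fixes f :: "'v::real_normed_vector \<Rightarrow> real"
  assumes op: "open S" and x: "x \<in> S" and max: "\<And>y. y \<in> S \<Longrightarrow> f y \<le> f x"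
    and d1: "\<And>y. y \<in> S \<Longrightarrow> f differentiable (at y)"
    and d2: "(\<lambda>y. dir_deriv f y u) differentiable (at x)"
  shows "dir_deriv f x v = 0" "dir_deriv (\<lambda>y. dir_deriv f y u) x u \<le> 0"
proof -
  obtain r where r: "r > 0" "ball x r \<subseteq> S" using op x open_contains_ball by blast
  have zero: "dir_deriv f x v = 0" for v
  proof -
    have "dir_deriv f x = (\<lambda>v. 0)"
      using differential_zero_maxmin[of x S f "dir_deriv f x"] op x max
        has_derivative_dir_deriv[OF d1[OF x]] by blast
    then show ?thesis by simp
  qed
  then show "dir_deriv f x v = 0" .
  show "dir_deriv (\<lambda>y. dir_deriv f y u) x u \<le> 0"
  proof (rule ccontr)
    assume "\<not> ?thesis"
    then have pos: "dir_deriv (\<lambda>y. dir_deriv f y u) x u > 0" by simp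
    have "((\<lambda>t. dir_deriv f (x + t *\<^sub>R u) u) has_real_derivative dir_deriv (\<lambda>y. dir_deriv f y u) x u) (at 0)"
      using vector_derivative_line[of "\<lambda>y. dir_deriv f y u" x 0 u] d2
      by (simp add: has_real_derivative_iff_has_vector_derivative)
    then obtain d where d: "d > 0" "\<forall>h>0. h < d \<longrightarrow> dir_deriv f (x + 0 *\<^sub>R u) u < dir_deriv f (x + (0 + h) *\<^sub>R u) u"
      using DERIV_pos_inc_right[OF _ pos] by blast
    have np: "norm u + 1 > 0" by (simp add: add_nonneg_pos)
    define e where "e = min (d / 2) (r / (2 * (norm u + 1)))"
    have e: "e > 0" using d r np by (simp add: e_def)
    have ed: "e < d" using d by (simp add: e_def)
    have "e * (norm u + 1) \<le> r / (2 * (norm u + 1)) * (norm u + 1)"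
      using np by (intro mult_right_mono) (auto simp: e_def)
    also have "\<dots> = r / 2" using np by (simp add: divide_simps)
    finally have er: "e * (norm u + 1) \<le> r / 2" .
    have inS: "x + t *\<^sub>R u \<in> S" if "0 \<le> t" "t \<le> e" for t
    proof -
      have "t * norm u \<le> e * (norm u + 1)" using that e by (intro mult_mono) auto
      then have "norm (t *\<^sub>R u) < r" using er r that by simp
      then show ?thesis using r(2) by (auto simp: dist_norm)
    qed
    obtain t where t: "0 < t" "t < e" "f (x + e *\<^sub>R u) - f x = e * dir_deriv f (x + t *\<^sub>R u) u"
      using mean_value_dir[of e f x u] e inS d1 by blast
    have "dir_deriv f (x + t *\<^sub>R u) u > 0" using d(2) t ed zero by auto
    then have "f (x + e *\<^sub>R u) > f x" using t e by (smt (verit) mult_pos_pos)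
    then show False using max[OF inS[of e]] e by simp
  qed
qed

subsection \<open>Inner products and the Levi-Civita connection\<close>

lemma inner_productD:
  assumes "inner_product b"
  shows "linear (b u)" "linear (\<lambda>u. b u v)" "b u v = b v u" "u \<noteq> 0 \<Longrightarrow> b u u > 0"
proof -
  have l: "linear (b u)" for u using assms by (simp add: inner_product_def)
  have s: "b u v = b v u" for u v using assms by (simp add: inner_product_def)
  show "linear (b u)" "b u v = b v u" "u \<noteq> 0 \<Longrightarrow> b u u > 0"
    using assms by (simp_all add: inner_product_def)
  have "(\<lambda>u. b u v) = b v" using s by auto
  then show "linear (\<lambda>u. b u v)" using l by simp
qed

lemma inner_product_nondegenerate:
  assumes "inner_product b" "\<And>w. b u w = b v w"
  shows "u = v"
proof -
  have "b (u - v) (u - v) = 0"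
    using assms(2)[of "u - v"] linear_diff[OF inner_productD(2)[OF assms(1)]] by simp
  then show ?thesis using inner_productD(4)[OF assms(1), of "u - v"] by fastforce
qed

text \<open>The Gram map \<open>G\<close> is injective by definiteness, hence onto in finite
  dimension.\<close>

lemma sharp_exists:
  fixes b :: "'v::euclidean_space \<Rightarrow> 'v \<Rightarrow> real"
  assumes b: "inner_product b" and a: "linear \<alpha>"
  shows "\<exists>!z. \<forall>w. b z w = \<alpha> w"
proof -
  note lin = inner_productD[OF b]
  define G where "G = (\<lambda>u. \<Sum>e\<in>Basis. b u e *\<^sub>R e)"
  have rep: "f w = (\<Sum>e\<in>Basis. (w \<bullet> e) * f e)" if "linear f" for f :: "'v \<Rightarrow> real" and w
  proof -
    have "f w = f (\<Sum>e\<in>Basis. (w \<bullet> e) *\<^sub>R e)" by (simp add: euclidean_representation)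
    also have "\<dots> = (\<Sum>e\<in>Basis. (w \<bullet> e) * f e)"
      by (simp add: linear_sum[OF that] linear_cmul[OF that])
    finally show ?thesis .
  qed
  have Gin: "G u \<bullet> w = b u w" for u w
  proof -
    have "G u \<bullet> w = (\<Sum>e\<in>Basis. (w \<bullet> e) * b u e)"
      by (simp add: G_def inner_sum_left inner_commute[of w] mult.commute)
    then show ?thesis using rep[OF lin(1), of u w] by simp
  qed
  have "linear G"
    by (rule linearI) (simp_all add: G_def linear_add[OF lin(2)] linear_cmul[OF lin(2)] scaleR_left_distrib
        sum.distrib scaleR_sum_right)
  moreover have "inj G"
  proof (rule injI)
    fix u v assume "G u = G v"
    then have "b u w = b v w" for w using Gin by metis
    then show "u = v" using inner_product_nondegenerate[OF b] by blast
  qed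
  ultimately have "surj G" using linear_inj_imp_surj by blast
  then obtain z where z: "G z = (\<Sum>e\<in>Basis. \<alpha> e *\<^sub>R e)" by (metis surjD)
  have "b z w = \<alpha> w" for w
  proof -
    have "b z w = (\<Sum>e\<in>Basis. (w \<bullet> e) * \<alpha> e)"
      using Gin[of z w] z by (simp add: inner_sum_left inner_commute[of w] mult.commute)
    then show ?thesis using rep[OF a, of w] by simp
  qed
  moreover have "u = z" if "\<forall>w. b u w = \<alpha> w" for u
    using that calculation by (intro inner_product_nondegenerate[OF b]) simp
  ultimately show ?thesis by blast
qed

lemma sharp_works:
  fixes b :: "'v::euclidean_space \<Rightarrow> 'v \<Rightarrow> real"
  assumes "inner_product b" "linear \<alpha>"
  shows "b (sharp b \<alpha>) w = \<alpha> w"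
  unfolding sharp_def using theI'[OF sharp_exists[OF assms]] by (rule spec)

text \<open>Raises the index of the coordinate covector of \<open>e\<close>. Summing over
  \<open>Basis\<close> with \<open>e\<close> in one slot and \<open>dual b e\<close> in another
  contracts the two slots with the inverse metric, so traces need no orthonormal frame that varies
  with the point.\<close>

definition dual :: "('v::euclidean_space \<Rightarrow> 'v \<Rightarrow> real) \<Rightarrow> 'v \<Rightarrow> 'v" where
  "dual b e = sharp b (\<lambda>z. e \<bullet> z)"

lemma dual_works:
  fixes b :: "'v::euclidean_space \<Rightarrow> 'v \<Rightarrow> real"
  assumes "inner_product b"
  shows "b (dual b e) w = e \<bullet> w" "b w (dual b e) = e \<bullet> w"
proof -
  have "linear (\<lambda>z. e \<bullet> z)" by (simp add: bounded_linear.linear bounded_linear_inner_right)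
  then show "b (dual b e) w = e \<bullet> w" using sharp_works[OF assms] by (simp add: dual_def)
  then show "b w (dual b e) = e \<bullet> w" using inner_productD(3)[OF assms] by metis
qed

lemma linear_expand:
  fixes f :: "'v::euclidean_space \<Rightarrow> 'b::real_vector"
  assumes "linear f"
  shows "f w = (\<Sum>e\<in>Basis. (w \<bullet> e) *\<^sub>R f e)"
proof -
  have "f w = f (\<Sum>e\<in>Basis. (w \<bullet> e) *\<^sub>R e)" by (simp add: euclidean_representation)
  also have "\<dots> = (\<Sum>e\<in>Basis. (w \<bullet> e) *\<^sub>R f e)"
    by (simp add: linear_sum[OF assms] linear_cmul[OF assms])
  finally show ?thesis .
qed

lemma dual_expand:
  fixes b :: "'v::euclidean_space \<Rightarrow> 'v \<Rightarrow> real"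
  assumes "inner_product b"
  shows "(\<Sum>e\<in>Basis. b y e *\<^sub>R dual b e) = y"
proof (rule inner_product_nondegenerate[OF assms])
  fix w
  note lin = inner_productD[OF assms]
  have "b (\<Sum>e\<in>Basis. b y e *\<^sub>R dual b e) w = (\<Sum>e\<in>Basis. (w \<bullet> e) *\<^sub>R b y e)"
    by (simp add: linear_sum[OF lin(2)] linear_cmul[OF lin(2)] dual_works[OF assms] inner_commute mult.commute)
  then show "b (\<Sum>e\<in>Basis. b y e *\<^sub>R dual b e) w = b y w"
    using linear_expand[OF lin(1)[of y], of w] by simp
qed

text \<open>At a zero of the differentiable factor the other factor needs no derivative: its
  oscillation is multiplied by something of first order. This lifts continuity of the inverse metric
  to differentiability in \<open>dual_differentiable\<close>.\<close>

lemma differentiable_mult_vanishing: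
  fixes c h :: "'v::real_normed_vector \<Rightarrow> real"
  assumes "isCont c x" "h differentiable (at x)" "h x = 0"
  shows "(\<lambda>y. c y * h y) differentiable (at x)"
proof -
  obtain h' where h': "(h has_derivative h') (at x)" using assms(2) differentiable_def by blast
  have bl: "bounded_linear h'" using h' has_derivative_bounded_linear by blast
  have lim: "((\<lambda>y. (h y - h x - h' (y - x)) /\<^sub>R norm (y - x)) \<longlongrightarrow> 0) (at x)"
    using h' by (simp add: has_derivative_at_within)
  have c: "(c \<longlongrightarrow> c x) (at x)" using assms(1) by (simp add: isCont_def)
  obtain K where K: "\<And>v. norm (h' v) \<le> norm v * K" using bl bounded_linear.bounded by blast
  have b1: "((\<lambda>y. (c y - c x) * (h' (y - x) /\<^sub>R norm (y - x))) \<longlongrightarrow> 0) (at x)"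
  proof (rule Lim_null_comparison[where g = "\<lambda>y. \<bar>c y - c x\<bar> * \<bar>K\<bar>"])
    have "norm ((c y - c x) * (h' (y - x) /\<^sub>R norm (y - x))) \<le> \<bar>c y - c x\<bar> * \<bar>K\<bar>" for y
    proof (cases "y = x")
      case False
      have "\<bar>h' (y - x)\<bar> \<le> \<bar>K\<bar> * norm (y - x)" using K[of "y - x"]
        by (smt (verit) abs_ge_self mult.commute mult_right_mono norm_ge_zero real_norm_def)
      then have "\<bar>h' (y - x)\<bar> / norm (y - x) \<le> \<bar>K\<bar>" using False by (simp add: divide_simps)
      then have "\<bar>c y - c x\<bar> * (\<bar>h' (y - x)\<bar> / norm (y - x)) \<le> \<bar>c y - c x\<bar> * \<bar>K\<bar>"
        by (intro mult_left_mono) auto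
      then show ?thesis by (simp add: abs_mult divide_inverse mult.commute)
    qed simp
    then show "\<forall>\<^sub>F y in at x. norm ((c y - c x) * (h' (y - x) /\<^sub>R norm (y - x))) \<le> \<bar>c y - c x\<bar> * \<bar>K\<bar>"
      by simp
    show "((\<lambda>y. \<bar>c y - c x\<bar> * \<bar>K\<bar>) \<longlongrightarrow> 0) (at x)"
      using c by (intro tendsto_mult_left_zero tendsto_rabs_zero) (simp add: LIM_zero)
  qed
  have b2: "((\<lambda>y. c y * ((h y - h x - h' (y - x)) /\<^sub>R norm (y - x))) \<longlongrightarrow> c x * 0) (at x)"
    by (rule tendsto_mult[OF c lim])
  have "((\<lambda>y. (c y * h y - c x * h x - c x * h' (y - x)) /\<^sub>R norm (y - x)) \<longlongrightarrow> 0) (at x)"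
  proof -
    have eq: "(c y * h y - c x * h x - c x * h' (y - x)) /\<^sub>R norm (y - x)
       = c y * ((h y - h x - h' (y - x)) /\<^sub>R norm (y - x)) + (c y - c x) * (h' (y - x) /\<^sub>R norm (y - x))" for y
      by (simp add: assms(3) algebra_simps)
    show ?thesis unfolding eq using tendsto_add[OF b2 b1] by simp
  qed
  then have "((\<lambda>y. c y * h y) has_derivative (\<lambda>v. c x * h' v)) (at x)"
    using bl by (auto simp: has_derivative_at_within intro: bounded_linear_mult_right[THEN bounded_linear_compose])
  then show ?thesis using differentiable_def by blast
qed

lemma inner_product_lower_bound:
  fixes b :: "'v::euclidean_space \<Rightarrow> 'v \<Rightarrow> real"
  assumes "inner_product b"
  obtains c where "c > 0" "\<And>u. b u u \<ge> c * (norm u)\<^sup>2"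
proof -
  note lin = inner_productD[OF assms]
  have bl: "bounded_bilinear b"
    using lin(1,2) bilinear_conv_bounded_bilinear bilinear_def by blast
  have cont: "continuous_on (sphere 0 1) (\<lambda>u. b u u)"
    by (intro bounded_bilinear.continuous_on[OF bl] continuous_intros)
  have ne: "sphere (0::'v) 1 \<noteq> {}" by simp
  obtain u0 where u0: "u0 \<in> sphere 0 1" "\<And>u. u \<in> sphere 0 1 \<Longrightarrow> b u0 u0 \<le> b u u"
    using continuous_attains_inf[OF compact_sphere ne cont] by blast
  show ?thesis
  proof
    show "b u0 u0 > 0" using u0(1) lin(4) by (metis dist_0_norm mem_sphere norm_zero zero_neq_one)
    fix u
    show "b u u \<ge> b u0 u0 * (norm u)\<^sup>2"
    proof (cases "u = 0")
      case True then show ?thesis using linear_0[OF lin(1)] by simp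
    next
      case False
      have "b u0 u0 \<le> b (u /\<^sub>R norm u) (u /\<^sub>R norm u)" using False by (intro u0) simp
      also have "\<dots> = b u u / (norm u)\<^sup>2"
        by (simp add: linear_cmul[OF lin(1)] linear_cmul[OF lin(2)] power2_eq_square divide_inverse)
      finally show ?thesis using False by (simp add: pos_le_divide_eq)
    qed
  qed
qed

section \<open>Regularity of the inverse metric in a chart\<close>

locale metric_chart =
  fixes S :: "'v::euclidean_space set" and g :: "'v metric"
  assumes open_S: "open S"
    and inner_g: "x \<in> S \<Longrightarrow> inner_product (g x)"
    and smooth_g: "smooth_on_open S (\<lambda>x. g x u v)"
begin

lemmas g_lin = inner_productD(1)[OF inner_g] and g_lin' = inner_productD(2)[OF inner_g]
  and g_sym = inner_productD(3)[OF inner_g] and g_pos = inner_productD(4)[OF inner_g]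

lemma g_differentiable: "x \<in> S \<Longrightarrow> (\<lambda>y. g y u v) differentiable (at x)"
  using smooth_differentiable[OF smooth_g] .

lemma g_expand:
  assumes "x \<in> S"
  shows "g x u v = (\<Sum>k\<in>Basis. \<Sum>l\<in>Basis. (u \<bullet> k) * (v \<bullet> l) * g x k l)"
proof -
  have "g x u v = (\<Sum>k\<in>Basis. (u \<bullet> k) *\<^sub>R g x k v)"
    by (rule linear_expand[OF g_lin'[OF assms]])
  also have "\<dots> = (\<Sum>k\<in>Basis. (u \<bullet> k) *\<^sub>R (\<Sum>l\<in>Basis. (v \<bullet> l) *\<^sub>R g x k l))"
    by (intro sum.cong arg_cong[where f = "(*\<^sub>R) _"] linear_expand[OF g_lin[OF assms]] refl)
  finally show ?thesis by (simp add: sum_distrib_left mult.assoc)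
qed

lemma g_difference:
  assumes "x \<in> S" "y \<in> S"
  shows "g x a b - g y a b = (\<Sum>k\<in>Basis. \<Sum>l\<in>Basis. (a \<bullet> k) * (b \<bullet> l) * (g x k l - g y k l))"
  by (subst g_expand[OF assms(1)], subst g_expand[OF assms(2)])
    (simp only: sum_subtractf[symmetric] right_diff_distrib)

text \<open>The lower bound at \<open>x\<close> survives nearby with half the constant, because the
  entries of the metric are continuous. It is what keeps the vectors \<open>dual (g y) f\<close>
  bounded.\<close>

lemma locally_elliptic:
  assumes x: "x \<in> S"
  obtains c where "c > 0" "\<forall>\<^sub>F y in at x. y \<in> S \<and> (\<forall>u. g y u u \<ge> c * (norm u)\<^sup>2)"
proof -
  obtain c where c: "c > 0" "\<And>u. g x u u \<ge> c * (norm u)\<^sup>2"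
    using inner_product_lower_bound[OF inner_g[OF x]] by blast
  define h where "h = (\<lambda>y. \<Sum>k\<in>Basis. \<Sum>l\<in>Basis. \<bar>g y k l - g x k l\<bar>)"
  have cont: "isCont (\<lambda>y. g y k l) x" for k l
    using g_differentiable[OF x] differentiable_at_continuous by blast
  have "isCont h x" unfolding h_def by (intro continuous_intros cont)
  then have "(h \<longlongrightarrow> 0) (at x)" by (simp add: isCont_def h_def)
  then have ev: "\<forall>\<^sub>F y in at x. h y < c / 2"
    using order_tendstoD(2) c by (metis half_gt_zero)
  have ev2: "\<forall>\<^sub>F y in at x. y \<in> S" using open_S x eventually_at_topological by blast
  have bound: "g y u u \<ge> c / 2 * (norm u)\<^sup>2" if "y \<in> S" "h y < c / 2" for y u
  proof -
    have "\<bar>g y u u - g x u u\<bar> = \<bar>\<Sum>k\<in>Basis. \<Sum>l\<in>Basis. (u \<bullet> k) * (u \<bullet> l) * (g y k l - g x k l)\<bar>"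
      by (rule arg_cong[OF g_difference[OF that(1) x]])
    also have "\<dots> \<le> (\<Sum>k\<in>Basis. \<Sum>l\<in>Basis. (norm u)\<^sup>2 * \<bar>g y k l - g x k l\<bar>)"
    proof (intro order_trans[OF sum_abs] sum_mono)
      fix k l :: 'v assume "k \<in> Basis" "l \<in> Basis"
      then have "\<bar>u \<bullet> k\<bar> * \<bar>u \<bullet> l\<bar> \<le> norm u * norm u"
        by (intro mult_mono Basis_le_norm) auto
      then show "\<bar>(u \<bullet> k) * (u \<bullet> l) * (g y k l - g x k l)\<bar> \<le> (norm u)\<^sup>2 * \<bar>g y k l - g x k l\<bar>"
        by (simp add: abs_mult power2_eq_square mult_right_mono)
    qed
    also have "\<dots> = (norm u)\<^sup>2 * h y" by (simp add: h_def sum_distrib_left)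
    also have "\<dots> \<le> (norm u)\<^sup>2 * (c / 2)" using that by (intro mult_left_mono) auto
    finally have "\<bar>g y u u - g x u u\<bar> \<le> c / 2 * (norm u)\<^sup>2" by (simp add: mult.commute)
    then show ?thesis using c(2)[of u] by linarith
  qed
  show ?thesis
  proof
    show "c / 2 > 0" using c by simp
    show "\<forall>\<^sub>F y in at x. y \<in> S \<and> (\<forall>u. g y u u \<ge> c / 2 * (norm u)\<^sup>2)"
      using ev ev2 by eventually_elim (use bound in blast)
  qed
qed

text \<open>The resolvent identity for the inverse metric: a difference of inverses is one inverse
  times the difference of the metrics times the other inverse. Only the factor at \<open>y\<close>
  varies along with the difference.\<close>

lemma dual_difference:
  assumes "x \<in> S" "y \<in> S"
  shows "(dual (g y) e - dual (g x) e) \<bullet> f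
    = (\<Sum>k\<in>Basis. \<Sum>l\<in>Basis. (dual (g y) f \<bullet> l) * ((dual (g x) e \<bullet> k) * (g x k l - g y k l)))"
proof -
  have "(dual (g y) e - dual (g x) e) \<bullet> f = g y (dual (g y) e - dual (g x) e) (dual (g y) f)"
    using dual_works(2)[OF inner_g[OF assms(2)]] by (metis inner_commute)
  also have "\<dots> = g y (dual (g y) e) (dual (g y) f) - g y (dual (g x) e) (dual (g y) f)"
    by (rule linear_diff[OF g_lin'[OF assms(2)]])
  also have "g y (dual (g y) e) (dual (g y) f) = g x (dual (g x) e) (dual (g y) f)"
    using dual_works(1)[OF inner_g[OF assms(2)]] dual_works(1)[OF inner_g[OF assms(1)]] by simp
  also have "g x (dual (g x) e) (dual (g y) f) - g y (dual (g x) e) (dual (g y) f)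
    = (\<Sum>k\<in>Basis. \<Sum>l\<in>Basis. (dual (g x) e \<bullet> k) * (dual (g y) f \<bullet> l) * (g x k l - g y k l))"
    by (rule g_difference[OF assms])
  finally show ?thesis by (simp only: mult_ac)
qed

text \<open>In the resolvent identity the moving factor is bounded by ellipticity and the difference
  of the metrics tends to zero.\<close>

lemma isCont_dual:
  assumes x: "x \<in> S"
  shows "isCont (\<lambda>y. dual (g y) e) x"
proof -
  obtain c where c: "c > 0" "\<forall>\<^sub>F y in at x. y \<in> S \<and> (\<forall>u. g y u u \<ge> c * (norm u)\<^sup>2)"
    using locally_elliptic[OF x] by blast
  have bd: "\<forall>\<^sub>F y in at x. y \<in> S \<and> norm (dual (g y) f) \<le> norm f / c" for f
    using c(2)
  proof eventually_elim
    case (elim y)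
    let ?s = "dual (g y) f"
    have "c * (norm ?s)\<^sup>2 \<le> f \<bullet> ?s" using elim dual_works(1)[OF inner_g] by metis
    also have "\<dots> \<le> norm f * norm ?s" by (rule norm_cauchy_schwarz)
    finally have "(c * norm ?s) * norm ?s \<le> norm f * norm ?s" by (simp add: power2_eq_square)
    then have "c * norm ?s \<le> norm f" by (cases "?s = 0") auto
    then show ?case using elim c(1) by (simp add: pos_le_divide_eq mult.commute)
  qed
  have comp: "((\<lambda>y. (dual (g y) e - dual (g x) e) \<bullet> f) \<longlongrightarrow> 0) (at x)" for f
  proof -
    have term0: "((\<lambda>y. (dual (g y) f \<bullet> l) * ((dual (g x) e \<bullet> k) * (g x k l - g y k l))) \<longlongrightarrow> 0) (at x)"
      if "l \<in> Basis" for k l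
    proof (rule Lim_null_comparison)
      show "\<forall>\<^sub>F y in at x. norm ((dual (g y) f \<bullet> l) * ((dual (g x) e \<bullet> k) * (g x k l - g y k l)))
         \<le> (norm f / c) * \<bar>(dual (g x) e \<bullet> k) * (g x k l - g y k l)\<bar>"
        using bd[of f]
      proof eventually_elim
        case (elim y)
        have "\<bar>dual (g y) f \<bullet> l\<bar> \<le> norm f / c" using elim Basis_le_norm[OF that, of "dual (g y) f"] by linarith
        then show ?case unfolding real_norm_def abs_mult[of "dual (g y) f \<bullet> l"] by (intro mult_right_mono) auto
      qed
      have "isCont (\<lambda>y. (norm f / c) * \<bar>(dual (g x) e \<bullet> k) * (g x k l - g y k l)\<bar>) x"
        using g_differentiable[OF x, THEN differentiable_at_continuous] by (intro continuous_intros) (use c in auto)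
      then show "((\<lambda>y. (norm f / c) * \<bar>(dual (g x) e \<bullet> k) * (g x k l - g y k l)\<bar>) \<longlongrightarrow> 0) (at x)"
        by (simp add: isCont_def)
    qed
    have "((\<lambda>y. \<Sum>k\<in>Basis. \<Sum>l\<in>Basis. (dual (g y) f \<bullet> l) * ((dual (g x) e \<bullet> k) * (g x k l - g y k l))) \<longlongrightarrow> 0) (at x)"
      by (intro tendsto_null_sum term0)
    moreover have "\<forall>\<^sub>F y in at x. (dual (g y) e - dual (g x) e) \<bullet> f =
       (\<Sum>k\<in>Basis. \<Sum>l\<in>Basis. (dual (g y) f \<bullet> l) * ((dual (g x) e \<bullet> k) * (g x k l - g y k l)))"
      using c(2) by eventually_elim (use dual_difference[OF x] in blast)
    ultimately show ?thesis by (simp add: tendsto_cong)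
  qed
  have "((\<lambda>y. \<Sum>f\<in>Basis. ((dual (g y) e - dual (g x) e) \<bullet> f) *\<^sub>R f) \<longlongrightarrow> 0) (at x)"
    by (intro tendsto_null_sum) (use comp tendsto_scaleR[OF comp tendsto_const] in auto)
  then show ?thesis by (simp add: euclidean_representation isCont_def LIM_zero_iff)
qed

text \<open>The same identity again: each term is a function now known to be continuous times a
  differentiable one that vanishes at \<open>x\<close>.\<close>

lemma dual_differentiable:
  assumes x: "x \<in> S"
  shows "(\<lambda>y. dual (g y) e) differentiable (at x)"
proof (rule differentiable_basis_expansion)
  fix f :: 'v assume "f \<in> Basis"
  have *: "(\<lambda>y. (dual (g y) f \<bullet> l) * ((dual (g x) e \<bullet> k) * (g x k l - g y k l))) differentiable (at x)" for k l
  proof (rule differentiable_mult_vanishing)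
    show "isCont (\<lambda>y. dual (g y) f \<bullet> l) x"
      by (intro isCont_inner isCont_dual[OF x] continuous_const)
    show "(\<lambda>y. (dual (g x) e \<bullet> k) * (g x k l - g y k l)) differentiable (at x)"
      using g_differentiable[OF x] by simp
  qed simp
  have D: "(\<lambda>y. dual (g x) e \<bullet> f + (\<Sum>k\<in>Basis. \<Sum>l\<in>Basis. (dual (g y) f \<bullet> l) * ((dual (g x) e \<bullet> k) * (g x k l - g y k l))))
     differentiable (at x)"
    by (intro differentiable_add differentiable_const differentiable_sum_fun *)
  have eq: "dual (g y) e \<bullet> f = dual (g x) e \<bullet> f
      + (\<Sum>k\<in>Basis. \<Sum>l\<in>Basis. (dual (g y) f \<bullet> l) * ((dual (g x) e \<bullet> k) * (g x k l - g y k l)))"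
    if "y \<in> S" for y
  proof -
    note that
    then have "dual (g y) e \<bullet> f - dual (g x) e \<bullet> f
      = (\<Sum>k\<in>Basis. \<Sum>l\<in>Basis. (dual (g y) f \<bullet> l) * ((dual (g x) e \<bullet> k) * (g x k l - g y k l)))"
      by (simp only: dual_difference[OF x, symmetric] inner_diff_left)
    then show ?thesis by (simp only: diff_eq_eq add.commute)
  qed
  show "(\<lambda>y. dual (g y) e \<bullet> f) differentiable (at x)"
    by (rule iffD2[OF differentiable_cong_open[OF open_S x eq] D])
qed

lemma sharp_expand:
  assumes "x \<in> S" "linear \<alpha>"
  shows "sharp (g x) \<alpha> = (\<Sum>e\<in>Basis. \<alpha> e *\<^sub>R dual (g x) e)"
  using dual_expand[OF inner_g[OF assms(1)], of "sharp (g x) \<alpha>"] sharp_works[OF inner_g[OF assms(1)] assms(2)]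
  by simp

section \<open>The Koszul formula and the Levi-Civita connection\<close>

definition koszul :: "'v \<Rightarrow> 'v \<Rightarrow> 'v \<Rightarrow> 'v \<Rightarrow> real" where
  "koszul x u v w = (dir_deriv (\<lambda>y. g y v w) x u + dir_deriv (\<lambda>y. g y u w) x v
            - dir_deriv (\<lambda>y. g y u v) x w) / 2"

lemma dir_deriv_g_linear:
  assumes x: "x \<in> S"
  shows "linear (\<lambda>v. dir_deriv (\<lambda>y. g y v w) x u)" "linear (\<lambda>w. dir_deriv (\<lambda>y. g y v w) x u)"
    "linear (\<lambda>u. dir_deriv (\<lambda>y. g y v w) x u)"
proof -
  show "linear (\<lambda>u. dir_deriv (\<lambda>y. g y v w) x u)" by (rule linear_dir_deriv[OF g_differentiable[OF x]])
  have add: "dir_deriv (\<lambda>y. g y v (w1 + w2)) x u = dir_deriv (\<lambda>y. g y v w1) x u + dir_deriv (\<lambda>y. g y v w2) x u" for v w1 w2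
  proof -
    have "dir_deriv (\<lambda>y. g y v (w1 + w2)) x u = dir_deriv (\<lambda>y. g y v w1 + g y v w2) x u"
      using dir_deriv_cong_open[OF open_S x, of "\<lambda>y. g y v (w1 + w2)" "\<lambda>y. g y v w1 + g y v w2"] linear_add[OF g_lin] by simp
    then show ?thesis using dir_deriv_add g_differentiable[OF x] by metis
  qed
  have scale: "dir_deriv (\<lambda>y. g y v (c *\<^sub>R w)) x u = c *\<^sub>R dir_deriv (\<lambda>y. g y v w) x u" for c v w
  proof -
    have "dir_deriv (\<lambda>y. g y v (c *\<^sub>R w)) x u = dir_deriv (\<lambda>y. c *\<^sub>R g y v w) x u"
      using dir_deriv_cong_open[OF open_S x, of "\<lambda>y. g y v (c *\<^sub>R w)" "\<lambda>y. c *\<^sub>R g y v w"] linear_cmul[OF g_lin] by simp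
    then show ?thesis using dir_deriv_linear[OF bounded_linear_scaleR_right g_differentiable[OF x]] by metis
  qed
  show l2: "linear (\<lambda>w. dir_deriv (\<lambda>y. g y v w) x u)" for v
    by (rule linearI) (simp_all only: add scale)
  have "dir_deriv (\<lambda>y. g y v w) x u = dir_deriv (\<lambda>y. g y w v) x u" for v
    using dir_deriv_cong_open[OF open_S x] g_sym by metis
  then have "(\<lambda>v. dir_deriv (\<lambda>y. g y v w) x u) = (\<lambda>v. dir_deriv (\<lambda>y. g y w v) x u)" by auto
  then show "linear (\<lambda>v. dir_deriv (\<lambda>y. g y v w) x u)" using l2[of w] by simp
qed

lemma koszul_linear:
  assumes x: "x \<in> S"
  shows "linear (\<lambda>u. koszul x u v w)" "linear (\<lambda>v. koszul x u v w)" "linear (koszul x u v)"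
proof -
  note d = dir_deriv_g_linear[OF x]
  have h: "linear (\<lambda>u. (f u + h u - k u) / 2)" if "linear f" "linear h" "linear k" for f h k :: "'v \<Rightarrow> real"
    by (rule linearI) (simp_all add: linear_add[OF that(1)] linear_add[OF that(2)] linear_add[OF that(3)]
        linear_cmul[OF that(1)] linear_cmul[OF that(2)] linear_cmul[OF that(3)] field_simps)
  show "linear (\<lambda>u. koszul x u v w)" unfolding koszul_def by (rule h[OF d(3) d(1) d(1)])
  show "linear (\<lambda>v. koszul x u v w)" unfolding koszul_def by (rule h[OF d(1) d(3) d(2)])
  have "linear (\<lambda>w. koszul x u v w)" unfolding koszul_def by (rule h[OF d(2) d(2) d(3)])
  then show "linear (koszul x u v)" by simp
qed

lemma christoffel_eq: "christoffel g x u v = sharp (g x) (koszul x u v)"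
  by (simp add: christoffel_def koszul_def[abs_def])

lemma g_christoffel: "x \<in> S \<Longrightarrow> g x (christoffel g x u v) w = koszul x u v w"
  unfolding christoffel_eq by (rule sharp_works[OF inner_g koszul_linear(3)])

lemma christoffel_linear:
  assumes x: "x \<in> S"
  shows "linear (\<lambda>u. christoffel g x u v)" "linear (christoffel g x u)"
proof -
  note nd = inner_product_nondegenerate[OF inner_g[OF x]]
  note k = koszul_linear[OF x]
  show "linear (\<lambda>u. christoffel g x u v)"
    by (rule linearI; rule nd; simp only: g_christoffel[OF x] linear_add[OF g_lin'[OF x]]
        linear_cmul[OF g_lin'[OF x]] linear_add[OF k(1)] linear_cmul[OF k(1)])
  show "linear (christoffel g x u)"
    by (rule linearI; rule nd; simp only: g_christoffel[OF x] linear_add[OF g_lin'[OF x]]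
        linear_cmul[OF g_lin'[OF x]] linear_add[OF k(2)] linear_cmul[OF k(2)])
qed

lemma christoffel_sym: "x \<in> S \<Longrightarrow> christoffel g x u v = christoffel g x v u"
proof (rule inner_product_nondegenerate[OF inner_g], assumption)
  fix w assume x: "x \<in> S"
  have "dir_deriv (\<lambda>y. g y u v) x = dir_deriv (\<lambda>y. g y v u) x"
    using dir_deriv_cong_open[OF open_S x] g_sym by metis
  then show "g x (christoffel g x u v) w = g x (christoffel g x v u) w"
    by (simp add: g_christoffel x koszul_def)
qed

lemma metric_compatible:
  assumes x: "x \<in> S"
  shows "dir_deriv (\<lambda>y. g y v w) x u = g x (christoffel g x u v) w + g x v (christoffel g x u w)"
proof -
  have s: "dir_deriv (\<lambda>y. g y a b) x = dir_deriv (\<lambda>y. g y b a) x" for a b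
    using dir_deriv_cong_open[OF open_S x] g_sym by metis
  show ?thesis
    unfolding g_sym[OF x, of v] g_christoffel[OF x] koszul_def
    using s[of w v] s[of w u] s[of v u] by (simp add: field_simps)
qed

lemma christoffel_differentiable:
  assumes x: "x \<in> S"
  shows "(\<lambda>y. christoffel g y u v) differentiable (at x)"
proof -
  have d: "(\<lambda>y. dir_deriv (\<lambda>y. g y v w) y u) differentiable (at x)" for u v w
    using smooth_differentiable[OF smooth_dir_deriv[OF smooth_g] x] .
  have k: "(\<lambda>y. koszul y u v w) differentiable (at x)" for w
    unfolding koszul_def divide_inverse
    by (intro differentiable_mult differentiable_add differentiable_diff d differentiable_const)
  have "(\<lambda>y. \<Sum>e\<in>Basis. koszul y u v e *\<^sub>R dual (g y) e) differentiable (at x)"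
    by (intro differentiable_sum_fun differentiable_bilinear[OF bounded_bilinear_scaleR] k dual_differentiable x)
  then show ?thesis
    using differentiable_cong_open[OF open_S x, of "\<lambda>y. christoffel g y u v"]
      sharp_expand koszul_linear(3) by (simp add: christoffel_eq)
qed

end

subsection \<open>Curvature\<close>

text \<open>Leibniz rule for a field of linear maps applied to a field of vectors. Differentiability
  of \<open>F\<close> is known only for each fixed argument, so the argument \<open>Z y\<close> is
  expanded in the standard basis.\<close>

lemma apply_field:
  fixes F :: "'v::euclidean_space \<Rightarrow> 'w::euclidean_space \<Rightarrow> 'b::real_normed_vector"
  assumes op: "open S" and x: "x \<in> S" and lin: "\<And>y. y \<in> S \<Longrightarrow> linear (F y)"
    and dF: "\<And>z. (\<lambda>y. F y z) differentiable (at x)" and dZ: "Z differentiable (at x)"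
  shows "(\<lambda>y. F y (Z y)) differentiable (at x)"
    "dir_deriv (\<lambda>y. F y (Z y)) x u = dir_deriv (\<lambda>y. F y (Z x)) x u + F x (dir_deriv Z x u)"
proof -
  have dZe: "(\<lambda>y. Z y \<bullet> e) differentiable (at x)" for e
    by (rule differentiable_linear[OF bounded_linear_inner_left dZ])
  have d1: "(\<lambda>y. (Z y \<bullet> e) *\<^sub>R F y e) differentiable (at x)" for e
    by (rule differentiable_bilinear[OF bounded_bilinear_scaleR dZe dF])
  have eq: "F y (Z y) = (\<Sum>e\<in>Basis. (Z y \<bullet> e) *\<^sub>R F y e)" if "y \<in> S" for y
    by (rule linear_expand[OF lin[OF that]])
  have sd: "(\<lambda>y. \<Sum>e\<in>Basis. (Z y \<bullet> e) *\<^sub>R F y e) differentiable (at x)"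
    by (rule differentiable_sum_fun[OF d1])
  show "(\<lambda>y. F y (Z y)) differentiable (at x)"
    by (rule iffD2[OF differentiable_cong_open[OF op x eq] sd])
  have eq2: "F y z = (\<Sum>e\<in>Basis. (z \<bullet> e) *\<^sub>R F y e)" if "y \<in> S" for y z
    by (rule linear_expand[OF lin[OF that]])
  have "dir_deriv (\<lambda>y. F y (Z y)) x u = (\<Sum>e\<in>Basis. dir_deriv (\<lambda>y. (Z y \<bullet> e) *\<^sub>R F y e) x u)"
    by (simp add: dir_deriv_cong_open[OF op x eq] dir_deriv_sum d1)
  also have "\<dots> = (\<Sum>e\<in>Basis. (Z x \<bullet> e) *\<^sub>R dir_deriv (\<lambda>y. F y e) x u + (dir_deriv Z x u \<bullet> e) *\<^sub>R F x e)"
    by (simp add: dir_deriv_bilinear[OF bounded_bilinear_scaleR dZe dF]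
       dir_deriv_linear[OF bounded_linear_inner_left dZ])
  also have "\<dots> = (\<Sum>e\<in>Basis. (Z x \<bullet> e) *\<^sub>R dir_deriv (\<lambda>y. F y e) x u) + F x (dir_deriv Z x u)"
    by (simp add: sum.distrib linear_expand[OF lin[OF x], of "dir_deriv Z x u", symmetric])
  also have "(\<Sum>e\<in>Basis. (Z x \<bullet> e) *\<^sub>R dir_deriv (\<lambda>y. F y e) x u) = dir_deriv (\<lambda>y. F y (Z x)) x u"
  proof -
    have d2: "(\<lambda>y. (Z x \<bullet> e) *\<^sub>R F y e) differentiable (at x)" for e
      by (rule differentiable_linear[OF bounded_linear_scaleR_right dF])
    have "dir_deriv (\<lambda>y. F y (Z x)) x u = dir_deriv (\<lambda>y. \<Sum>e\<in>Basis. (Z x \<bullet> e) *\<^sub>R F y e) x u"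
      using dir_deriv_cong_open[OF op x eq2[of _ "Z x"]] by simp
    also have "\<dots> = (\<Sum>e\<in>Basis. dir_deriv (\<lambda>y. (Z x \<bullet> e) *\<^sub>R F y e) x u)"
      by (rule dir_deriv_sum[OF d2])
    finally show ?thesis by (simp add: dir_deriv_linear[OF bounded_linear_scaleR_right dF])
  qed
  finally show "dir_deriv (\<lambda>y. F y (Z y)) x u = dir_deriv (\<lambda>y. F y (Z x)) x u + F x (dir_deriv Z x u)" .
qed

lemma dir_deriv_field_linear:
  fixes F :: "'v::euclidean_space \<Rightarrow> 'w::real_vector \<Rightarrow> 'b::real_normed_vector"
  assumes op: "open S" and x: "x \<in> S" and lin: "\<And>y. y \<in> S \<Longrightarrow> linear (F y)"
    and dF: "\<And>z. (\<lambda>y. F y z) differentiable (at x)"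
  shows "linear (\<lambda>z. dir_deriv (\<lambda>y. F y z) x u)"
proof (rule linearI)
  fix a b
  have "dir_deriv (\<lambda>y. F y (a + b)) x = dir_deriv (\<lambda>y. F y a + F y b) x"
    by (rule dir_deriv_cong_open[OF op x]) (rule linear_add[OF lin])
  then show "dir_deriv (\<lambda>y. F y (a + b)) x u = dir_deriv (\<lambda>y. F y a) x u + dir_deriv (\<lambda>y. F y b) x u"
    using dir_deriv_add[OF dF dF] by simp
next
  fix c a
  have "dir_deriv (\<lambda>y. F y (c *\<^sub>R a)) x = dir_deriv (\<lambda>y. c *\<^sub>R F y a) x"
    by (rule dir_deriv_cong_open[OF op x]) (rule linear_cmul[OF lin])
  then show "dir_deriv (\<lambda>y. F y (c *\<^sub>R a)) x u = c *\<^sub>R dir_deriv (\<lambda>y. F y a) x u"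
    using dir_deriv_linear[OF bounded_linear_scaleR_right dF] by simp
qed

context metric_chart
begin

lemma deriv_christoffel_sym:
  assumes "x \<in> S"
  shows "dir_deriv (\<lambda>y. christoffel g y u v) x = dir_deriv (\<lambda>y. christoffel g y v u) x"
  by (rule dir_deriv_cong_open[OF open_S assms christoffel_sym])

lemma curvature_linear:
  assumes x: "x \<in> S"
  shows "linear (\<lambda>u. curvature_endo g x u v w)" "linear (\<lambda>v. curvature_endo g x u v w)"
    "linear (curvature_endo g x u v)"
proof -
  note cl = christoffel_linear[OF x]
  note cd = christoffel_differentiable[OF x]
  note d1 = dir_deriv_field_linear[OF open_S x christoffel_linear(1) cd]
  note d2 = dir_deriv_field_linear[OF open_S x christoffel_linear(2) cd]
  note d3 = linear_dir_deriv[OF cd]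
  note add = linear_add[OF cl(1)] linear_add[OF cl(2)] linear_add[OF d1] linear_add[OF d2] linear_add[OF d3]
  note cm = linear_cmul[OF cl(1)] linear_cmul[OF cl(2)] linear_cmul[OF d1] linear_cmul[OF d2] linear_cmul[OF d3]
  show "linear (\<lambda>u. curvature_endo g x u v w)" "linear (\<lambda>v. curvature_endo g x u v w)"
     "linear (curvature_endo g x u v)"
    by (rule linearI; simp only: curvature_endo_def add cm scaleR_diff_right scaleR_add_right; simp)+
qed

lemma curvature_antisym: "curvature_endo g x u v w = - curvature_endo g x v u w"
  by (simp add: curvature_endo_def)

lemma curvature_bianchi:
  assumes x: "x \<in> S"
  shows "curvature_endo g x u v w + curvature_endo g x v w u + curvature_endo g x w u v = 0"
  using deriv_christoffel_sym[OF x, of v w] deriv_christoffel_sym[OF x, of u w] deriv_christoffel_sym[OF x, of u v]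
    christoffel_sym[OF x, of v w] christoffel_sym[OF x, of u w] christoffel_sym[OF x, of u v]
  by (simp add: curvature_endo_def)

lemma dir_deriv_metric_fields:
  assumes x: "x \<in> S" and dZ: "Z differentiable (at x)"
  shows "(\<lambda>y. g y (Z y) z) differentiable (at x)"
    "dir_deriv (\<lambda>y. g y (Z y) z) x u =
      g x (christoffel g x u (Z x)) z + g x (Z x) (christoffel g x u z) + g x (dir_deriv Z x u) z"
  using apply_field[OF open_S x g_lin' g_differentiable[OF x] dZ]
  by (simp_all add: metric_compatible[OF x])

lemma second_metric_derivative:
  assumes x: "x \<in> S"
  shows "dir_deriv (\<lambda>y. dir_deriv (\<lambda>y. g y w z) y v) x u =
    g x (christoffel g x u (christoffel g x v w)) z + g x (christoffel g x v w) (christoffel g x u z)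
    + g x (dir_deriv (\<lambda>y. christoffel g y v w) x u) z
    + g x (christoffel g x u (christoffel g x v z)) w + g x (christoffel g x v z) (christoffel g x u w)
    + g x (dir_deriv (\<lambda>y. christoffel g y v z) x u) w"
proof -
  have "dir_deriv (\<lambda>y. dir_deriv (\<lambda>y. g y w z) y v) x u
     = dir_deriv (\<lambda>y. g y (christoffel g y v w) z + g y (christoffel g y v z) w) x u"
    by (rule fun_cong[OF dir_deriv_cong_open[OF open_S x]])
      (simp add: metric_compatible g_sym[of _ w])
  then show ?thesis
    using dir_deriv_metric_fields[OF x christoffel_differentiable[OF x]]
    by (simp add: dir_deriv_add)
qed

text \<open>Metric compatibility, differentiated once more and antisymmetrized in \<open>u\<close>
  and \<open>v\<close>, expresses the sum of the two sides as a commutator of partial derivatives of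
  \<open>g y w z\<close>, which is zero; the products of two Christoffel symbols cancel by symmetry
  of \<open>g\<close>.\<close>

lemma curvature_skew:
  assumes x: "x \<in> S"
  shows "g x (curvature_endo g x u v w) z = - g x w (curvature_endo g x u v z)"
proof -
  have "g x (curvature_endo g x u v w) z + g x (curvature_endo g x u v z) w
     = dir_deriv (\<lambda>y. dir_deriv (\<lambda>y. g y w z) y v) x u - dir_deriv (\<lambda>y. dir_deriv (\<lambda>y. g y w z) y u) x v"
    unfolding second_metric_derivative[OF x] curvature_endo_def
    using g_sym[OF x, of "christoffel g x v w" "christoffel g x u z"]
      g_sym[OF x, of "christoffel g x v z" "christoffel g x u w"]
    by (simp add: linear_add[OF g_lin'[OF x]] linear_diff[OF g_lin'[OF x]])
  also have "\<dots> = 0"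
    using second_derivative_symmetric[OF smooth_g x] by simp
  finally show ?thesis using g_sym[OF x, of w] by simp
qed

lemma riem_linear:
  assumes x: "x \<in> S"
  shows "linear (\<lambda>u. riem g x u v z w)" "linear (\<lambda>v. riem g x u v z w)"
    "linear (\<lambda>z. riem g x u v z w)" "linear (riem g x u v z)"
proof -
  note r = curvature_linear[OF x]
  note gl = g_lin[OF x] g_lin'[OF x]
  show "linear (\<lambda>u. riem g x u v z w)"
    unfolding riem_def using linear_compose[OF r(1) gl(2)] by (simp add: o_def)
  show "linear (\<lambda>v. riem g x u v z w)"
    unfolding riem_def using linear_compose[OF r(2) gl(2)] by (simp add: o_def)
  show "linear (\<lambda>z. riem g x u v z w)" unfolding riem_def by (rule gl(1))
  have "linear (\<lambda>w. riem g x u v z w)"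
    unfolding riem_def using linear_compose[OF r(3) gl(2)] by (simp add: o_def)
  then show "linear (riem g x u v z)" by simp
qed

lemma riem_antisym:
  assumes x: "x \<in> S"
  shows "riem g x u v z w = - riem g x v u z w" "riem g x u v z w = - riem g x u v w z"
proof -
  show "riem g x u v z w = - riem g x v u z w"
    unfolding riem_def by (subst curvature_antisym) (rule linear_neg[OF g_lin'[OF x]])
  show "riem g x u v z w = - riem g x u v w z"
    unfolding riem_def using curvature_skew[OF x, of u v w z] g_sym[OF x, of w] by simp
qed

lemma riem_bianchi:
  assumes x: "x \<in> S"
  shows "riem g x u v z w + riem g x v w z u + riem g x w u z v = 0"
  using arg_cong[OF curvature_bianchi[OF x, of u v w], of "\<lambda>y. g x y z"]
  by (simp add: riem_def linear_add[OF g_lin'[OF x]] linear_0[OF g_lin'[OF x]])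

text \<open>The octahedron argument: four instances of the Bianchi identity, brought to a common
  form by the two antisymmetries, combine linearly.\<close>

lemma riem_pair_sym:
  assumes x: "x \<in> S"
  shows "riem g x u v z w = riem g x z w u v"
  using riem_bianchi[OF x, of u v z w] riem_bianchi[OF x, of v z w u]
    riem_bianchi[OF x, of z w u v] riem_bianchi[OF x, of w u v z]
    riem_antisym[OF x, of u v z w] riem_antisym[OF x, of v w z u] riem_antisym[OF x, of w u z v]
    riem_antisym[OF x, of v z w u] riem_antisym[OF x, of z u w v] riem_antisym[OF x, of u v w z]
    riem_antisym[OF x, of z w u v] riem_antisym[OF x, of w v u z] riem_antisym[OF x, of v z u w]
    riem_antisym[OF x, of w u v z] riem_antisym[OF x, of u z v w] riem_antisym[OF x, of z w v u]
    riem_antisym[OF x, of w v z u] riem_antisym[OF x, of u w z v] riem_antisym[OF x, of u z w v]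
     riem_antisym[OF x, of z u v w] riem_antisym[OF x, of v w u z]
  by linarith

end

section \<open>The complex structure and the Kaehler symmetries of the curvature\<close>

lemma J_J [simp]: "J (J v) = - v"
  by (simp add: J_def vec_eq_iff)

lemma linear_J: "linear J"
  by (rule linearI) (simp_all add: J_def vec_eq_iff algebra_simps)

lemma bounded_linear_J: "bounded_linear (J :: complex ^ 'n::finite \<Rightarrow> complex ^ 'n)"
  using linear_J linear_conv_bounded_linear by blast

lemma J_minus [simp]: "J (- v) = - J v" and J_add: "J (u + v) = J u + J v"
  and J_scaleR: "J (c *\<^sub>R v) = c *\<^sub>R J v" and J_diff: "J (u - v) = J u - J v" and J_zero [simp]: "J 0 = 0"
  using linear_neg[OF linear_J] linear_add[OF linear_J] linear_cmul[OF linear_J] linear_diff[OF linear_J]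
   linear_0[OF linear_J] by auto

locale kahler_chart = metric_chart S g
  for S :: "(complex ^ 'n::finite) set" and g +
  assumes g_J: "x \<in> S \<Longrightarrow> g x (J u) (J v) = g x u v"
    and closed: "x \<in> S \<Longrightarrow> ext_deriv (kahler_form g) x [u, v, w] = 0"
begin

lemma g_J_left: "x \<in> S \<Longrightarrow> g x (J u) v = - g x u (J v)"
  using g_J[of x u "J v"] g_J[of x "J u" v] linear_neg[OF g_lin] linear_neg[OF g_lin'] by simp

lemma kahler_closed:
  assumes x: "x \<in> S"
  shows "dir_deriv (\<lambda>y. g y (J v) w) x u + dir_deriv (\<lambda>y. g y u (J w)) x v - dir_deriv (\<lambda>y. g y u (J v)) x w = 0"
proof -
  have neg: "dir_deriv (\<lambda>y. g y (J a) b) x c = - dir_deriv (\<lambda>y. g y a (J b)) x c" for a b c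
  proof -
    have "dir_deriv (\<lambda>y. g y (J a) b) x = dir_deriv (\<lambda>y. - g y a (J b)) x"
      by (rule dir_deriv_cong_open[OF open_S x g_J_left])
    then show ?thesis using dir_deriv_minus[OF g_differentiable[OF x]] by simp
  qed
  show ?thesis using closed[OF x, of u v w] neg[of u w v] neg[of u v w]
    by (simp add: ext_deriv_def kahler_form_def eval_nat_numeral)
qed

text \<open>\<open>J\<close> is parallel. It has constant coefficients in a holomorphic chart, so
  closedness of the Kaehler form is the only input: its instances for \<open>v, w\<close> and for
  \<open>J v, J w\<close> cancel the Koszul expression. Symmetry of the Christoffel symbols carries
  the statement to the first argument.\<close>

lemma christoffel_J:
  assumes x: "x \<in> S"
  shows "christoffel g x u (J v) = J (christoffel g x u v)" "christoffel g x (J u) v = J (christoffel g x u v)"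
proof -
  have main: "christoffel g x u (J v) = J (christoffel g x u v)" for u v
  proof (rule inner_product_nondegenerate[OF inner_g[OF x]])
    fix w
    have d0: "dir_deriv (\<lambda>y. g y (J v) w) x u + dir_deriv (\<lambda>y. g y v (J w)) x u = 0"
    proof -
      have "dir_deriv (\<lambda>y. g y (J v) w) x = dir_deriv (\<lambda>y. - g y v (J w)) x"
        by (rule dir_deriv_cong_open[OF open_S x g_J_left])
      then show ?thesis using dir_deriv_minus[OF g_differentiable[OF x]] by simp
    qed
    have JJ: "dir_deriv (\<lambda>y. g y (- v) (J w)) x u = - dir_deriv (\<lambda>y. g y v (J w)) x u"
      "dir_deriv (\<lambda>y. g y u (- w)) x (J v) = - dir_deriv (\<lambda>y. g y u w) x (J v)"
      "dir_deriv (\<lambda>y. g y u (- v)) x (J w) = - dir_deriv (\<lambda>y. g y u v) x (J w)"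
      using linear_neg[OF dir_deriv_g_linear(1)[OF x]] linear_neg[OF dir_deriv_g_linear(2)[OF x]] by auto
    have "koszul x u (J v) w + koszul x u v (J w) = 0"
      using d0 kahler_closed[OF x, of v w u] kahler_closed[OF x, of "J v" "J w" u] JJ
      unfolding koszul_def by (simp add: field_simps)
    then show "g x (christoffel g x u (J v)) w = g x (J (christoffel g x u v)) w"
      using g_J_left[OF x, of "christoffel g x u v" w] by (simp add: g_christoffel[OF x])
  qed
  show "christoffel g x u (J v) = J (christoffel g x u v)" by (rule main)
  show "christoffel g x (J u) v = J (christoffel g x u v)"
    using main[of v u] christoffel_sym[OF x] by metis
qed

lemma curvature_J:
  assumes x: "x \<in> S"
  shows "curvature_endo g x u v (J w) = J (curvature_endo g x u v w)"
proof -
  have d: "dir_deriv (\<lambda>y. christoffel g y v (J w)) x u = J (dir_deriv (\<lambda>y. christoffel g y v w) x u)" for u v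
  proof -
    have "dir_deriv (\<lambda>y. christoffel g y v (J w)) x = dir_deriv (\<lambda>y. J (christoffel g y v w)) x"
      by (rule dir_deriv_cong_open[OF open_S x christoffel_J(1)])
    then show ?thesis using dir_deriv_linear[OF bounded_linear_J christoffel_differentiable[OF x]] by simp
  qed
  show ?thesis by (simp add: curvature_endo_def d christoffel_J[OF x] J_add J_diff)
qed

lemma riem_J:
  assumes x: "x \<in> S"
  shows "riem g x u v (J z) (J w) = riem g x u v z w" "riem g x (J u) (J v) z w = riem g x u v z w"
proof -
  show 1: "riem g x u v (J z) (J w) = riem g x u v z w" for u v z w
    by (simp add: riem_def curvature_J[OF x] g_J[OF x])
  show "riem g x (J u) (J v) z w = riem g x u v z w"
    using 1 riem_pair_sym[OF x] by metis
qed

end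

subsection \<open>Covariant derivatives of tensor fields\<close>

definition multilinear :: "nat \<Rightarrow> ('v::real_vector list \<Rightarrow> complex) \<Rightarrow> bool" where
  "multilinear k w \<longleftrightarrow> (\<forall>vs i. length vs = k \<and> i < k \<longrightarrow> linear (\<lambda>v. w (vs[i := v])))"

lemma multilinearD: "multilinear k w \<Longrightarrow> length vs = k \<Longrightarrow> i < k \<Longrightarrow> linear (\<lambda>v. w (vs[i := v]))"
  by (simp add: multilinear_def)

lemma multilinear_Cons:
  assumes "multilinear (Suc k) w" "length vs = k"
  shows "linear (\<lambda>a. w (a # vs))"
  using multilinearD[OF assms(1), of "undefined # vs" 0] assms(2) by simp

lemma multilinear_tail:
  assumes "multilinear (Suc k) w"
  shows "multilinear k (\<lambda>vs. w (a # vs))"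
  unfolding multilinear_def
proof (intro allI impI)
  fix vs :: "'a list" and i assume "length vs = k \<and> i < k"
  then show "linear (\<lambda>v. w (a # vs[i := v]))"
    using multilinearD[OF assms, of "a # vs" "Suc i"] by simp
qed

lemma alternating_multilinear: "alternating k w \<Longrightarrow> multilinear k w"
  by (simp add: alternating_def multilinear_def)

lemma alternating_zero: "alternating k w \<Longrightarrow> length vs \<noteq> k \<Longrightarrow> w vs = 0"
  by (simp add: alternating_def)

lemma alternating_repeat:
  assumes "alternating k w" "length vs = k" "i < k" "j < k" "i \<noteq> j" "vs ! i = vs ! j"
  shows "w vs = 0"
proof (cases "i < j")
  case True then show ?thesis using assms unfolding alternating_def by blast
next
  case False
  then have "j < i" using assms(5) by simp
  moreover have "vs ! j = vs ! i" using assms(6) by simp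
  ultimately show ?thesis using assms unfolding alternating_def by blast
qed

lemma alternating_swap:
  assumes w: "alternating k w" and vs: "length vs = k" and ij: "i < k" "j < k" "i \<noteq> j"
  shows "w (vs[i := a, j := b]) = - w (vs[i := b, j := a])"
proof -
  note ml = multilinearD[OF alternating_multilinear[OF w]]
  define F where "F = (\<lambda>a b. w (vs[i := a, j := b]))"
  have l2: "linear (F a)" for a unfolding F_def using ml[of "vs[i := a]" j] vs ij by simp
  have l1: "linear (\<lambda>a. F a b)" for b
    unfolding F_def using ml[of "vs[j := b]" i] vs ij by (simp add: list_update_swap)
  have z: "F a a = 0" for a
    unfolding F_def by (rule alternating_repeat[OF w, of _ i j]) (use vs ij in auto)
  have "F (a + b) (a + b) = F a a + F a b + (F b a + F b b)"
    by (simp add: linear_add[OF l1] linear_add[OF l2])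
  then have "F a b + F b a = 0" by (simp add: z)
  then show ?thesis by (simp add: F_def eq_neg_iff_add_eq_0)
qed

lemma alternating_move:
  assumes w: "alternating k w"
  shows "length (ps @ v # xs @ ys) = k \<Longrightarrow> w (ps @ v # xs @ ys) = (-1) ^ length xs * w (ps @ xs @ v # ys)"
proof (induction xs arbitrary: ps)
  case (Cons a xs)
  have "w (ps @ v # a # xs @ ys) = - w (ps @ a # v # xs @ ys)"
    using alternating_swap[OF w, of "ps @ v # a # xs @ ys" "length ps" "Suc (length ps)" v a] Cons.prems
    by (simp add: list_update_append)
  also have "w (ps @ a # v # xs @ ys) = (-1) ^ length xs * w (ps @ a # xs @ v # ys)"
    using Cons.IH[of "ps @ [a]"] Cons.prems by simp
  finally show ?case by simp
qed simp

lemma alternating_insert: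
  assumes w: "alternating k w" and "length us = k" "i < k"
  shows "(-1) ^ i * w (v # take i us @ drop (Suc i) us) = w (us[i := v])"
proof -
  have "w (v # take i us @ drop (Suc i) us) = (-1) ^ i * w (take i us @ v # drop (Suc i) us)"
    using alternating_move[OF w, of "[]" v "take i us" "drop (Suc i) us"] assms by simp
  then show ?thesis using assms by (simp add: upd_conv_take_nth_drop flip: power_add mult.assoc mult_2_right)
qed

lemma nth_list_update_swap_slots:
  "i < length vs \<Longrightarrow> j < length vs \<Longrightarrow> l < length vs \<Longrightarrow>
   (vs[i := vs ! j, j := vs ! i]) ! l = vs ! (Transposition.transpose i j l)"
  by (auto simp: nth_list_update Transposition.transpose_def)

text \<open>The exterior derivative is the antisymmetrization of \<open>nabla w\<close> by exchanges
  of the differentiating slot with each other slot. Covariant differentiation commutes with such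
  exchanges, and this allows the codifferential to be taken term by term.\<close>

definition swap_slots :: "nat \<Rightarrow> nat \<Rightarrow> 'a list \<Rightarrow> 'a list" where
  "swap_slots i j vs = vs[i := vs ! j, j := vs ! i]"

lemma length_swap_slots [simp]: "length (swap_slots i j vs) = length vs"
  by (simp add: swap_slots_def)

lemma swap_slots_update:
  assumes "i < length vs" "j < length vs" "l < length vs"
  shows "swap_slots i j (vs[l := z]) = (swap_slots i j vs)[Transposition.transpose i j l := z]"
  by (rule nth_equalityI) (use assms in \<open>auto simp: swap_slots_def nth_list_update Transposition.transpose_def\<close>)

lemma swap_slots_Cons: "i < length vs \<Longrightarrow> swap_slots 0 (Suc i) (v # vs) = vs ! i # vs[i := v]"
  by (simp add: swap_slots_def)

section \<open>Rules for covariant differentiation in a chart\<close>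

context metric_chart
begin

text \<open>Only one derivative is required, so that covariant derivatives of smooth tensors
  qualify: they contain Christoffel symbols, for which one derivative is available.\<close>

definition tensor_field :: "nat \<Rightarrow> ('v \<Rightarrow> 'v list \<Rightarrow> complex) \<Rightarrow> bool" where
  "tensor_field k w \<longleftrightarrow> (\<forall>x\<in>S. multilinear k (w x) \<and>
     (\<forall>vs. length vs = k \<longrightarrow> (\<lambda>y. w y vs) differentiable (at x)))"

lemma tensor_fieldD:
  assumes "tensor_field k w" "x \<in> S"
  shows "multilinear k (w x)" "length vs = k \<Longrightarrow> (\<lambda>y. w y vs) differentiable (at x)"
  using assms by (auto simp: tensor_field_def)

lemma tensor_field_slot:
  assumes w: "tensor_field k w" and x: "x \<in> S" and vs: "length vs = k" "i < k" and Z: "Z differentiable (at x)"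
  shows "(\<lambda>y. w y (vs[i := Z y])) differentiable (at x)"
    "dir_deriv (\<lambda>y. w y (vs[i := Z y])) x u
      = dir_deriv (\<lambda>y. w y (vs[i := Z x])) x u + w x (vs[i := dir_deriv Z x u])"
proof -
  have lin: "linear (\<lambda>z. w y (vs[i := z]))" if "y \<in> S" for y
    by (rule multilinearD[OF tensor_fieldD(1)[OF w that] vs])
  have d: "(\<lambda>y. w y (vs[i := z])) differentiable (at x)" for z
    by (rule tensor_fieldD(2)[OF w x]) (simp add: vs)
  show "(\<lambda>y. w y (vs[i := Z y])) differentiable (at x)"
    "dir_deriv (\<lambda>y. w y (vs[i := Z y])) x u
      = dir_deriv (\<lambda>y. w y (vs[i := Z x])) x u + w x (vs[i := dir_deriv Z x u])"
    by (rule apply_field[OF open_S x lin d Z], assumption)+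
qed

lemma cov_deriv_cong:
  assumes "x \<in> S" "\<And>y vs. y \<in> S \<Longrightarrow> length vs = k \<Longrightarrow> w y vs = w' y vs" "length vs = k"
  shows "cov_deriv g w x u vs = cov_deriv g w' x u vs"
proof -
  have "dir_deriv (\<lambda>y. w y vs) x = dir_deriv (\<lambda>y. w' y vs) x"
    by (rule dir_deriv_cong_open[OF open_S assms(1)]) (simp add: assms)
  then show ?thesis using assms by (simp add: cov_deriv_def)
qed

lemma cov_deriv_diff:
  assumes "tensor_field k w" "tensor_field k w'" "x \<in> S" "length vs = k"
  shows "cov_deriv g (\<lambda>y vs. w y vs - w' y vs) x u vs = cov_deriv g w x u vs - cov_deriv g w' x u vs"
  using tensor_fieldD(2)[OF assms(1,3,4)] tensor_fieldD(2)[OF assms(2,3,4)]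
  by (simp add: cov_deriv_def dir_deriv_diff sum_subtractf)

lemma cov_deriv_minus:
  assumes "tensor_field k w" "x \<in> S" "length vs = k"
  shows "cov_deriv g (\<lambda>y vs. - w y vs) x u vs = - cov_deriv g w x u vs"
  using tensor_fieldD(2)[OF assms] by (simp add: cov_deriv_def dir_deriv_minus sum_negf)

lemma cov_deriv_sum:
  assumes "\<And>i. i \<in> I \<Longrightarrow> tensor_field k (w i)" "x \<in> S" "length vs = k"
  shows "cov_deriv g (\<lambda>y vs. \<Sum>i\<in>I. w i y vs) x u vs = (\<Sum>i\<in>I. cov_deriv g (w i) x u vs)"
proof -
  have "dir_deriv (\<lambda>y. \<Sum>i\<in>I. w i y vs) x u = (\<Sum>i\<in>I. dir_deriv (\<lambda>y. w i y vs) x u)"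
    by (rule dir_deriv_sum) (rule tensor_fieldD(2)[OF assms(1) assms(2,3)])
  then show ?thesis by (simp add: cov_deriv_def sum_subtractf) (rule sum.swap)
qed

lemma tensor_field_sum:
  assumes "\<And>i. i \<in> I \<Longrightarrow> tensor_field k (w i)"
  shows "tensor_field k (\<lambda>y vs. \<Sum>i\<in>I. w i y vs)"
  unfolding tensor_field_def multilinear_def
proof (intro ballI conjI allI impI)
  fix x and vs :: "'v list" and i assume x: "x \<in> S" and vs: "length vs = k \<and> i < k"
  show "linear (\<lambda>v. \<Sum>j\<in>I. w j x (vs[i := v]))"
    by (rule linear_compose_sum) (use vs multilinearD[OF tensor_fieldD(1)[OF assms x]] in blast)
next
  fix x and vs :: "'v list" assume x: "x \<in> S" and vs: "length vs = k"
  show "(\<lambda>y. \<Sum>i\<in>I. w i y vs) differentiable (at x)"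
    by (rule differentiable_sum_fun) (rule tensor_fieldD(2)[OF assms x vs])
qed

lemma tensor_field_swap:
  assumes w: "tensor_field k w" and ij: "i < k" "j < k"
  shows "tensor_field k (\<lambda>y vs. w y (swap_slots i j vs))"
  unfolding tensor_field_def multilinear_def
proof (intro ballI conjI allI impI)
  fix x and vs :: "'v list" and l assume x: "x \<in> S" and vs: "length vs = k \<and> l < k"
  then have "Transposition.transpose i j l < k" using ij by (auto simp: Transposition.transpose_def)
  then show "linear (\<lambda>v. w x (swap_slots i j (vs[l := v])))"
    using multilinearD[OF tensor_fieldD(1)[OF w x], of "swap_slots i j vs" "Transposition.transpose i j l"] vs ij
    by (simp add: swap_slots_update)
next
  fix x and vs :: "'v list" assume x: "x \<in> S" and vs: "length vs = k"
  show "(\<lambda>y. w y (swap_slots i j vs)) differentiable (at x)"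
    by (rule tensor_fieldD(2)[OF w x]) (simp add: vs)
qed

lemma cov_deriv_swap:
  assumes ij: "i < k" "j < k" and vs: "length vs = k"
  shows "cov_deriv g (\<lambda>y vs. w y (swap_slots i j vs)) x u vs = cov_deriv g w x u (swap_slots i j vs)"
proof -
  let ?t = "Transposition.transpose i j"
  have "(\<Sum>l<k. w x (swap_slots i j (vs[l := christoffel g x u (vs ! l)])))
    = (\<Sum>l<k. w x ((swap_slots i j vs)[?t l := christoffel g x u (swap_slots i j vs ! ?t l)]))"
  proof (rule sum.cong[OF refl])
    fix l assume "l \<in> {..<k}"
    moreover have "?t l < k" if "l < k" using ij that by (auto simp: Transposition.transpose_def)
    ultimately show "w x (swap_slots i j (vs[l := christoffel g x u (vs ! l)]))
      = w x ((swap_slots i j vs)[?t l := christoffel g x u (swap_slots i j vs ! ?t l)])"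
      using ij vs by (simp add: swap_slots_update) (simp add: swap_slots_def nth_list_update_swap_slots)
  qed
  also have "\<dots> = (\<Sum>l<k. w x ((swap_slots i j vs)[l := christoffel g x u (swap_slots i j vs ! l)]))"
    by (rule sum.reindex_bij_witness[of _ ?t ?t]) (use ij in \<open>auto simp: Transposition.transpose_def\<close>)
  finally show ?thesis using vs by (simp add: cov_deriv_def)
qed

lemma cov_deriv_linear:
  assumes w: "tensor_field k w" and x: "x \<in> S" and vs: "length vs = k"
  shows "linear (\<lambda>u. cov_deriv g w x u vs)"
proof -
  note ml = multilinearD[OF tensor_fieldD(1)[OF w x] vs]
  have 1: "linear (\<lambda>u. \<Sum>i<k. w x (vs[i := christoffel g x u (vs ! i)]))"
    by (rule linear_compose_sum) (use linear_compose[OF christoffel_linear(1)[OF x] ml] in \<open>auto simp: o_def\<close>)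
  show ?thesis
    unfolding cov_deriv_def vs
    by (rule linear_compose_sub[OF linear_dir_deriv[OF tensor_fieldD(2)[OF w x vs]] 1])
qed

lemma cov_deriv_multilinear:
  assumes w: "tensor_field k w" and x: "x \<in> S"
  shows "multilinear k (cov_deriv g w x u)"
  unfolding multilinear_def
proof (intro allI impI)
  fix vs :: "'v list" and j assume "length vs = k \<and> j < k"
  then have vs: "length vs = k" "j < k" by auto
  note ml = multilinearD[OF tensor_fieldD(1)[OF w x]]
  have D: "linear (\<lambda>v. dir_deriv (\<lambda>y. w y (vs[j := v])) x u)"
    by (rule dir_deriv_field_linear[OF open_S x])
      (use multilinearD[OF tensor_fieldD(1)[OF w] vs] tensor_fieldD(2)[OF w x] vs in auto)
  have 1: "linear (\<lambda>v. w x ((vs[j := v])[i := christoffel g x u ((vs[j := v]) ! i)]))" if "i < k" for i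
  proof (cases "i = j")
    case True
    then show ?thesis using linear_compose[OF christoffel_linear(2)[OF x] ml[OF vs]] vs by (simp add: o_def)
  next
    case False
    then show ?thesis using ml[of "vs[i := christoffel g x u (vs ! i)]" j] vs
      by (simp add: list_update_swap)
  qed
  have "linear (\<lambda>v. dir_deriv (\<lambda>y. w y (vs[j := v])) x u
     - (\<Sum>i<k. w x ((vs[j := v])[i := christoffel g x u ((vs[j := v]) ! i)])))"
    by (intro linear_compose_sub D linear_compose_sum ballI) (use 1 in auto)
  then show "linear (\<lambda>v. cov_deriv g w x u (vs[j := v]))" using vs by (simp add: cov_deriv_def)
qed

lemma cov_deriv_alternating:
  assumes w: "\<And>y. y \<in> S \<Longrightarrow> alternating k (w y)" and t: "tensor_field k w" and x: "x \<in> S"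
  shows "alternating k (cov_deriv g w x u)"
  unfolding alternating_def
proof (intro conjI allI impI)
  fix vs :: "'v list" assume vs: "length vs \<noteq> k"
  have "dir_deriv (\<lambda>y. w y vs) x = dir_deriv (\<lambda>y. 0) x"
    by (rule dir_deriv_cong_open[OF open_S x]) (use alternating_zero[OF w] vs in auto)
  then show "cov_deriv g w x u vs = 0"
    using alternating_zero[OF w[OF x]] vs by (simp add: cov_deriv_def)
next
  fix vs :: "'v list" and i assume "length vs = k \<and> i < k"
  then show "linear (\<lambda>v. cov_deriv g w x u (vs[i := v]))"
    using multilinearD[OF cov_deriv_multilinear[OF t x]] by blast
next
  fix vs :: "'v list" and i j assume a: "length vs = k \<and> i < j \<and> j < k \<and> vs ! i = vs ! j"
  have "dir_deriv (\<lambda>y. w y vs) x = dir_deriv (\<lambda>y. 0) x"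
    by (rule dir_deriv_cong_open[OF open_S x]) (use alternating_repeat[OF w, of _ vs i j] a in auto)
  then have 1: "dir_deriv (\<lambda>y. w y vs) x u = 0" by simp
  let ?h = "\<lambda>l. w x (vs[l := christoffel g x u (vs ! l)])"
  have z: "?h l = 0" if "l < k" "l \<noteq> i" "l \<noteq> j" for l
    by (rule alternating_repeat[OF w[OF x], of _ i j]) (use a that in auto)
  have "vs[i := z] = vs[i := z, j := vs ! i]" "vs[j := z] = vs[i := vs ! i, j := z]" for z
    using a by (metis list_update_id list_update_swap nat_neq_iff, metis list_update_id)
  then have "?h i + ?h j = 0"
    using alternating_swap[OF w[OF x], of vs i j "christoffel g x u (vs ! i)" "vs ! i"] a
    by (metis add.left_inverse less_trans nat_neq_iff)
  \<comment> \<open>A correction in any slot other than \<open>i\<close> and \<open>j\<close> leaves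
    the repeated vector in place; the corrections in these two slots cancel each other.\<close>
  moreover have "(\<Sum>l<k. ?h l) = (\<Sum>l\<in>{i, j}. ?h l)"
    by (rule sum.mono_neutral_right) (use a z in auto)
  ultimately show "cov_deriv g w x u vs = 0" using 1 a by (simp add: cov_deriv_def)
qed

text \<open>The inverse metric is parallel. Since the coordinate vectors \<open>e\<close> and the
  fields \<open>dual (g y) e\<close> are not parallel one by one, the statement is that the
  corrections cancel after summation. It makes covariant differentiation commute with
  contractions.\<close>

lemma dual_parallel:
  fixes \<beta> :: "'v \<Rightarrow> 'v \<Rightarrow> complex"
  assumes x: "x \<in> S" and b1: "\<And>v. linear (\<lambda>u. \<beta> u v)" and b2: "\<And>u. linear (\<beta> u)"
  shows "(\<Sum>e\<in>Basis. \<beta> (christoffel g x u e) (dual (g x) e)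
     + \<beta> e (dir_deriv (\<lambda>y. dual (g y) e) x u + christoffel g x u (dual (g x) e))) = 0"
proof -
  note gl = g_lin[OF x] g_lin'[OF x]
  let ?G = "christoffel g x u"
  define D where "D e = dir_deriv (\<lambda>y. dual (g y) e) x u + ?G (dual (g x) e)" for e
  \<comment> \<open>The pairing of \<open>dual (g y) e\<close> with a constant vector is constant in
    \<open>y\<close>; differentiating it determines the covariant derivative \<open>D e\<close> of
    the dual field.\<close>
  have D: "D e = - (\<Sum>f\<in>Basis. (e \<bullet> ?G f) *\<^sub>R dual (g x) f)" for e
  proof (rule inner_product_nondegenerate[OF inner_g[OF x]])
    fix z
    have "dir_deriv (\<lambda>y. g y (dual (g y) e) z) x u = dir_deriv (\<lambda>y. e \<bullet> z) x u"
      by (rule fun_cong[OF dir_deriv_cong_open[OF open_S x]]) (simp add: dual_works[OF inner_g])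
    then have "g x (D e) z = - (e \<bullet> ?G z)"
      using dir_deriv_metric_fields(2)[OF x dual_differentiable[OF x], of e z u]
      by (simp add: D_def linear_add[OF gl(2)] dual_works[OF inner_g[OF x]] eq_neg_iff_add_eq_0)
    also have "?G z = (\<Sum>f\<in>Basis. (z \<bullet> f) *\<^sub>R ?G f)"
      by (rule linear_expand[OF christoffel_linear(2)[OF x]])
    also have "- (e \<bullet> (\<Sum>f\<in>Basis. (z \<bullet> f) *\<^sub>R ?G f)) = g x (- (\<Sum>f\<in>Basis. (e \<bullet> ?G f) *\<^sub>R dual (g x) f)) z"
      by (simp add: linear_neg[OF gl(2)] linear_sum[OF gl(2)] linear_cmul[OF gl(2)]
          dual_works[OF inner_g[OF x]] inner_sum_right inner_commute mult.commute)
    finally show "g x (D e) z = g x (- (\<Sum>f\<in>Basis. (e \<bullet> ?G f) *\<^sub>R dual (g x) f)) z" .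
  qed
  have "(\<Sum>e\<in>Basis. \<beta> e (D e)) = - (\<Sum>e\<in>Basis. \<Sum>f\<in>Basis. (e \<bullet> ?G f) *\<^sub>R \<beta> e (dual (g x) f))"
    by (simp add: D linear_neg[OF b2] linear_sum[OF b2] linear_cmul[OF b2] sum_negf)
  also have "\<dots> = - (\<Sum>f\<in>Basis. \<Sum>e\<in>Basis. (?G f \<bullet> e) *\<^sub>R \<beta> e (dual (g x) f))"
    by (subst sum.swap) (simp add: inner_commute)
  also have "\<dots> = - (\<Sum>f\<in>Basis. \<beta> (?G f) (dual (g x) f))"
    by (simp add: linear_expand[OF b1, of "?G _", symmetric])
  finally show ?thesis unfolding D_def[symmetric] by (simp add: sum.distrib)
qed

lemma cov_deriv_Cons:
  assumes "length vs = k"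
  shows "cov_deriv g (\<lambda>y vs. w y (a # vs)) x u vs = cov_deriv g w x u (a # vs) + w x (christoffel g x u a # vs)"
  by (simp add: cov_deriv_def sum.lessThan_Suc_shift del: sum.lessThan_Suc)

lemma cov_deriv_Cons_field:
  assumes w: "tensor_field (Suc k) w" and x: "x \<in> S" and vs: "length vs = k" and Z: "Z differentiable (at x)"
  shows "cov_deriv g (\<lambda>y vs. w y (Z y # vs)) x u vs
    = cov_deriv g w x u (Z x # vs) + w x ((dir_deriv Z x u + christoffel g x u (Z x)) # vs)"
  using tensor_field_slot(2)[OF w x, of "undefined # vs" 0 Z u] vs Z
  by (simp add: cov_deriv_def sum.lessThan_Suc_shift linear_add[OF multilinear_Cons[OF tensor_fieldD(1)[OF w x] vs]]
      del: sum.lessThan_Suc)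

lemma tensor_field_Cons_field:
  assumes w: "tensor_field (Suc k) w" and Z: "\<And>x. x \<in> S \<Longrightarrow> Z differentiable (at x)"
  shows "tensor_field k (\<lambda>y vs. w y (Z y # vs))"
  unfolding tensor_field_def
proof (intro ballI conjI allI impI)
  fix x assume x: "x \<in> S"
  show "multilinear k (\<lambda>vs. w x (Z x # vs))" by (rule multilinear_tail[OF tensor_fieldD(1)[OF w x]])
  fix vs :: "'v list" assume "length vs = k"
  then show "(\<lambda>y. w y (Z y # vs)) differentiable (at x)"
    using tensor_field_slot(1)[OF w x, of "undefined # vs" 0 Z] Z[OF x] by simp
qed

lemma tensor_field_trace:
  assumes w: "tensor_field (Suc (Suc k)) w"
  shows "tensor_field k (\<lambda>y vs. \<Sum>e\<in>Basis. w y (e # dual (g y) e # vs))"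
  by (intro tensor_field_sum tensor_field_Cons_field[where w = "\<lambda>y vs. w y (_ # vs)"]
      tensor_field_Cons_field[OF w, where Z = "\<lambda>y. _"] dual_differentiable) auto

lemma cov_deriv_trace:
  assumes w: "tensor_field (Suc (Suc k)) w" and x: "x \<in> S" and vs: "length vs = k"
  shows "cov_deriv g (\<lambda>y vs. \<Sum>e\<in>Basis. w y (e # dual (g y) e # vs)) x u vs
    = (\<Sum>e\<in>Basis. cov_deriv g w x u (e # dual (g x) e # vs))"
proof -
  have t1: "tensor_field (Suc k) (\<lambda>y vs. w y (e # vs))" for e
    by (rule tensor_field_Cons_field[OF w]) simp
  have t2: "tensor_field k (\<lambda>y vs. w y (e # dual (g y) e # vs))" for e
    by (rule tensor_field_Cons_field[OF t1 dual_differentiable])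
  define \<beta> where "\<beta> a b = w x (a # b # vs)" for a b
  have b1: "linear (\<lambda>a. \<beta> a b)" for b
    unfolding \<beta>_def by (rule multilinear_Cons[OF tensor_fieldD(1)[OF w x]]) (simp add: vs)
  have b2: "linear (\<beta> a)" for a
    unfolding \<beta>_def by (rule multilinear_Cons[OF tensor_fieldD(1)[OF t1 x]]) (simp add: vs)
  have "cov_deriv g (\<lambda>y vs. w y (e # dual (g y) e # vs)) x u vs = cov_deriv g w x u (e # dual (g x) e # vs)
     + (\<beta> (christoffel g x u e) (dual (g x) e)
     + \<beta> e (dir_deriv (\<lambda>y. dual (g y) e) x u + christoffel g x u (dual (g x) e)))" for e
    using cov_deriv_Cons_field[OF t1 x vs dual_differentiable[OF x], of e e u]
      cov_deriv_Cons[of "dual (g x) e # vs" "Suc k" w e x u] vs by (simp add: \<beta>_def)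
  then have "(\<Sum>e\<in>Basis. cov_deriv g (\<lambda>y vs. w y (e # dual (g y) e # vs)) x u vs)
    = (\<Sum>e\<in>Basis. cov_deriv g w x u (e # dual (g x) e # vs))"
    using dual_parallel[OF x b1 b2] by (simp add: sum.distrib)
  then show ?thesis
    using cov_deriv_sum[where w = "\<lambda>e y vs. w y (e # dual (g y) e # vs)" and I = Basis, OF t2 x vs] by simp
qed

end

subsection \<open>The Weitzenboeck formula\<close>

lemma antisymmetric_double_sum:
  fixes B :: "nat \<Rightarrow> nat \<Rightarrow> complex"
  assumes "\<And>i j. i < k \<Longrightarrow> j < k \<Longrightarrow> B i j = - B j i"
  shows "(\<Sum>i<k. \<Sum>j<k. B i j) = 0"
proof -
  have "(\<Sum>i<k. \<Sum>j<k. B i j) = (\<Sum>i<k. \<Sum>j<k. - B j i)"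
    by (intro sum.cong refl assms) auto
  also have "\<dots> = - (\<Sum>i<k. \<Sum>j<k. B i j)"
    by (subst sum.swap) (simp add: sum_negf)
  finally show ?thesis by (simp add: eq_neg_iff_add_eq_0 flip: mult_2)
qed

lemma sum_split_diagonal:
  fixes B :: "nat \<Rightarrow> complex"
  assumes "i < k"
  shows "(\<Sum>j<k. B j) = B i + (\<Sum>j<k. if j = i then 0 else B j)"
proof -
  have "(\<Sum>j<k. B j) = (\<Sum>j<k. (if j = i then B i else 0) + (if j = i then 0 else B j))"
    by (rule sum.cong) auto
  then show ?thesis using assms by (simp add: sum.distrib)
qed

lemma alternating_tail: "alternating (Suc k) w \<Longrightarrow> alternating k (\<lambda>vs. w (a # vs))"
  unfolding alternating_def
proof (intro conjI allI impI)
  assume w: "(\<forall>vs. length vs \<noteq> Suc k \<longrightarrow> w vs = 0) \<and>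
    (\<forall>vs i. length vs = Suc k \<and> i < Suc k \<longrightarrow> linear (\<lambda>v. w (vs[i := v]))) \<and>
    (\<forall>vs i j. length vs = Suc k \<and> i < j \<and> j < Suc k \<and> vs ! i = vs ! j \<longrightarrow> w vs = 0)"
  show "w (a # vs) = 0" if "length vs \<noteq> k" for vs using w that by simp
  show "linear (\<lambda>v. w (a # vs[i := v]))" if "length vs = k \<and> i < k" for vs i
    using w[THEN conjunct2, THEN conjunct1, rule_format, of "a # vs" "Suc i"] that by simp
  show "w (a # vs) = 0" if "length vs = k \<and> i < j \<and> j < k \<and> vs ! i = vs ! j" for vs i j
    using w[THEN conjunct2, THEN conjunct2, rule_format, of "a # vs" "Suc i" "Suc j"] that by simp
qed

lemma alternating_sum:
  fixes w :: "'i \<Rightarrow> 'v::real_vector list \<Rightarrow> complex"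
  assumes "\<And>i. i \<in> I \<Longrightarrow> alternating k (w i)"
  shows "alternating k (\<lambda>vs. \<Sum>i\<in>I. w i vs)"
  unfolding alternating_def
proof (intro conjI allI impI)
  fix vs :: "'v list" and i
  show "(\<Sum>i\<in>I. w i vs) = 0" if "length vs \<noteq> k"
    using assms alternating_zero that by (intro sum.neutral) blast
  show "linear (\<lambda>v. \<Sum>j\<in>I. w j (vs[i := v]))" if "length vs = k \<and> i < k"
    by (rule linear_compose_sum) (use assms that in \<open>simp add: alternating_def\<close>)
  show "(\<Sum>i\<in>I. w i vs) = 0" if "length vs = k \<and> i < j \<and> j < k \<and> vs ! i = vs ! j" for j
    using assms that by (intro sum.neutral ballI) (simp add: alternating_def, blast)
qed

lemma alternating_minus: "alternating k w \<Longrightarrow> alternating k (\<lambda>vs. - w vs)"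
  by (auto simp: alternating_def intro: linear_compose_neg)

lemma alternating_diff: "alternating k w \<Longrightarrow> alternating k w' \<Longrightarrow> alternating k (\<lambda>vs. w vs - w' vs)"
  by (auto simp: alternating_def intro: linear_compose_sub)

context metric_chart
begin

text \<open>The direction of differentiation becomes the first slot, so that second derivatives are
  again covariant derivatives of a tensor field.\<close>

definition nabla :: "('v \<Rightarrow> 'v list \<Rightarrow> complex) \<Rightarrow> 'v \<Rightarrow> 'v list \<Rightarrow> complex" where
  "nabla w x vs = cov_deriv g w x (hd vs) (tl vs)"

lemma nabla_Cons [simp]: "nabla w x (v # vs) = cov_deriv g w x v vs"
  by (simp add: nabla_def)

definition smooth_tensor :: "nat \<Rightarrow> ('v \<Rightarrow> 'v list \<Rightarrow> complex) \<Rightarrow> bool" where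
  "smooth_tensor k w \<longleftrightarrow> (\<forall>x\<in>S. multilinear k (w x)) \<and> (\<forall>vs. length vs = k \<longrightarrow> smooth_on_open S (\<lambda>x. w x vs))"

lemma smooth_tensor_field: "smooth_tensor k w \<Longrightarrow> tensor_field k w"
  by (auto simp: smooth_tensor_def tensor_field_def intro: smooth_differentiable)

lemma cov_deriv_differentiable:
  assumes w: "smooth_tensor k w" and x: "x \<in> S" and vs: "length vs = k"
  shows "(\<lambda>y. dir_deriv (\<lambda>y. w y vs) y v) differentiable (at x)"
    "(\<lambda>y. w y (vs[i := christoffel g y v (vs ! i)])) differentiable (at x)"
    "(\<lambda>y. cov_deriv g w y v vs) differentiable (at x)"
proof -
  note tf = smooth_tensor_field[OF w]
  have sm: "smooth_on_open S (\<lambda>x. w x vs)" using w vs by (simp add: smooth_tensor_def)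
  show 1: "(\<lambda>y. dir_deriv (\<lambda>y. w y vs) y v) differentiable (at x)"
    by (rule smooth_differentiable[OF smooth_dir_deriv[OF sm] x])
  show 2: "(\<lambda>y. w y (vs[i := christoffel g y v (vs ! i)])) differentiable (at x)" for i
  proof (cases "i < k")
    case True
    show ?thesis by (rule tensor_field_slot(1)[OF tf x vs True christoffel_differentiable[OF x]])
  next
    case False
    then have "vs[i := z] = vs" for z using vs by (simp add: list_update_beyond)
    then show ?thesis using tensor_fieldD(2)[OF tf x vs] by simp
  qed
  show "(\<lambda>y. cov_deriv g w y v vs) differentiable (at x)"
    unfolding cov_deriv_def by (intro differentiable_diff differentiable_sum_fun 1 2)
qed

lemma tensor_field_cov_deriv:
  assumes w: "smooth_tensor k w"
  shows "tensor_field k (\<lambda>y. cov_deriv g w y v)"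
  using cov_deriv_multilinear[OF smooth_tensor_field[OF w]] cov_deriv_differentiable(3)[OF w]
  by (simp add: tensor_field_def)

lemma tensor_field_nabla:
  assumes w: "smooth_tensor k w"
  shows "tensor_field (Suc k) (nabla w)"
  unfolding tensor_field_def multilinear_def
proof (intro ballI conjI allI impI)
  fix x and vs :: "'v list" and i assume x: "x \<in> S" and "length vs = Suc k \<and> i < Suc k"
  then obtain u us where vs: "vs = u # us" "length us = k" "i < Suc k" by (cases vs) auto
  show "linear (\<lambda>v. nabla w x (vs[i := v]))"
  proof (cases i)
    case 0
    then show ?thesis using cov_deriv_linear[OF smooth_tensor_field[OF w] x vs(2)] vs by simp
  next
    case (Suc j)
    then show ?thesis
      using multilinearD[OF cov_deriv_multilinear[OF smooth_tensor_field[OF w] x] vs(2)] vs by simp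
  qed
next
  fix x and vs :: "'v list" assume x: "x \<in> S" and "length vs = Suc k"
  then obtain u us where vs: "vs = u # us" "length us = k" by (cases vs) auto
  then show "(\<lambda>y. nabla w y vs) differentiable (at x)"
    using cov_deriv_differentiable(3)[OF w x] by simp
qed

lemma second_cov_deriv:
  assumes "length vs = k"
  shows "cov_deriv g (nabla w) x u (v # vs)
    = cov_deriv g (\<lambda>y. cov_deriv g w y v) x u vs - cov_deriv g w x (christoffel g x u v) vs"
  using cov_deriv_Cons[OF assms, of "nabla w" v x u] by simp

lemma second_cov_deriv_expand:
  assumes w: "smooth_tensor k w" and x: "x \<in> S" and vs: "length vs = k"
  shows "cov_deriv g (\<lambda>y. cov_deriv g w y v) x u vs =
    dir_deriv (\<lambda>y. dir_deriv (\<lambda>y. w y vs) y v) x u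
    - (\<Sum>i<k. dir_deriv (\<lambda>y. w y (vs[i := christoffel g x v (vs ! i)])) x u)
    - (\<Sum>i<k. w x (vs[i := dir_deriv (\<lambda>y. christoffel g y v (vs ! i)) x u]))
    - (\<Sum>i<k. dir_deriv (\<lambda>y. w y (vs[i := christoffel g x u (vs ! i)])) x v)
    + (\<Sum>i<k. w x (vs[i := christoffel g x v (christoffel g x u (vs ! i))]))
    + (\<Sum>i<k. \<Sum>j<k. if j = i then 0
        else w x (vs[i := christoffel g x u (vs ! i), j := christoffel g x v (vs ! j)]))"
proof -
  note tf = smooth_tensor_field[OF w]
  note d = cov_deriv_differentiable[OF w x vs]
  have 1: "dir_deriv (\<lambda>y. cov_deriv g w y v vs) x u = dir_deriv (\<lambda>y. dir_deriv (\<lambda>y. w y vs) y v) x u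
    - (\<Sum>i<k. dir_deriv (\<lambda>y. w y (vs[i := christoffel g x v (vs ! i)])) x u
             + w x (vs[i := dir_deriv (\<lambda>y. christoffel g y v (vs ! i)) x u]))"
  proof -
    have "dir_deriv (\<lambda>y. cov_deriv g w y v vs) x u = dir_deriv (\<lambda>y. dir_deriv (\<lambda>y. w y vs) y v) x u
      - (\<Sum>i<k. dir_deriv (\<lambda>y. w y (vs[i := christoffel g y v (vs ! i)])) x u)"
      unfolding cov_deriv_def vs
      by (simp add: dir_deriv_diff dir_deriv_sum d differentiable_sum_fun)
    then show ?thesis
      using tensor_field_slot(2)[OF tf x vs _ christoffel_differentiable[OF x]] by simp
  qed
  have 2: "cov_deriv g w x v (vs[i := christoffel g x u (vs ! i)])
    = dir_deriv (\<lambda>y. w y (vs[i := christoffel g x u (vs ! i)])) x v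
     - w x (vs[i := christoffel g x v (christoffel g x u (vs ! i))])
     - (\<Sum>j<k. if j = i then 0
          else w x (vs[i := christoffel g x u (vs ! i), j := christoffel g x v (vs ! j)]))"
    if "i < k" for i
  proof -
    have "(\<Sum>j<k. w x (vs[i := christoffel g x u (vs ! i),
             j := christoffel g x v (vs[i := christoffel g x u (vs ! i)] ! j)]))
       = w x (vs[i := christoffel g x v (christoffel g x u (vs ! i))])
       + (\<Sum>j<k. if j = i then 0
          else w x (vs[i := christoffel g x u (vs ! i), j := christoffel g x v (vs ! j)]))"
      using that vs by (subst sum_split_diagonal[OF that]) (auto intro!: sum.cong)
    then show ?thesis by (simp add: cov_deriv_def vs)
  qed
  have "cov_deriv g (\<lambda>y. cov_deriv g w y v) x u vs = dir_deriv (\<lambda>y. cov_deriv g w y v vs) x u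
     - (\<Sum>i<k. cov_deriv g w x v (vs[i := christoffel g x u (vs ! i)]))"
    by (simp add: cov_deriv_def[of g "\<lambda>y. cov_deriv g w y v"] vs)
  then show ?thesis by (simp add: 1 2 sum.distrib sum_subtractf)
qed

text \<open>The Ricci identity. In the expansion of both second derivatives the partial derivatives
  commute, the terms with one derivative of \<open>w\<close> form a symmetric pair, and the terms
  that change two different slots match after renaming the slots. What remains are the terms in a
  single slot, which make up the curvature.\<close>

lemma cov_deriv_commutator:
  assumes w: "smooth_tensor k w" and x: "x \<in> S" and vs: "length vs = k"
  shows "cov_deriv g (nabla w) x u (v # vs) - cov_deriv g (nabla w) x v (u # vs)
    = - (\<Sum>i<k. w x (vs[i := curvature_endo g x u v (vs ! i)]))"
proof -
  note tf = smooth_tensor_field[OF w]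
  note ml = multilinearD[OF tensor_fieldD(1)[OF tf x] vs]
  have sm: "smooth_on_open S (\<lambda>x. w x vs)" using w vs by (simp add: smooth_tensor_def)
  have R: "(\<Sum>i<k. w x (vs[i := curvature_endo g x u v (vs ! i)]))
    = (\<Sum>i<k. w x (vs[i := dir_deriv (\<lambda>y. christoffel g y v (vs ! i)) x u]))
     - (\<Sum>i<k. w x (vs[i := dir_deriv (\<lambda>y. christoffel g y u (vs ! i)) x v]))
     + (\<Sum>i<k. w x (vs[i := christoffel g x u (christoffel g x v (vs ! i))]))
     - (\<Sum>i<k. w x (vs[i := christoffel g x v (christoffel g x u (vs ! i))]))"
    unfolding sum_subtractf[symmetric] sum.distrib[symmetric]
    by (rule sum.cong[OF refl]) (simp add: curvature_endo_def linear_diff[OF ml] linear_add[OF ml])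
  have sw: "(\<Sum>i<k. \<Sum>j<k. if j = i then 0
        else w x (vs[i := christoffel g x u (vs ! i), j := christoffel g x v (vs ! j)]))
     = (\<Sum>i<k. \<Sum>j<k. if j = i then 0
        else w x (vs[i := christoffel g x v (vs ! i), j := christoffel g x u (vs ! j)]))"
    by (subst sum.swap, intro sum.cong refl) (auto simp: list_update_swap)
  show ?thesis
    unfolding second_cov_deriv[OF vs] second_cov_deriv_expand[OF w x vs] R sw
      christoffel_sym[OF x, of v u] second_derivative_symmetric[OF sm x, of u v]
    by simp
qed

text \<open>Replacing partial by covariant derivatives costs nothing since the connection has no
  torsion: the corrections form a double sum that is antisymmetric, because Christoffel symbols are
  symmetric and \<open>w\<close> alternates.\<close>

lemma ext_deriv_cov_deriv:
  assumes alt: "\<And>y. y \<in> S \<Longrightarrow> alternating k (w y)" and tf: "tensor_field k w"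
    and x: "x \<in> S" and us: "length us = k"
  shows "ext_deriv w x (v # us) = cov_deriv g w x v us - (\<Sum>i<k. cov_deriv g w x (us ! i) (us[i := v]))"
proof -
  have ins: "(- 1) ^ i *\<^sub>R dir_deriv (\<lambda>y. w y (v # take i us @ drop (Suc i) us)) x u
    = dir_deriv (\<lambda>y. w y (us[i := v])) x u" if "i < k" for i u
  proof -
    have "(\<lambda>y. w y (v # take i us @ drop (Suc i) us)) differentiable (at x)"
      by (rule tensor_fieldD(2)[OF tf x]) (use us that in simp)
    then have "(- 1) ^ i *\<^sub>R dir_deriv (\<lambda>y. w y (v # take i us @ drop (Suc i) us)) x u
      = dir_deriv (\<lambda>y. (- 1) ^ i *\<^sub>R w y (v # take i us @ drop (Suc i) us)) x u"
      by (simp add: dir_deriv_linear[OF bounded_linear_scaleR_right])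
    also have "dir_deriv (\<lambda>y. (- 1) ^ i *\<^sub>R w y (v # take i us @ drop (Suc i) us)) x
       = dir_deriv (\<lambda>y. w y (us[i := v])) x"
      by (rule dir_deriv_cong_open[OF open_S x])
        (use alternating_insert[OF alt us that] in \<open>simp add: scaleR_conv_of_real\<close>)
    finally show ?thesis .
  qed
  have 1: "ext_deriv w x (v # us) = dir_deriv (\<lambda>y. w y us) x v
    - (\<Sum>i<k. dir_deriv (\<lambda>y. w y (us[i := v])) x (us ! i))"
  proof -
    have "ext_deriv w x (v # us) = dir_deriv (\<lambda>y. w y us) x v
     + (\<Sum>i<k. - ((- 1) ^ i *\<^sub>R dir_deriv (\<lambda>y. w y (v # take i us @ drop (Suc i) us)) x (us ! i)))"
      by (simp add: ext_deriv_def us sum.lessThan_Suc_shift del: sum.lessThan_Suc)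
    also have "\<dots> = dir_deriv (\<lambda>y. w y us) x v + (\<Sum>i<k. - dir_deriv (\<lambda>y. w y (us[i := v])) x (us ! i))"
      using ins by simp
    finally show ?thesis by (simp add: sum_negf)
  qed
  define A where "A i j = w x (us[i := v, j := christoffel g x (us ! i) (us ! j)])" for i j
  have inner: "(\<Sum>j<k. w x (us[i := v, j := christoffel g x (us ! i) (us[i := v] ! j)]))
     = w x (us[i := christoffel g x v (us ! i)]) + (\<Sum>j<k. if j = i then 0 else A i j)" if "i < k" for i
    using that us by (subst sum_split_diagonal[OF that])
      (auto intro!: sum.cong simp: A_def christoffel_sym[OF x, of _ v])
  have "(\<Sum>i<k. \<Sum>j<k. if j = i then 0 else A i j) = 0"
  proof (rule antisymmetric_double_sum)
    fix i j assume ij: "i < k" "j < k"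
    show "(if j = i then 0 else A i j) = - (if i = j then 0 else A j i)"
    proof (cases "i = j")
      case False
      have "A i j = - w x (us[i := christoffel g x (us ! i) (us ! j), j := v])"
        unfolding A_def by (rule alternating_swap[OF alt[OF x] us ij False])
      also have "us[i := christoffel g x (us ! i) (us ! j), j := v] = us[j := v, i := christoffel g x (us ! j) (us ! i)]"
        using False by (simp add: list_update_swap christoffel_sym[OF x, of "us ! i"])
      finally show ?thesis using False by (simp add: A_def)
    qed simp
  qed
  then have "(\<Sum>i<k. \<Sum>j<k. w x (us[i := v, j := christoffel g x (us ! i) (us[i := v] ! j)]))
     = (\<Sum>i<k. w x (us[i := christoffel g x v (us ! i)]))"
    by (simp add: inner sum.distrib)
  then show ?thesis
    unfolding 1 by (simp add: cov_deriv_def us sum_subtractf)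
qed

lemma second_cov_deriv_alternating:
  assumes alt: "\<And>y. y \<in> S \<Longrightarrow> alternating k (w y)" and w: "smooth_tensor k w" and x: "x \<in> S"
  shows "alternating k (\<lambda>vs. cov_deriv g (nabla w) x u (v # vs))"
proof -
  have a: "alternating k (cov_deriv g w y v)" if "y \<in> S" for y v
    by (rule cov_deriv_alternating[OF alt smooth_tensor_field[OF w] that])
  have "(\<lambda>vs. cov_deriv g (nabla w) x u (v # vs)) =
    (\<lambda>vs. cov_deriv g (\<lambda>y. cov_deriv g w y v) x u vs - cov_deriv g w x (christoffel g x u v) vs)"
    by (rule ext) (rule second_cov_deriv[OF refl])
  then show ?thesis
    using alternating_diff[OF cov_deriv_alternating[OF a tensor_field_cov_deriv[OF w] x] a[OF x]] by simp
qed

lemma codiff_eq: "codiff g w x vs = - (\<Sum>e\<in>Basis. nabla w x (e # dual (g x) e # vs))"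
  by (simp add: codiff_def dual_def)

text \<open>Both halves of the Laplacian contain the same mixed second derivatives, with opposite
  signs and with the two differentiations in opposite order. Besides the rough Laplacian only
  commutators are left, and these are curvature terms.\<close>

theorem weitzenboeck:
  assumes alt: "\<And>y. y \<in> S \<Longrightarrow> alternating k (w y)" and w: "smooth_tensor k w"
    and x: "x \<in> S" and vs: "length vs = k" and k: "k > 0"
  shows "hodge_laplacian g w x vs = - (\<Sum>e\<in>Basis. cov_deriv g (nabla w) x e (dual (g x) e # vs))
    - (\<Sum>i<k. \<Sum>e\<in>Basis. \<Sum>j<k. w x (vs[i := dual (g x) e,
         j := curvature_endo g x e (vs ! i) (vs[i := dual (g x) e] ! j)]))"
proof -
  note tf = smooth_tensor_field[OF w] and tn = tensor_field_nabla[OF w]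
  note cd = cov_deriv_alternating[OF alt tf]
  define N where "N u v vs = cov_deriv g (nabla w) x u (v # vs)" for u v vs
  note altN = second_cov_deriv_alternating[OF alt w x, folded N_def]
  obtain m where m: "k = Suc m" using k by (cases k) auto
  obtain v0 us where vs': "vs = v0 # us" "length us = m" using vs m by (cases vs) auto
  have tn2: "tensor_field (Suc (Suc m)) (nabla w)" using tn m by simp
  have tt: "tensor_field m (\<lambda>y vs. \<Sum>e\<in>Basis. nabla w y (e # dual (g y) e # vs))"
    by (rule tensor_field_trace[OF tn2])
  have codiff_field: "codiff g w = (\<lambda>y vs. - (\<Sum>e\<in>Basis. nabla w y (e # dual (g y) e # vs)))"
    by (intro ext codiff_eq)
  have tc: "tensor_field m (codiff g w)"
    using tt unfolding codiff_field tensor_field_def multilinear_def by (auto intro: linear_compose_neg)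
  have altc: "alternating m (codiff g w y)" if "y \<in> S" for y
    unfolding codiff_field nabla_Cons
    by (intro alternating_minus alternating_sum alternating_tail) (use cd[OF _ that] m in simp)
  have covc: "cov_deriv g (codiff g w) x u ts = - (\<Sum>e\<in>Basis. N u e (dual (g x) e # ts))"
    if "length ts = m" for u ts
    unfolding codiff_field N_def
    by (simp only: cov_deriv_minus[OF tt x that] cov_deriv_trace[OF tn2 x that])
  \<comment> \<open>Exchanging the contracted vector with \<open>v0\<close> brings the terms of
    \<open>ext_deriv\<close> to the common shape in which one entry of \<open>vs\<close> is replaced
    by the dual vector.\<close>
  have sw: "N u e (dual (g x) e # us[i := v0]) = - N u e (vs[Suc i := dual (g x) e])" if "i < m" for u e i
    using alternating_swap[OF altN[where u = u and v = e], of vs 0 "Suc i" "dual (g x) e" v0] that vs' m by simp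
  have part1: "ext_deriv (codiff g w) x vs = - (\<Sum>i<k. \<Sum>e\<in>Basis. N (vs ! i) e (vs[i := dual (g x) e]))"
  proof -
    have "ext_deriv (codiff g w) x (v0 # us)
      = cov_deriv g (codiff g w) x v0 us - (\<Sum>i<m. cov_deriv g (codiff g w) x (us ! i) (us[i := v0]))"
      by (rule ext_deriv_cov_deriv[OF altc tc x vs'(2)])
    then show ?thesis
    unfolding vs'(1)
    by (simp add: covc vs' m sw[unfolded vs'(1)] sum.lessThan_Suc_shift sum_negf del: sum.lessThan_Suc)
  qed
  \<comment> \<open>This agrees with \<open>ext_deriv w\<close> on lists of length
    \<open>Suc k\<close> and is built from \<open>nabla\<close> and slot exchanges, to which the
    differentiation rules apply.\<close>
  define dT where "dT y ts = nabla w y ts - (\<Sum>i<k. nabla w y (swap_slots 0 (Suc i) ts))" for y ts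
  have eq: "ext_deriv w y ts = dT y ts" if y: "y \<in> S" and lts: "length ts = Suc k" for y ts
  proof -
    obtain a bs where ts: "ts = a # bs" "length bs = k" using lts by (cases ts) auto
    show ?thesis using ext_deriv_cov_deriv[OF alt tf y ts(2), of a] ts
      by (simp add: dT_def swap_slots_Cons)
  qed
  have tsw: "tensor_field (Suc k) (\<lambda>y ts. nabla w y (swap_slots 0 (Suc i) ts))" if "i \<in> {..<k}" for i
    by (rule tensor_field_swap[OF tn]) (use that in auto)
  have part2: "codiff g (ext_deriv w) x vs
    = - (\<Sum>e\<in>Basis. N e (dual (g x) e) vs) + (\<Sum>i<k. \<Sum>e\<in>Basis. N e (vs ! i) (vs[i := dual (g x) e]))"
  proof -
    have "cov_deriv g (ext_deriv w) x e (dual (g x) e # vs)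
       = N e (dual (g x) e) vs - (\<Sum>i<k. N e (vs ! i) (vs[i := dual (g x) e]))" for e
    proof -
      have len: "length (dual (g x) e # vs) = Suc k" using vs by simp
      have "cov_deriv g (ext_deriv w) x e (dual (g x) e # vs) = cov_deriv g dT x e (dual (g x) e # vs)"
        by (rule cov_deriv_cong[OF x eq len])
      also have "\<dots> = cov_deriv g (nabla w) x e (dual (g x) e # vs)
         - (\<Sum>i<k. cov_deriv g (\<lambda>y ts. nabla w y (swap_slots 0 (Suc i) ts)) x e (dual (g x) e # vs))"
        unfolding dT_def
        by (simp only: cov_deriv_diff[OF tn tensor_field_sum[OF tsw] x len] cov_deriv_sum[OF tsw x len])
      also have "\<dots> = N e (dual (g x) e) vs - (\<Sum>i<k. N e (vs ! i) (vs[i := dual (g x) e]))"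
        unfolding N_def using len vs by (simp add: cov_deriv_swap[of 0 "Suc k"] swap_slots_Cons)
      finally show ?thesis .
    qed
    then have "codiff g (ext_deriv w) x vs
       = - (\<Sum>e\<in>Basis. N e (dual (g x) e) vs) + (\<Sum>e\<in>Basis. \<Sum>i<k. N e (vs ! i) (vs[i := dual (g x) e]))"
      by (simp add: codiff_def dual_def[symmetric] sum_subtractf)
    then show ?thesis by (simp only: sum.swap[of _ "{..<k}" Basis])
  qed
  \<comment> \<open>The two orders of differentiation meet here.\<close>
  have comm: "N e (vs ! i) (vs[i := dual (g x) e]) - N (vs ! i) e (vs[i := dual (g x) e])
     = - (\<Sum>j<k. w x (vs[i := dual (g x) e, j := curvature_endo g x e (vs ! i) (vs[i := dual (g x) e] ! j)]))"
    for i e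
    unfolding N_def by (rule cov_deriv_commutator[OF w x]) (simp add: vs)
  have "hodge_laplacian g w x vs = - (\<Sum>e\<in>Basis. N e (dual (g x) e) vs)
     + (\<Sum>i<k. \<Sum>e\<in>Basis. N e (vs ! i) (vs[i := dual (g x) e]) - N (vs ! i) e (vs[i := dual (g x) e]))"
    by (simp add: hodge_laplacian_def part1 part2 sum_subtractf)
  then show ?thesis by (simp only: comm sum_negf) (simp add: N_def)
qed

end

subsection \<open>Orthonormal and unitary frames\<close>

lemma bilinear_differentiable_bounded:
  fixes b :: "'v::euclidean_space \<Rightarrow> 'v \<Rightarrow> real"
  assumes "\<And>u. linear (b u)" "\<And>v. linear (\<lambda>u. b u v)"
  shows "bounded_bilinear b"
  using assms bilinear_conv_bounded_bilinear bilinear_def by blast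

text \<open>The Rayleigh quotient attains its maximum on the unit sphere of the subspace, which is
  compact by the lower bound for \<open>b\<close>. Homogeneity extends the estimate to all
  vectors.\<close>

lemma constrained_maximum:
  fixes b P :: "'v::euclidean_space \<Rightarrow> 'v \<Rightarrow> real"
  assumes b: "inner_product b" and P: "\<And>u. linear (P u)" "\<And>v. linear (\<lambda>u. P u v)"
    and W: "subspace W" "W \<noteq> {0}"
  obtains u where "u \<in> W" "b u u = 1" "\<And>v. v \<in> W \<Longrightarrow> P v v \<le> P u u * b v v"
proof -
  note bl = inner_productD[OF b]
  note bb = bilinear_differentiable_bounded[OF bl(1) bl(2)] and PP = bilinear_differentiable_bounded[OF P]
  obtain c where c: "c > 0" "\<And>u. b u u \<ge> c * (norm u)\<^sup>2" using inner_product_lower_bound[OF b] by blast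
  define K where "K = {u \<in> W. b u u = 1}"
  have contb: "continuous_on UNIV (\<lambda>u. b u u)"
    by (intro bounded_bilinear.continuous_on[OF bb] continuous_intros)
  have "closed {u. b u u = 1}" by (rule closed_Collect_eq[OF contb continuous_on_const])
  moreover have "K = W \<inter> {u. b u u = 1}" by (auto simp: K_def)
  ultimately have clK: "closed K" using closed_subspace[OF W(1)] by (simp add: closed_Int)
  have "bounded K"
  proof (rule boundedI)
    fix u assume "u \<in> K"
    then have "c * (norm u)\<^sup>2 \<le> 1" using c(2)[of u] by (simp add: K_def)
    then have "(norm u)\<^sup>2 \<le> 1 / c" using c(1) by (simp add: field_simps)
    then show "norm u \<le> sqrt (1 / c)" using real_le_rsqrt by blast
  qed
  then have cK: "compact K" using clK compact_eq_bounded_closed by blast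
  have norm1: "v /\<^sub>R sqrt (b v v) \<in> K" "b v v > 0" if "v \<in> W" "v \<noteq> 0" for v
  proof -
    show pos: "b v v > 0" by (rule bl(4)[OF that(2)])
    then show "v /\<^sub>R sqrt (b v v) \<in> K"
      using that W(1) by (simp add: K_def subspace_scale linear_cmul[OF bl(1)] linear_cmul[OF bl(2)] field_simps)
  qed
  have "\<exists>w\<in>W. w \<noteq> 0" using W subspace_0 by blast
  then have "K \<noteq> {}" using norm1 by blast
  moreover have "continuous_on K (\<lambda>u. P u u)"
    by (intro bounded_bilinear.continuous_on[OF PP] continuous_intros)
  ultimately obtain u where u: "u \<in> K" "\<And>v. v \<in> K \<Longrightarrow> P v v \<le> P u u"
    using continuous_attains_sup[OF cK] by blast
  show ?thesis
  proof
    show "u \<in> W" "b u u = 1" using u(1) by (auto simp: K_def)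
    fix v assume v: "v \<in> W"
    show "P v v \<le> P u u * b v v"
    proof (cases "v = 0")
      case True then show ?thesis by (simp add: linear_0[OF bl(1)] linear_0[OF P(1)])
    next
      case False
      have "P (v /\<^sub>R sqrt (b v v)) (v /\<^sub>R sqrt (b v v)) \<le> P u u" using u(2) norm1(1)[OF v False] by blast
      moreover have "P (v /\<^sub>R r) (v /\<^sub>R r) = P v v / (r * r)" for r
        by (simp add: linear_cmul[OF P(1)] linear_cmul[OF P(2)] divide_inverse)
      moreover have "sqrt (b v v) * sqrt (b v v) = b v v" using norm1(2)[OF v False] by simp
      ultimately have "P v v / b v v \<le> P u u" by simp
      then show ?thesis using norm1(2)[OF v False] by (simp add: pos_divide_le_eq)
    qed
  qed
qed

lemma quadratic_vanishing_linear_term: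
  fixes a c :: real
  assumes "\<And>t. 2 * t * a \<le> t\<^sup>2 * c"
  shows "a = 0"
proof (rule ccontr)
  assume a: "a \<noteq> 0"
  \<comment> \<open>With this value \<open>t\<^sup>2 * (\<bar>c\<bar> + 1)\<close> equals
    \<open>t * a\<close>, only half of the left side.\<close>
  define t where "t = a / (\<bar>c\<bar> + 1)"
  have p: "\<bar>c\<bar> + 1 > 0" by simp
  have "2 * t * a \<le> t\<^sup>2 * c" by (rule assms)
  also have "\<dots> \<le> t\<^sup>2 * (\<bar>c\<bar> + 1)" by (intro mult_left_mono) auto
  also have "\<dots> = t * a" using p by (simp add: t_def power2_eq_square)
  finally have "t * a \<le> 0" by (simp add: mult.commute)
  moreover have "t * a > 0" using a p by (simp add: t_def zero_less_mult_iff zero_less_divide_iff) linarith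
  ultimately show False by simp
qed

text \<open>First variation of the Rayleigh quotient along \<open>u + t *\<^sub>R v\<close>: the
  linear term must vanish because \<open>t\<close> may have either sign.\<close>

lemma maximum_critical:
  fixes b P :: "'v::euclidean_space \<Rightarrow> 'v \<Rightarrow> real"
  assumes b: "inner_product b" and P: "\<And>u. linear (P u)" "\<And>v. linear (\<lambda>u. P u v)" "\<And>u v. P u v = P v u"
    and W: "subspace W" and u: "u \<in> W" "b u u = 1" and max: "\<And>v. v \<in> W \<Longrightarrow> P v v \<le> P u u * b v v"
    and v: "v \<in> W" "b u v = 0"
  shows "P u v = 0"
proof (rule quadratic_vanishing_linear_term)
  fix t :: real
  note bl = inner_productD[OF b]
  have "b v u = 0" using v(2) bl(3) by metis
  then have "b (u + t *\<^sub>R v) (u + t *\<^sub>R v) = 1 + t\<^sup>2 * b v v"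
    using u v by (simp add: linear_add[OF bl(1)] linear_add[OF bl(2)] linear_cmul[OF bl(1)] linear_cmul[OF bl(2)]
      power2_eq_square)
  moreover have "P (u + t *\<^sub>R v) (u + t *\<^sub>R v) = P u u + 2 * t * P u v + t\<^sup>2 * P v v"
    using P(3)[of v u]
    by (simp add: linear_add[OF P(1)] linear_add[OF P(2)] linear_cmul[OF P(1)] linear_cmul[OF P(2)]
      power2_eq_square algebra_simps)
  moreover have "u + t *\<^sub>R v \<in> W" using W u v by (simp add: subspace_add subspace_scale)
  ultimately have "P u u + 2 * t * P u v + t\<^sup>2 * P v v \<le> P u u * (1 + t\<^sup>2 * b v v)"
    using max by fastforce
  then show "2 * t * P u v \<le> t\<^sup>2 * (P u u * b v v - P v v)" by (simp add: algebra_simps)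
qed

lemma subspace_orthogonal:
  assumes b: "inner_product b" and W: "subspace W"
  shows "subspace {v \<in> W. b u v = 0}"
  using W linear_0[OF inner_productD(1)[OF b]] linear_add[OF inner_productD(1)[OF b]]
    linear_cmul[OF inner_productD(1)[OF b]]
  by (auto simp: subspace_def)

lemma dim_psubset_subspace:
  fixes W :: "'v::euclidean_space set"
  assumes "subspace W" "subspace V" "V \<subset> W"
  shows "dim V < dim W"
  using assms dim_psubset[of V W] by (metis span_eq_iff)

text \<open>Spectral theorem for a symmetric form relative to an arbitrary inner product, by
  splitting off a maximizer and passing to its orthogonal complement. Completeness is stated as an
  expansion formula, the form in which it is used later.\<close>

lemma orthonormal_eigenframe:
  fixes b P :: "'v::euclidean_space \<Rightarrow> 'v \<Rightarrow> real"
  assumes b: "inner_product b" and P: "\<And>u. linear (P u)" "\<And>v. linear (\<lambda>u. P u v)" "\<And>u v. P u v = P v u"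
  shows "subspace W \<Longrightarrow> \<exists>(m::nat) e. (\<forall>i<m. e i \<in> W) \<and> (\<forall>i<m. \<forall>j<m. b (e i) (e j) = (if i = j then 1 else 0)) \<and>
     (\<forall>v\<in>W. v = (\<Sum>i<m. b v (e i) *\<^sub>R e i)) \<and> (\<forall>i<m. \<forall>j<m. i \<noteq> j \<longrightarrow> P (e i) (e j) = 0)"
proof (induction "dim W" arbitrary: W rule: less_induct)
  case less
  note bl = inner_productD[OF b]
  show ?case
  proof (cases "W = {0}")
    case True
    show ?thesis by (rule exI[of _ "0::nat"], rule exI[of _ "\<lambda>_. 0"]) (use True in simp)
  next
    case False
    obtain u where u: "u \<in> W" "b u u = 1" and max: "\<And>v. v \<in> W \<Longrightarrow> P v v \<le> P u u * b v v"
      using constrained_maximum[where P = P, OF b P(1,2) less.prems False] by blast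
    define W' where "W' = {v \<in> W. b u v = 0}"
    have sW': "subspace W'" unfolding W'_def by (rule subspace_orthogonal[OF b less.prems])
    have "u \<notin> W'" using u by (simp add: W'_def)
    moreover have "W' \<subseteq> W" by (auto simp: W'_def)
    ultimately have "W' \<subset> W" using u by blast
    then have dimlt: "dim W' < dim W" by (rule dim_psubset_subspace[OF less.prems sW'])
    obtain m :: nat and e where e: "\<forall>i<m. e i \<in> W'" "\<forall>i<m. \<forall>j<m. b (e i) (e j) = (if i = j then 1 else 0)"
      "\<forall>v\<in>W'. v = (\<Sum>i<m. b v (e i) *\<^sub>R e i)" "\<forall>i<m. \<forall>j<m. i \<noteq> j \<longrightarrow> P (e i) (e j) = 0"
      using less.hyps[OF dimlt sW'] by (elim exE conjE) (rule that)
    define f where "f i = (if i < m then e i else u)" for i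
    have f: "i < m \<Longrightarrow> f i = e i" "f m = u" for i by (auto simp: f_def)
    have ue: "b u (e i) = 0" "b (e i) u = 0" "P u (e i) = 0" "P (e i) u = 0" if "i < m" for i
    proof -
      have m: "e i \<in> W" "b u (e i) = 0" using e(1) that by (auto simp: W'_def)
      show 1: "b u (e i) = 0" by (rule m(2))
      show 2: "P u (e i) = 0" by (rule maximum_critical[OF b P less.prems u max m])
      show "b (e i) u = 0" "P (e i) u = 0" using 1 2 bl(3)[of u "e i"] P(3)[of u "e i"] by simp_all
    qed
    show ?thesis
    proof (intro exI[of _ "Suc m"] exI[of _ f] conjI)
      show "\<forall>i<Suc m. f i \<in> W" using e(1) u by (auto simp: f_def W'_def)
      show "\<forall>i<Suc m. \<forall>j<Suc m. b (f i) (f j) = (if i = j then 1 else 0)"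
        using e(2) ue u by (auto simp: f_def less_Suc_eq)
      show "\<forall>i<Suc m. \<forall>j<Suc m. i \<noteq> j \<longrightarrow> P (f i) (f j) = 0"
        using e(4) ue by (auto simp: f_def less_Suc_eq)
      show "\<forall>v\<in>W. v = (\<Sum>i<Suc m. b v (f i) *\<^sub>R f i)"
      proof
        fix v assume v: "v \<in> W"
        define v' where "v' = v - b v u *\<^sub>R u"
        have "b u v = b v u" by (rule bl(3))
        then have "v' \<in> W'" using v u less.prems
          by (simp add: W'_def v'_def subspace_diff subspace_scale linear_diff[OF bl(1)] linear_cmul[OF bl(1)])
        then have "v' = (\<Sum>i<m. b v' (e i) *\<^sub>R e i)" using e(3) by blast
        also have "\<dots> = (\<Sum>i<m. b v (e i) *\<^sub>R e i)"
          by (rule sum.cong) (auto simp: v'_def linear_diff[OF bl(2)] linear_cmul[OF bl(2)] ue)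
        finally show "v = (\<Sum>i<Suc m. b v (f i) *\<^sub>R f i)" by (simp add: f v'_def algebra_simps)
      qed
    qed
  qed
qed

section \<open>Unitary frames and Takagi diagonalization\<close>

definition unitary_frame :: "(complex ^ 'n \<Rightarrow> complex ^ 'n \<Rightarrow> real) \<Rightarrow> nat \<Rightarrow> (nat \<Rightarrow> complex ^ 'n) \<Rightarrow> bool" where
  "unitary_frame b m e \<longleftrightarrow>
     (\<forall>i<m. \<forall>j<m. b (e i) (e j) = (if i = j then 1 else 0) \<and> b (e i) (J (e j)) = 0) \<and>
     (\<forall>v. v = (\<Sum>i<m. b v (e i) *\<^sub>R e i + b v (J (e i)) *\<^sub>R J (e i)))"

text \<open>Such a \<open>P\<close> is the real part of a complex symmetric form, and this is
  Takagi's factorization. For a maximizer \<open>u\<close> the vector \<open>J u\<close> is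
  orthogonal to \<open>u\<close>, so \<open>P u (J u)\<close> vanishes by criticality, and the
  complement of both vectors is again invariant under \<open>J\<close>. The value at
  \<open>u\<close> is nonnegative since the value at \<open>J u\<close> is its negative and not
  larger.\<close>

lemma takagi_frame_subspace:
  fixes b P :: "complex ^ 'n::finite \<Rightarrow> complex ^ 'n \<Rightarrow> real"
  assumes b: "inner_product b" and bJ: "\<And>u v. b (J u) (J v) = b u v"
    and P: "\<And>u. linear (P u)" "\<And>v. linear (\<lambda>u. P u v)" "\<And>u v. P u v = P v u"
    and PJ: "\<And>u v. P (J u) (J v) = - P u v"
  shows "subspace W \<Longrightarrow> J ` W \<subseteq> W \<Longrightarrow> \<exists>(m::nat) e. (\<forall>i<m. e i \<in> W) \<and>
     (\<forall>i<m. \<forall>j<m. b (e i) (e j) = (if i = j then 1 else 0) \<and> b (e i) (J (e j)) = 0) \<and>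
     (\<forall>v\<in>W. v = (\<Sum>i<m. b v (e i) *\<^sub>R e i + b v (J (e i)) *\<^sub>R J (e i))) \<and>
     (\<forall>i<m. \<forall>j<m. (i \<noteq> j \<longrightarrow> P (e i) (e j) = 0) \<and> P (e i) (J (e j)) = 0) \<and> (\<forall>i<m. P (e i) (e i) \<ge> 0)"
proof (induction "dim W" arbitrary: W rule: less_induct)
  case less
  note bl = inner_productD[OF b]
  have bJl: "b (J x) y = - b x (J y)" for x y
    using bJ[of x "J y"] bJ[of "J x" y] by (simp add: linear_neg[OF bl(1)] linear_neg[OF bl(2)])
  have PJl: "P (J x) y = P x (J y)" for x y
    using PJ[of x "J y"] PJ[of "J x" y] by (simp add: linear_neg[OF P(1)] linear_neg[OF P(2)])
  have bJ0: "b x (J x) = 0" for x using bJl[of x x] bl(3)[of x "J x"] by simp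
  show ?case
  proof (cases "W = {0}")
    case True
    show ?thesis by (rule exI[of _ "0::nat"], rule exI[of _ "\<lambda>_. 0"]) (use True in simp)
  next
    case False
    obtain u where u: "u \<in> W" "b u u = 1" and max: "\<And>v. v \<in> W \<Longrightarrow> P v v \<le> P u u * b v v"
      using constrained_maximum[where P = P, OF b P(1,2) less.prems(1) False] by blast
    have Ju: "J u \<in> W" using u less.prems by blast
    have crit: "P u v = 0" if "v \<in> W" "b u v = 0" for v
      by (rule maximum_critical[OF b P less.prems(1) u max that])
    define W' where "W' = {v \<in> {v \<in> W. b u v = 0}. b (J u) v = 0}"
    have sW': "subspace W'" unfolding W'_def by (intro subspace_orthogonal[OF b] less.prems)
    have JW': "J ` W' \<subseteq> W'"
    proof -
      have "J v \<in> W'" if "v \<in> W'" for v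
        using that less.prems bJl[of u v] bJ[of u v] by (auto simp: W'_def)
      then show ?thesis by blast
    qed
    have "u \<notin> W'" using u by (simp add: W'_def)
    moreover have "W' \<subseteq> W" by (auto simp: W'_def)
    ultimately have "W' \<subset> W" using u by blast
    then have dimlt: "dim W' < dim W" by (rule dim_psubset_subspace[OF less.prems(1) sW'])
    obtain m :: nat and e where e: "\<forall>i<m. e i \<in> W'"
      "\<forall>i<m. \<forall>j<m. b (e i) (e j) = (if i = j then 1 else 0) \<and> b (e i) (J (e j)) = 0"
      "\<forall>v\<in>W'. v = (\<Sum>i<m. b v (e i) *\<^sub>R e i + b v (J (e i)) *\<^sub>R J (e i))"
      "\<forall>i<m. \<forall>j<m. (i \<noteq> j \<longrightarrow> P (e i) (e j) = 0) \<and> P (e i) (J (e j)) = 0" "\<forall>i<m. P (e i) (e i) \<ge> 0"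
      using less.hyps[OF dimlt sW' JW'] by (elim exE conjE) (rule that)
    define f where "f i = (if i < m then e i else u)" for i
    have f: "i < m \<Longrightarrow> f i = e i" "f m = u" for i by (auto simp: f_def)
    have ue: "b u (e i) = 0" "b u (J (e i)) = 0" "P u (e i) = 0" "P u (J (e i)) = 0"
      "b (e i) u = 0" "b (e i) (J u) = 0" "P (e i) u = 0" "P (e i) (J u) = 0" if "i < m" for i
    proof -
      have m: "e i \<in> W" "b u (e i) = 0" "J (e i) \<in> W" "b u (J (e i)) = 0"
        using e(1) JW' that by (auto simp: W'_def)
      show 1: "b u (e i) = 0" "b u (J (e i)) = 0" by (rule m)+
      show 2: "P u (e i) = 0" by (rule crit[OF m(1,2)])
      show 3: "P u (J (e i)) = 0" by (rule crit[OF m(3,4)])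
      show "b (e i) u = 0" "P (e i) u = 0" using 1 2 bl(3)[of u "e i"] P(3)[of u "e i"] by simp_all
      have "b (J u) (e i) = 0" "P (J u) (e i) = 0" using 1 3 bJl[of u "e i"] PJl[of u "e i"] by auto
      then show "b (e i) (J u) = 0" "P (e i) (J u) = 0" using bl(3)[of "J u" "e i"] P(3)[of "J u" "e i"] by simp_all
    qed
    have PuJ: "P u (J u) = 0" by (rule crit[OF Ju bJ0])
    have "P (J u) (J u) \<le> P u u * b (J u) (J u)" by (rule max[OF Ju])
    then have Puu: "P u u \<ge> 0" using u by (simp add: PJ bJ)
    show ?thesis
    proof (intro exI[of _ "Suc m"] exI[of _ f] conjI)
      show "\<forall>i<Suc m. f i \<in> W" using e(1) u by (auto simp: f_def W'_def)
      show "\<forall>i<Suc m. \<forall>j<Suc m. b (f i) (f j) = (if i = j then 1 else 0) \<and> b (f i) (J (f j)) = 0"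
        using e(2) ue u bJ0 by (auto simp: f_def less_Suc_eq)
      show "\<forall>i<Suc m. \<forall>j<Suc m. (i \<noteq> j \<longrightarrow> P (f i) (f j) = 0) \<and> P (f i) (J (f j)) = 0"
        using e(4) ue PuJ by (auto simp: f_def less_Suc_eq)
      show "\<forall>i<Suc m. P (f i) (f i) \<ge> 0" using e(5) Puu by (auto simp: f_def less_Suc_eq)
      show "\<forall>v\<in>W. v = (\<Sum>i<Suc m. b v (f i) *\<^sub>R f i + b v (J (f i)) *\<^sub>R J (f i))"
      proof
        fix v assume v: "v \<in> W"
        define v' where "v' = v - b v u *\<^sub>R u - b v (J u) *\<^sub>R J u"
        have s: "b u v = b v u" "b (J u) v = b v (J u)" by (rule bl(3))+
        have z: "b u (J u) = 0" "b (J u) u = 0" "b (J u) (J u) = 1"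
          using bJ0[of u] bl(3)[of "J u" u] bJ[of u u] u by auto
        have "v' \<in> W" unfolding v'_def using v u Ju less.prems(1) by (simp add: subspace_diff subspace_scale)
        moreover have "b u v' = 0" "b (J u) v' = 0"
          unfolding v'_def linear_diff[OF bl(1)] linear_cmul[OF bl(1)] z u s by simp_all
        ultimately have "v' \<in> W'" by (simp add: W'_def)
        then have "v' = (\<Sum>i<m. b v' (e i) *\<^sub>R e i + b v' (J (e i)) *\<^sub>R J (e i))" using e(3) by blast
        also have "\<dots> = (\<Sum>i<m. b v (e i) *\<^sub>R e i + b v (J (e i)) *\<^sub>R J (e i))"
        proof (rule sum.cong[OF refl])
          fix i assume i: "i \<in> {..<m}"
          then have "b (J u) (e i) = 0" "b (J u) (J (e i)) = 0" using ue[of i] bJl[of u "e i"] bJ[of u "e i"] by auto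
          then have "b v' (e i) = b v (e i)" "b v' (J (e i)) = b v (J (e i))"
            unfolding v'_def linear_diff[OF bl(2)] linear_cmul[OF bl(2)] using ue i by auto
          then show "b v' (e i) *\<^sub>R e i + b v' (J (e i)) *\<^sub>R J (e i) = b v (e i) *\<^sub>R e i + b v (J (e i)) *\<^sub>R J (e i)"
            by simp
        qed
        finally show "v = (\<Sum>i<Suc m. b v (f i) *\<^sub>R f i + b v (J (f i)) *\<^sub>R J (f i))"
          by (simp add: f v'_def algebra_simps)
      qed
    qed
  qed
qed

lemma unitary_frame_trace:
  fixes b :: "complex ^ 'n::finite \<Rightarrow> complex ^ 'n \<Rightarrow> real" and \<beta> :: "complex ^ 'n \<Rightarrow> complex ^ 'n \<Rightarrow> 'b::real_vector"
  assumes b: "inner_product b" and e: "unitary_frame b m e"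
    and \<beta>: "\<And>u. linear (\<beta> u)" "\<And>v. linear (\<lambda>u. \<beta> u v)"
  shows "(\<Sum>k\<in>Basis. \<beta> k (dual b k)) = (\<Sum>i<m. \<beta> (e i) (e i) + \<beta> (J (e i)) (J (e i)))"
proof -
  have ex: "v = (\<Sum>i<m. b v (e i) *\<^sub>R e i + b v (J (e i)) *\<^sub>R J (e i))" for v
    using e unfolding unitary_frame_def by blast
  have "\<beta> k (dual b k) = (\<Sum>i<m. (e i \<bullet> k) *\<^sub>R \<beta> k (e i) + (J (e i) \<bullet> k) *\<^sub>R \<beta> k (J (e i)))" for k
    using arg_cong[OF ex[of "dual b k"], of "\<beta> k"]
    by (simp add: linear_sum[OF \<beta>(1)] linear_add[OF \<beta>(1)] linear_cmul[OF \<beta>(1)] dual_works[OF b] inner_commute[of k])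
  then have "(\<Sum>k\<in>Basis. \<beta> k (dual b k))
    = (\<Sum>i<m. (\<Sum>k\<in>Basis. (e i \<bullet> k) *\<^sub>R \<beta> k (e i)) + (\<Sum>k\<in>Basis. (J (e i) \<bullet> k) *\<^sub>R \<beta> k (J (e i))))"
    by (simp only: sum.swap[of _ "{..<m}" Basis] sum.distrib)
  then show ?thesis by (simp add: linear_expand[OF \<beta>(2), symmetric])
qed

lemma takagi_frame:
  fixes b P :: "complex ^ 'n::finite \<Rightarrow> complex ^ 'n \<Rightarrow> real"
  assumes b: "inner_product b" and bJ: "\<And>u v. b (J u) (J v) = b u v"
    and P: "\<And>u. linear (P u)" "\<And>v. linear (\<lambda>u. P u v)" "\<And>u v. P u v = P v u"
    and PJ: "\<And>u v. P (J u) (J v) = - P u v"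
  obtains e where "unitary_frame b CARD('n) e"
    "\<And>i j. i < CARD('n) \<Longrightarrow> j < CARD('n) \<Longrightarrow> i \<noteq> j \<Longrightarrow> P (e i) (e j) = 0"
    "\<And>i j. i < CARD('n) \<Longrightarrow> j < CARD('n) \<Longrightarrow> P (e i) (J (e j)) = 0"
    "\<And>i. i < CARD('n) \<Longrightarrow> P (e i) (e i) \<ge> 0"
proof -
  obtain m :: nat and e :: "nat \<Rightarrow> complex ^ 'n"
    where e: "\<forall>i<m. \<forall>j<m. b (e i) (e j) = (if i = j then 1 else 0) \<and> b (e i) (J (e j)) = 0"
     "\<forall>v\<in>UNIV. v = (\<Sum>i<m. b v (e i) *\<^sub>R e i + b v (J (e i)) *\<^sub>R J (e i))"
     "\<forall>i<m. \<forall>j<m. (i \<noteq> j \<longrightarrow> P (e i) (e j) = 0) \<and> P (e i) (J (e j)) = 0" "\<forall>i<m. P (e i) (e i) \<ge> 0"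
    using takagi_frame_subspace[where b = b and P = P and W = UNIV, OF b bJ P PJ subspace_UNIV subset_UNIV]
    by (elim exE conjE) (rule that)
  have uf: "unitary_frame b m e" using e(1,2) by (simp add: unitary_frame_def)
  \<comment> \<open>The metric trace of \<open>b\<close> itself, computed in the frame and in the
    standard basis, shows that \<open>2 * m\<close> is the real dimension.\<close>
  have "(\<Sum>k\<in>Basis. b k (dual b k)) = (\<Sum>i<m. b (e i) (e i) + b (J (e i)) (J (e i)))"
    by (rule unitary_frame_trace[where \<beta> = b, OF b uf inner_productD(1,2)[OF b]])
  moreover have "(\<Sum>k\<in>Basis. b k (dual b k)) = (\<Sum>k\<in>(Basis :: (complex ^ 'n) set). 1)"
    by (rule sum.cong[OF refl]) (simp only: dual_works(2)[OF b] inner_same_Basis)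
  moreover have "(\<Sum>i<m. b (e i) (e i) + b (J (e i)) (J (e i))) = (\<Sum>i<m. 2)"
    by (rule sum.cong[OF refl]) (use e(1) in \<open>simp add: bJ\<close>)
  ultimately have "real DIM(complex ^ 'n) = 2 * real m" by simp
  then have "m = CARD('n)" by (simp only: DIM_cart DIM_complex)
  then show ?thesis using uf e(3,4) by (intro that[of e]) auto
qed

lemma unitary_frame_exists:
  fixes b :: "complex ^ 'n::finite \<Rightarrow> complex ^ 'n \<Rightarrow> real"
  assumes b: "inner_product b" and bJ: "\<And>u v. b (J u) (J v) = b u v"
  obtains e where "unitary_frame b CARD('n) e"
proof -
  have z: "linear (\<lambda>v :: complex ^ 'n. 0 :: real)" by (rule linearI) simp_all
  show ?thesis
  proof (rule takagi_frame[where b = b and P = "\<lambda>u v. 0"])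
    fix e assume "unitary_frame b CARD('n) e"
    then show thesis by (rule that)
  qed (use b bJ z in simp_all)
qed

subsection \<open>The inner product of tensors\<close>

text \<open>The Hermitian product of \<open>k\<close>-tensors, conjugate linear in the second
  argument. Each slot is contracted with the inverse metric, so the formula makes sense at every
  point without choosing a frame. The sum runs over all index tuples; on forms this differs from the
  usual norm by a factor \<open>k!\<close>, which is harmless.\<close>

primrec tensor_ip :: "('v::euclidean_space \<Rightarrow> 'v \<Rightarrow> real) \<Rightarrow> nat \<Rightarrow>
    ('v list \<Rightarrow> complex) \<Rightarrow> ('v list \<Rightarrow> complex) \<Rightarrow> complex" where
  "tensor_ip b 0 w w' = w [] * cnj (w' [])"
| "tensor_ip b (Suc k) w w' = (\<Sum>e\<in>Basis. tensor_ip b k (\<lambda>vs. w (e # vs)) (\<lambda>vs. w' (dual b e # vs)))"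

lemma tensor_ip_cong:
  "(\<And>vs. length vs = k \<Longrightarrow> w vs = v vs) \<Longrightarrow> (\<And>vs. length vs = k \<Longrightarrow> w' vs = v' vs) \<Longrightarrow>
   tensor_ip b k w w' = tensor_ip b k v v'"
proof (induction k arbitrary: w w' v v')
  case (Suc k)
  have "tensor_ip b k (\<lambda>vs. w (e # vs)) (\<lambda>vs. w' (dual b e # vs))
     = tensor_ip b k (\<lambda>vs. v (e # vs)) (\<lambda>vs. v' (dual b e # vs))" for e
    by (rule Suc.IH) (simp_all add: Suc.prems)
  then show ?case by simp
qed simp

lemma tensor_ip_add:
  "tensor_ip b k (\<lambda>vs. w vs + v vs) u = tensor_ip b k w u + tensor_ip b k v u"
  "tensor_ip b k u (\<lambda>vs. w vs + v vs) = tensor_ip b k u w + tensor_ip b k u v"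
proof -
  show "tensor_ip b k (\<lambda>vs. w vs + v vs) u = tensor_ip b k w u + tensor_ip b k v u"
    by (induction k arbitrary: w v u) (simp_all add: sum.distrib algebra_simps)
  show "tensor_ip b k u (\<lambda>vs. w vs + v vs) = tensor_ip b k u w + tensor_ip b k u v"
    by (induction k arbitrary: w v u) (simp_all add: sum.distrib algebra_simps)
qed

lemma tensor_ip_scale:
  "tensor_ip b k (\<lambda>vs. c * w vs) u = c * tensor_ip b k w u"
  "tensor_ip b k u (\<lambda>vs. c * w vs) = cnj c * tensor_ip b k u w"
proof -
  show "tensor_ip b k (\<lambda>vs. c * w vs) u = c * tensor_ip b k w u"
    by (induction k arbitrary: w u) (simp_all add: sum_distrib_left algebra_simps)
  show "tensor_ip b k u (\<lambda>vs. c * w vs) = cnj c * tensor_ip b k u w"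
    by (induction k arbitrary: w u) (simp_all add: sum_distrib_left algebra_simps)
qed

lemma tensor_ip_zero:
  "tensor_ip b k (\<lambda>vs. 0) u = 0" "tensor_ip b k u (\<lambda>vs. 0) = 0"
  using tensor_ip_scale(1)[where c = 0 and b = b and k = k and w = "\<lambda>_. 0" and u = u]
    tensor_ip_scale(2)[where c = 0 and b = b and k = k and w = "\<lambda>_. 0" and u = u] by simp_all

lemma tensor_ip_diff:
  "tensor_ip b k (\<lambda>vs. w vs - v vs) u = tensor_ip b k w u - tensor_ip b k v u"
  using tensor_ip_add(1)[of b k w "\<lambda>vs. -1 * v vs" u] tensor_ip_scale(1)[where c = "-1" and b = b and k = k and w = v and u = u] by simp

lemma tensor_ip_minus:
  "tensor_ip b k (\<lambda>vs. - w vs) u = - tensor_ip b k w u"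
  using tensor_ip_scale(1)[where c = "-1" and b = b and k = k and w = w and u = u] by simp

lemma tensor_ip_sum:
  "tensor_ip b k (\<lambda>vs. \<Sum>i\<in>I. w i vs) u = (\<Sum>i\<in>I. tensor_ip b k (w i) u)"
  "tensor_ip b k u (\<lambda>vs. \<Sum>i\<in>I. w i vs) = (\<Sum>i\<in>I. tensor_ip b k u (w i))"
  by (induction I rule: infinite_finite_induct; simp add: tensor_ip_zero tensor_ip_add)+

lemma tensor_ip_linear:
  assumes "multilinear (Suc k) w"
  shows "linear (\<lambda>a. tensor_ip b k (\<lambda>vs. w (a # vs)) u)" "linear (\<lambda>a. tensor_ip b k u (\<lambda>vs. w (a # vs)))"
proof -
  note l = multilinear_Cons[OF assms]
  have add: "w ((a + c) # vs) = w (a # vs) + w (c # vs)" if "length vs = k" for a c vs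
    using linear_add[OF l[OF that]] .
  have scale: "w ((r *\<^sub>R a) # vs) = complex_of_real r * w (a # vs)" if "length vs = k" for a r vs
    using linear_cmul[OF l[OF that]] by (simp add: scaleR_conv_of_real)
  show "linear (\<lambda>a. tensor_ip b k (\<lambda>vs. w (a # vs)) u)"
  proof (rule linearI)
    fix a c
    have "tensor_ip b k (\<lambda>vs. w ((a + c) # vs)) u = tensor_ip b k (\<lambda>vs. w (a # vs) + w (c # vs)) u"
      by (rule tensor_ip_cong[OF add refl])
    then show "tensor_ip b k (\<lambda>vs. w ((a + c) # vs)) u = tensor_ip b k (\<lambda>vs. w (a # vs)) u + tensor_ip b k (\<lambda>vs. w (c # vs)) u"
      by (simp only: tensor_ip_add)
  next
    fix r a
    have "tensor_ip b k (\<lambda>vs. w ((r *\<^sub>R a) # vs)) u = tensor_ip b k (\<lambda>vs. complex_of_real r * w (a # vs)) u"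
      by (rule tensor_ip_cong[OF scale refl])
    then show "tensor_ip b k (\<lambda>vs. w ((r *\<^sub>R a) # vs)) u = r *\<^sub>R tensor_ip b k (\<lambda>vs. w (a # vs)) u"
      by (simp only: tensor_ip_scale scaleR_conv_of_real)
  qed
  show "linear (\<lambda>a. tensor_ip b k u (\<lambda>vs. w (a # vs)))"
  proof (rule linearI)
    fix a c
    have "tensor_ip b k u (\<lambda>vs. w ((a + c) # vs)) = tensor_ip b k u (\<lambda>vs. w (a # vs) + w (c # vs))"
      by (rule tensor_ip_cong[OF refl add])
    then show "tensor_ip b k u (\<lambda>vs. w ((a + c) # vs)) = tensor_ip b k u (\<lambda>vs. w (a # vs)) + tensor_ip b k u (\<lambda>vs. w (c # vs))"
      by (simp only: tensor_ip_add)
  next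
    fix r a
    have "tensor_ip b k u (\<lambda>vs. w ((r *\<^sub>R a) # vs)) = tensor_ip b k u (\<lambda>vs. complex_of_real r * w (a # vs))"
      by (rule tensor_ip_cong[OF refl scale])
    then show "tensor_ip b k u (\<lambda>vs. w ((r *\<^sub>R a) # vs)) = r *\<^sub>R tensor_ip b k u (\<lambda>vs. w (a # vs))"
      by (simp only: tensor_ip_scale complex_cnj_complex_of_real scaleR_conv_of_real)
  qed
qed

context metric_chart
begin

text \<open>The product rule holds without correction terms because the inverse metric in each slot
  is parallel (\<open>dual_parallel\<close>).\<close>

lemma tensor_ip_derivative:
  "tensor_field k w \<Longrightarrow> tensor_field k w' \<Longrightarrow> x \<in> S \<Longrightarrow>
   (\<lambda>y. tensor_ip (g y) k (w y) (w' y)) differentiable (at x) \<and>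
   dir_deriv (\<lambda>y. tensor_ip (g y) k (w y) (w' y)) x u
     = tensor_ip (g x) k (cov_deriv g w x u) (w' x) + tensor_ip (g x) k (w x) (cov_deriv g w' x u)"
proof (induction k arbitrary: w w')
  case 0
  have d: "(\<lambda>y. w y []) differentiable (at x)" "(\<lambda>y. w' y []) differentiable (at x)"
    using 0 tensor_fieldD(2) by auto
  have c: "(\<lambda>y. cnj (w' y [])) differentiable (at x)"
    by (rule differentiable_linear[OF bounded_linear_cnj d(2)])
  show ?case
    using dir_deriv_bilinear[OF bounded_bilinear_mult d(1) c, of u]
      differentiable_bilinear[OF bounded_bilinear_mult d(1) c] dir_deriv_linear[OF bounded_linear_cnj d(2), of u]
    by (simp add: cov_deriv_def)
next
  case (Suc k)
  note x = Suc.prems(3)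
  have m: "multilinear (Suc k) (w x)" "multilinear (Suc k) (w' x)"
    using Suc.prems tensor_fieldD(1) by blast+
  have t1: "tensor_field k (\<lambda>y vs. w y (e # vs))" for e
    by (rule tensor_field_Cons_field[OF Suc.prems(1)]) simp
  have t2: "tensor_field k (\<lambda>y vs. w' y (dual (g y) e # vs))" for e
    by (rule tensor_field_Cons_field[OF Suc.prems(2) dual_differentiable])
  note IH = Suc.IH[OF t1 t2 x]
  have diff: "(\<lambda>y. tensor_ip (g y) (Suc k) (w y) (w' y)) differentiable (at x)"
    by (simp add: differentiable_sum_fun IH)
  define \<beta> where "\<beta> a c = tensor_ip (g x) k (\<lambda>vs. w x (a # vs)) (\<lambda>vs. w' x (c # vs))" for a c
  have b1: "linear (\<lambda>a. \<beta> a c)" for c unfolding \<beta>_def by (rule tensor_ip_linear(1)[OF m(1)])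
  have b2: "linear (\<beta> a)" for a unfolding \<beta>_def by (rule tensor_ip_linear(2)[OF m(2)])
  have 1: "tensor_ip (g x) k (cov_deriv g (\<lambda>y vs. w y (e # vs)) x u) v
     = tensor_ip (g x) k (\<lambda>vs. cov_deriv g w x u (e # vs)) v
      + tensor_ip (g x) k (\<lambda>vs. w x (christoffel g x u e # vs)) v" for e v
    unfolding tensor_ip_add(1)[symmetric] by (rule tensor_ip_cong) (simp_all add: cov_deriv_Cons)
  have 2: "tensor_ip (g x) k v (cov_deriv g (\<lambda>y vs. w' y (dual (g y) e # vs)) x u)
     = tensor_ip (g x) k v (\<lambda>vs. cov_deriv g w' x u (dual (g x) e # vs))
      + tensor_ip (g x) k v (\<lambda>vs. w' x ((dir_deriv (\<lambda>y. dual (g y) e) x u + christoffel g x u (dual (g x) e)) # vs))" for e v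
    unfolding tensor_ip_add(2)[symmetric]
    by (rule tensor_ip_cong) (simp_all add: cov_deriv_Cons_field[OF Suc.prems(2) x _ dual_differentiable[OF x]])
  have "dir_deriv (\<lambda>y. tensor_ip (g y) (Suc k) (w y) (w' y)) x u
    = (\<Sum>e\<in>Basis. dir_deriv (\<lambda>y. tensor_ip (g y) k (\<lambda>vs. w y (e # vs)) (\<lambda>vs. w' y (dual (g y) e # vs))) x u)"
    unfolding tensor_ip.simps by (rule dir_deriv_sum) (use IH in blast)
  also have "\<dots> = tensor_ip (g x) (Suc k) (cov_deriv g w x u) (w' x) + tensor_ip (g x) (Suc k) (w x) (cov_deriv g w' x u)
    + (\<Sum>e\<in>Basis. \<beta> (christoffel g x u e) (dual (g x) e)
        + \<beta> e (dir_deriv (\<lambda>y. dual (g y) e) x u + christoffel g x u (dual (g x) e)))"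
    by (simp add: IH[THEN conjunct2] 1 2 \<beta>_def sum.distrib)
  also have "(\<Sum>e\<in>Basis. \<beta> (christoffel g x u e) (dual (g x) e)
        + \<beta> e (dir_deriv (\<lambda>y. dual (g y) e) x u + christoffel g x u (dual (g x) e))) = 0"
    by (rule dual_parallel[OF x b1 b2])
  finally show ?case using diff by simp
qed

end

text \<open>In a unitary frame both arguments receive the same vector, which turns Hermitian
  symmetry, positivity and definiteness into inductions on the number of slots.\<close>

lemma tensor_ip_frame:
  fixes b :: "complex ^ 'n::finite \<Rightarrow> complex ^ 'n \<Rightarrow> real"
  assumes b: "inner_product b" and e: "unitary_frame b m e"
    and w: "multilinear (Suc k) w" "multilinear (Suc k) w'"
  shows "tensor_ip b (Suc k) w w' =
    (\<Sum>i<m. tensor_ip b k (\<lambda>vs. w (e i # vs)) (\<lambda>vs. w' (e i # vs))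
         + tensor_ip b k (\<lambda>vs. w (J (e i) # vs)) (\<lambda>vs. w' (J (e i) # vs)))"
proof -
  define \<beta> where "\<beta> a c = tensor_ip b k (\<lambda>vs. w (a # vs)) (\<lambda>vs. w' (c # vs))" for a c
  have b1: "linear (\<lambda>a. \<beta> a c)" for c unfolding \<beta>_def by (rule tensor_ip_linear(1)[OF w(1)])
  have b2: "linear (\<beta> a)" for a unfolding \<beta>_def by (rule tensor_ip_linear(2)[OF w(2)])
  show ?thesis
    using unitary_frame_trace[where \<beta> = \<beta>, OF b e b2 b1] by (simp add: \<beta>_def)
qed

lemma tensor_ip_cnj:
  fixes b :: "complex ^ 'n::finite \<Rightarrow> complex ^ 'n \<Rightarrow> real"
  assumes b: "inner_product b" and e: "unitary_frame b m e"
  shows "multilinear k w \<Longrightarrow> multilinear k w' \<Longrightarrow> tensor_ip b k w w' = cnj (tensor_ip b k w' w)"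
proof (induction k arbitrary: w w')
  case (Suc k)
  have "tensor_ip b k (\<lambda>vs. w (a # vs)) (\<lambda>vs. w' (a # vs)) = cnj (tensor_ip b k (\<lambda>vs. w' (a # vs)) (\<lambda>vs. w (a # vs)))" for a
    by (intro Suc.IH multilinear_tail Suc.prems)
  then show ?case
    unfolding tensor_ip_frame[OF b e Suc.prems] tensor_ip_frame[OF b e Suc.prems(2,1)]
    by (simp add: cnj_sum)
qed simp

lemma tensor_ip_nonneg:
  fixes b :: "complex ^ 'n::finite \<Rightarrow> complex ^ 'n \<Rightarrow> real"
  assumes b: "inner_product b" and e: "unitary_frame b m e"
  shows "multilinear k w \<Longrightarrow> Re (tensor_ip b k w w) \<ge> 0"
proof (induction k arbitrary: w)
  case 0 then show ?case by simp
next
  case (Suc k)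
  have "Re (tensor_ip b k (\<lambda>vs. w (a # vs)) (\<lambda>vs. w (a # vs))) \<ge> 0" for a
    by (intro Suc.IH multilinear_tail Suc.prems)
  then show ?case
    unfolding tensor_ip_frame[OF b e Suc.prems Suc.prems] Re_sum plus_complex.sel
    by (intro sum_nonneg add_nonneg_nonneg)
qed

lemma tensor_ip_eq_0:
  fixes b :: "complex ^ 'n::finite \<Rightarrow> complex ^ 'n \<Rightarrow> real"
  assumes b: "inner_product b" and e: "unitary_frame b m e"
  shows "multilinear k w \<Longrightarrow> Re (tensor_ip b k w w) = 0 \<Longrightarrow> length vs = k \<Longrightarrow> w vs = 0"
proof (induction k arbitrary: w vs)
  case 0
  then have "(norm (w []))\<^sup>2 = 0" by (simp add: complex_mult_cnj cmod_power2)
  then show ?case using 0 by simp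
next
  case (Suc k)
  let ?N = "\<lambda>a. Re (tensor_ip b k (\<lambda>vs. w (a # vs)) (\<lambda>vs. w (a # vs)))"
  have nn: "?N a \<ge> 0" for a
    by (intro tensor_ip_nonneg[OF b e] multilinear_tail Suc.prems)
  have "(\<Sum>i<m. ?N (e i) + ?N (J (e i))) = 0"
    using Suc.prems(2) unfolding tensor_ip_frame[OF b e Suc.prems(1,1)] by simp
  then have "\<forall>i\<in>{..<m}. ?N (e i) + ?N (J (e i)) = 0"
    by (subst (asm) sum_nonneg_eq_0_iff) (simp_all add: nn)
  then have "?N (e i) = 0 \<and> ?N (J (e i)) = 0" if "i < m" for i
    using that nn[of "e i"] nn[of "J (e i)"] by (metis add_nonneg_eq_0_iff lessThan_iff)
  then have z: "w (e i # us) = 0 \<and> w (J (e i) # us) = 0" if "i < m" "length us = k" for i us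
    using Suc.IH[OF multilinear_tail[OF Suc.prems(1)] _ that(2)] that by blast
  obtain a us where vs: "vs = a # us" "length us = k" using Suc.prems(3) by (cases vs) auto
  note l = multilinear_Cons[OF Suc.prems(1) vs(2)]
  have "a = (\<Sum>i<m. b a (e i) *\<^sub>R e i + b a (J (e i)) *\<^sub>R J (e i))"
    using e unfolding unitary_frame_def by blast
  then have "w (a # us) = w ((\<Sum>i<m. b a (e i) *\<^sub>R e i + b a (J (e i)) *\<^sub>R J (e i)) # us)" by simp
  also have "\<dots> = (\<Sum>i<m. b a (e i) *\<^sub>R w (e i # us) + b a (J (e i)) *\<^sub>R w (J (e i) # us))"
    by (simp only: linear_sum[OF l] linear_add[OF l] linear_cmul[OF l])
  also have "\<dots> = 0" using z vs(2) by simp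
  finally show ?case using vs by simp
qed

context kahler_chart
begin

text \<open>At a maximum of the squared norm of a tensor field, the first derivatives of the squared norm vanish
  and the second ones are nonpositive; the terms \<open>|\<nabla>\<^sub>u w|\<^sup>2\<close> have the good sign.\<close>

theorem bochner_inequality:
  assumes w: "smooth_tensor k w" and x: "x \<in> S"
    and max: "\<And>y. y \<in> S \<Longrightarrow> Re (tensor_ip (g y) k (w y) (w y)) \<le> Re (tensor_ip (g x) k (w x) (w x))"
  shows "Re (tensor_ip (g x) k (\<lambda>vs. \<Sum>e\<in>Basis. cov_deriv g (nabla w) x e (dual (g x) e # vs)) (w x)) \<le> 0"
proof -
  obtain e where e: "unitary_frame (g x) CARD('n) e"
    using unitary_frame_exists[OF inner_g[OF x] g_J[OF x]] by blast
  have ex: "\<exists>e. unitary_frame (g y) CARD('n) e" if "y \<in> S" for y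
    using unitary_frame_exists[OF inner_g[OF that] g_J[OF that]] by blast
  note tf = smooth_tensor_field[OF w] and tc = tensor_field_cov_deriv[OF w]
  note mw = tensor_fieldD(1)[OF tf] and mc = tensor_fieldD(1)[OF tc]
  define f where "f y = Re (tensor_ip (g y) k (w y) (w y))" for y
  have dfc: "(\<lambda>y. tensor_ip (g y) k (w y) (w y)) differentiable (at y)" if "y \<in> S" for y
    using tensor_ip_derivative[OF tf tf that] by blast
  have df: "f differentiable (at y)" if "y \<in> S" for y
    unfolding f_def by (rule differentiable_linear[OF bounded_linear_Re dfc[OF that]])
  have f': "dir_deriv f y u = 2 * Re (tensor_ip (g y) k (cov_deriv g w y u) (w y))" if y: "y \<in> S" for y u
  proof -
    obtain e' where e': "unitary_frame (g y) CARD('n) e'" using ex[OF y] by blast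
    have "tensor_ip (g y) k (w y) (cov_deriv g w y u) = cnj (tensor_ip (g y) k (cov_deriv g w y u) (w y))"
      by (rule tensor_ip_cnj[OF inner_g[OF y] e' mw[OF y] mc[OF y]])
    then show ?thesis
      unfolding f_def using tensor_ip_derivative[OF tf tf y, of u] dir_deriv_linear[OF bounded_linear_Re dfc[OF y], of u]
      by simp
  qed
  have dc: "(\<lambda>y. tensor_ip (g y) k (cov_deriv g w y u) (w y)) differentiable (at x)" for u
    using tensor_ip_derivative[OF tc tf x] by blast
  have d2: "(\<lambda>y. 2 * Re (tensor_ip (g y) k (cov_deriv g w y u) (w y))) differentiable (at x)" for u
    by (intro differentiable_mult differentiable_const differentiable_linear[OF bounded_linear_Re dc])
  have df2: "(\<lambda>y. dir_deriv f y u) differentiable (at x)" for u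
    by (rule iffD2[OF differentiable_cong_open[OF open_S x f'] d2])
  have f'': "dir_deriv (\<lambda>y. dir_deriv f y u) x u
    = 2 * Re (tensor_ip (g x) k (cov_deriv g (\<lambda>y. cov_deriv g w y u) x u) (w x))
      + 2 * Re (tensor_ip (g x) k (cov_deriv g w x u) (cov_deriv g w x u))" for u
  proof -
    have "dir_deriv (\<lambda>y. dir_deriv f y u) x = dir_deriv (\<lambda>y. 2 *\<^sub>R Re (tensor_ip (g y) k (cov_deriv g w y u) (w y))) x"
      by (rule dir_deriv_cong_open[OF open_S x]) (simp add: f')
    then have "dir_deriv (\<lambda>y. dir_deriv f y u) x u
       = 2 * Re (dir_deriv (\<lambda>y. tensor_ip (g y) k (cov_deriv g w y u) (w y)) x u)"
      using dir_deriv_linear[OF bounded_linear_scaleR_right differentiable_linear[OF bounded_linear_Re dc], of 2 u u]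
        dir_deriv_linear[OF bounded_linear_Re dc, of u u] by simp
    then show ?thesis using tensor_ip_derivative[OF tc tf x, of u u] by simp
  qed
  have max': "f y \<le> f x" if "y \<in> S" for y using max[OF that] by (simp add: f_def)
  have first: "Re (tensor_ip (g x) k (cov_deriv g w x u) (w x)) = 0" for u
    using local_max_derivatives(1)[OF open_S x max' df df2, of u] f'[OF x, of u] by simp
  have second: "Re (tensor_ip (g x) k (cov_deriv g (\<lambda>y. cov_deriv g w y u) x u) (w x)) \<le> 0" for u
    using local_max_derivatives(2)[OF open_S x max' df df2, of u] f''[of u]
      tensor_ip_nonneg[OF inner_g[OF x] e mc[OF x], of u] by simp
  define N where "N u v vs = cov_deriv g (nabla w) x u (v # vs)" for u v vs
  \<comment> \<open>The Christoffel correction in the second covariant derivative is a first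
    derivative of \<open>w\<close>, whose pairing with \<open>w\<close> vanishes at the
    maximum.\<close>
  have N: "Re (tensor_ip (g x) k (N u u) (w x)) \<le> 0" for u
  proof -
    have "N u u = (\<lambda>vs. cov_deriv g (\<lambda>y. cov_deriv g w y u) x u vs - cov_deriv g w x (christoffel g x u u) vs)"
      unfolding N_def by (rule ext) (rule second_cov_deriv[OF refl])
    then show ?thesis using first second[of u] by (simp add: tensor_ip_diff)
  qed
  note tn = tensor_field_nabla[OF w]
  have tr: "(\<Sum>k\<in>Basis. N k (dual (g x) k) vs) = (\<Sum>i<CARD('n). N (e i) (e i) vs + N (J (e i)) (J (e i)) vs)"
    if "length vs = k" for vs
  proof (rule unitary_frame_trace[where \<beta> = "\<lambda>u v. N u v vs", OF inner_g[OF x] e])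
    show "linear (\<lambda>v. N u v vs)" for u
      unfolding N_def by (rule multilinear_Cons[OF cov_deriv_multilinear[OF tn x] that])
    show "linear (\<lambda>u. N u v vs)" for v
      unfolding N_def by (rule cov_deriv_linear[OF tn x]) (simp add: that)
  qed
  have "tensor_ip (g x) k (\<lambda>vs. \<Sum>k\<in>Basis. N k (dual (g x) k) vs) (w x)
     = tensor_ip (g x) k (\<lambda>vs. \<Sum>i<CARD('n). N (e i) (e i) vs + N (J (e i)) (J (e i)) vs) (w x)"
    by (rule tensor_ip_cong[OF tr refl])
  also have "\<dots> = (\<Sum>i<CARD('n). tensor_ip (g x) k (N (e i) (e i)) (w x) + tensor_ip (g x) k (N (J (e i)) (J (e i))) (w x))"
    by (simp only: tensor_ip_sum tensor_ip_add)
  finally have "Re (tensor_ip (g x) k (\<lambda>vs. \<Sum>k\<in>Basis. N k (dual (g x) k) vs) (w x))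
    = (\<Sum>i<CARD('n). Re (tensor_ip (g x) k (N (e i) (e i)) (w x)) + Re (tensor_ip (g x) k (N (J (e i)) (J (e i))) (w x)))"
    by simp
  also have "\<dots> \<le> 0"
    by (intro sum_nonpos add_nonpos_nonpos N)
  finally show ?thesis unfolding N_def .
qed

end

subsection \<open>The Kaehler curvature operator\<close>

lemma sum_double_range:
  fixes f :: "nat \<Rightarrow> 'b::comm_monoid_add"
  shows "(\<Sum>i<2 * n. f i) = (\<Sum>i<n. f i + f (n + i))"
proof -
  have "(\<Sum>i<n + n. f i) = (\<Sum>i<n. f i) + (\<Sum>i<n. f (n + i))"
    by (simp add: sum.atLeastLessThan_concat[of 0 n "n + n", symmetric] lessThan_atLeast0
        sum.shift_bounds_nat_ivl[of f 0 n n, simplified] add.commute)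
  then show ?thesis by (simp add: mult_2 sum.distrib)
qed

locale kahler_point = kahler_chart S g for S :: "(complex ^ 'n::finite) set" and g +
  fixes x assumes x: "x \<in> S"
begin

abbreviation b where "b \<equiv> g x"

lemmas inner_b = inner_g[OF x] and b_lin = g_lin[OF x] and b_lin' = g_lin'[OF x] and b_sym = g_sym[OF x]
  and b_J = g_J[OF x] and b_J_left = g_J_left[OF x]
  and riem_lin = riem_linear[OF x]

definition frame :: "nat \<Rightarrow> complex ^ 'n" where
  "frame = (SOME e. unitary_frame b CARD('n) e)"

lemma unitary_frame_frame: "unitary_frame b CARD('n) frame"
  unfolding frame_def using unitary_frame_exists[OF inner_b b_J] by (metis someI_ex)

text \<open>The real orthonormal basis that belongs to \<open>frame\<close>: first the frame, then
  its image under \<open>J\<close>. Real traces become sums over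
  \<open>{..<2 * CARD('n)}\<close>.\<close>

definition F :: "nat \<Rightarrow> complex ^ 'n" where
  "F i = (if i < CARD('n) then frame i else J (frame (i - CARD('n))))"

lemma sum_F: "(\<Sum>i<2 * CARD('n). f (F i)) = (\<Sum>i<CARD('n). f (frame i) + f (J (frame i)))"
  unfolding sum_double_range by (rule sum.cong) (auto simp: F_def)

lemma F_expand: "v = (\<Sum>i<2 * CARD('n). b v (F i) *\<^sub>R F i)"
  unfolding sum_F[of "\<lambda>u. b v u *\<^sub>R u"] using unitary_frame_frame unfolding unitary_frame_def by blast

lemma F_linear: "linear f \<Longrightarrow> f v = (\<Sum>i<2 * CARD('n). b v (F i) *\<^sub>R f (F i))"
  by (subst F_expand[of v]) (simp add: linear_sum linear_cmul)

lemma F_trace: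
  assumes "\<And>u. linear (\<beta> u)" "\<And>v. linear (\<lambda>u. \<beta> u v)"
  shows "(\<Sum>k\<in>Basis. \<beta> k (dual b k)) = (\<Sum>i<2 * CARD('n). \<beta> (F i) (F i))"
  unfolding sum_F[of "\<lambda>u. \<beta> u u"] by (rule unitary_frame_trace[OF inner_b unitary_frame_frame assms])

lemma b_F_inner: "b u v = (\<Sum>i<2 * CARD('n). b u (F i) * b v (F i))"
  using F_linear[OF b_lin', of u v] b_sym[of "F _" v] by simp

text \<open>For an integrand invariant under \<open>J\<close>, a sum over a unitary frame is half of
  a real trace and hence does not depend on the frame.\<close>

lemma sum_unitary_frame:
  assumes e: "unitary_frame b CARD('n) e" and L: "linear L" "linear L'"
    and LJ: "\<And>v. b (L (J v)) (L' (J v)) = b (L v) (L' v)"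
  shows "2 * (\<Sum>i<CARD('n). b (L (e i)) (L' (e i))) = (\<Sum>i<2 * CARD('n). b (L (F i)) (L' (F i)))"
proof -
  define \<beta> where "\<beta> u v = b (L u) (L' v)" for u v
  have \<beta>: "linear (\<beta> u)" "linear (\<lambda>u. \<beta> u v)" for u v
    unfolding \<beta>_def using linear_compose[OF L(2) b_lin] linear_compose[OF L(1) b_lin'] by (simp_all add: o_def)
  have "(\<Sum>i<CARD('n). \<beta> (e i) (e i) + \<beta> (J (e i)) (J (e i))) = (\<Sum>i<2 * CARD('n). \<beta> (F i) (F i))"
    using F_trace[OF \<beta>] unitary_frame_trace[OF inner_b e \<beta>] by simp
  then show ?thesis by (simp add: \<beta>_def LJ sum_distrib_left)
qed

lemma bivectors_skew: "A \<in> bivectors b \<Longrightarrow> b (blinfun_apply A u) v = - b u (blinfun_apply A v)"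
  by (simp add: bivectors_def)

lemma blinfun_linear: "linear (blinfun_apply A)"
  by (simp add: bounded_linear.linear blinfun.bounded_linear_right)

lemma wedge_bivector: "wedge b u v \<in> bivectors b"
  unfolding bivectors_def
proof (intro CollectI allI)
  fix p q
  show "b (blinfun_apply (wedge b u v) p) q = - b p (blinfun_apply (wedge b u v) q)"
    using b_sym[of p u] b_sym[of p v]
    by (simp add: blinfun_apply_wedge[OF inner_b] linear_diff[OF b_lin] linear_diff[OF b_lin'] linear_cmul[OF b_lin]
        linear_cmul[OF b_lin'])
qed

lemma subspace_bivectors: "subspace (bivectors b)"
  unfolding subspace_def bivectors_def
  by (auto simp: blinfun.zero_left blinfun.add_left blinfun.scaleR_left linear_0[OF b_lin] linear_0[OF b_lin']
     linear_add[OF b_lin] linear_add[OF b_lin'] linear_cmul[OF b_lin] linear_cmul[OF b_lin'])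

lemma subspace_real_11: "subspace (real_11_bivectors b)"
  using subspace_bivectors unfolding subspace_def real_11_bivectors_def
  by (auto simp: blinfun.zero_left blinfun.add_left blinfun.scaleR_left J_add J_scaleR)

lemma bivector_inner_linear: "linear (bivector_inner A)" "linear (\<lambda>A. bivector_inner A B)"
  by (rule linearI; simp add: bivector_inner_def blinfun.add_left blinfun.scaleR_left blinfun.add_right
      blinfun.scaleR_right inner_add_left sum.distrib sum_distrib_left add_divide_distrib)+

text \<open>The factor 1/2 compensates for running over ordered pairs.\<close>

lemma bivector_expand:
  assumes A: "A \<in> bivectors b"
  shows "A = (1/2) *\<^sub>R (\<Sum>i<2 * CARD('n). \<Sum>j<2 * CARD('n). b (blinfun_apply A (F i)) (F j) *\<^sub>R wedge b (F i) (F j))"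
proof (rule blinfun_eqI)
  fix v
  have "(\<Sum>i<2 * CARD('n). \<Sum>j<2 * CARD('n). b (blinfun_apply A (F i)) (F j) *\<^sub>R blinfun_apply (wedge b (F i) (F j)) v)
    = (\<Sum>i<2 * CARD('n). \<Sum>j<2 * CARD('n). (b (F i) v * b (blinfun_apply A (F i)) (F j)) *\<^sub>R F j)
     - (\<Sum>i<2 * CARD('n). \<Sum>j<2 * CARD('n). (b (F j) v * b (blinfun_apply A (F i)) (F j)) *\<^sub>R F i)"
    by (simp add: blinfun_apply_wedge[OF inner_b] algebra_simps sum_subtractf)
  also have "(\<Sum>i<2 * CARD('n). \<Sum>j<2 * CARD('n). (b (F i) v * b (blinfun_apply A (F i)) (F j)) *\<^sub>R F j)
     = (\<Sum>i<2 * CARD('n). b (F i) v *\<^sub>R blinfun_apply A (F i))"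
    by (intro sum.cong refl) (simp add: F_expand[of "blinfun_apply A (F _)", symmetric] flip: scaleR_scaleR scaleR_sum_right)
  also have "\<dots> = blinfun_apply A v"
    using F_linear[OF blinfun_linear, of A v] b_sym[of v] by simp
  also have "(\<Sum>i<2 * CARD('n). \<Sum>j<2 * CARD('n). (b (F j) v * b (blinfun_apply A (F i)) (F j)) *\<^sub>R F i)
     = (\<Sum>i<2 * CARD('n). b (blinfun_apply A (F i)) v *\<^sub>R F i)"
  proof (intro sum.cong refl)
    fix i
    have "b (blinfun_apply A (F i)) v = (\<Sum>j<2 * CARD('n). b (F j) v * b (blinfun_apply A (F i)) (F j))"
      unfolding b_F_inner[of "blinfun_apply A (F i)" v] using b_sym[of v] by (simp add: mult.commute)
    then show "(\<Sum>j<2 * CARD('n). (b (F j) v * b (blinfun_apply A (F i)) (F j)) *\<^sub>R F i) = b (blinfun_apply A (F i)) v *\<^sub>R F i"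
      by (simp only: scaleR_sum_left)
  qed
  also have "\<dots> = - blinfun_apply A v"
  proof -
    have "b (blinfun_apply A (F i)) v = - b (blinfun_apply A v) (F i)" for i
      using bivectors_skew[OF A, of "F i" v] b_sym by simp
    then show ?thesis by (simp add: sum_negf F_expand[symmetric])
  qed
  finally show "blinfun_apply A v =
     blinfun_apply ((1/2) *\<^sub>R (\<Sum>i<2 * CARD('n). \<Sum>j<2 * CARD('n). b (blinfun_apply A (F i)) (F j) *\<^sub>R wedge b (F i) (F j))) v"
    by (simp add: blinfun.scaleR_left blinfun.sum_left flip: scaleR_2)
qed

lemma riem_expand: "riem g x u v z w = (\<Sum>i<2 * CARD('n). \<Sum>j<2 * CARD('n). b u (F i) * b v (F j) * riem g x (F i) (F j) z w)"
  using F_linear[OF riem_lin(1), of u v z w] F_linear[OF riem_lin(2), of _ v z w]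
  by (simp add: sum_distrib_left mult.assoc)

section \<open>The curvature operator at a point\<close>

definition is_curv_op :: "(((complex ^ 'n) \<Rightarrow>\<^sub>L (complex ^ 'n)) \<Rightarrow> ((complex ^ 'n) \<Rightarrow>\<^sub>L (complex ^ 'n))) \<Rightarrow> bool" where
  "is_curv_op \<R> \<longleftrightarrow> linear \<R> \<and> \<R> ` bivectors b \<subseteq> bivectors b \<and>
     (\<forall>u v z w. bivector_inner (\<R> (wedge b u v)) (wedge b z w) = riem g x u v z w)"

text \<open>\<open>curvature_operator\<close> is chosen by \<open>SOME\<close>, so an operator with
  the required properties has to be exhibited. The witness extends the values prescribed on wedges
  linearly, by the coefficients of \<open>bivector_expand\<close>.\<close>

lemma curv_op_exists: "\<exists>\<R>. is_curv_op \<R>"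
proof -
  \<comment> \<open>The sign reflects the convention of \<open>riem\<close>, which pairs the
    curvature endomorphism applied to the last argument with the third one; by skewness this is an
    entry of the negative endomorphism.\<close>
  define C where "C u v = Blinfun (\<lambda>z. - curvature_endo g x u v z)" for u v
  have C: "blinfun_apply (C u v) z = - curvature_endo g x u v z" for u v z
  proof -
    have "bounded_linear (\<lambda>z. - curvature_endo g x u v z)"
      using linear_compose_neg[OF curvature_linear(3)[OF x]] linear_conv_bounded_linear by blast
    then show ?thesis by (simp add: C_def bounded_linear_Blinfun_apply)
  qed
  have bC: "b (blinfun_apply (C u v) z) w = riem g x u v z w" for u v z w
    unfolding C riem_def using curvature_skew[OF x, of u v w z] b_sym[of w] by (simp add: linear_neg[OF b_lin'])
  define R where "R A = (1/2) *\<^sub>R (\<Sum>i<2 * CARD('n). \<Sum>j<2 * CARD('n). b (blinfun_apply A (F i)) (F j) *\<^sub>R C (F i) (F j))" for A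
  have bR: "b (blinfun_apply (R A) z) w = 1/2 * (\<Sum>i<2 * CARD('n). \<Sum>j<2 * CARD('n). b (blinfun_apply A (F i)) (F j) * riem g x (F i) (F j) z w)" for A z w
    by (simp add: R_def blinfun.scaleR_left blinfun.sum_left linear_cmul[OF b_lin'] linear_sum[OF b_lin'] bC)
  have lin: "linear R"
    by (rule linearI) (simp_all add: R_def blinfun.add_left blinfun.scaleR_left linear_add[OF b_lin'] linear_cmul[OF b_lin']
      scaleR_left_distrib sum.distrib scaleR_sum_right scaleR_right_distrib)
  have biv: "R A \<in> bivectors b" for A
    unfolding bivectors_def
  proof (intro CollectI allI)
    fix z w
    have "b (blinfun_apply (R A) z) w = - b (blinfun_apply (R A) w) z"
      unfolding bR using riem_antisym(2)[OF x, of _ _ z w] by (simp add: sum_negf)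
    then show "b (blinfun_apply (R A) z) w = - b z (blinfun_apply (R A) w)" using b_sym by metis
  qed
  have "bivector_inner (R (wedge b u v)) (wedge b z w) = riem g x u v z w" for u v z w
  proof -
    have "bivector_inner (R (wedge b u v)) (wedge b z w) = b (blinfun_apply (R (wedge b u v)) z) w"
      by (rule bivector_inner_wedge[OF inner_b biv])
    also have "\<dots> = 1/2 * (\<Sum>i<2 * CARD('n). \<Sum>j<2 * CARD('n). b u (F i) * b v (F j) * riem g x (F i) (F j) z w
        - b v (F i) * b u (F j) * riem g x (F i) (F j) z w)"
      unfolding bR by (simp add: blinfun_apply_wedge[OF inner_b] linear_diff[OF b_lin'] linear_cmul[OF b_lin'] left_diff_distrib)
    also have "\<dots> = 1/2 * (riem g x u v z w - riem g x v u z w)"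
      by (simp only: sum_subtractf riem_expand[symmetric])
    finally show ?thesis using riem_antisym(1)[OF x, of v u z w] by simp
  qed
  then show ?thesis using lin biv unfolding is_curv_op_def by blast
qed

abbreviation Rop where "Rop \<equiv> curvature_operator g x"

lemma is_curv_op: "is_curv_op Rop"
proof -
  have "curvature_operator g x = (SOME \<R>. is_curv_op \<R>)"
    by (simp add: curvature_operator_def is_curv_op_def[abs_def])
  then show ?thesis using curv_op_exists someI_ex by metis
qed

lemma Rop_linear: "linear Rop" using is_curv_op by (simp add: is_curv_op_def)

lemma Rop_bivector: "A \<in> bivectors b \<Longrightarrow> Rop A \<in> bivectors b"
  using is_curv_op by (auto simp: is_curv_op_def)

lemma Rop_wedge: "b (blinfun_apply (Rop (wedge b u v)) z) w = riem g x u v z w"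
  using bivector_inner_wedge[OF inner_b Rop_bivector[OF wedge_bivector], of u v z w] is_curv_op
  by (simp add: is_curv_op_def)

lemma Rop_apply:
  assumes A: "A \<in> bivectors b"
  shows "b (blinfun_apply (Rop A) z) w
    = 1/2 * (\<Sum>i<2 * CARD('n). \<Sum>j<2 * CARD('n). b (blinfun_apply A (F i)) (F j) * riem g x (F i) (F j) z w)"
proof -
  have "Rop A = Rop ((1/2) *\<^sub>R (\<Sum>i<2 * CARD('n). \<Sum>j<2 * CARD('n). b (blinfun_apply A (F i)) (F j) *\<^sub>R wedge b (F i) (F j)))"
    by (rule arg_cong[OF bivector_expand[OF A]])
  also have "\<dots> = (1/2) *\<^sub>R (\<Sum>i<2 * CARD('n). \<Sum>j<2 * CARD('n). b (blinfun_apply A (F i)) (F j) *\<^sub>R Rop (wedge b (F i) (F j)))"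
    by (simp only: linear_sum[OF Rop_linear] linear_cmul[OF Rop_linear])
  finally show ?thesis
    by (simp add: blinfun.scaleR_left blinfun.sum_left linear_cmul[OF b_lin'] linear_sum[OF b_lin'] Rop_wedge)
qed

lemma real_11D:
  assumes "A \<in> real_11_bivectors b"
  shows "A \<in> bivectors b" "blinfun_apply A (J v) = J (blinfun_apply A v)"
  using assms by (auto simp: real_11_bivectors_def)

lemma Rop_real_11:
  assumes A: "A \<in> real_11_bivectors b"
  shows "Rop A \<in> real_11_bivectors b"
proof -
  note A' = real_11D(1)[OF A]
  have J: "riem g x u v (J z) w = - riem g x u v z (J w)" for u v z w
    using riem_J(1)[OF x, of u v z "J w"] by (simp add: linear_neg[OF riem_lin(4)])
  have "blinfun_apply (Rop A) (J v) = J (blinfun_apply (Rop A) v)" for v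
  proof (rule inner_product_nondegenerate[OF inner_b])
    fix w
    show "b (blinfun_apply (Rop A) (J v)) w = b (J (blinfun_apply (Rop A) v)) w"
      unfolding b_J_left Rop_apply[OF A'] by (simp add: J sum_negf)
  qed
  then show ?thesis using Rop_bivector[OF A'] by (simp add: real_11_bivectors_def)
qed

lemma bivector_inner_F:
  assumes A: "A \<in> bivectors b" and B: "B \<in> bivectors b"
  shows "bivector_inner A B = 1/2 * (\<Sum>i<2 * CARD('n). \<Sum>j<2 * CARD('n). b (blinfun_apply B (F i)) (F j) * b (blinfun_apply A (F i)) (F j))"
proof -
  have "bivector_inner A B = bivector_inner A ((1/2) *\<^sub>R (\<Sum>i<2 * CARD('n). \<Sum>j<2 * CARD('n). b (blinfun_apply B (F i)) (F j) *\<^sub>R wedge b (F i) (F j)))"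
    by (rule arg_cong[OF bivector_expand[OF B]])
  also have "\<dots> = 1/2 * (\<Sum>i<2 * CARD('n). \<Sum>j<2 * CARD('n). b (blinfun_apply B (F i)) (F j) * bivector_inner A (wedge b (F i) (F j)))"
    by (simp add: linear_sum[OF bivector_inner_linear(1)] linear_cmul[OF bivector_inner_linear(1)])
  finally show ?thesis by (simp add: bivector_inner_wedge[OF inner_b A])
qed

lemma bivector_inner_sym:
  assumes "A \<in> bivectors b" "B \<in> bivectors b"
  shows "bivector_inner A B = bivector_inner B A"
  unfolding bivector_inner_F[OF assms] bivector_inner_F[OF assms(2,1)] by (simp add: mult.commute)

lemma bivector_inner_unitary:
  assumes A: "A \<in> real_11_bivectors b" and B: "B \<in> real_11_bivectors b" and e: "unitary_frame b CARD('n) e"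
  shows "bivector_inner A B = (\<Sum>i<CARD('n). b (blinfun_apply A (e i)) (blinfun_apply B (e i)))"
proof -
  have "2 * (\<Sum>i<CARD('n). b (blinfun_apply A (e i)) (blinfun_apply B (e i)))
     = (\<Sum>i<2 * CARD('n). b (blinfun_apply A (F i)) (blinfun_apply B (F i)))"
    by (rule sum_unitary_frame[OF e blinfun_linear blinfun_linear]) (simp add: real_11D(2)[OF A] real_11D(2)[OF B] b_J)
  then show ?thesis
    unfolding bivector_inner_F[OF real_11D(1)[OF A] real_11D(1)[OF B]]
    by (simp add: b_F_inner[of "blinfun_apply A _" "blinfun_apply B _"] mult.commute)
qed

lemma Rop_self_adjoint:
  assumes A: "A \<in> bivectors b" and B: "B \<in> bivectors b"
  shows "bivector_inner (Rop A) B = 1/4 * (\<Sum>i<2 * CARD('n). \<Sum>j<2 * CARD('n). \<Sum>k<2 * CARD('n). \<Sum>l<2 * CARD('n).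
     b (blinfun_apply A (F i)) (F j) * b (blinfun_apply B (F k)) (F l) * riem g x (F i) (F j) (F k) (F l))"
proof -
  have "bivector_inner (Rop A) B = 1/4 * (\<Sum>k<2 * CARD('n). \<Sum>l<2 * CARD('n). \<Sum>i<2 * CARD('n). \<Sum>j<2 * CARD('n).
     b (blinfun_apply A (F i)) (F j) * b (blinfun_apply B (F k)) (F l) * riem g x (F i) (F j) (F k) (F l))"
    unfolding bivector_inner_F[OF Rop_bivector[OF A] B] Rop_apply[OF A]
    by (simp add: sum_distrib_left mult_ac)
  also have "(\<Sum>k<2 * CARD('n). \<Sum>l<2 * CARD('n). \<Sum>i<2 * CARD('n). \<Sum>j<2 * CARD('n).
     b (blinfun_apply A (F i)) (F j) * b (blinfun_apply B (F k)) (F l) * riem g x (F i) (F j) (F k) (F l))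
    = (\<Sum>i<2 * CARD('n). \<Sum>j<2 * CARD('n). \<Sum>k<2 * CARD('n). \<Sum>l<2 * CARD('n).
     b (blinfun_apply A (F i)) (F j) * b (blinfun_apply B (F k)) (F l) * riem g x (F i) (F j) (F k) (F l))"
    by (subst (2) sum.swap, subst sum.swap, subst (3) sum.swap, subst (2) sum.swap) (rule refl)
  finally show ?thesis .
qed

end

text \<open>The spectral theorem above is about Euclidean spaces; complex linear endomorphisms are
  moved there by encoding them as matrices.\<close>

definition of_matrix :: "complex ^ 'n ^ 'n \<Rightarrow> ((complex ^ 'n::finite) \<Rightarrow>\<^sub>L (complex ^ 'n))" where
  "of_matrix M = Blinfun (\<lambda>v. M *v v)"

lemma linear_matrix_vector: "linear (\<lambda>v :: complex ^ 'n::finite. M *v v)"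
  by (rule linearI) (simp_all add: matrix_vector_mult_def vec_eq_iff sum.distrib algebra_simps scaleR_sum_right)

lemma linear_matrix_vector': "linear (\<lambda>M :: complex ^ 'n ^ 'n. M *v (v :: complex ^ 'n::finite))"
  by (rule linearI) (simp_all add: matrix_vector_mult_def vec_eq_iff sum.distrib algebra_simps scaleR_sum_right)

lemma of_matrix_apply [simp]: "blinfun_apply (of_matrix M) v = M *v v"
  using linear_matrix_vector[of M] linear_conv_bounded_linear
  by (metis bounded_linear_Blinfun_apply of_matrix_def)

lemma of_matrix_linear: "linear of_matrix"
  by (rule linearI; rule blinfun_eqI)
    (simp_all add: blinfun.add_left blinfun.scaleR_left linear_add[OF linear_matrix_vector'] linear_cmul[OF linear_matrix_vector'])

lemma smult_decompose:
  fixes v :: "complex ^ 'n"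
  shows "c *s v = Re c *\<^sub>R v + Im c *\<^sub>R J v"
  by (simp add: vec_eq_iff J_def complex_eq_iff)

lemma matrix_J:
  fixes v :: "complex ^ 'n::finite"
  shows "M *v (J v) = J (M *v v)"
  by (simp add: J_def matrix_vector_mult_def vec_eq_iff sum_distrib_left mult_ac)

lemma J_linear_scale:
  fixes f :: "complex ^ 'n \<Rightarrow> complex ^ 'm"
  assumes "linear f" "\<And>v. f (J v) = J (f v)"
  shows "f (c *s v) = c *s f v"
  by (simp add: smult_decompose linear_add[OF assms(1)] linear_cmul[OF assms(1)] assms(2))

lemma of_matrix_surj:
  assumes "\<And>v. blinfun_apply A (J v) = J (blinfun_apply A v)"
  shows "\<exists>M. A = of_matrix M"
proof -
  have l: "linear (blinfun_apply A)" by (simp add: bounded_linear.linear blinfun.bounded_linear_right)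
  have "Vector_Spaces.linear (*s) (*s) (blinfun_apply A)"
    using linear_add[OF l] J_linear_scale[OF l assms]
    by (intro Vector_Spaces.linear_iff[THEN iffD2]) (auto simp: vec.vector_space_axioms)
  then have "A = of_matrix (matrix (blinfun_apply A))"
    by (intro blinfun_eqI) (simp add: matrix_works)
  then show ?thesis by blast
qed

section \<open>Eigenframes of the curvature operator\<close>

lemma sum_quadruple_swap:
  fixes f :: "nat \<Rightarrow> nat \<Rightarrow> nat \<Rightarrow> nat \<Rightarrow> 'b::comm_monoid_add"
  shows "(\<Sum>i\<in>I. \<Sum>j\<in>I. \<Sum>k\<in>I. \<Sum>l\<in>I. f i j k l) = (\<Sum>i\<in>I. \<Sum>j\<in>I. \<Sum>k\<in>I. \<Sum>l\<in>I. f k l i j)"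
proof -
  have dbl: "(\<Sum>i\<in>I. \<Sum>j\<in>I. h i j) = (\<Sum>p\<in>I\<times>I. h (fst p) (snd p))" for h :: "nat \<Rightarrow> nat \<Rightarrow> 'b"
    by (simp add: sum.cartesian_product case_prod_beta)
  show ?thesis
    unfolding dbl[of "\<lambda>i j. \<Sum>k\<in>I. \<Sum>l\<in>I. f i j k l"] dbl[of "\<lambda>i j. \<Sum>k\<in>I. \<Sum>l\<in>I. f k l i j"]
    unfolding dbl by (rule sum.swap)
qed

context kahler_point
begin

text \<open>\<open>orthonormal_eigenframe\<close> is applied to the matrices of real
  (1,1)-bivectors, with the curvature as quadratic form. Pair symmetry makes the form symmetric, and
  diagonality of \<open>P\<close> together with completeness of the frame says that its members are
  eigenvectors.\<close>

lemma eigenframe_exists: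
  "\<exists>(m::nat) \<Xi> lam. (\<forall>i<m. \<Xi> i \<in> real_11_bivectors b) \<and>
     (\<forall>i<m. \<forall>j<m. bivector_inner (\<Xi> i) (\<Xi> j) = (if i = j then 1 else 0)) \<and>
     (\<forall>A\<in>real_11_bivectors b. A = (\<Sum>i<m. bivector_inner A (\<Xi> i) *\<^sub>R \<Xi> i)) \<and>
     (\<forall>i<m. Rop (\<Xi> i) = lam i *\<^sub>R \<Xi> i)"
proof -
  let ?I = "{..<2 * CARD('n)}"
  \<comment> \<open>\<open>bivector_inner\<close> is indefinite on arbitrary complex matrices. This
    product is definite on all of them and agrees with \<open>bivector_inner\<close> on
    \<open>W\<close>.\<close>
  define b' where "b' M M' = (\<Sum>i<CARD('n). b (M *v frame i) (M' *v frame i))" for M M' :: "complex ^ 'n ^ 'n"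
  define P where "P M M' = 1/4 * (\<Sum>i\<in>?I. \<Sum>j\<in>?I. \<Sum>k\<in>?I. \<Sum>l\<in>?I.
     b (M *v F i) (F j) * b (M' *v F k) (F l) * riem g x (F i) (F j) (F k) (F l))" for M M' :: "complex ^ 'n ^ 'n"
  define W where "W = {M. of_matrix M \<in> real_11_bivectors b}"
  note lm = linear_matrix_vector'
  have b': "inner_product b'"
    unfolding inner_product_def
  proof (intro conjI allI impI)
    show "linear (b' M)" for M
      by (rule linearI) (simp_all add: b'_def linear_add[OF lm] linear_cmul[OF lm] linear_add[OF b_lin] linear_cmul[OF b_lin]
        sum.distrib sum_distrib_left)
    show "b' M M' = b' M' M" for M M' unfolding b'_def by (simp add: b_sym)
    fix M :: "complex ^ 'n ^ 'n" assume "M \<noteq> 0"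
    have nn: "b u u \<ge> 0" for u using g_pos[OF x, of u] linear_0[OF b_lin] by (cases "u = 0") auto
    have "\<not> b' M M \<le> 0"
    proof
      assume "b' M M \<le> 0"
      then have "b' M M = 0" using nn by (simp add: b'_def sum_nonneg order_antisym)
      then have "\<forall>i\<in>{..<CARD('n)}. b (M *v frame i) (M *v frame i) = 0"
        unfolding b'_def by (subst (asm) sum_nonneg_eq_0_iff) (auto simp: nn)
      then have z: "M *v frame i = 0" if "i < CARD('n)" for i using g_pos[OF x, of "M *v frame i"] that by force
      have "M *v v = 0" for v
      proof -
        have "M *v v = (\<Sum>i<2 * CARD('n). b v (F i) *\<^sub>R (M *v F i))" by (rule F_linear[OF linear_matrix_vector])
        also have "\<dots> = 0" unfolding sum_F[of "\<lambda>u. b v u *\<^sub>R (M *v u)"] by (simp add: z matrix_J)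
        finally show ?thesis .
      qed
      then have "M = 0" by (simp add: matrix_eq)
      then show False using \<open>M \<noteq> 0\<close> by simp
    qed
    then show "b' M M > 0" by simp
  qed
  have P1: "linear (P M)" for M
    by (rule linearI) (simp_all add: P_def linear_add[OF lm] linear_cmul[OF lm] linear_add[OF b_lin'] linear_cmul[OF b_lin']
      sum.distrib sum_distrib_left algebra_simps)
  have P3: "P M M' = P M' M" for M M'
    unfolding P_def
    by (subst sum_quadruple_swap, intro arg_cong[where f = "\<lambda>t. 1/4 * t"] sum.cong refl)
      (simp add: riem_pair_sym[OF x, of "F _" "F _" "F _" "F _"] mult_ac)
  have P2: "linear (\<lambda>M. P M M')" for M' using P1[of M'] P3[of _ M'] by simp
  have subW: "subspace W"
    using subspace_real_11 unfolding W_def subspace_def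
    by (simp add: linear_0[OF of_matrix_linear] linear_add[OF of_matrix_linear] linear_cmul[OF of_matrix_linear])
  obtain m :: nat and e where e: "\<forall>i<m. e i \<in> W" "\<forall>i<m. \<forall>j<m. b' (e i) (e j) = (if i = j then 1 else 0)"
     "\<forall>M\<in>W. M = (\<Sum>i<m. b' M (e i) *\<^sub>R e i)" "\<forall>i<m. \<forall>j<m. i \<noteq> j \<longrightarrow> P (e i) (e j) = 0"
    using orthonormal_eigenframe[where b = b' and P = P, OF b' P1 P2 P3 subW] by (elim exE conjE) (rule that)
  have bb: "b' M M' = bivector_inner (of_matrix M) (of_matrix M')" if "M \<in> W" "M' \<in> W" for M M'
    using bivector_inner_unitary[OF _ _ unitary_frame_frame, of "of_matrix M" "of_matrix M'"] that by (simp add: W_def b'_def)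
  have PP: "P M M' = bivector_inner (Rop (of_matrix M)) (of_matrix M')" if "M \<in> W" "M' \<in> W" for M M'
    using Rop_self_adjoint[of "of_matrix M" "of_matrix M'"] that real_11D(1) by (simp add: W_def P_def)
  have ex: "A = (\<Sum>i<m. bivector_inner A (of_matrix (e i)) *\<^sub>R of_matrix (e i))" if A: "A \<in> real_11_bivectors b" for A
  proof -
    obtain M where M: "A = of_matrix M" using of_matrix_surj[OF real_11D(2)[OF A]] by blast
    then have MW: "M \<in> W" using A by (simp add: W_def)
    then have "M = (\<Sum>i<m. b' M (e i) *\<^sub>R e i)" using e(3) by blast
    then have "of_matrix M = of_matrix (\<Sum>i<m. b' M (e i) *\<^sub>R e i)" by (rule arg_cong)
    also have "\<dots> = (\<Sum>i<m. b' M (e i) *\<^sub>R of_matrix (e i))"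
      by (simp add: linear_sum[OF of_matrix_linear] linear_cmul[OF of_matrix_linear])
    finally show ?thesis using e(1) MW M by (simp add: bb)
  qed
  have eig: "Rop (of_matrix (e i)) = P (e i) (e i) *\<^sub>R of_matrix (e i)" if i: "i < m" for i
  proof -
    have "of_matrix (e i) \<in> real_11_bivectors b" using e(1) i by (simp add: W_def)
    then have "Rop (of_matrix (e i)) = (\<Sum>j<m. bivector_inner (Rop (of_matrix (e i))) (of_matrix (e j)) *\<^sub>R of_matrix (e j))"
      by (rule ex[OF Rop_real_11])
    also have "\<dots> = (\<Sum>j<m. (if j = i then P (e i) (e i) *\<^sub>R of_matrix (e i) else 0))"
      using e(1,4) i by (intro sum.cong refl) (auto simp: PP[symmetric])
    finally show ?thesis using i by simp
  qed
  show ?thesis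
  proof (rule exI[of _ m], rule exI[of _ "\<lambda>i. of_matrix (e i)"], rule exI[of _ "\<lambda>i. P (e i) (e i)"], intro conjI)
    show "\<forall>i<m. of_matrix (e i) \<in> real_11_bivectors b" using e(1) by (simp add: W_def)
    show "\<forall>i<m. \<forall>j<m. bivector_inner (of_matrix (e i)) (of_matrix (e j)) = (if i = j then 1 else 0)"
      using e(1,2) by (auto simp: bb[symmetric])
  qed (use ex eig in auto)
qed

lemma sorted_eigenframe_exists:
  "\<exists>ls \<Xi>. sorted ls \<and> (\<forall>i<length ls. \<Xi> i \<in> real_11_bivectors b) \<and>
     (\<forall>i<length ls. \<forall>j<length ls. bivector_inner (\<Xi> i) (\<Xi> j) = (if i = j then 1 else 0)) \<and>
     (\<forall>A\<in>real_11_bivectors b. A = (\<Sum>i<length ls. bivector_inner A (\<Xi> i) *\<^sub>R \<Xi> i)) \<and>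
     (\<forall>i<length ls. Rop (\<Xi> i) = ls ! i *\<^sub>R \<Xi> i)"
proof -
  obtain m :: nat and \<Xi> lam where e: "\<forall>i<m. \<Xi> i \<in> real_11_bivectors b"
     "\<forall>i<m. \<forall>j<m. bivector_inner (\<Xi> i) (\<Xi> j) = (if i = j then 1 else 0)"
     "\<forall>A\<in>real_11_bivectors b. A = (\<Sum>i<m. bivector_inner A (\<Xi> i) *\<^sub>R \<Xi> i)"
     "\<forall>i<m. Rop (\<Xi> i) = lam i *\<^sub>R \<Xi> i"
    using eigenframe_exists by (elim exE conjE) (rule that)
  define ks where "ks = sort_key lam [0..<m]"
  have ks: "length ks = m" "set ks = {..<m}" "distinct ks" by (simp_all add: ks_def lessThan_atLeast0)
  have bij: "bij_betw (\<lambda>i. ks ! i) {..<m} {..<m}"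
    by (rule bij_betw_nth[OF ks(3)]) (simp_all add: ks)
  have lt: "ks ! i < m" if "i < m" for i using that ks nth_mem[of i ks] by auto
  have inj: "ks ! i = ks ! j \<longleftrightarrow> i = j" if "i < m" "j < m" for i j
    using nth_eq_iff_index_eq[OF ks(3)] that ks(1) by simp
  show ?thesis
  proof (rule exI[of _ "map lam ks"], rule exI[of _ "\<lambda>i. \<Xi> (ks ! i)"], intro conjI)
    show "sorted (map lam ks)" by (simp add: ks_def)
    show "\<forall>A\<in>real_11_bivectors b. A = (\<Sum>i<length (map lam ks). bivector_inner A (\<Xi> (ks ! i)) *\<^sub>R \<Xi> (ks ! i))"
    proof
      fix A assume "A \<in> real_11_bivectors b"
      then have "A = (\<Sum>i<m. bivector_inner A (\<Xi> i) *\<^sub>R \<Xi> i)" using e(3) by blast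
      also have "\<dots> = (\<Sum>i<m. bivector_inner A (\<Xi> (ks ! i)) *\<^sub>R \<Xi> (ks ! i))"
        by (rule sum.reindex_bij_betw[OF bij, symmetric])
      finally show "A = (\<Sum>i<length (map lam ks). bivector_inner A (\<Xi> (ks ! i)) *\<^sub>R \<Xi> (ks ! i))" using ks by simp
    qed
  qed (use e(1,2,4) ks lt inj in auto)
qed

text \<open>Identifies the definite description in \<open>kahler_eigenvalues\<close>. The eigenspace
  of \<open>l\<close> is spanned by the frame members with eigenvalue \<open>l\<close>, so its
  dimension is the multiplicity of \<open>l\<close> in the list, and a sorted list is determined by
  its multiplicities.\<close>

lemma kahler_eigenvalues_frame:
  "\<exists>\<Xi>. sorted (kahler_eigenvalues g x) \<and>
     (\<forall>i<length (kahler_eigenvalues g x). \<Xi> i \<in> real_11_bivectors b) \<and>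
     (\<forall>i<length (kahler_eigenvalues g x). \<forall>j<length (kahler_eigenvalues g x).
       bivector_inner (\<Xi> i) (\<Xi> j) = (if i = j then 1 else 0)) \<and>
     (\<forall>A\<in>real_11_bivectors b. A = (\<Sum>i<length (kahler_eigenvalues g x). bivector_inner A (\<Xi> i) *\<^sub>R \<Xi> i)) \<and>
     (\<forall>i<length (kahler_eigenvalues g x). Rop (\<Xi> i) = kahler_eigenvalues g x ! i *\<^sub>R \<Xi> i)"
proof -
  obtain ls \<Xi> where e: "sorted ls" "\<forall>i<length ls. \<Xi> i \<in> real_11_bivectors b"
     "\<forall>i<length ls. \<forall>j<length ls. bivector_inner (\<Xi> i) (\<Xi> j) = (if i = j then 1 else 0)"
     "\<forall>A\<in>real_11_bivectors b. A = (\<Sum>i<length ls. bivector_inner A (\<Xi> i) *\<^sub>R \<Xi> i)"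
     "\<forall>i<length ls. Rop (\<Xi> i) = ls ! i *\<^sub>R \<Xi> i"
    using sorted_eigenframe_exists by (elim exE conjE) (rule that)
  let ?m = "length ls"
  have inj: "inj_on \<Xi> {..<?m}"
  proof (rule inj_onI)
    fix i j assume "i \<in> {..<?m}" "j \<in> {..<?m}" "\<Xi> i = \<Xi> j"
    then show "i = j" using e(3) by (metis lessThan_iff zero_neq_one)
  qed
  have coeff: "bivector_inner (\<Sum>i\<in>K. c i *\<^sub>R \<Xi> i) (\<Xi> j) = c j" if "K \<subseteq> {..<?m}" "j \<in> K" for K c j
  proof -
    have fin: "finite K" using that finite_subset by blast
    have lt: "i < ?m" if "i \<in> K" for i using \<open>K \<subseteq> {..<?m}\<close> that by auto
    have "bivector_inner (\<Sum>i\<in>K. c i *\<^sub>R \<Xi> i) (\<Xi> j) = (\<Sum>i\<in>K. c i * bivector_inner (\<Xi> i) (\<Xi> j))"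
      by (simp add: linear_sum[OF bivector_inner_linear(2)] linear_cmul[OF bivector_inner_linear(2)])
    also have "\<dots> = (\<Sum>i\<in>K. if i = j then c j else 0)"
      using that(2) e(3) by (intro sum.cong refl) (auto simp: lt)
    finally show ?thesis using fin that by simp
  qed
  have dim: "dim (kahler_eigenspace g x l) = count_list ls l" for l
  proof -
    define K where "K = {i. i < ?m \<and> ls ! i = l}"
    have K: "K \<subseteq> {..<?m}" "finite K" by (auto simp: K_def)
    have ind: "independent (\<Xi> ` K)"
    proof (rule independent_if_scalars_zero)
      show "finite (\<Xi> ` K)" using K by simp
      fix f v assume s: "(\<Sum>v\<in>\<Xi> ` K. f v *\<^sub>R v) = 0" and "v \<in> \<Xi> ` K"
      then obtain j where j: "j \<in> K" "v = \<Xi> j" by blast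
      have "(\<Sum>i\<in>K. f (\<Xi> i) *\<^sub>R \<Xi> i) = 0"
        using s sum.reindex[OF inj_on_subset[OF inj K(1)], of "\<lambda>v. f v *\<^sub>R v"] by simp
      then show "f v = 0"
        using coeff[OF K(1) j(1), of "\<lambda>i. f (\<Xi> i)"] j(2) linear_0[OF bivector_inner_linear(2), of "\<Xi> j"] by simp
    qed
    have "kahler_eigenspace g x l = span (\<Xi> ` K)"
    proof (intro equalityI subsetI)
      fix A assume "A \<in> kahler_eigenspace g x l"
      then have A: "A \<in> real_11_bivectors b" "Rop A = l *\<^sub>R A" by (auto simp: kahler_eigenspace_def)
      have Ae: "A = (\<Sum>i<?m. bivector_inner A (\<Xi> i) *\<^sub>R \<Xi> i)" using e(4) A by blast
      have z: "bivector_inner A (\<Xi> j) = 0" if j: "j < ?m" "ls ! j \<noteq> l" for j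
      proof -
        have "Rop A = (\<Sum>i<?m. bivector_inner A (\<Xi> i) *\<^sub>R Rop (\<Xi> i))"
          by (rule trans[OF arg_cong[OF Ae]]) (simp add: linear_sum[OF Rop_linear] linear_cmul[OF Rop_linear])
        also have "\<dots> = (\<Sum>i<?m. (bivector_inner A (\<Xi> i) * ls ! i) *\<^sub>R \<Xi> i)" using e(5) by simp
        finally have "bivector_inner (Rop A) (\<Xi> j) = bivector_inner A (\<Xi> j) * ls ! j"
          using coeff[of "{..<?m}" j] j by simp
        moreover have "bivector_inner (Rop A) (\<Xi> j) = l * bivector_inner A (\<Xi> j)"
          by (simp add: A(2) linear_cmul[OF bivector_inner_linear(2)])
        ultimately show ?thesis using j(2) by simp
      qed
      have "(\<Sum>i<?m. bivector_inner A (\<Xi> i) *\<^sub>R \<Xi> i) = (\<Sum>i\<in>K. bivector_inner A (\<Xi> i) *\<^sub>R \<Xi> i)"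
        by (rule sum.mono_neutral_right) (use z in \<open>auto simp: K_def\<close>)
      also have "\<dots> \<in> span (\<Xi> ` K)"
        by (intro span_sum span_scale span_base imageI)
      finally show "A \<in> span (\<Xi> ` K)" using Ae by simp
    next
      fix A assume A: "A \<in> span (\<Xi> ` K)"
      have sub: "subspace (kahler_eigenspace g x l)"
        using subspace_real_11 unfolding kahler_eigenspace_def subspace_def
        by (auto simp: linear_0[OF Rop_linear] linear_add[OF Rop_linear] linear_cmul[OF Rop_linear] scaleR_right_distrib)
      have "\<Xi> ` K \<subseteq> kahler_eigenspace g x l" using e(2,5) by (auto simp: K_def kahler_eigenspace_def)
      then show "A \<in> kahler_eigenspace g x l" using A span_minimal[OF _ sub] by blast
    qed
    then have "dim (kahler_eigenspace g x l) = card (\<Xi> ` K)"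
      using dim_span_eq_card_independent[OF ind] by simp
    also have "\<dots> = card K" by (rule card_image[OF inj_on_subset[OF inj K(1)]])
    also have "\<dots> = count_list ls l"
      by (simp add: K_def count_list_eq_length_filter length_filter_conv_card eq_commute[of l])
    finally show ?thesis .
  qed
  have "kahler_eigenvalues g x = ls"
    unfolding kahler_eigenvalues_def
  proof (rule the_equality)
    show "sorted ls \<and> (\<forall>l. count_list ls l = dim (kahler_eigenspace g x l))" using e(1) dim by simp
    fix ks assume ks: "sorted ks \<and> (\<forall>l. count_list ks l = dim (kahler_eigenspace g x l))"
    then have "mset ks = mset ls" by (intro multiset_eqI) (simp add: dim count_mset)
    then show "ks = ls" using ks e(1) by (metis sorted_list_of_multiset_mset sorted_sort_id)
  qed
  then show ?thesis using e by (intro exI[of _ \<Xi>]) simp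
qed

text \<open>All that the later algebra has to know about the eigenvalues. The last two identities
  are the spectral expansions of the curvature operator and of the identity on real (1,1)-bivectors:
  the second is the first with every eigenvalue set to 1.\<close>

theorem curvature_spectral:
  obtains \<Xi> :: "nat \<Rightarrow> complex ^ 'n \<Rightarrow> complex ^ 'n" where "sorted (kahler_eigenvalues g x)"
    "\<And>i. linear (\<Xi> i)"
    "\<And>i u v. i < length (kahler_eigenvalues g x) \<Longrightarrow> b (\<Xi> i u) v = - b u (\<Xi> i v)"
    "\<And>i v. i < length (kahler_eigenvalues g x) \<Longrightarrow> \<Xi> i (J v) = J (\<Xi> i v)"
    "\<And>i e. i < length (kahler_eigenvalues g x) \<Longrightarrow> unitary_frame b CARD('n) e \<Longrightarrow>
       (\<Sum>j<CARD('n). b (\<Xi> i (e j)) (\<Xi> i (e j))) = 1"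
    "\<And>u v z w. riem g x u v z w
       = (\<Sum>i<length (kahler_eigenvalues g x). kahler_eigenvalues g x ! i * (b (\<Xi> i u) v * b (\<Xi> i z) w))"
    "\<And>u v z w. (\<Sum>i<length (kahler_eigenvalues g x). b (\<Xi> i u) v * b (\<Xi> i z) w)
       = (b u z * b v w - b v z * b u w + b (J u) z * b (J v) w - b (J v) z * b (J u) w) / 2"
proof -
  let ?m = "length (kahler_eigenvalues g x)"
  obtain \<Xi> where srt: "sorted (kahler_eigenvalues g x)"
    and e: "\<forall>i<?m. \<Xi> i \<in> real_11_bivectors b"
      "\<forall>i<?m. \<forall>j<?m. bivector_inner (\<Xi> i) (\<Xi> j) = (if i = j then 1 else 0)"
      "\<forall>A\<in>real_11_bivectors b. A = (\<Sum>i<?m. bivector_inner A (\<Xi> i) *\<^sub>R \<Xi> i)"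
      "\<forall>i<?m. Rop (\<Xi> i) = kahler_eigenvalues g x ! i *\<^sub>R \<Xi> i"
    using kahler_eigenvalues_frame by (elim exE conjE) (rule that)
  have m: "\<Xi> i \<in> real_11_bivectors b" if "i < ?m" for i using e(1) that by blast
  have on: "bivector_inner (\<Xi> i) (\<Xi> j) = (if i = j then 1 else 0)" if "i < ?m" "j < ?m" for i j
    using e(2) that by blast
  have ex: "A = (\<Sum>i<?m. bivector_inner A (\<Xi> i) *\<^sub>R \<Xi> i)" if "A \<in> real_11_bivectors b" for A
    using e(3) that by blast
  have eig: "Rop (\<Xi> i) = kahler_eigenvalues g x ! i *\<^sub>R \<Xi> i" if "i < ?m" for i using e(4) that by blast
  note skew = bivectors_skew[OF real_11D(1)[OF m]] and JJ = real_11D(2)[OF m]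
  \<comment> \<open>The orthogonal projection of the wedge of \<open>u\<close> and \<open>v\<close>
    to the bivectors invariant under \<open>J\<close>.\<close>
  define A where "A u v = (1/2) *\<^sub>R (wedge b u v + wedge b (J u) (J v))" for u v
  have Abv: "A u v \<in> bivectors b" for u v
    unfolding A_def by (intro subspace_scale[OF subspace_bivectors] subspace_add[OF subspace_bivectors] wedge_bivector)
  have Aap: "blinfun_apply (A u v) z = (1/2) *\<^sub>R (b u z *\<^sub>R v - b v z *\<^sub>R u + b (J u) z *\<^sub>R J v - b (J v) z *\<^sub>R J u)" for u v z
    by (simp add: A_def blinfun.scaleR_left blinfun.add_left blinfun_apply_wedge[OF inner_b])
  have A11: "A u v \<in> real_11_bivectors b" for u v
    unfolding real_11_bivectors_def using Abv
    by (auto simp: Aap b_J b_J_left J_add J_diff J_scaleR linear_neg[OF b_lin] algebra_simps)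
  have ip: "bivector_inner (A u v) (\<Xi> i) = b (blinfun_apply (\<Xi> i) u) v" if "i < ?m" for u v i
  proof -
    have "bivector_inner (A u v) (\<Xi> i) = bivector_inner (\<Xi> i) (A u v)"
      by (rule bivector_inner_sym[OF Abv real_11D(1)[OF m[OF that]]])
    also have "\<dots> = 1/2 * (bivector_inner (\<Xi> i) (wedge b u v) + bivector_inner (\<Xi> i) (wedge b (J u) (J v)))"
      by (simp add: A_def linear_cmul[OF bivector_inner_linear(1)] linear_add[OF bivector_inner_linear(1)])
    finally show ?thesis
      using bivector_inner_wedge[OF inner_b real_11D(1)[OF m[OF that]]] JJ[OF that] b_J by simp
  qed
  have Aex: "A u v = (\<Sum>i<?m. b (blinfun_apply (\<Xi> i) u) v *\<^sub>R \<Xi> i)" for u v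
    using ex[OF A11[of u v]] ip by simp
  show ?thesis
  proof (rule that[of "\<lambda>i. blinfun_apply (\<Xi> i)"])
    show "sorted (kahler_eigenvalues g x)" by (rule srt)
    show "linear (blinfun_apply (\<Xi> i))" for i by (rule blinfun_linear)
    show "i < ?m \<Longrightarrow> b (blinfun_apply (\<Xi> i) u) v = - b u (blinfun_apply (\<Xi> i) v)" for i u v by (rule skew)
    show "i < ?m \<Longrightarrow> blinfun_apply (\<Xi> i) (J v) = J (blinfun_apply (\<Xi> i) v)" for i v by (rule JJ)
    show "i < ?m \<Longrightarrow> unitary_frame b CARD('n) e \<Longrightarrow>
       (\<Sum>j<CARD('n). b (blinfun_apply (\<Xi> i) (e j)) (blinfun_apply (\<Xi> i) (e j))) = 1" for i e
      using bivector_inner_unitary[OF m m, of i i e] on[of i i] by simp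
    fix u v z w
    have "b (blinfun_apply (A u v) z) w = (\<Sum>i<?m. b (blinfun_apply (\<Xi> i) u) v * b (blinfun_apply (\<Xi> i) z) w)"
      unfolding Aex by (simp add: blinfun.sum_left blinfun.scaleR_left linear_sum[OF b_lin'] linear_cmul[OF b_lin'])
    then show "(\<Sum>i<?m. b (blinfun_apply (\<Xi> i) u) v * b (blinfun_apply (\<Xi> i) z) w)
       = (b u z * b v w - b v z * b u w + b (J u) z * b (J v) w - b (J v) z * b (J u) w) / 2"
      unfolding Aap by (simp add: linear_add[OF b_lin'] linear_diff[OF b_lin'] linear_cmul[OF b_lin'])
    have "Rop (A u v) = (\<Sum>i<?m. (b (blinfun_apply (\<Xi> i) u) v * kahler_eigenvalues g x ! i) *\<^sub>R \<Xi> i)"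
      unfolding Aex using eig by (simp add: linear_sum[OF Rop_linear] linear_cmul[OF Rop_linear])
    then have 1: "b (blinfun_apply (Rop (A u v)) z) w
      = (\<Sum>i<?m. kahler_eigenvalues g x ! i * (b (blinfun_apply (\<Xi> i) u) v * b (blinfun_apply (\<Xi> i) z) w))"
      by (simp add: blinfun.sum_left blinfun.scaleR_left linear_sum[OF b_lin'] linear_cmul[OF b_lin'] mult_ac)
    \<comment> \<open>Both summands are equal by \<open>riem_J\<close>: the curvature sees only the
      projection of a wedge.\<close>
    have "b (blinfun_apply (Rop (A u v)) z) w = 1/2 * (riem g x u v z w + riem g x (J u) (J v) z w)"
      unfolding A_def linear_cmul[OF Rop_linear] linear_add[OF Rop_linear]
      by (simp add: blinfun.scaleR_left blinfun.add_left linear_add[OF b_lin'] linear_cmul[OF b_lin'] Rop_wedge)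
    then show "riem g x u v z w
       = (\<Sum>i<?m. kahler_eigenvalues g x ! i * (b (blinfun_apply (\<Xi> i) u) v * b (blinfun_apply (\<Xi> i) z) w))"
      using 1 riem_J(2)[OF x] by simp
  qed
qed

end

subsection \<open>Derivation action of endomorphisms on tensors\<close>

text \<open>The derivation extension of an endomorphism to covectors, without the customary minus
  sign. Composition consequently reverses the order, as visible in \<open>act_act\<close> and
  \<open>act_commutator\<close>.\<close>

definition act :: "nat \<Rightarrow> ('v \<Rightarrow> 'v) \<Rightarrow> ('v list \<Rightarrow> complex) \<Rightarrow> 'v list \<Rightarrow> complex" where
  "act k A w vs = (\<Sum>j<k. w (vs[j := A (vs ! j)]))"

lemma multilinear_slot:
  assumes w: "multilinear k w" and A: "linear A" and j: "j < k"
  shows "multilinear k (\<lambda>vs. w (vs[j := A (vs ! j)]))"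
  unfolding multilinear_def
proof (intro allI impI)
  fix vs :: "'a list" and i assume vs: "length vs = k \<and> i < k"
  show "linear (\<lambda>v. w ((vs[i := v])[j := A ((vs[i := v]) ! j)]))"
  proof (cases "i = j")
    case True
    then show ?thesis using linear_compose[OF A multilinearD[OF w]] vs by (simp add: o_def)
  next
    case False
    then show ?thesis using multilinearD[OF w, of "vs[j := A (vs ! j)]" i] vs by (simp add: list_update_swap)
  qed
qed

lemma multilinear_sum:
  assumes "\<And>i. i \<in> I \<Longrightarrow> multilinear k (w i)"
  shows "multilinear k (\<lambda>vs. \<Sum>i\<in>I. w i vs)"
  unfolding multilinear_def by (intro allI impI linear_compose_sum) (use assms multilinearD in blast)

lemma multilinear_act: "multilinear k w \<Longrightarrow> linear A \<Longrightarrow> multilinear k (act k A w)"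
  unfolding act_def by (rule multilinear_sum) (simp add: multilinear_slot)

lemma trace_adjoint:
  fixes b :: "'v::euclidean_space \<Rightarrow> 'v \<Rightarrow> real" and \<beta> :: "'v \<Rightarrow> 'v \<Rightarrow> complex"
  assumes b: "inner_product b" and A: "linear A" and adj: "\<And>u v. b (A u) v = b u (B v)"
    and \<beta>: "\<And>u. linear (\<beta> u)" "\<And>v. linear (\<lambda>u. \<beta> u v)"
  shows "(\<Sum>e\<in>Basis. \<beta> (A e) (dual b e)) = (\<Sum>e\<in>Basis. \<beta> e (B (dual b e)))"
proof -
  have "(\<Sum>e\<in>Basis. \<beta> (A e) (dual b e)) = (\<Sum>e\<in>Basis. \<Sum>f\<in>Basis. (A e \<bullet> f) *\<^sub>R \<beta> f (dual b e))"
    by (intro sum.cong refl linear_expand[OF \<beta>(2)])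
  also have "\<dots> = (\<Sum>f\<in>Basis. \<beta> f (\<Sum>e\<in>Basis. (A e \<bullet> f) *\<^sub>R dual b e))"
    by (subst sum.swap) (simp add: linear_sum[OF \<beta>(1)] linear_cmul[OF \<beta>(1)])
  also have "\<dots> = (\<Sum>f\<in>Basis. \<beta> f (B (dual b f)))"
  proof (intro sum.cong refl arg_cong[where f = "\<beta> _"])
    fix f :: 'v
    have "A e \<bullet> f = b (B (dual b f)) e" for e
      using adj[of e "dual b f"] inner_productD(3)[OF b, of e "B (dual b f)"] dual_works(2)[OF b, of "A e" f]
      by (simp add: inner_commute)
    then show "(\<Sum>e\<in>Basis. (A e \<bullet> f) *\<^sub>R dual b e) = B (dual b f)"
      using dual_expand[OF b, of "B (dual b f)"] by simp
  qed
  finally show ?thesis .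
qed

lemma tensor_ip_slot_adjoint:
  fixes b :: "'v::euclidean_space \<Rightarrow> 'v \<Rightarrow> real"
  assumes b: "inner_product b" and A: "linear A" and adj: "\<And>u v. b (A u) v = b u (B v)"
  shows "multilinear k w \<Longrightarrow> multilinear k w' \<Longrightarrow> j < k \<Longrightarrow>
    tensor_ip b k (\<lambda>vs. w (vs[j := A (vs ! j)])) w' = tensor_ip b k w (\<lambda>vs. w' (vs[j := B (vs ! j)]))"
proof (induction k arbitrary: w w' j)
  case (Suc k)
  show ?case
  proof (cases j)
    case 0
    define \<beta> where "\<beta> a c = tensor_ip b k (\<lambda>vs. w (a # vs)) (\<lambda>vs. w' (c # vs))" for a c
    have b1: "linear (\<lambda>a. \<beta> a c)" for c unfolding \<beta>_def by (rule tensor_ip_linear(1)[OF Suc.prems(1)])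
    have b2: "linear (\<beta> a)" for a unfolding \<beta>_def by (rule tensor_ip_linear(2)[OF Suc.prems(2)])
    show ?thesis using trace_adjoint[where \<beta> = \<beta>, OF b A adj b2 b1] by (simp add: 0 \<beta>_def)
  next
    case (Suc i)
    have "tensor_ip b k (\<lambda>vs. w (e # vs[i := A (vs ! i)])) (\<lambda>vs. w' (c # vs))
      = tensor_ip b k (\<lambda>vs. w (e # vs)) (\<lambda>vs. w' (c # vs[i := B (vs ! i)]))" for e c
      using Suc.prems Suc by (intro Suc.IH multilinear_tail) auto
    then show ?thesis by (simp add: Suc)
  qed
qed simp

lemma tensor_ip_act_adjoint:
  fixes b :: "'v::euclidean_space \<Rightarrow> 'v \<Rightarrow> real"
  assumes b: "inner_product b" and A: "linear A" and adj: "\<And>u v. b (A u) v = b u (B v)"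
    and w: "multilinear k w" "multilinear k w'"
  shows "tensor_ip b k (act k A w) w' = tensor_ip b k w (act k B w')"
proof -
  have "tensor_ip b k (act k A w) w' = (\<Sum>j<k. tensor_ip b k (\<lambda>vs. w (vs[j := A (vs ! j)])) w')"
    unfolding act_def[abs_def] by (rule tensor_ip_sum)
  also have "\<dots> = (\<Sum>j<k. tensor_ip b k w (\<lambda>vs. w' (vs[j := B (vs ! j)])))"
    by (intro sum.cong refl tensor_ip_slot_adjoint[OF b A adj w]) auto
  also have "\<dots> = tensor_ip b k w (act k B w')"
    unfolding act_def[abs_def] by (rule tensor_ip_sum(2)[symmetric])
  finally show ?thesis .
qed

lemma act_act:
  assumes "length vs = k"
  shows "act k A (act k B w) vs = act k (\<lambda>v. B (A v)) w vs
    + (\<Sum>j<k. \<Sum>l<k. if l = j then 0 else w (vs[j := A (vs ! j), l := B (vs ! l)]))"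
proof -
  have "(\<Sum>l<k. w (vs[j := A (vs ! j), l := B (vs[j := A (vs ! j)] ! l)]))
     = w (vs[j := B (A (vs ! j))]) + (\<Sum>l<k. if l = j then 0 else w (vs[j := A (vs ! j), l := B (vs ! l)]))"
    if "j < k" for j
    using that assms by (subst sum_split_diagonal[OF that]) (auto intro!: sum.cong)
  then show ?thesis by (simp add: act_def sum.distrib)
qed

text \<open>The terms in which the endomorphisms hit two different slots are symmetric in
  \<open>A\<close> and \<open>B\<close> and cancel.\<close>

lemma act_commutator:
  assumes w: "multilinear k w" and vs: "length vs = k"
  shows "act k A (act k B w) vs - act k B (act k A w) vs = act k (\<lambda>v. B (A v) - A (B v)) w vs"
proof -
  have "(\<Sum>j<k. \<Sum>l<k. if l = j then 0 else w (vs[j := A (vs ! j), l := B (vs ! l)]))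
     = (\<Sum>j<k. \<Sum>l<k. if l = j then 0 else w (vs[j := B (vs ! j), l := A (vs ! l)]))"
    by (subst sum.swap, intro sum.cong refl) (auto simp: list_update_swap)
  moreover have "act k (\<lambda>v. B (A v) - A (B v)) w vs = act k (\<lambda>v. B (A v)) w vs - act k (\<lambda>v. A (B v)) w vs"
    unfolding act_def sum_subtractf[symmetric]
    by (intro sum.cong refl linear_diff[OF multilinearD[OF w vs]]) auto
  ultimately show ?thesis unfolding act_act[OF vs] by simp
qed

lemma act_add:
  assumes w: "multilinear k w" and vs: "length vs = k"
  shows "act k (\<lambda>v. A v + B v) w vs = act k A w vs + act k B w vs"
  unfolding act_def sum.distrib[symmetric]
  by (intro sum.cong refl linear_add[OF multilinearD[OF w vs]]) auto

lemma act_scaleR: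
  assumes w: "multilinear k w" and vs: "length vs = k"
  shows "act k (\<lambda>v. c *\<^sub>R A v) w vs = c *\<^sub>R act k A w vs"
  unfolding act_def scaleR_sum_right
  by (intro sum.cong refl linear_cmul[OF multilinearD[OF w vs]]) auto

context kahler_point
begin

text \<open>Expanding the curvature endomorphism in the eigenframe, the Weitzenboeck term becomes
  the sum over \<open>a\<close> of \<open>lam a\<close> times the twofold action of
  \<open>\<Xi> a\<close> on \<open>w\<close>. Skewness moves one of the two actions to the other
  side of the inner product with a minus sign, leaving squared norms.\<close>

theorem bochner_curvature_term:
  assumes alt: "\<And>y. y \<in> S \<Longrightarrow> alternating k (w y)" and w: "smooth_tensor k w" and k: "k > 0"
    and harm: "\<And>vs. hodge_laplacian g w x vs = 0"
    and max: "\<And>y. y \<in> S \<Longrightarrow> Re (tensor_ip (g y) k (w y) (w y)) \<le> Re (tensor_ip b k (w x) (w x))"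
    and \<Xi>: "\<And>i. linear (\<Xi> i)" "\<And>i u v. i < m \<Longrightarrow> b (\<Xi> i u) v = - b u (\<Xi> i v)"
    and riem: "\<And>u v z w. riem g x u v z w = (\<Sum>i<m. lam i * (b (\<Xi> i u) v * b (\<Xi> i z) w))"
  shows "(\<Sum>i<m. lam i * Re (tensor_ip b k (act k (\<Xi> i) (w x)) (act k (\<Xi> i) (w x)))) \<le> 0"
proof -
  note mw = tensor_fieldD(1)[OF smooth_tensor_field[OF w] x]
  have R: "curvature_endo g x u v z = - (\<Sum>a<m. (lam a * b (\<Xi> a u) v) *\<^sub>R \<Xi> a z)" for u v z
  proof (rule inner_product_nondegenerate[OF inner_b])
    fix t
    have "b (curvature_endo g x u v z) t = (\<Sum>a<m. lam a * (b (\<Xi> a u) v * b (\<Xi> a t) z))"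
      using riem[of u v t z] by (simp add: riem_def)
    also have "\<dots> = (\<Sum>a<m. - (lam a * b (\<Xi> a u) v * b (\<Xi> a z) t))"
      using \<Xi>(2)[of _ t z] b_sym[of t] by (intro sum.cong refl) simp
    finally show "b (curvature_endo g x u v z) t = b (- (\<Sum>a<m. (lam a * b (\<Xi> a u) v) *\<^sub>R \<Xi> a z)) t"
      by (simp add: linear_neg[OF b_lin'] linear_sum[OF b_lin'] linear_cmul[OF b_lin'] sum_negf)
  qed
  define M where "M a = act k (\<Xi> a) (w x)" for a
  have mM: "multilinear k (M a)" for a unfolding M_def by (rule multilinear_act[OF mw \<Xi>(1)])
  have inner: "(\<Sum>e\<in>Basis. \<Sum>j<k. w x (vs[i := dual b e, j := curvature_endo g x e (vs ! i) (vs[i := dual b e] ! j)]))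
     = (\<Sum>a<m. lam a *\<^sub>R M a (vs[i := \<Xi> a (vs ! i)]))" if vs: "length vs = k" and i: "i < k" for vs i
  proof -
    have "(\<Sum>j<k. w x (vs[i := dual b e, j := curvature_endo g x e (vs ! i) (vs[i := dual b e] ! j)]))
      = - (\<Sum>a<m. (lam a * b (\<Xi> a e) (vs ! i)) *\<^sub>R M a (vs[i := dual b e]))" for e
    proof -
      have "w x (vs[i := dual b e, j := curvature_endo g x e (vs ! i) (vs[i := dual b e] ! j)])
         = - (\<Sum>a<m. (lam a * b (\<Xi> a e) (vs ! i)) *\<^sub>R w x (vs[i := dual b e, j := \<Xi> a (vs[i := dual b e] ! j)]))"
        if "j < k" for j
      proof -
        have l: "linear (\<lambda>z. w x (vs[i := dual b e, j := z]))"
          by (rule multilinearD[OF mw]) (use vs that in auto)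
        show ?thesis unfolding R by (simp only: linear_neg[OF l] linear_sum[OF l] linear_cmul[OF l])
      qed
      then have "(\<Sum>j<k. w x (vs[i := dual b e, j := curvature_endo g x e (vs ! i) (vs[i := dual b e] ! j)]))
        = (\<Sum>j<k. - (\<Sum>a<m. (lam a * b (\<Xi> a e) (vs ! i)) *\<^sub>R w x (vs[i := dual b e, j := \<Xi> a (vs[i := dual b e] ! j)])))"
        by simp
      also have "\<dots> = - (\<Sum>a<m. (lam a * b (\<Xi> a e) (vs ! i)) *\<^sub>R M a (vs[i := dual b e]))"
        unfolding M_def act_def scaleR_sum_right sum_negf by (subst sum.swap) (rule refl)
      finally show ?thesis .
    qed
    then have "(\<Sum>e\<in>Basis. \<Sum>j<k. w x (vs[i := dual b e, j := curvature_endo g x e (vs ! i) (vs[i := dual b e] ! j)]))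
      = (\<Sum>e\<in>Basis. - (\<Sum>a<m. (lam a * b (\<Xi> a e) (vs ! i)) *\<^sub>R M a (vs[i := dual b e])))"
      by simp
    also have "\<dots> = (\<Sum>a<m. \<Sum>e\<in>Basis. - ((lam a * b (\<Xi> a e) (vs ! i)) *\<^sub>R M a (vs[i := dual b e])))"
      unfolding sum_negf[symmetric] by (rule sum.swap)
    \<comment> \<open>Skewness shifts \<open>\<Xi> a\<close> from \<open>e\<close> to
      \<open>vs ! i\<close>; the sum over \<open>e\<close> then reassembles the vector by
      \<open>dual_expand\<close>.\<close>
    also have "\<dots> = (\<Sum>a<m. lam a *\<^sub>R M a (vs[i := \<Xi> a (vs ! i)]))"
    proof (rule sum.cong[OF refl])
      fix a assume "a \<in> {..<m}"
      then have a: "a < m" by simp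
      have l: "linear (\<lambda>z. M a (vs[i := z]))" by (rule multilinearD[OF mM vs i])
      have "M a (vs[i := \<Xi> a (vs ! i)]) = M a (vs[i := (\<Sum>e\<in>Basis. b (\<Xi> a (vs ! i)) e *\<^sub>R dual b e)])"
        by (simp only: dual_expand[OF inner_b])
      also have "\<dots> = (\<Sum>e\<in>Basis. b (\<Xi> a (vs ! i)) e *\<^sub>R M a (vs[i := dual b e]))"
        by (simp only: linear_sum[OF l] linear_cmul[OF l])
      also have "\<dots> = (\<Sum>e\<in>Basis. - (b (\<Xi> a e) (vs ! i) *\<^sub>R M a (vs[i := dual b e])))"
      proof (intro sum.cong refl)
        fix e
        have "b (\<Xi> a (vs ! i)) e = - b (\<Xi> a e) (vs ! i)"
          using \<Xi>(2)[OF a, of "vs ! i" e] b_sym[of "vs ! i" "\<Xi> a e"] by simp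
        then show "b (\<Xi> a (vs ! i)) e *\<^sub>R M a (vs[i := dual b e]) = - (b (\<Xi> a e) (vs ! i) *\<^sub>R M a (vs[i := dual b e]))"
          by simp
      qed
      finally show "(\<Sum>e\<in>Basis. - ((lam a * b (\<Xi> a e) (vs ! i)) *\<^sub>R M a (vs[i := dual b e])))
        = lam a *\<^sub>R M a (vs[i := \<Xi> a (vs ! i)])"
        by (simp add: scaleR_sum_right sum_negf)
    qed
    finally show ?thesis .
  qed
  have tr: "(\<Sum>e\<in>Basis. cov_deriv g (nabla w) x e (dual b e # vs)) = - (\<Sum>a<m. complex_of_real (lam a) * act k (\<Xi> a) (M a) vs)"
    if vs: "length vs = k" for vs
  proof -
    have "(\<Sum>e\<in>Basis. cov_deriv g (nabla w) x e (dual b e # vs)) = - (\<Sum>i<k. \<Sum>a<m. lam a *\<^sub>R M a (vs[i := \<Xi> a (vs ! i)]))"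
    proof -
      let ?A = "\<Sum>e\<in>Basis. cov_deriv g (nabla w) x e (dual b e # vs)"
      let ?B = "\<Sum>i<k. \<Sum>e\<in>Basis. \<Sum>j<k. w x (vs[i := dual b e, j := curvature_endo g x e (vs ! i) (vs[i := dual b e] ! j)])"
      have "hodge_laplacian g w x vs = - ?A - ?B" by (rule weitzenboeck[OF alt w x vs k])
      moreover have "A = - B" if "0 = - A - B" for A B :: complex using that by algebra
      ultimately have "?A = - ?B" unfolding harm by blast
      also have "?B = (\<Sum>i<k. \<Sum>a<m. lam a *\<^sub>R M a (vs[i := \<Xi> a (vs ! i)]))"
        by (rule sum.cong[OF refl]) (rule inner[OF vs], simp)
      finally show ?thesis .
    qed
    also have "(\<Sum>i<k. \<Sum>a<m. lam a *\<^sub>R M a (vs[i := \<Xi> a (vs ! i)])) = (\<Sum>a<m. complex_of_real (lam a) * act k (\<Xi> a) (M a) vs)"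
      unfolding act_def sum_distrib_left scaleR_conv_of_real by (rule sum.swap)
    finally show ?thesis .
  qed
  have "tensor_ip b k (\<lambda>vs. \<Sum>e\<in>Basis. cov_deriv g (nabla w) x e (dual b e # vs)) (w x)
    = tensor_ip b k (\<lambda>vs. - (\<Sum>a<m. complex_of_real (lam a) * act k (\<Xi> a) (M a) vs)) (w x)"
    by (rule tensor_ip_cong[OF tr refl])
  also have "\<dots> = - (\<Sum>a<m. complex_of_real (lam a) * tensor_ip b k (act k (\<Xi> a) (M a)) (w x))"
    by (simp only: tensor_ip_minus tensor_ip_sum tensor_ip_scale)
  also have "\<dots> = (\<Sum>a<m. complex_of_real (lam a) * tensor_ip b k (M a) (M a))"
  proof -
    have "tensor_ip b k (act k (\<Xi> a) (M a)) (w x) = - tensor_ip b k (M a) (M a)" if a: "a < m" for a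
    proof -
      have "tensor_ip b k (act k (\<Xi> a) (M a)) (w x) = tensor_ip b k (M a) (act k (\<lambda>v. - 1 *\<^sub>R \<Xi> a v) (w x))"
        by (rule tensor_ip_act_adjoint[OF inner_b \<Xi>(1) _ mM mw]) (simp add: \<Xi>(2)[OF a] linear_neg[OF b_lin])
      also have "\<dots> = tensor_ip b k (M a) (\<lambda>vs. - 1 * M a vs)"
        by (rule tensor_ip_cong[OF refl]) (simp only: act_scaleR[OF mw] M_def, simp)
      finally show ?thesis by (simp only: tensor_ip_scale) simp
    qed
    then show ?thesis by (simp add: sum_negf)
  qed
  finally have "Re (tensor_ip b k (\<lambda>vs. \<Sum>e\<in>Basis. cov_deriv g (nabla w) x e (dual b e # vs)) (w x))
    = (\<Sum>a<m. lam a * Re (tensor_ip b k (M a) (M a)))" by simp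
  then show ?thesis using bochner_inequality[OF w x max] by (simp add: M_def)
qed

end

subsection \<open>Forms of type (n - 1, 1)\<close>

text \<open>Covectors of type (k, 0): alternating and complex linear in each slot. Values on lists
  of other lengths are left free, so that combinations of such covectors need no bookkeeping
  there.\<close>

definition cform :: "nat \<Rightarrow> ((complex ^ 'n) list \<Rightarrow> complex) \<Rightarrow> bool" where
  "cform k G \<longleftrightarrow> multilinear k G \<and>
     (\<forall>vs i v. length vs = k \<and> i < k \<longrightarrow> G (vs[i := J v]) = \<i> * G (vs[i := v])) \<and>
     (\<forall>vs i j. length vs = k \<and> i < k \<and> j < k \<and> i \<noteq> j \<and> vs ! i = vs ! j \<longrightarrow> G vs = 0)"

lemma cformD:
  assumes "cform k G" "length vs = k" "i < k"
  shows "linear (\<lambda>v. G (vs[i := v]))" "G (vs[i := J v]) = \<i> * G (vs[i := v])"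
    "j < k \<Longrightarrow> i \<noteq> j \<Longrightarrow> vs ! i = vs ! j \<Longrightarrow> G vs = 0"
  using assms multilinearD unfolding cform_def by blast+

lemma scale_of_J:
  fixes f :: "complex ^ 'n \<Rightarrow> complex"
  assumes "linear f"
  shows "(\<And>v. f (J v) = \<i> * f v) \<Longrightarrow> f (c *s v) = c * f v" "(\<And>v. f (J v) = - \<i> * f v) \<Longrightarrow> f (c *s v) = cnj c * f v"
  unfolding smult_decompose linear_add[OF assms] linear_cmul[OF assms]
  by (simp_all add: complex_eq_iff)

lemma cform_scale: "cform k G \<Longrightarrow> length vs = k \<Longrightarrow> i < k \<Longrightarrow> G (vs[i := c *s v]) = c * G (vs[i := v])"
  using scale_of_J(1)[OF cformD(1), of k G vs i c v] cformD(2) by blast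

lemma cform_sum:
  assumes "cform k G" "length vs = k" "i < k"
  shows "G (vs[i := (\<Sum>j\<in>I. c j *s f j)]) = (\<Sum>j\<in>I. c j * G (vs[i := f j]))"
  by (simp only: linear_sum[OF cformD(1)[OF assms]] cform_scale[OF assms])

lemma cform_alternating:
  assumes "cform k G"
  shows "alternating k (\<lambda>vs. if length vs = k then G vs else 0)"
  unfolding alternating_def
proof (intro conjI allI impI)
  fix vs :: "(complex ^ 'a) list" and i
  show "length vs = k \<and> i < k \<Longrightarrow> linear (\<lambda>v. if length (vs[i := v]) = k then G (vs[i := v]) else 0)"
    using cformD(1)[OF assms, of vs i] by simp
  show "length vs = k \<and> i < j \<and> j < k \<and> vs ! i = vs ! j \<Longrightarrow> (if length vs = k then G vs else 0) = 0" for j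
    using cformD(3)[OF assms, of vs i j] by simp
qed simp

lemma cform_swap:
  assumes "cform k G" "length vs = k" "i < k" "j < k" "i \<noteq> j"
  shows "G (vs[i := a, j := c]) = - G (vs[i := c, j := a])"
  using alternating_swap[OF cform_alternating[OF assms(1)] assms(2-5), of a c] assms(2) by simp

lemma cform_diff_scale:
  assumes "cform k G" "cform k D"
  shows "cform k (\<lambda>vs. G vs - c * D vs)"
  unfolding cform_def multilinear_def
proof (intro conjI allI impI)
  fix vs :: "(complex ^ 'a) list" and i assume "length vs = k \<and> i < k"
  then have vs: "length vs = k" "i < k" by auto
  have "linear (\<lambda>z. c * z)" by (rule linearI) (simp_all add: algebra_simps)
  from linear_compose[OF cformD(1)[OF assms(2) vs] this]
  show "linear (\<lambda>v. G (vs[i := v]) - c * D (vs[i := v]))"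
    by (intro linear_compose_sub cformD(1)[OF assms(1) vs]) (simp add: o_def)
  show "G (vs[i := J v]) - c * D (vs[i := J v]) = \<i> * (G (vs[i := v]) - c * D (vs[i := v]))" for v
    using cformD(2)[OF assms(1) vs] cformD(2)[OF assms(2) vs] by (simp add: algebra_simps)
next
  fix vs :: "(complex ^ 'a) list" and i j
  assume "length vs = k \<and> i < k \<and> j < k \<and> i \<noteq> j \<and> vs ! i = vs ! j"
  then show "G vs - c * D vs = 0"
    using cformD(3)[OF assms(1), of vs i j] cformD(3)[OF assms(2), of vs i j] by simp
qed

text \<open>A repeated index gives zero; otherwise the indices form a permutation, which is reached
  from the identity by transpositions that change only the sign.\<close>

lemma cform_zero_on_frame:
  assumes G: "cform n G" and z: "G (map f [0..<n]) = 0" and p: "\<And>i. i < n \<Longrightarrow> p i < n"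
  shows "G (map (\<lambda>i. f (p i)) [0..<n]) = 0"
proof (cases "inj_on p {..<n}")
  case False
  then obtain i j where "i < n" "j < n" "i \<noteq> j" "p i = p j" by (auto simp: inj_on_def)
  then show ?thesis using cformD(3)[OF G, of "map (\<lambda>i. f (p i)) [0..<n]" i j] by simp
next
  case True
  define q where "q i = (if i < n then p i else i)" for i
  have "p ` {..<n} = {..<n}"
    using True p by (intro card_subset_eq) (auto simp: card_image)
  then have "bij_betw p {..<n} {..<n}" using True by (simp add: bij_betw_def)
  then have "bij_betw q {..<n} {..<n}" by (rule bij_betw_cong[THEN iffD1, rotated]) (simp add: q_def)
  then have "q permutes {..<n}" by (rule bij_imp_permutes) (simp add: q_def)
  with finite_lessThan have "G (map (\<lambda>i. f (q i)) [0..<n]) = 0"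
  proof (induction rule: permutes_rev_induct)
    case id
    then show ?case using z by simp
  next
    case (swap a b r)
    let ?vs = "map (\<lambda>i. f (r i)) [0..<n]"
    have "map (\<lambda>i. f ((r \<circ> Transposition.transpose a b) i)) [0..<n] = ?vs[a := f (r b), b := f (r a)]"
      using swap(1,2) by (intro nth_equalityI) (auto simp: nth_list_update Transposition.transpose_def)
    moreover have "?vs[a := f (r a), b := f (r b)] = ?vs"
      using swap(1,2) by (intro nth_equalityI) (auto simp: nth_list_update)
    ultimately show ?case
      using cform_swap[OF G, of ?vs a b "f (r b)" "f (r a)"] swap by simp
  qed
  moreover have "map (\<lambda>i. f (q i)) [0..<n] = map (\<lambda>i. f (p i)) [0..<n]" by (simp add: q_def)
  ultimately show ?thesis by simp
qed

text \<open>Covectors of type (n, 0) form a line. Comparing the values on one frame is therefore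
  enough to identify them (\<open>cform_unique\<close>).\<close>

lemma cform_zero:
  assumes G: "cform n G" and z: "G (map f [0..<n]) = 0" and f: "\<And>v. \<exists>c. v = (\<Sum>i<n. c i *s f i)"
    and vs: "length vs = n"
  shows "G vs = 0"
proof -
  \<comment> \<open>Slots below \<open>k\<close> are arbitrary and the others hold frame vectors;
    each step of the induction expands one more slot in the frame.\<close>
  have "\<forall>vs. length vs = n \<and> (\<forall>i. k \<le> i \<and> i < n \<longrightarrow> vs ! i \<in> f ` {..<n}) \<longrightarrow> G vs = 0" if "k \<le> n" for k
    using that
  proof (induction k)
    case 0
    show ?case
    proof (intro allI impI)
      fix vs assume a: "length vs = n \<and> (\<forall>i. 0 \<le> i \<and> i < n \<longrightarrow> vs ! i \<in> f ` {..<n})"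
      then have "\<forall>i\<in>{..<n}. \<exists>j. j < n \<and> vs ! i = f j" by auto
      then obtain p where p: "\<forall>i\<in>{..<n}. p i < n \<and> vs ! i = f (p i)" by metis
      then have "vs = map (\<lambda>i. f (p i)) [0..<n]" using a by (intro nth_equalityI) auto
      then show "G vs = 0" using cform_zero_on_frame[OF G z, of p] p by simp
    qed
  next
    case (Suc k)
    show ?case
    proof (intro allI impI)
      fix vs assume a: "length vs = n \<and> (\<forall>i. Suc k \<le> i \<and> i < n \<longrightarrow> vs ! i \<in> f ` {..<n})"
      have k: "k < n" using Suc.prems by simp
      obtain c where c: "vs ! k = (\<Sum>i<n. c i *s f i)" using f by blast
      have "G vs = G (vs[k := (\<Sum>i<n. c i *s f i)])" using c by (metis list_update_id)
      also have "\<dots> = (\<Sum>i<n. c i * G (vs[k := f i]))" using a k by (intro cform_sum[OF G]) auto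
      also have "\<dots> = 0"
      proof (rule sum.neutral, intro ballI)
        fix i assume "i \<in> {..<n}"
        then have "G (vs[k := f i]) = 0" using Suc.IH k a by (auto simp: nth_list_update)
        then show "c i * G (vs[k := f i]) = 0" by simp
      qed
      finally show "G vs = 0" .
    qed
  qed
  from this[of n] vs show ?thesis by auto
qed

lemma cform_unique:
  assumes G: "cform n G" and D: "cform n D" "D (map f [0..<n]) \<noteq> 0" and f: "\<And>v. \<exists>c. v = (\<Sum>i<n. c i *s f i)"
    and vs: "length vs = n"
  shows "G vs = G (map f [0..<n]) / D (map f [0..<n]) * D vs"
proof -
  have "G vs - G (map f [0..<n]) / D (map f [0..<n]) * D vs = 0"
    by (rule cform_zero[OF cform_diff_scale[OF G D(1)] _ f vs]) (simp add: D(2))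
  then show ?thesis by simp
qed

section \<open>Complex coordinates and the volume form of a unitary frame\<close>

definition frame_coord :: "(complex ^ 'n \<Rightarrow> complex ^ 'n \<Rightarrow> real) \<Rightarrow> complex ^ 'n \<Rightarrow> complex ^ 'n \<Rightarrow> complex" where
  "frame_coord b e v = Complex (b v e) (b v (J e))"

lemma frame_coord_expand:
  assumes "unitary_frame b n e"
  shows "v = (\<Sum>i<n. frame_coord b (e i) v *s e i)"
  using assms unfolding unitary_frame_def frame_coord_def smult_decompose by auto

lemma frame_coord_linear:
  fixes b :: "complex ^ 'n::finite \<Rightarrow> complex ^ 'n \<Rightarrow> real"
  assumes b: "inner_product b" and bJ: "\<And>u v. b (J u) (J v) = b u v"
  shows "linear (frame_coord b e)" "frame_coord b e (J v) = \<i> * frame_coord b e v"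
proof -
  note bl = inner_productD[OF b]
  show "linear (frame_coord b e)"
    by (rule linearI) (simp_all add: frame_coord_def linear_add[OF bl(2)] linear_cmul[OF bl(2)] complex_eq_iff)
  have "b (J v) e = - b v (J e)" using bJ[of v "J e"] by (simp add: linear_neg[OF bl(1)])
  then show "frame_coord b e (J v) = \<i> * frame_coord b e v"
    by (simp add: frame_coord_def complex_eq_iff bJ)
qed

lemma prod_slot:
  fixes as :: "('v \<Rightarrow> complex) list"
  assumes "\<sigma> permutes {..<n}" "length vs = n" "l < n"
  shows "(\<Prod>a<n. (as ! a) (vs[l := v] ! \<sigma> a)) =
    (as ! inv \<sigma> l) v * (\<Prod>a\<in>{..<n} - {inv \<sigma> l}. (as ! a) (vs ! \<sigma> a))"
proof -
  have m: "inv \<sigma> l \<in> {..<n}" using assms permutes_in_image[OF permutes_inv[OF assms(1)]] by simp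
  have s: "\<sigma> (inv \<sigma> l) = l" using permutes_inverses(1)[OF assms(1)] .
  have ne: "l \<noteq> \<sigma> a" if "a \<noteq> inv \<sigma> l" for a using that permutes_inverses(2)[OF assms(1)] by metis
  have "(\<Prod>a<n. (as ! a) (vs[l := v] ! \<sigma> a)) =
    (as ! inv \<sigma> l) (vs[l := v] ! \<sigma> (inv \<sigma> l)) * (\<Prod>a\<in>{..<n} - {inv \<sigma> l}. (as ! a) (vs[l := v] ! \<sigma> a))"
    by (rule prod.remove[OF _ m]) simp
  moreover have "(\<Prod>a\<in>{..<n} - {inv \<sigma> l}. (as ! a) (vs[l := v] ! \<sigma> a)) = (\<Prod>a\<in>{..<n} - {inv \<sigma> l}. (as ! a) (vs ! \<sigma> a))"
    by (rule prod.cong) (use ne in auto)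
  ultimately show ?thesis using s assms by simp
qed

lemma prod_slot_scale:
  fixes as :: "('v \<Rightarrow> complex) list"
  assumes "\<sigma> permutes {..<n}" "length vs = n" "l < n" "(as ! inv \<sigma> l) v = c * (as ! inv \<sigma> l) (vs ! l)"
  shows "(\<Prod>a<n. (as ! a) (vs[l := v] ! \<sigma> a)) = c * (\<Prod>a<n. (as ! a) (vs ! \<sigma> a))"
  using prod_slot[OF assms(1-3), of as v] prod_slot[OF assms(1-3), of as "vs ! l"] assms(4) by simp

lemma wedge_covectors_multilinear:
  fixes as :: "('v::real_vector \<Rightarrow> complex) list"
  assumes "\<And>a. a < length as \<Longrightarrow> linear (as ! a)"
  shows "multilinear (length as) (wedge_covectors as)"
  unfolding multilinear_def
proof (intro allI impI)
  fix vs :: "'v list" and i assume vs: "length vs = length as \<and> i < length as"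
  have l: "linear (\<lambda>v. of_int (sign \<sigma>) * (\<Prod>a<length as. (as ! a) (vs[i := v] ! \<sigma> a)))"
    if s: "\<sigma> permutes {..<length as}" for \<sigma>
  proof -
    have "inv \<sigma> i < length as" using vs permutes_in_image[OF permutes_inv[OF s]] by simp
    then have la: "linear (as ! inv \<sigma> i)" by (rule assms)
    show ?thesis
      using vs by (intro linearI) (simp_all add: prod_slot[OF s] linear_add[OF la] linear_cmul[OF la] algebra_simps)
  qed
  have "linear (\<lambda>v. \<Sum>\<sigma> | \<sigma> permutes {..<length as}. of_int (sign \<sigma>) * (\<Prod>a<length as. (as ! a) (vs[i := v] ! \<sigma> a)))"
    by (rule linear_compose_sum) (use l in auto)
  then show "linear (\<lambda>v. wedge_covectors as (vs[i := v]))"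
    using vs by (simp add: wedge_covectors_def)
qed

lemma wedge_covectors_repeat:
  assumes vs: "length vs = length as" and ij: "i < length as" "j < length as" "i \<noteq> j" "vs ! i = vs ! j"
  shows "wedge_covectors as vs = 0"
proof -
  let ?n = "length as" and ?t = "Transposition.transpose i j"
  let ?f = "\<lambda>\<sigma>. of_int (sign \<sigma>) * (\<Prod>a<?n. (as ! a) (vs ! \<sigma> a)) :: complex"
  have tp: "?t permutes {..<?n}" using ij by (intro permutes_swap_id) auto
  have tt: "?t \<circ> (?t \<circ> \<sigma>) = \<sigma>" for \<sigma> :: "nat \<Rightarrow> nat" by (simp add: fun_eq_iff)
  have f: "?f (?t \<circ> \<sigma>) = - ?f \<sigma>" if s: "\<sigma> permutes {..<?n}" for \<sigma>
  proof -
    have "permutation \<sigma>" using s permutation_permutes by blast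
    then have "sign (?t \<circ> \<sigma>) = - sign \<sigma>"
      using ij by (simp add: sign_compose permutation_swap_id sign_swap_id)
    moreover have "vs ! ((?t \<circ> \<sigma>) a) = vs ! \<sigma> a" for a
      using ij by (auto simp: Transposition.transpose_def)
    ultimately show ?thesis by simp
  qed
  have "(\<Sum>\<sigma> | \<sigma> permutes {..<?n}. ?f \<sigma>) = (\<Sum>\<sigma> | \<sigma> permutes {..<?n}. ?f (?t \<circ> \<sigma>))"
    by (rule sum.reindex_bij_witness[of _ "\<lambda>\<sigma>. ?t \<circ> \<sigma>" "\<lambda>\<sigma>. ?t \<circ> \<sigma>"])
      (use tp in \<open>simp_all only: tt mem_Collect_eq permutes_compose\<close>)
  also have "\<dots> = (\<Sum>\<sigma> | \<sigma> permutes {..<?n}. - ?f \<sigma>)" by (rule sum.cong) (use f in auto)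
  finally have "(\<Sum>\<sigma> | \<sigma> permutes {..<?n}. ?f \<sigma>) = - (\<Sum>\<sigma> | \<sigma> permutes {..<?n}. ?f \<sigma>)"
    by (simp add: sum_negf)
  then show ?thesis using vs by (simp add: wedge_covectors_def eq_neg_iff_add_eq_0 flip: mult_2)
qed

text \<open>The wedge of the coordinate functions of the frame, that is, the determinant of the
  coordinates.\<close>

lemma volume_form_exists:
  fixes b :: "complex ^ 'n::finite \<Rightarrow> complex ^ 'n \<Rightarrow> real"
  assumes b: "inner_product b" and bJ: "\<And>u v. b (J u) (J v) = b u v" and e: "unitary_frame b n e"
  obtains D where "cform n D" "D (map e [0..<n]) = 1"
proof -
  define as where "as = map (\<lambda>i. frame_coord b (e i)) [0..<n]"
  have as: "length as = n" "a < n \<Longrightarrow> as ! a = frame_coord b (e a)" for a by (auto simp: as_def)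
  note fc = frame_coord_linear[OF b bJ]
  have "cform n (wedge_covectors as)"
    unfolding cform_def
  proof (intro conjI allI impI)
    show "multilinear n (wedge_covectors as)"
      using wedge_covectors_multilinear[of as] as fc by simp
    fix vs :: "(complex ^ 'n) list" and i v assume vs: "length vs = n \<and> i < n"
    have "(\<Prod>a<n. (as ! a) (vs[i := J v] ! \<sigma> a)) = \<i> * (\<Prod>a<n. (as ! a) (vs[i := v] ! \<sigma> a))"
      if s: "\<sigma> permutes {..<n}" for \<sigma>
    proof -
      have "inv \<sigma> i < n" using vs permutes_in_image[OF permutes_inv[OF s]] by simp
      then show ?thesis
        using prod_slot_scale[OF s, of "vs[i := v]" i as "J v" \<i>] vs as fc by simp
    qed
    then show "wedge_covectors as (vs[i := J v]) = \<i> * wedge_covectors as (vs[i := v])"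
      using vs as by (simp add: wedge_covectors_def sum_distrib_left mult_ac)
  next
    fix vs :: "(complex ^ 'n) list" and i j
    assume "length vs = n \<and> i < n \<and> j < n \<and> i \<noteq> j \<and> vs ! i = vs ! j"
    then show "wedge_covectors as vs = 0" using as(1) wedge_covectors_repeat[of vs as i j] by simp
  qed
  moreover have "wedge_covectors as (map e [0..<n]) = 1"
  proof -
    have p: "(\<Prod>a<n. (as ! a) (map e [0..<n] ! \<sigma> a)) = (if \<sigma> = id then 1 else 0)" if s: "\<sigma> permutes {..<n}" for \<sigma>
    proof (cases "\<sigma> = id")
      case True
      then show ?thesis using as e by (simp add: frame_coord_def unitary_frame_def complex_eq_iff)
    next
      case False
      then obtain a where a: "\<sigma> a \<noteq> a" by (auto simp: fun_eq_iff)
      then have an: "a < n" using s unfolding permutes_def by (metis lessThan_iff)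
      then have sn: "\<sigma> a < n" using permutes_in_image[OF s, of a] by simp
      have "(as ! a) (map e [0..<n] ! \<sigma> a) = 0"
        using as(2)[OF an] an sn a e by (simp add: frame_coord_def unitary_frame_def complex_eq_iff)
      then show ?thesis using False an by (simp add: prod_zero[of "{..<n}"] bexI[of _ a])
    qed
    have "wedge_covectors as (map e [0..<n]) = (\<Sum>\<sigma> | \<sigma> permutes {..<n}. of_int (sign \<sigma>) * (if \<sigma> = id then 1 else 0))"
      using as p by (simp add: wedge_covectors_def)
    also have "\<dots> = (\<Sum>\<sigma> | \<sigma> permutes {..<n}. if \<sigma> = id then 1 else 0)"
      by (rule sum.cong) (auto simp: sign_id)
    also have "\<dots> = 1" by (simp add: finite_permutations permutes_id)
    finally show ?thesis .
  qed
  ultimately show ?thesis by (rule that)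
qed

section \<open>Decomposition of (n - 1, 1)-covectors by their antilinear slot\<close>

lemma type_1_0_linear:
  fixes \<alpha> :: "complex ^ 'n::finite \<Rightarrow> complex"
  assumes "type_1_0 \<alpha>"
  shows "linear \<alpha>" "\<alpha> (J v) = \<i> * \<alpha> v"
proof -
  have s: "r *\<^sub>R v = complex_of_real r *s v" for r and v :: "complex ^ 'n"
    by (simp add: vec_eq_iff scaleR_conv_of_real[where 'a = complex])
  show "linear \<alpha>"
    using assms by (intro linearI) (simp_all add: type_1_0_def s scaleR_conv_of_real)
  show "\<alpha> (J v) = \<i> * \<alpha> v" using assms by (simp add: type_1_0_def J_def)
qed

lemma type_0_1_linear:
  fixes \<alpha> :: "complex ^ 'n::finite \<Rightarrow> complex"
  assumes "type_0_1 \<alpha>"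
  shows "linear \<alpha>" "\<alpha> (J v) = - \<i> * \<alpha> v"
proof -
  have s: "r *\<^sub>R v = complex_of_real r *s v" for r and v :: "complex ^ 'n"
    by (simp add: vec_eq_iff scaleR_conv_of_real[where 'a = complex])
  show "linear \<alpha>"
    using assms by (intro linearI) (simp_all add: type_0_1_def s scaleR_conv_of_real)
  show "\<alpha> (J v) = - \<i> * \<alpha> v" using assms by (simp add: type_0_1_def J_def)
qed

text \<open>The \<open>(n - 1, 1)\<close>-forms are those on which \<open>J\<close> acts as \<open>(n - 2) \<i>\<close> and which have no
  component that is antilinear in two slots.\<close>

definition type_n1_1 :: "nat \<Rightarrow> ((complex ^ 'n) list \<Rightarrow> complex) \<Rightarrow> bool" where
  "type_n1_1 n w \<longleftrightarrow> (\<forall>vs. length vs = n \<longrightarrow> act n J w vs = (of_nat n - 2) * \<i> * w vs \<and>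
     (\<forall>i<n. \<forall>j<n. i \<noteq> j \<longrightarrow> w vs + \<i> * w (vs[i := J (vs ! i)]) + \<i> * w (vs[j := J (vs ! j)])
        - w (vs[i := J (vs ! i), j := J (vs ! j)]) = 0))"

text \<open>In each term of the wedge product a slot is fed to one factor, so \<open>J\<close> in
  that slot acts by the eigenvalue of the factor. It is -\<i> once and \<i> otherwise; the sum of
  all eigenvalues is (n - 2) \<i>.\<close>

lemma wedge_type_n1_1:
  fixes \<alpha>s :: "(complex ^ 'n::finite \<Rightarrow> complex) list"
  assumes \<alpha>: "length \<alpha>s = n - 1" "n > 0" "\<forall>\<alpha>\<in>set \<alpha>s. type_1_0 \<alpha>" and \<beta>: "type_0_1 \<beta>"
  shows "type_n1_1 n (wedge_covectors (\<alpha>s @ [\<beta>]))"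
proof -
  define as where "as = \<alpha>s @ [\<beta>]"
  define \<epsilon> where "\<epsilon> a = (if a = n - 1 then - \<i> else \<i>)" for a :: nat
  have len: "length as = n" using \<alpha> by (simp add: as_def)
  have as: "(as ! a) (J v) = \<epsilon> a * (as ! a) v" if "a < n" for a v
  proof (cases "a = n - 1")
    case True
    then have "as ! a = \<beta>" using \<alpha> by (simp add: as_def nth_append)
    then show ?thesis using type_0_1_linear(2)[OF \<beta>] True by (simp add: \<epsilon>_def)
  next
    case False
    then have l: "a < length \<alpha>s" using that \<alpha> by simp
    then have "as ! a = \<alpha>s ! a" "type_1_0 (\<alpha>s ! a)" using \<alpha>(3) by (simp_all add: as_def nth_append)
    then show ?thesis using type_1_0_linear(2)[of "\<alpha>s ! a" v] False by (simp add: \<epsilon>_def)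
  qed
  define p where "p \<sigma> vs = of_int (sign \<sigma>) * (\<Prod>a<n. (as ! a) (vs ! \<sigma> a))" for \<sigma> and vs :: "(complex ^ 'n) list"
  have W: "wedge_covectors as vs = (\<Sum>\<sigma> | \<sigma> permutes {..<n}. p \<sigma> vs)" if "length vs = n" for vs
    using that len by (simp add: wedge_covectors_def p_def)
  have pJ: "p \<sigma> (vs[j := J (vs ! j)]) = \<epsilon> (inv \<sigma> j) * p \<sigma> vs"
    if "\<sigma> permutes {..<n}" "length vs = n" "j < n" for \<sigma> vs j
  proof -
    have "inv \<sigma> j < n" using that permutes_in_image[OF permutes_inv[OF that(1)]] by simp
    then show ?thesis
      unfolding p_def using prod_slot_scale[OF that, of as "J (vs ! j)" "\<epsilon> (inv \<sigma> j)"] as by simp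
  qed
  show ?thesis
    unfolding type_n1_1_def as_def[symmetric]
  proof (intro allI impI conjI)
    fix vs :: "(complex ^ 'n) list" assume vs: "length vs = n"
    have e: "(\<Sum>j<n. \<epsilon> (inv \<sigma> j)) = (of_nat n - 2) * \<i>" if s: "\<sigma> permutes {..<n}" for \<sigma>
    proof -
      have "(\<Sum>j<n. \<epsilon> (inv \<sigma> j)) = (\<Sum>j<n. \<epsilon> j)"
        using sum.permute[OF permutes_inv[OF s], of \<epsilon>] by (simp add: o_def)
      also have "\<dots> = (\<Sum>j<n. \<i> + (if j = n - 1 then - 2 * \<i> else 0))"
        by (rule sum.cong) (auto simp: \<epsilon>_def)
      also have "\<dots> = (of_nat n - 2) * \<i>" using \<alpha>(2) by (simp add: sum.distrib algebra_simps)
      finally show ?thesis .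
    qed
    have "act n J (wedge_covectors as) vs = (\<Sum>j<n. \<Sum>\<sigma> | \<sigma> permutes {..<n}. \<epsilon> (inv \<sigma> j) * p \<sigma> vs)"
      unfolding act_def using vs pJ by (intro sum.cong refl) (simp add: W)
    also have "\<dots> = (\<Sum>\<sigma> | \<sigma> permutes {..<n}. (\<Sum>j<n. \<epsilon> (inv \<sigma> j)) * p \<sigma> vs)"
      unfolding sum_distrib_right by (rule sum.swap)
    also have "\<dots> = (\<Sum>\<sigma> | \<sigma> permutes {..<n}. (of_nat n - 2) * \<i> * p \<sigma> vs)"
      by (rule sum.cong) (simp_all add: e)
    also have "\<dots> = (of_nat n - 2) * \<i> * wedge_covectors as vs"
      by (simp only: W[OF vs] sum_distrib_left)
    finally show "act n J (wedge_covectors as) vs = (of_nat n - 2) * \<i> * wedge_covectors as vs" .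
    fix i j assume ij: "i < n" "j < n" "i \<noteq> j"
    have z: "p \<sigma> vs + \<i> * p \<sigma> (vs[i := J (vs ! i)]) + \<i> * p \<sigma> (vs[j := J (vs ! j)])
        - p \<sigma> (vs[i := J (vs ! i), j := J (vs ! j)]) = 0" if s: "\<sigma> permutes {..<n}" for \<sigma>
    proof -
      have "inv \<sigma> i \<noteq> inv \<sigma> j" using ij(3) permutes_inverses(1)[OF s] by metis
      \<comment> \<open>Two different slots meet two different factors. At least one of these is
        complex linear, with eigenvalue \<i>, and its bracket is zero.\<close>
      then have "(1 + \<i> * \<epsilon> (inv \<sigma> i)) * (1 + \<i> * \<epsilon> (inv \<sigma> j)) = 0" by (auto simp: \<epsilon>_def)
      moreover have "p \<sigma> (vs[i := J (vs ! i), j := J (vs ! j)]) = \<epsilon> (inv \<sigma> j) * (\<epsilon> (inv \<sigma> i) * p \<sigma> vs)"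
        using pJ[OF s, of "vs[i := J (vs ! i)]" j] pJ[OF s vs ij(1)] vs ij by simp
      moreover have "p \<sigma> vs + \<i> * (\<epsilon> (inv \<sigma> i) * p \<sigma> vs) + \<i> * (\<epsilon> (inv \<sigma> j) * p \<sigma> vs) - \<epsilon> (inv \<sigma> j) * (\<epsilon> (inv \<sigma> i) * p \<sigma> vs)
        = (1 + \<i> * \<epsilon> (inv \<sigma> i)) * (1 + \<i> * \<epsilon> (inv \<sigma> j)) * p \<sigma> vs"
        by (simp add: algebra_simps)
      ultimately show ?thesis using pJ[OF s vs ij(1)] pJ[OF s vs ij(2)] by simp
    qed
    show "wedge_covectors as vs + \<i> * wedge_covectors as (vs[i := J (vs ! i)]) + \<i> * wedge_covectors as (vs[j := J (vs ! j)])
        - wedge_covectors as (vs[i := J (vs ! i), j := J (vs ! j)]) = 0"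
      using vs z by (simp add: W sum_distrib_left flip: sum.distrib sum_subtractf)
  qed
qed

lemma act_lin:
  "act k A (\<lambda>vs. w vs + v vs) vs = act k A w vs + act k A v vs" "act k A (\<lambda>vs. c * w vs) vs = c * act k A w vs"
  by (simp_all add: act_def sum.distrib sum_distrib_left)

lemma pq_covectors_type:
  fixes w :: "(complex ^ 'n::finite) list \<Rightarrow> complex"
  assumes w: "w \<in> pq_covectors (n - 1) 1" and n: "n > 0"
  shows "type_n1_1 n w"
proof -
  interpret vector_space "covector_scale :: complex \<Rightarrow> ((complex ^ 'n) list \<Rightarrow> complex) \<Rightarrow> _"
    by (rule vector_space_covector_scale)
  have "type_n1_1 n w"
  proof (rule span_induct[OF w[unfolded pq_covectors_def]])
    show "subspace {w :: (complex ^ 'n) list \<Rightarrow> complex. type_n1_1 n w}"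
    proof (rule subspaceI)
      show "0 \<in> {w :: (complex ^ 'n) list \<Rightarrow> complex. type_n1_1 n w}"
        by (simp add: type_n1_1_def act_def)
    next
      fix w v :: "(complex ^ 'n) list \<Rightarrow> complex"
      assume a: "w \<in> {w. type_n1_1 n w}" "v \<in> {w. type_n1_1 n w}"
      show "w + v \<in> {w. type_n1_1 n w}"
        unfolding type_n1_1_def mem_Collect_eq plus_fun_def act_lin
      proof (intro allI impI conjI)
        fix vs :: "(complex ^ 'n) list" assume vs: "length vs = n"
        then show "act n J w vs + act n J v vs = (of_nat n - 2) * \<i> * (w vs + v vs)"
          using a by (simp add: type_n1_1_def distrib_left)
        fix i j assume ij: "i < n" "j < n" "i \<noteq> j"
        have z: "u vs + \<i> * u (vs[i := J (vs ! i)]) + \<i> * u (vs[j := J (vs ! j)])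
          - u (vs[i := J (vs ! i), j := J (vs ! j)]) = 0" if "u \<in> {w. type_n1_1 n w}" for u
          using that vs ij unfolding type_n1_1_def by blast
        have "w vs + v vs + \<i> * (w (vs[i := J (vs ! i)]) + v (vs[i := J (vs ! i)])) + \<i> * (w (vs[j := J (vs ! j)]) + v (vs[j := J (vs ! j)]))
          - (w (vs[i := J (vs ! i), j := J (vs ! j)]) + v (vs[i := J (vs ! i), j := J (vs ! j)]))
          = (w vs + \<i> * w (vs[i := J (vs ! i)]) + \<i> * w (vs[j := J (vs ! j)]) - w (vs[i := J (vs ! i), j := J (vs ! j)]))
          + (v vs + \<i> * v (vs[i := J (vs ! i)]) + \<i> * v (vs[j := J (vs ! j)]) - v (vs[i := J (vs ! i), j := J (vs ! j)]))"
          by (simp add: algebra_simps)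
        then show "w vs + v vs + \<i> * (w (vs[i := J (vs ! i)]) + v (vs[i := J (vs ! i)])) + \<i> * (w (vs[j := J (vs ! j)]) + v (vs[j := J (vs ! j)]))
          - (w (vs[i := J (vs ! i), j := J (vs ! j)]) + v (vs[i := J (vs ! i), j := J (vs ! j)])) = 0"
          unfolding z[OF a(1)] z[OF a(2)] by simp
      qed
    next
      fix c and w :: "(complex ^ 'n) list \<Rightarrow> complex"
      assume a: "w \<in> {w. type_n1_1 n w}"
      show "covector_scale c w \<in> {w. type_n1_1 n w}"
        unfolding type_n1_1_def mem_Collect_eq covector_scale_def act_lin
      proof (intro allI impI conjI)
        fix vs :: "(complex ^ 'n) list" assume vs: "length vs = n"
        then show "c * act n J w vs = (of_nat n - 2) * \<i> * (c * w vs)" using a by (simp add: type_n1_1_def)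
        fix i j assume "i < n" "j < n" "i \<noteq> j"
        then have z: "w vs + \<i> * w (vs[i := J (vs ! i)]) + \<i> * w (vs[j := J (vs ! j)])
          - w (vs[i := J (vs ! i), j := J (vs ! j)]) = 0" using a vs by (simp add: type_n1_1_def)
        have "c * w vs + \<i> * (c * w (vs[i := J (vs ! i)])) + \<i> * (c * w (vs[j := J (vs ! j)]))
          - c * w (vs[i := J (vs ! i), j := J (vs ! j)]) = c * (w vs + \<i> * w (vs[i := J (vs ! i)]) + \<i> * w (vs[j := J (vs ! j)])
          - w (vs[i := J (vs ! i), j := J (vs ! j)]))" by (simp add: algebra_simps)
        then show "c * w vs + \<i> * (c * w (vs[i := J (vs ! i)])) + \<i> * (c * w (vs[j := J (vs ! j)]))
          - c * w (vs[i := J (vs ! i), j := J (vs ! j)]) = 0" by (simp only: z mult_zero_right)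
      qed
    qed
    fix x :: "(complex ^ 'n) list \<Rightarrow> complex"
    assume "x \<in> {wedge_covectors (\<alpha>s @ \<beta>s) | \<alpha>s \<beta>s. length \<alpha>s = n - 1 \<and> length \<beta>s = 1 \<and>
        (\<forall>\<alpha>\<in>set \<alpha>s. type_1_0 \<alpha>) \<and> (\<forall>\<beta>\<in>set \<beta>s. type_0_1 \<beta>)}"
    then obtain \<alpha>s \<beta>s where x: "x = wedge_covectors (\<alpha>s @ \<beta>s)" "length \<alpha>s = n - 1" "length \<beta>s = 1"
      "\<forall>\<alpha>\<in>set \<alpha>s. type_1_0 \<alpha>" "\<forall>\<beta>\<in>set \<beta>s. type_0_1 \<beta>" by blast
    obtain \<beta> where "\<beta>s = [\<beta>]" using x(3) by (metis One_nat_def length_0_conv length_Suc_conv)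
    then show "type_n1_1 n x" using x wedge_type_n1_1[OF x(2) n x(4), of \<beta>] by simp
  qed
  then show ?thesis .
qed

text \<open>The part of \<open>w\<close> that is antilinear in the \<open>j\<close>-th slot\<close>

definition slot_part :: "nat \<Rightarrow> ((complex ^ 'n) list \<Rightarrow> complex) \<Rightarrow> (complex ^ 'n) list \<Rightarrow> complex" where
  "slot_part j w vs = (w vs + \<i> * w (vs[j := J (vs ! j)])) / 2"

text \<open>The eigenvalue of \<open>J\<close> counts the antilinear slots: the sum equals
  \<open>(n - (n - 2)) / 2\<close> times \<open>w\<close>.\<close>

lemma sum_slot_part:
  assumes "type_n1_1 n w" "length vs = n"
  shows "(\<Sum>j<n. slot_part j w vs) = w vs"
proof -
  have "(\<Sum>j<n. slot_part j w vs) = (of_nat n * w vs + \<i> * act n J w vs) / 2"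
    by (simp add: slot_part_def act_def sum.distrib sum_distrib_left flip: sum_divide_distrib)
  also have "act n J w vs = (of_nat n - 2) * \<i> * w vs" using assms by (simp add: type_n1_1_def)
  finally show ?thesis by (simp add: algebra_simps)
qed

lemma linear_complex_mult:
  fixes f :: "'a::real_vector \<Rightarrow> complex"
  assumes "linear f" shows "linear (\<lambda>v. c * f v)"
  by (rule linearI) (simp_all add: linear_add[OF assms] linear_cmul[OF assms] algebra_simps)

lemma slot_part_linear:
  assumes w: "alternating n w" and vs: "length vs = n" "i < n" and j: "j < n"
  shows "linear (\<lambda>v. slot_part j w (vs[i := v]))"
proof -
  note ml = alternating_multilinear[OF w]
  note m2 = multilinear_slot[OF ml linear_J j]
  have "linear (\<lambda>v. (1/2) * (w (vs[i := v]) + \<i> * w (vs[i := v, j := J (vs[i := v] ! j)])))"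
    by (intro linear_complex_mult linear_compose_add multilinearD[OF ml vs] multilinearD[OF m2 vs])
  then show ?thesis by (simp add: slot_part_def)
qed

text \<open>\<open>slot_part j w\<close> is antilinear in slot \<open>j\<close> by construction.
  Linearity in every other slot is the second condition of \<open>type_n1_1\<close>, which excludes
  two antilinear slots.\<close>

lemma slot_part_J:
  fixes w :: "(complex ^ 'n) list \<Rightarrow> complex"
  assumes w: "alternating n w" "type_n1_1 n w" and vs: "length vs = n" "i < n" and j: "j < n"
  shows "slot_part j w (vs[i := J v]) = (if i = j then - \<i> else \<i>) * slot_part j w (vs[i := v])"
proof (cases "i = j")
  case True
  have "w (vs[i := - v]) = - w (vs[i := v])"
    using linear_neg[OF multilinearD[OF alternating_multilinear[OF w(1)] vs]] .
  then show ?thesis using True vs by (simp add: slot_part_def algebra_simps)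
next
  case False
  let ?u = "vs[i := v]"
  have "w ?u + \<i> * w (?u[i := J (?u ! i)]) + \<i> * w (?u[j := J (?u ! j)]) - w (?u[i := J (?u ! i), j := J (?u ! j)]) = 0"
    using w(2) vs j False unfolding type_n1_1_def by (metis length_list_update)
  then have z: "w (vs[i := v]) + \<i> * w (vs[i := J v]) + \<i> * w (vs[i := v, j := J (vs ! j)]) - w (vs[i := J v, j := J (vs ! j)]) = 0"
    using vs False by simp
  have "\<i> * (w (vs[i := v]) + \<i> * w (vs[i := J v]) + \<i> * w (vs[i := v, j := J (vs ! j)]) - w (vs[i := J v, j := J (vs ! j)]))
     = 2 * (\<i> * slot_part j w (vs[i := v]) - slot_part j w (vs[i := J v]))"
    using vs False by (simp add: slot_part_def algebra_simps)
  then have "\<i> * slot_part j w (vs[i := v]) - slot_part j w (vs[i := J v]) = 0" unfolding z by simp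
  then show ?thesis using False by simp
qed

lemma slot_part_swap:
  assumes w: "alternating n w" and vs: "length vs = n" "i < n" "j < n" "i \<noteq> j"
  shows "slot_part i w (vs[i := a, j := c]) = - slot_part j w (vs[i := c, j := a])"
proof -
  have "w (vs[i := a, j := c]) = - w (vs[i := c, j := a])" "w (vs[i := J a, j := c]) = - w (vs[i := c, j := J a])"
    by (rule alternating_swap[OF w vs])+
  moreover have "vs[i := a, j := c, i := J a] = vs[i := J a, j := c]"
    using vs by (intro nth_equalityI) (auto simp: nth_list_update)
  ultimately show ?thesis using vs by (simp add: slot_part_def field_simps)
qed

lemma slot_part_repeat:
  assumes w: "alternating n w" and vs: "length vs = n" "a < n" "c < n" "a \<noteq> c" "vs ! a = vs ! c" and l: "l < n" "l \<noteq> a" "l \<noteq> c"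
  shows "slot_part l w (vs[l := y]) = 0"
proof -
  have "w (vs[l := y]) = 0" "w (vs[l := J y]) = 0"
    by (rule alternating_repeat[OF w _ vs(2,3,4)]; use vs l in simp)+
  then show ?thesis using vs l by (simp add: slot_part_def)
qed

text \<open>Inserting a fixed \<open>y\<close> into the antilinear slot leaves a covector of type (n
  - 1, 0); the sum is its wedge product with \<open>\<gamma>\<close>, hence of type (n, 0) and a
  multiple of any volume form.\<close>

lemma slot_part_top_form:
  fixes w :: "(complex ^ 'n) list \<Rightarrow> complex"
  assumes w: "alternating n w" "type_n1_1 n w" and \<gamma>: "linear \<gamma>" "\<And>v. \<gamma> (J v) = \<i> * \<gamma> v"
  shows "cform n (\<lambda>vs. \<Sum>l<n. \<gamma> (vs ! l) * slot_part l w (vs[l := y]))"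
  unfolding cform_def multilinear_def
proof (intro conjI allI impI)
  fix vs :: "(complex ^ 'n) list" and i assume "length vs = n \<and> i < n"
  then have vs: "length vs = n" "i < n" by auto
  have l: "linear (\<lambda>v. \<gamma> (vs[i := v] ! l) * slot_part l w (vs[i := v, l := y]))" if "l < n" for l
  proof (cases "l = i")
    case True
    have "linear (\<lambda>v. slot_part l w (vs[l := y]) * \<gamma> v)" by (rule linear_complex_mult[OF \<gamma>(1)])
    then show ?thesis using True vs by (simp add: mult.commute)
  next
    case False
    have "linear (\<lambda>v. \<gamma> (vs ! l) * slot_part l w (vs[l := y, i := v]))"
      by (rule linear_complex_mult[OF slot_part_linear[OF w(1)]]) (use vs that in auto)
    moreover have "vs[i := v, l := y] = vs[l := y, i := v]" for v using False by (rule list_update_swap[symmetric])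
    ultimately show ?thesis using False vs by simp
  qed
  show "linear (\<lambda>v. \<Sum>l<n. \<gamma> (vs[i := v] ! l) * slot_part l w (vs[i := v, l := y]))"
    by (rule linear_compose_sum) (use l in auto)
  show "(\<Sum>l<n. \<gamma> (vs[i := J v] ! l) * slot_part l w (vs[i := J v, l := y]))
    = \<i> * (\<Sum>l<n. \<gamma> (vs[i := v] ! l) * slot_part l w (vs[i := v, l := y]))" for v
    unfolding sum_distrib_left
  proof (rule sum.cong[OF refl])
    fix l assume "l \<in> {..<n}"
    then have ln: "l < n" by simp
    show "\<gamma> (vs[i := J v] ! l) * slot_part l w (vs[i := J v, l := y])
      = \<i> * (\<gamma> (vs[i := v] ! l) * slot_part l w (vs[i := v, l := y]))"
    proof (cases "l = i")
      case True
      then show ?thesis using vs by (simp add: \<gamma>(2))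
    next
      case False
      have "slot_part l w (vs[l := y, i := J v]) = \<i> * slot_part l w (vs[l := y, i := v])"
        using slot_part_J[OF w, of "vs[l := y]" i l v] vs ln False by simp
      moreover have "vs[i := v, l := y] = vs[l := y, i := v]" for v using False by (rule list_update_swap[symmetric])
      ultimately show ?thesis using False vs by simp
    qed
  qed
next
  fix vs :: "(complex ^ 'n) list" and a c
  assume "length vs = n \<and> a < n \<and> c < n \<and> a \<noteq> c \<and> vs ! a = vs ! c"
  then have vs: "length vs = n" "a < n" "c < n" "a \<noteq> c" "vs ! a = vs ! c" by auto
  let ?h = "\<lambda>l. \<gamma> (vs ! l) * slot_part l w (vs[l := y])"
  have z: "?h l = 0" if "l < n" "l \<noteq> a" "l \<noteq> c" for l
    using slot_part_repeat[OF w(1) vs that] by simp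
  have "vs[a := y] = vs[a := y, c := vs ! a]" "vs[c := y] = vs[a := vs ! a, c := y]"
    using vs by (metis list_update_id list_update_swap, metis list_update_id)
  then have "slot_part a w (vs[a := y]) = - slot_part c w (vs[c := y])"
    using slot_part_swap[OF w(1) vs(1-4), of y "vs ! a"] by metis
  then have "?h a + ?h c = 0" using vs(5) by simp
  moreover have "(\<Sum>l<n. ?h l) = (\<Sum>l\<in>{a, c}. ?h l)"
    by (rule sum.mono_neutral_right) (use vs z in auto)
  ultimately show "(\<Sum>l<n. ?h l) = 0" using vs(4) by simp
qed

text \<open>Covectors of type (n - 1, 0) are contractions of a volume form with vectors. A covector
  of type (n - 1, 1) therefore amounts to a vector depending antilinearly on the argument of its (0,
  1)-slot, and that dependence is \<open>H\<close>.\<close>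

theorem antilinear_representation:
  fixes w :: "(complex ^ 'n::finite) list \<Rightarrow> complex"
  assumes b: "inner_product b" and bJ: "\<And>u v. b (J u) (J v) = b u v" and e: "unitary_frame b n e"
    and w: "alternating n w" "type_n1_1 n w" and D: "cform n D" "D (map e [0..<n]) \<noteq> 0"
  obtains H where "linear H" "\<And>v. H (J v) = - J (H v)" "\<And>vs. length vs = n \<Longrightarrow> w vs = act n H D vs"
proof -
  define fl where "fl = map e [0..<n]"
  have fl: "length fl = n" "i < n \<Longrightarrow> fl ! i = e i" for i by (auto simp: fl_def)
  define \<gamma> where "\<gamma> i = frame_coord b (e i)" for i
  have \<gamma>: "linear (\<gamma> i)" "\<gamma> i (J v) = \<i> * \<gamma> i v" for i v
    unfolding \<gamma>_def by (rule frame_coord_linear[OF b bJ])+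
  have \<gamma>e: "\<gamma> i (e l) = (if i = l then 1 else 0)" if "i < n" "l < n" for i l
    using e that by (simp add: \<gamma>_def frame_coord_def unitary_frame_def complex_eq_iff)
  have ex: "v = (\<Sum>i<n. \<gamma> i v *s e i)" for v unfolding \<gamma>_def by (rule frame_coord_expand[OF e])
  have span: "\<exists>c. v = (\<Sum>i<n. c i *s e i)" for v by (rule exI[of _ "\<lambda>i. \<gamma> i v"]) (rule ex)
  define G where "G i y vs = (\<Sum>l<n. \<gamma> i (vs ! l) * slot_part l w (vs[l := y]))" for i y vs
  have cG: "cform n (G i y)" for i y
    unfolding G_def[abs_def] by (rule slot_part_top_form[OF w \<gamma>])
  have Gfl: "G i y fl = slot_part i w (fl[i := y])" if "i < n" for i y
  proof -
    have "G i y fl = (\<Sum>l<n. if l = i then slot_part i w (fl[i := y]) else 0)"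
      unfolding G_def using that by (intro sum.cong refl) (auto simp: fl \<gamma>e)
    then show ?thesis using that by simp
  qed
  \<comment> \<open>The coordinates of \<open>H y\<close> are the ratios to \<open>D\<close> of the
    volume forms \<open>G i y\<close>, read off on the frame.\<close>
  define H where "H y = (\<Sum>i<n. (slot_part i w (fl[i := y]) / D fl) *s e i)" for y
  have GD: "G i y vs = slot_part i w (fl[i := y]) / D fl * D vs" if "i < n" "length vs = n" for i y vs
    using cform_unique[OF cG D span that(2), of i y] Gfl[OF that(1), of y] by (simp add: fl_def)
  have main: "slot_part j w (vs[j := y]) = D (vs[j := H y])" if vs: "length vs = n" and j: "j < n" for vs j y
  proof -
    have "D (vs[j := H y]) = (\<Sum>i<n. slot_part i w (fl[i := y]) / D fl * D (vs[j := e i]))"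
      unfolding H_def by (rule cform_sum[OF D(1) vs j])
    also have "\<dots> = (\<Sum>i<n. G i y (vs[j := e i]))" using GD vs by simp
    \<comment> \<open>For each of the n indices the term \<open>l = j\<close> gives the wanted
      value. Each of the n - 1 other slots, after summation over \<open>i\<close> and an exchange of
      \<open>y\<close> with \<open>vs ! l\<close>, gives its negative. The balance is exactly
      one.\<close>
    also have "\<dots> = (\<Sum>i<n. slot_part j w (vs[j := y])
        + (\<Sum>l<n. if l = j then 0 else \<gamma> i (vs ! l) * slot_part l w (vs[j := e i, l := y])))"
    proof (rule sum.cong[OF refl])
      fix i assume "i \<in> {..<n}"
      then show "G i y (vs[j := e i]) = slot_part j w (vs[j := y])
        + (\<Sum>l<n. if l = j then 0 else \<gamma> i (vs ! l) * slot_part l w (vs[j := e i, l := y]))"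
        unfolding G_def using vs j \<gamma>e[of i i]
        by (subst sum_split_diagonal[OF j]) (auto intro!: sum.cong)
    qed
    also have "\<dots> = of_nat n * slot_part j w (vs[j := y])
      + (\<Sum>l<n. \<Sum>i<n. if l = j then 0 else \<gamma> i (vs ! l) * slot_part l w (vs[j := e i, l := y]))"
      unfolding sum.distrib by (subst sum.swap) simp
    also have "(\<Sum>l<n. \<Sum>i<n. if l = j then 0 else \<gamma> i (vs ! l) * slot_part l w (vs[j := e i, l := y]))
      = (\<Sum>l<n. if l = j then 0 else - slot_part j w (vs[j := y]))"
    proof (rule sum.cong[OF refl])
      fix l assume "l \<in> {..<n}"
      then have l: "l < n" by simp
      show "(\<Sum>i<n. if l = j then 0 else \<gamma> i (vs ! l) * slot_part l w (vs[j := e i, l := y]))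
        = (if l = j then 0 else - slot_part j w (vs[j := y]))"
      proof (cases "l = j")
        case False
        have lin: "linear (\<lambda>v. slot_part l w (vs[l := y, j := v]))"
          by (rule slot_part_linear[OF w(1)]) (use vs l j in auto)
        have sc: "slot_part l w (vs[l := y, j := c *s v]) = c * slot_part l w (vs[l := y, j := v])" for c v
          using scale_of_J(1)[OF lin, of c v] slot_part_J[OF w, of "vs[l := y]" j l] vs l j False by simp
        have "(\<Sum>i<n. \<gamma> i (vs ! l) * slot_part l w (vs[l := y, j := e i])) = slot_part l w (vs[l := y, j := (\<Sum>i<n. \<gamma> i (vs ! l) *s e i)])"
          by (simp only: linear_sum[OF lin] sc)
        also have "\<dots> = slot_part l w (vs[l := y, j := vs ! l])" by (simp only: ex[symmetric])
        also have "\<dots> = - slot_part j w (vs[l := vs ! l, j := y])"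
          by (rule slot_part_swap[OF w(1) vs l j False])
        also have "vs[l := vs ! l, j := y] = vs[j := y]" by simp
        finally have "(\<Sum>i<n. \<gamma> i (vs ! l) * slot_part l w (vs[l := y, j := e i])) = - slot_part j w (vs[j := y])" .
        moreover have "vs[j := v, l := y] = vs[l := y, j := v]" for v using False by (rule list_update_swap[symmetric])
        ultimately show ?thesis using False by simp
      qed simp
    qed
    also have "\<dots> = - ((of_nat n - 1) * slot_part j w (vs[j := y]))"
    proof -
      have "(\<Sum>l<n. if l = j then 0 else - slot_part j w (vs[j := y]))
        = (\<Sum>l<n. - slot_part j w (vs[j := y])) + (\<Sum>l<n. if l = j then slot_part j w (vs[j := y]) else 0)"
        unfolding sum.distrib[symmetric] by (rule sum.cong) auto
      also have "\<dots> = - (of_nat n * slot_part j w (vs[j := y])) + slot_part j w (vs[j := y])"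
        using j by simp
      finally show ?thesis by (simp add: algebra_simps)
    qed
    finally show ?thesis by (simp add: algebra_simps)
  qed
  show ?thesis
  proof (rule that[of H])
    show "linear H"
    proof (rule linearI)
      fix u v :: "complex ^ 'n" and r :: real
      have l: "linear (\<lambda>v. slot_part i w (fl[i := v]))" if "i < n" for i
        by (rule slot_part_linear[OF w(1) fl(1) that that])
      show "H (u + v) = H u + H v"
        unfolding H_def sum.distrib[symmetric]
        by (intro sum.cong refl) (simp add: linear_add[OF l] add_divide_distrib vec_eq_iff algebra_simps)
      show "H (r *\<^sub>R v) = r *\<^sub>R H v"
        unfolding H_def scaleR_sum_right
        by (intro sum.cong refl) (simp add: linear_cmul[OF l] vec_eq_iff scaleR_conv_of_real[where 'a = complex])
    qed
    show "H (J v) = - J (H v)" for v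
    proof -
      have "J (H v) = (\<Sum>i<n. (\<i> * (slot_part i w (fl[i := v]) / D fl)) *s e i)"
        unfolding H_def by (simp add: linear_sum[OF linear_J]) (simp add: J_def)
      then have "- J (H v) = (\<Sum>i<n. - ((\<i> * (slot_part i w (fl[i := v]) / D fl)) *s e i))"
        by (simp add: sum_negf)
      also have "\<dots> = H (J v)"
        unfolding H_def
        by (intro sum.cong refl) (simp add: slot_part_J[OF w fl(1)] vec_eq_iff)
      finally show ?thesis by simp
    qed
    fix vs :: "(complex ^ 'n) list" assume vs: "length vs = n"
    have "slot_part j w vs = D (vs[j := H (vs ! j)])" if "j < n" for j
      using main[OF vs that, of "vs ! j"] by simp
    then show "w vs = act n H D vs" using sum_slot_part[OF w(2) vs] by (simp add: act_def)
  qed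
qed

subsection \<open>The curvature term on forms of type (n - 1, 1)\<close>

lemma cform_act:
  assumes D: "cform n D" and A: "linear A" "\<And>v. A (J v) = J (A v)"
  shows "cform n (act n A D)"
  unfolding cform_def
proof (intro conjI allI impI)
  show "multilinear n (act n A D)"
    using multilinear_act[OF _ A(1)] D by (simp add: cform_def)
  fix vs :: "(complex ^ 'a) list" and i v assume "length vs = n \<and> i < n"
  then have vs: "length vs = n" "i < n" by auto
  show "act n A D (vs[i := J v]) = \<i> * act n A D (vs[i := v])"
    unfolding act_def sum_distrib_left
  proof (rule sum.cong[OF refl])
    fix l assume "l \<in> {..<n}"
    then have l: "l < n" by simp
    show "D (vs[i := J v, l := A (vs[i := J v] ! l)]) = \<i> * D (vs[i := v, l := A (vs[i := v] ! l)])"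
    proof (cases "l = i")
      case True
      then show ?thesis using cformD(2)[OF D vs, of "A v"] vs by (simp add: A(2))
    next
      case False
      then have sw: "vs[i := u, l := z] = vs[l := z, i := u]" for u z by (rule list_update_swap[symmetric])
      show ?thesis using cformD(2)[OF D, of "vs[l := A (vs ! l)]" i v] vs False by (simp add: sw)
    qed
  qed
next
  fix vs :: "(complex ^ 'a) list" and a c
  assume "length vs = n \<and> a < n \<and> c < n \<and> a \<noteq> c \<and> vs ! a = vs ! c"
  then have vs: "length vs = n" "a < n" "c < n" "a \<noteq> c" "vs ! a = vs ! c" by auto
  let ?h = "\<lambda>l. D (vs[l := A (vs ! l)])"
  have z: "?h l = 0" if "l < n" "l \<noteq> a" "l \<noteq> c" for l
    by (rule cformD(3)[OF D, of _ a c]) (use vs that in auto)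
  have e: "vs[a := y] = vs[a := y, c := vs ! a]" "vs[c := y] = vs[a := vs ! a, c := y]" for y
    using vs by (metis list_update_id list_update_swap, metis list_update_id)
  have "?h a = - ?h c"
    using cform_swap[OF D vs(1-4), of "A (vs ! a)" "vs ! a"] e vs(5) by metis
  moreover have "(\<Sum>l<n. ?h l) = (\<Sum>l\<in>{a, c}. ?h l)"
    by (rule sum.mono_neutral_right) (use vs z in auto)
  ultimately show "act n A D vs = 0" using vs(4) by (simp add: act_def)
qed

definition ctrace :: "(complex ^ 'n \<Rightarrow> complex ^ 'n \<Rightarrow> real) \<Rightarrow> nat \<Rightarrow> (nat \<Rightarrow> complex ^ 'n) \<Rightarrow> (complex ^ 'n \<Rightarrow> complex ^ 'n) \<Rightarrow> complex" where
  "ctrace b n e A = (\<Sum>j<n. Complex (b (A (e j)) (e j)) (b (A (e j)) (J (e j))))"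

text \<open>A derivation acts on the line of (n, 0)-covectors by a scalar; evaluation on the frame
  identifies the scalar as the complex trace.\<close>

lemma cform_trace:
  fixes D :: "(complex ^ 'n::finite) list \<Rightarrow> complex"
  assumes e: "unitary_frame b n e"
    and D: "cform n D" "D (map e [0..<n]) \<noteq> 0" and A: "linear A" "\<And>v. A (J v) = J (A v)" and vs: "length vs = n"
  shows "act n A D vs = ctrace b n e A * D vs"
proof -
  let ?fl = "map e [0..<n]"
  have ex: "v = (\<Sum>i<n. frame_coord b (e i) v *s e i)" for v by (rule frame_coord_expand[OF e])
  have span: "\<exists>c. v = (\<Sum>i<n. c i *s e i)" for v by (rule exI[of _ "\<lambda>i. frame_coord b (e i) v"]) (rule ex)
  have "D (?fl[j := A (e j)]) = frame_coord b (e j) (A (e j)) * D ?fl" if j: "j < n" for j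
  proof -
    have "D (?fl[j := A (e j)]) = D (?fl[j := (\<Sum>i<n. frame_coord b (e i) (A (e j)) *s e i)])"
      by (simp only: ex[symmetric])
    also have "\<dots> = (\<Sum>i<n. frame_coord b (e i) (A (e j)) * D (?fl[j := e i]))"
      by (rule cform_sum[OF D(1)]) (use j in auto)
    also have "\<dots> = (\<Sum>i<n. if i = j then frame_coord b (e j) (A (e j)) * D ?fl else 0)"
    proof (rule sum.cong[OF refl])
      fix i assume "i \<in> {..<n}"
      then have i: "i < n" by simp
      show "frame_coord b (e i) (A (e j)) * D (?fl[j := e i]) = (if i = j then frame_coord b (e j) (A (e j)) * D ?fl else 0)"
      proof (cases "i = j")
        case True
        have "?fl[j := e j] = ?fl" using j by (intro nth_equalityI) (auto simp: nth_list_update)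
        then show ?thesis using True by simp
      next
        case False
        have "D (?fl[j := e i]) = 0" by (rule cformD(3)[OF D(1), of _ i j]) (use i j False in auto)
        then show ?thesis using False by simp
      qed
    qed
    finally show ?thesis using j by simp
  qed
  then have "act n A D ?fl = ctrace b n e A * D ?fl"
    by (simp add: act_def ctrace_def frame_coord_def sum_distrib_right)
  then show ?thesis using cform_unique[OF cform_act[OF D(1) A] D span vs] D(2) by simp
qed

section \<open>Norms of forms given by antilinear endomorphisms\<close>

context kahler_point
begin

text \<open>\<open>J\<close> in slot \<open>j\<close> is skew for the inner product and multiplies
  \<open>D\<close> by \<i> but \<open>E\<close> by -\<i>, so the product equals its own
  negative.\<close>

lemma type_orthogonal:
  assumes D: "cform CARD('n) D" and E: "multilinear CARD('n) E" and j: "j < CARD('n)"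
    and EJ: "\<And>vs v. length vs = CARD('n) \<Longrightarrow> E (vs[j := J v]) = - \<i> * E (vs[j := v])"
  shows "tensor_ip b CARD('n) D E = 0"
proof -
  have mD: "multilinear CARD('n) D" using D by (simp add: cform_def)
  have "\<i> * tensor_ip b CARD('n) D E = tensor_ip b CARD('n) (\<lambda>vs. \<i> * D vs) E" by (simp only: tensor_ip_scale)
  also have "\<dots> = tensor_ip b CARD('n) (\<lambda>vs. D (vs[j := J (vs ! j)])) E"
    by (rule tensor_ip_cong) (use cformD(2)[OF D _ j] in simp_all)
  also have "\<dots> = tensor_ip b CARD('n) D (\<lambda>vs. E (vs[j := - J (vs ! j)]))"
    by (rule tensor_ip_slot_adjoint[OF inner_b linear_J _ mD E j]) (simp add: b_J_left linear_neg[OF b_lin])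
  also have "\<dots> = tensor_ip b CARD('n) D (\<lambda>vs. \<i> * E vs)"
  proof (rule tensor_ip_cong[OF refl])
    fix vs :: "(complex ^ 'n) list" assume vs: "length vs = CARD('n)"
    have "E (vs[j := - J (vs ! j)]) = - E (vs[j := J (vs ! j)])"
      by (rule linear_neg[OF multilinearD[OF E vs j]])
    then show "E (vs[j := - J (vs ! j)]) = \<i> * E vs" using EJ[OF vs, of "vs ! j"] by simp
  qed
  also have "\<dots> = - \<i> * tensor_ip b CARD('n) D E" by (simp only: tensor_ip_scale) simp
  finally show ?thesis by simp
qed

text \<open>Moving \<open>N\<close> across turns the norm into the product of \<open>D\<close> with
  the action of \<open>M\<close> on that of \<open>N\<close>. When both hit the same slot, the
  composition is complex linear and contributes its trace. When they hit different slots, the result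
  is antilinear in both of them and orthogonal to \<open>D\<close>.\<close>

lemma act_antilinear_norm:
  assumes e: "unitary_frame b CARD('n) e" and D: "cform CARD('n) D" "D (map e [0..<CARD('n)]) \<noteq> 0"
    and N: "linear N" "\<And>v. N (J v) = - J (N v)" and M: "linear M" "\<And>v. M (J v) = - J (M v)"
    and adj: "\<And>u v. b (N u) v = b u (M v)"
  shows "Re (tensor_ip b CARD('n) (act CARD('n) N D) (act CARD('n) N D)) = (\<Sum>j<CARD('n). b (M (e j)) (M (e j))) * Re (tensor_ip b CARD('n) D D)"
proof -
  have mD: "multilinear CARD('n) D" using D by (simp add: cform_def)
  have mN: "multilinear CARD('n) (act CARD('n) N D)" by (rule multilinear_act[OF mD N(1)])
  define E where "E j l vs = (if l = j then 0 else D (vs[j := M (vs ! j), l := N (vs ! l)]))" for j l vs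
  have NM: "linear (\<lambda>v. N (M v))" using linear_compose[OF M(1) N(1)] by (simp add: o_def)
  have E0: "tensor_ip b CARD('n) D (E j l) = 0" if jl: "j < CARD('n)" "l < CARD('n)" for j l
  proof (cases "l = j")
    case True
    then show ?thesis by (simp add: E_def[abs_def] tensor_ip_zero)
  next
    case False
    define D' where "D' vs = D (vs[l := N (vs ! l)])" for vs
    have mD': "multilinear CARD('n) D'" unfolding D'_def[abs_def] by (rule multilinear_slot[OF mD N(1) jl(2)])
    have E: "E j l = (\<lambda>vs. D' (vs[j := M (vs ! j)]))" using False by (simp add: E_def D'_def fun_eq_iff)
    show ?thesis
    proof (rule type_orthogonal[OF D(1) _ jl(1)])
      show "multilinear CARD('n) (E j l)" unfolding E by (rule multilinear_slot[OF mD' M(1) jl(1)])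
      fix vs :: "(complex ^ 'n) list" and v assume vs: "length vs = CARD('n)"
      have l: "linear (\<lambda>v. D' (vs[j := v]))" by (rule multilinearD[OF mD' vs jl(1)])
      have J: "D' (vs[j := J u]) = \<i> * D' (vs[j := u])" for u
      proof -
        have "vs[j := u, l := z] = vs[l := z, j := u]" for u z using False by (metis list_update_swap)
        then show ?thesis unfolding D'_def using cformD(2)[OF D(1), of "vs[l := N (vs ! l)]" j u] vs jl False by simp
      qed
      show "E j l (vs[j := J v]) = - \<i> * E j l (vs[j := v])"
        unfolding E using vs jl by (simp add: M(2) linear_neg[OF l] J)
    qed
  qed
  have "tensor_ip b CARD('n) (act CARD('n) N D) (act CARD('n) N D) = tensor_ip b CARD('n) D (act CARD('n) M (act CARD('n) N D))"
    by (rule tensor_ip_act_adjoint[OF inner_b N(1) adj mD mN])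
  also have "\<dots> = tensor_ip b CARD('n) D (\<lambda>vs. ctrace b CARD('n) e (\<lambda>v. N (M v)) * D vs + (\<Sum>j<CARD('n). \<Sum>l<CARD('n). E j l vs))"
  proof (rule tensor_ip_cong[OF refl])
    fix vs :: "(complex ^ 'n) list" assume vs: "length vs = CARD('n)"
    have "act CARD('n) (\<lambda>v. N (M v)) D vs = ctrace b CARD('n) e (\<lambda>v. N (M v)) * D vs"
      by (rule cform_trace[OF e D NM _ vs]) (simp add: M(2) N(2) linear_neg[OF N(1)])
    then show "act CARD('n) M (act CARD('n) N D) vs = ctrace b CARD('n) e (\<lambda>v. N (M v)) * D vs + (\<Sum>j<CARD('n). \<Sum>l<CARD('n). E j l vs)"
      unfolding act_act[OF vs] E_def by simp
  qed
  also have "\<dots> = cnj (ctrace b CARD('n) e (\<lambda>v. N (M v))) * tensor_ip b CARD('n) D D"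
    unfolding tensor_ip_add tensor_ip_scale tensor_ip_sum by (simp add: E0)
  finally have eq: "tensor_ip b CARD('n) (act CARD('n) N D) (act CARD('n) N D) = cnj (ctrace b CARD('n) e (\<lambda>v. N (M v))) * tensor_ip b CARD('n) D D" .
  have "Im (tensor_ip b CARD('n) D D) = 0"
    using tensor_ip_cnj[OF inner_b e mD mD] by (metis complex_cnj_cancel_iff cnj.simps(2) neg_equal_zero)
  moreover have "Re (ctrace b CARD('n) e (\<lambda>v. N (M v))) = (\<Sum>j<CARD('n). b (M (e j)) (M (e j)))"
    by (simp add: ctrace_def adj)
  ultimately show ?thesis unfolding eq by simp
qed

definition adjoint_map :: "(complex ^ 'n \<Rightarrow> complex ^ 'n) \<Rightarrow> complex ^ 'n \<Rightarrow> complex ^ 'n" where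
  "adjoint_map H v = (\<Sum>i<2 * CARD('n). b v (H (F i)) *\<^sub>R F i)"

lemma adjoint_map:
  assumes H: "linear H"
  shows "b (H u) v = b u (adjoint_map H v)" "b (adjoint_map H v) u = b v (H u)" "linear (adjoint_map H)"
proof -
  show 1: "b (H u) v = b u (adjoint_map H v)" for u v
  proof -
    have "linear (\<lambda>u. b (H u) v)" using linear_compose[OF H b_lin'] by (simp add: o_def)
    from F_linear[OF this, of u] show ?thesis
      using b_sym[of v] by (simp add: adjoint_map_def linear_sum[OF b_lin] linear_cmul[OF b_lin] mult.commute)
  qed
  then show "b (adjoint_map H v) u = b v (H u)" using b_sym by metis
  show "linear (adjoint_map H)"
    by (rule linearI) (simp_all add: adjoint_map_def linear_add[OF b_lin'] linear_cmul[OF b_lin'] scaleR_left_distrib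
      sum.distrib scaleR_sum_right)
qed

lemma adjoint_map_antilinear:
  assumes H: "linear H" "\<And>v. H (J v) = - J (H v)"
  shows "adjoint_map H (J v) = - J (adjoint_map H v)"
proof (rule inner_product_nondegenerate[OF inner_b])
  fix w
  show "b (adjoint_map H (J v)) w = b (- J (adjoint_map H v)) w"
    by (simp add: adjoint_map(2)[OF H(1)] linear_neg[OF b_lin'] b_J_left H(2) linear_neg[OF b_lin])
qed

text \<open>The imaginary part of the complex trace of \<open>A\<close>; for skew \<open>A\<close>
  the real part vanishes.\<close>

definition tau :: "(nat \<Rightarrow> complex ^ 'n) \<Rightarrow> (complex ^ 'n \<Rightarrow> complex ^ 'n) \<Rightarrow> real" where
  "tau e A = (\<Sum>j<CARD('n). b (A (e j)) (J (e j)))"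

text \<open>If \<open>w = H \<cdot> D\<close> with \<open>D\<close> of type \<open>(n, 0)\<close>, then \<open>A \<cdot> D = \<i> * tau e A * D\<close>, whence
  \<open>A \<cdot> w = curv_map e A H \<cdot> D\<close>.\<close>

definition curv_map :: "(nat \<Rightarrow> complex ^ 'n) \<Rightarrow> (complex ^ 'n \<Rightarrow> complex ^ 'n) \<Rightarrow> (complex ^ 'n \<Rightarrow> complex ^ 'n) \<Rightarrow> complex ^ 'n \<Rightarrow> complex ^ 'n" where
  "curv_map e A K v = K (A v) - A (K v) + tau e A *\<^sub>R J (K v)"

lemma curv_map_props:
  assumes K: "linear K" "\<And>v. K (J v) = - J (K v)" and A: "linear A" "\<And>v. A (J v) = J (A v)"
  shows "linear (curv_map e A K)" "curv_map e A K (J v) = - J (curv_map e A K v)"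
proof -
  show "linear (curv_map e A K)"
    by (rule linearI) (simp_all add: curv_map_def linear_add[OF K(1)] linear_add[OF A(1)] linear_cmul[OF K(1)] linear_cmul[OF A(1)]
      J_add J_scaleR algebra_simps)
  show "curv_map e A K (J v) = - J (curv_map e A K v)"
    by (simp add: curv_map_def K(2) A(2) linear_neg[OF A(1)] J_add J_diff J_scaleR)
qed

text \<open>Commuting \<open>A\<close> past \<open>H\<close> leaves the action of \<open>A\<close>
  on \<open>D\<close>, a multiplication by \<i> times \<open>tau e A\<close>. Since \<open>D\<close>
  is complex linear, the factor \<i> can be absorbed as \<open>J\<close> after
  \<open>H\<close>.\<close>

lemma act_antilinear:
  assumes e: "unitary_frame b CARD('n) e" and D: "cform CARD('n) D" "D (map e [0..<CARD('n)]) \<noteq> 0"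
    and H: "linear H" "\<And>v. H (J v) = - J (H v)" and A: "linear A" "\<And>v. A (J v) = J (A v)"
    and skew: "\<And>u v. b (A u) v = - b u (A v)" and vs: "length vs = CARD('n)"
  shows "act CARD('n) A (act CARD('n) H D) vs = act CARD('n) (curv_map e A H) D vs"
proof -
  have mD: "multilinear CARD('n) D" using D by (simp add: cform_def)
  have s0: "b (A v) v = 0" for v using skew[of v v] b_sym[of v "A v"] by simp
  have tr: "ctrace b CARD('n) e A = \<i> * complex_of_real (tau e A)"
    by (simp add: ctrace_def tau_def s0 complex_eq_iff)
  have "act CARD('n) H (act CARD('n) A D) vs = ctrace b CARD('n) e A * act CARD('n) H D vs"
  proof -
    have "act CARD('n) A D (vs[j := z]) = ctrace b CARD('n) e A * D (vs[j := z])" for j z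
      by (rule cform_trace[OF e D A]) (simp add: vs)
    then show ?thesis by (simp add: act_def[of "CARD('n)" H] sum_distrib_left)
  qed
  also have "\<dots> = tau e A *\<^sub>R act CARD('n) (\<lambda>v. J (H v)) D vs"
  proof -
    have "D (vs[j := J (H (vs ! j))]) = \<i> * D (vs[j := H (vs ! j)])" if "j < CARD('n)" for j
      by (rule cformD(2)[OF D(1) vs that])
    then have "act CARD('n) (\<lambda>v. J (H v)) D vs = \<i> * act CARD('n) H D vs" by (simp add: act_def sum_distrib_left)
    then show ?thesis by (simp add: tr scaleR_conv_of_real)
  qed
  also have "\<dots> = act CARD('n) (\<lambda>v. tau e A *\<^sub>R J (H v)) D vs" by (rule act_scaleR[OF mD vs, symmetric])
  finally have 1: "act CARD('n) H (act CARD('n) A D) vs = act CARD('n) (\<lambda>v. tau e A *\<^sub>R J (H v)) D vs" .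
  have "act CARD('n) A (act CARD('n) H D) vs = act CARD('n) (\<lambda>v. H (A v) - A (H v)) D vs + act CARD('n) (\<lambda>v. tau e A *\<^sub>R J (H v)) D vs"
    using act_commutator[OF mD vs, of A H] 1 by (simp add: algebra_simps)
  also have "\<dots> = act CARD('n) (\<lambda>v. H (A v) - A (H v) + tau e A *\<^sub>R J (H v)) D vs"
    by (rule act_add[OF mD vs, symmetric])
  finally show ?thesis by (simp add: curv_map_def[abs_def])
qed

lemma curv_map_adjoint:
  assumes H: "linear H" "\<And>v. H (J v) = - J (H v)" and A: "\<And>u v. b (A u) v = - b u (A v)"
  shows "b (curv_map e A H u) v = b u (curv_map e A (adjoint_map H) v)"
proof -
  have "b (J (H u)) v = b u (J (adjoint_map H v))"
    by (simp add: b_J_left adjoint_map(1)[OF H(1)] adjoint_map_antilinear[OF H] linear_neg[OF b_lin])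
  then show ?thesis
    by (simp add: curv_map_def linear_add[OF b_lin'] linear_diff[OF b_lin'] linear_cmul[OF b_lin'] linear_add[OF b_lin]
      linear_diff[OF b_lin] linear_cmul[OF b_lin] adjoint_map(1)[OF H(1)] A)
qed

theorem act_norm:
  assumes e: "unitary_frame b CARD('n) e" and D: "cform CARD('n) D" "D (map e [0..<CARD('n)]) \<noteq> 0"
    and H: "linear H" "\<And>v. H (J v) = - J (H v)" and A: "linear A" "\<And>v. A (J v) = J (A v)"
    and skew: "\<And>u v. b (A u) v = - b u (A v)" and w: "\<And>vs. length vs = CARD('n) \<Longrightarrow> w vs = act CARD('n) H D vs"
  shows "Re (tensor_ip b CARD('n) (act CARD('n) A w) (act CARD('n) A w))
    = (\<Sum>j<CARD('n). b (curv_map e A (adjoint_map H) (e j)) (curv_map e A (adjoint_map H) (e j))) * Re (tensor_ip b CARD('n) D D)"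
proof -
  have 1: "act CARD('n) A w vs = act CARD('n) (curv_map e A H) D vs" if "length vs = CARD('n)" for vs
  proof -
    have "act CARD('n) A w vs = act CARD('n) A (act CARD('n) H D) vs" by (simp add: act_def[of "CARD('n)" A] w that)
    then show ?thesis using act_antilinear[OF e D H A skew that] by simp
  qed
  note adj = adjoint_map(3)[OF H(1)] adjoint_map_antilinear[OF H]
  have "tensor_ip b CARD('n) (act CARD('n) A w) (act CARD('n) A w) = tensor_ip b CARD('n) (act CARD('n) (curv_map e A H) D) (act CARD('n) (curv_map e A H) D)"
    by (rule tensor_ip_cong[OF 1 1])
  then show ?thesis
    by (simp only: act_antilinear_norm[OF e D curv_map_props[OF H A] curv_map_props[OF adj A] curv_map_adjoint[OF H skew]])
qed

end

subsection \<open>Weighted sums of eigenvalues\<close>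

text \<open>Under these constraints the least favourable choice puts the full weight
  \<open>M\<close> on the \<open>K\<close> smallest eigenvalues, which gives \<open>M\<close> times
  their sum. Comparison with the \<open>K\<close>-th eigenvalue makes this precise.\<close>

lemma weighted_sum_pos:
  fixes ls :: "real list" and v :: "nat \<Rightarrow> real"
  assumes ls: "sorted ls" "(\<Sum>i<K. ls ! i) > 0"
    and v: "\<And>i. i < length ls \<Longrightarrow> 0 \<le> v i" "\<And>i. i < length ls \<Longrightarrow> v i \<le> M" "0 < M" "M * real K \<le> (\<Sum>i<length ls. v i)"
  shows "(\<Sum>i<length ls. ls ! i * v i) > 0"
proof -
  let ?m = "length ls"
  have K: "0 < K" using ls(2) by (cases K) auto
  have "(\<Sum>i<?m. v i) \<le> (\<Sum>i<?m. M)" by (rule sum_mono) (use v(2) in auto)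
  then have "M * real K \<le> M * real ?m" using v(4) by (simp add: mult.commute)
  then have Km: "K \<le> ?m" using v(3) by simp
  define l where "l = ls ! (K - 1)"
  have le: "ls ! i \<le> l" if "i < K" for i unfolding l_def by (rule sorted_nth_mono[OF ls(1)]) (use that Km in auto)
  have ge: "l \<le> ls ! i" if "K \<le> i" "i < ?m" for i unfolding l_def by (rule sorted_nth_mono[OF ls(1)]) (use that in auto)
  \<comment> \<open>If the largest of the first \<open>K\<close> eigenvalues were not positive,
    their sum could not be. Positivity allows the total weight to exceed
    \<open>M * real K\<close>.\<close>
  have l: "0 < l"
  proof (rule ccontr)
    assume "\<not> 0 < l"
    then have "(\<Sum>i<K. ls ! i) \<le> (\<Sum>i<K. 0)" by (intro sum_mono) (use le in force)
    then show False using ls(2) by simp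
  qed
  have "(\<Sum>i<?m. ls ! i * v i) = (\<Sum>i<?m. (ls ! i - l) * v i) + l * (\<Sum>i<?m. v i)"
    by (simp add: sum_distrib_left sum.distrib[symmetric] algebra_simps)
  also have "(\<Sum>i<?m. (ls ! i - l) * v i) \<ge> (\<Sum>i<?m. if i < K then (ls ! i - l) * M else 0)"
  proof (rule sum_mono)
    fix i assume "i \<in> {..<?m}"
    then have i: "i < ?m" by simp
    show "(if i < K then (ls ! i - l) * M else 0) \<le> (ls ! i - l) * v i"
    proof (cases "i < K")
      case True
      have "(l - ls ! i) * v i \<le> (l - ls ! i) * M" by (rule mult_left_mono) (use le[OF True] v(2)[OF i] in auto)
      then show ?thesis using True by (simp add: algebra_simps)
    next
      case False
      then show ?thesis using ge[of i] v(1)[OF i] i by simp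
    qed
  qed
  moreover have "(\<Sum>i<?m. if i < K then (ls ! i - l) * M else 0) = (\<Sum>i<K. (ls ! i - l) * M)"
    by (rule sum.mono_neutral_cong_right) (use Km in auto)
  moreover have "l * (M * real K) \<le> l * (\<Sum>i<?m. v i)" using v(4) l by simp
  ultimately have "(\<Sum>i<K. (ls ! i - l) * M) + l * (M * real K) \<le> (\<Sum>i<?m. ls ! i * v i)" by linarith
  moreover have "(\<Sum>i<K. (ls ! i - l) * M) + l * (M * real K) = M * (\<Sum>i<K. ls ! i)"
    by (simp add: sum_subtractf sum_distrib_left sum_distrib_right[symmetric] algebra_simps)
  ultimately show ?thesis using v(3) ls(2) by (smt (verit) mult_pos_pos)
qed

subsection \<open>A bound for signless graph Laplacians\<close>

text \<open>The signless Laplacian of a graph with \<open>m\<close> edges is bounded by the maximum of the sum of the degrees of two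
  adjacent vertices, hence by \<open>m + 1\<close>; the graph consists of the pairs contributing to the sum.\<close>

lemma signless_laplacian_bound:
  fixes \<mu> :: "nat \<Rightarrow> real"
  assumes \<mu>: "\<And>i. i < n \<Longrightarrow> 0 \<le> \<mu> i" "(\<Sum>i<n. (\<mu> i)\<^sup>2) = 1"
  shows "(\<Sum>p<n. \<Sum>q<n. if p = q then 0 else max 0 ((\<mu> p + \<mu> q)\<^sup>2 - 1)) \<le> 2"
proof -
  \<comment> \<open>The adjacency matrix of the graph of pairs with positive excess. Sums run over
    ordered pairs, so \<open>W\<close> is twice the number of edges and \<open>V\<close> twice the
    signless Laplacian form at \<mu>.\<close>
  define c :: "nat \<Rightarrow> nat \<Rightarrow> real" where "c p q = (if p \<noteq> q \<and> (\<mu> p + \<mu> q)\<^sup>2 > 1 then 1 else 0)" for p q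
  define y where "y p q = c p q * (\<mu> p + \<mu> q)" for p q
  define d where "d p = (\<Sum>q<n. c p q)" for p
  define W where "W = (\<Sum>p<n. d p)"
  define V where "V = (\<Sum>p<n. \<Sum>q<n. (y p q)\<^sup>2)"
  define z where "z p = (\<Sum>q<n. y p q)" for p
  have c: "c p q = c q p" "0 \<le> c p q" "c p p = 0" "c p q \<le> 1" "(c p q)\<^sup>2 = c p q" "c p q * y p q = y p q" for p q
    by (auto simp: c_def y_def add.commute power2_eq_square)
  have y: "y p q = y q p" for p q by (simp add: y_def c(1)[of p q] add.commute)
  have eq: "(\<Sum>p<n. \<Sum>q<n. if p = q then 0 else max 0 ((\<mu> p + \<mu> q)\<^sup>2 - 1)) = V - W"
    by (simp add: V_def W_def d_def y_def c_def sum_subtractf[symmetric])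
       (intro sum.cong refl, auto simp: max_def)
  have V0: "0 \<le> V" unfolding V_def by (intro sum_nonneg) auto
  have "V = (\<Sum>p<n. \<Sum>q<n. \<mu> p * y p q) + (\<Sum>p<n. \<Sum>q<n. \<mu> q * y p q)"
    unfolding V_def sum.distrib[symmetric]
    by (intro sum.cong refl) (auto simp: y_def c_def power2_eq_square algebra_simps)
  also have "(\<Sum>p<n. \<Sum>q<n. \<mu> q * y p q) = (\<Sum>p<n. \<Sum>q<n. \<mu> p * y p q)"
    by (subst sum.swap) (simp add: y)
  finally have V: "V = 2 * (\<Sum>p<n. \<mu> p * z p)" by (simp add: z_def sum_distrib_left)
  have "V\<^sup>2 = 4 * (\<Sum>p<n. \<mu> p * z p)\<^sup>2" by (simp add: V power_mult_distrib)
  also have "(\<Sum>p<n. \<mu> p * z p)\<^sup>2 \<le> (\<Sum>p<n. (\<mu> p)\<^sup>2) * (\<Sum>p<n. (z p)\<^sup>2)" by (rule Cauchy_Schwarz_ineq_sum)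
  also have "\<dots> = (\<Sum>p<n. (z p)\<^sup>2)" using \<mu>(2) by simp
  also have "\<dots> \<le> (\<Sum>p<n. d p * (\<Sum>q<n. (y p q)\<^sup>2))"
  proof (rule sum_mono)
    fix p
    have "(z p)\<^sup>2 = (\<Sum>q<n. c p q * y p q)\<^sup>2" by (simp add: z_def c(6))
    also have "\<dots> \<le> (\<Sum>q<n. (c p q)\<^sup>2) * (\<Sum>q<n. (y p q)\<^sup>2)" by (rule Cauchy_Schwarz_ineq_sum)
    finally show "(z p)\<^sup>2 \<le> d p * (\<Sum>q<n. (y p q)\<^sup>2)" by (simp add: c(5) d_def)
  qed
  finally have V2: "V\<^sup>2 \<le> 4 * (\<Sum>p<n. \<Sum>q<n. d p * (y p q)\<^sup>2)" by (simp add: sum_distrib_left)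
  have sw: "(\<Sum>p<n. \<Sum>q<n. d p * (y p q)\<^sup>2) = (\<Sum>p<n. \<Sum>q<n. d q * (y p q)\<^sup>2)"
    by (subst sum.swap) (simp add: y)
  have "4 * (\<Sum>p<n. \<Sum>q<n. d p * (y p q)\<^sup>2) = 2 * (\<Sum>p<n. \<Sum>q<n. (d p + d q) * (y p q)\<^sup>2)"
    using sw by (simp add: algebra_simps sum.distrib)
  also have "\<dots> \<le> 2 * (\<Sum>p<n. \<Sum>q<n. (W / 2 + 1) * (y p q)\<^sup>2)"
  proof (intro mult_left_mono sum_mono)
    fix p q assume "p \<in> {..<n}" "q \<in> {..<n}"
    then have pq: "p < n" "q < n" by auto
    show "(d p + d q) * (y p q)\<^sup>2 \<le> (W / 2 + 1) * (y p q)\<^sup>2"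
    proof (cases "c p q = 0")
      case True
      then show ?thesis by (simp add: y_def)
    next
      case False
      then have cpq: "c p q = 1" "p \<noteq> q" by (auto simp: c_def split: if_splits)
      \<comment> \<open>Summed over all vertices outside {p, q}, this bounds
        \<open>d p + d q - 2\<close> by the remaining part of \<open>W\<close>, where 2 stands for
        the edge between \<open>p\<close> and \<open>q\<close> seen from both ends. Hence
        \<open>d p + d q\<close> is at most \<open>W / 2 + 1\<close>.\<close>
      have row: "c a p + c a q \<le> d a" if "a < n" for a
      proof -
        have "sum (c a) {p, q} \<le> sum (c a) {..<n}" by (rule sum_mono2) (use pq c in auto)
        then show ?thesis using cpq(2) by (simp add: d_def)
      qed
      have sd: "d p + d q = (\<Sum>a<n. c a p + c a q)" by (simp add: d_def sum.distrib c(1))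
      have sp: "sum f {..<n} = sum f {p, q} + sum f ({..<n} - {p, q})" for f :: "nat \<Rightarrow> real"
        by (rule sum.subset_diff[of "{p, q}" "{..<n}", simplified add.commute]) (use pq in auto)
      have "W = d p + d q + sum d ({..<n} - {p, q})" unfolding W_def sp[of d] using cpq(2) by simp
      moreover have "sum d ({..<n} - {p, q}) \<ge> (\<Sum>a\<in>{..<n} - {p, q}. c a p + c a q)"
        by (rule sum_mono) (use row in auto)
      moreover have "d p + d q = 2 + (\<Sum>a\<in>{..<n} - {p, q}. c a p + c a q)"
        unfolding sd sp[of "\<lambda>a. c a p + c a q"] using cpq c(1)[of p q] by (simp add: c(3))
      ultimately have "d p + d q \<le> W / 2 + 1" by linarith
      then show ?thesis by (rule mult_right_mono) simp
    qed
  qed simp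
  also have "\<dots> = (W + 2) * V" by (simp add: V_def sum_distrib_left algebra_simps)
  finally have "V * V \<le> (W + 2) * V" using V2 by (simp add: power2_eq_square)
  moreover have "0 \<le> W" unfolding W_def d_def by (intro sum_nonneg c)
  ultimately have "V \<le> W + 2" using V0 by (cases "V = 0") auto
  then show ?thesis using eq by simp
qed

section \<open>Transfer weights and positivity of the symmetric part\<close>

lemma sum_off_diagonal:
  fixes f :: "nat \<Rightarrow> nat \<Rightarrow> real"
  assumes "finite A"
  shows "(\<Sum>i\<in>A. \<Sum>j\<in>A. if i = j then 0 else f i j) = (\<Sum>i\<in>A. \<Sum>j\<in>A. f i j) - (\<Sum>i\<in>A. f i i)"
proof -
  have "(\<Sum>j\<in>A. if i = j then 0 else f i j) = (\<Sum>j\<in>A. f i j) - f i i" if "i \<in> A" for i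
  proof -
    have "(\<Sum>j\<in>A. if i = j then 0 else f i j) = (\<Sum>j\<in>A. f i j - (if i = j then f i j else 0))"
      by (intro sum.cong) auto
    also have "\<dots> = (\<Sum>j\<in>A. f i j) - f i i" using assms that by (simp add: sum_subtractf)
    finally show ?thesis .
  qed
  then show ?thesis by (simp add: sum_subtractf)
qed

text \<open>The matrix with ones off the diagonal has eigenvalues -1 and \<open>card A - 1\<close>,
  so dividing by the latter leaves norm at most 1. For a single index the divisor is zero and the
  quotient is 0 by convention.\<close>

lemma off_diagonal_form_bounds:
  fixes x :: "nat \<Rightarrow> real"
  assumes A: "finite A" "A \<noteq> {}"
  shows "\<bar>((\<Sum>i\<in>A. x i)\<^sup>2 - (\<Sum>i\<in>A. (x i)\<^sup>2)) / (real (card A) - 1)\<bar> \<le> (\<Sum>i\<in>A. (x i)\<^sup>2)"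
proof -
  have 1: "(\<Sum>i\<in>A. x i)\<^sup>2 \<le> (\<Sum>i\<in>A. (x i)\<^sup>2) * card A" by (rule sum_squared_le_sum_of_squares)
  have S: "0 \<le> (\<Sum>i\<in>A. (x i)\<^sup>2)" by (intro sum_nonneg) auto
  have "card A \<noteq> 0" using A by simp
  then consider "card A = 1" | "2 \<le> card A" by linarith
  then show ?thesis
  proof cases
    case 1
    then show ?thesis using S by simp
  next
    case 2
    then have "(\<Sum>i\<in>A. (x i)\<^sup>2) * 1 \<le> (\<Sum>i\<in>A. (x i)\<^sup>2) * (real (card A) - 1)"
      by (intro mult_left_mono S) simp
    then have "\<bar>(\<Sum>i\<in>A. x i)\<^sup>2 - (\<Sum>i\<in>A. (x i)\<^sup>2)\<bar> \<le> (\<Sum>i\<in>A. (x i)\<^sup>2) * (real (card A) - 1)"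
      using 1 zero_le_power2[of "\<Sum>i\<in>A. x i"] unfolding abs_le_iff right_diff_distrib by linarith
    then show ?thesis using 2 by (simp add: divide_le_eq abs_divide)
  qed
qed

lemma sum_single_pair:
  fixes f :: "nat \<Rightarrow> nat \<Rightarrow> real"
  assumes "p < n" "q < n"
  shows "(\<Sum>i<n. \<Sum>j<n. if i = p \<and> j = q then f i j else 0) = f p q"
proof -
  have "(\<Sum>i<n. \<Sum>j<n. if i = p \<and> j = q then f i j else 0) = (\<Sum>i<n. if i = p then f p q else 0)"
  proof (rule sum.cong[OF refl])
    fix i
    show "(\<Sum>j<n. if i = p \<and> j = q then f i j else 0) = (if i = p then f p q else 0)"
      using assms by (cases "i = p") simp_all
  qed
  then show ?thesis using assms by simp
qed

text \<open>The matrices \<open>pair_form n p q\<close> and the constant matrix \<open>- 1 / (n - 1)\<close> off the diagonal have norm at most \<open>1\<close>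
  as quadratic forms. A convex combination of them says which part of each \<open>s a i i * s a j j\<close> is traded, by the Bianchi
  identity, for \<open>(r a i j)\<^sup>2 + (s a i j)\<^sup>2\<close>. For \<open>n = 3\<close> the coefficient \<open>1 / (n - 3) = 0\<close> never matters.\<close>

definition pair_form :: "nat \<Rightarrow> nat \<Rightarrow> nat \<Rightarrow> nat \<Rightarrow> nat \<Rightarrow> real" where
  "pair_form n p q i j = - (if i = p \<and> j = q then 1 else 0) - (if i = q \<and> j = p then 1 else 0)
     - (if i \<in> {..<n} - {p, q} \<and> j \<in> {..<n} - {p, q} \<and> i \<noteq> j then 1 / (real n - 3) else 0)"

lemma pair_form_quadratic:
  assumes pq: "p < n" "q < n" "p \<noteq> q"
  shows "(\<Sum>i<n. \<Sum>j<n. pair_form n p q i j * (x i * x j))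
    = - 2 * (x p * x q) - ((\<Sum>i\<in>{..<n} - {p, q}. x i)\<^sup>2 - (\<Sum>i\<in>{..<n} - {p, q}. (x i)\<^sup>2)) / (real n - 3)"
proof -
  let ?A = "{..<n} - {p, q}"
  let ?g = "\<lambda>i j. if i \<in> ?A \<and> j \<in> ?A \<and> i \<noteq> j then x i * x j else 0"
  have "(\<Sum>i<n. \<Sum>j<n. pair_form n p q i j * (x i * x j))
    = (\<Sum>i<n. \<Sum>j<n. - (if i = p \<and> j = q then x i * x j else 0) - (if i = q \<and> j = p then x i * x j else 0) - ?g i j / (real n - 3))"
  proof -
    have "(- (if A then 1 else 0) - (if B then 1 else 0) - (if C then 1 / d else 0)) * y
      = - (if A then y else 0) - (if B then y else 0) - (if C then y else 0) / d" for A B C and y d :: real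
      by (cases A; cases B; cases C) (simp_all add: algebra_simps)
    then show ?thesis unfolding pair_form_def by (simp only:)
  qed
  also have "\<dots> = - (x p * x q) - x q * x p - (\<Sum>i<n. \<Sum>j<n. ?g i j) / (real n - 3)"
    unfolding sum_subtractf sum_negf
    by (simp only: sum_single_pair[OF pq(1,2)] sum_single_pair[OF pq(2,1)] sum_divide_distrib)
  also have "(\<Sum>i<n. \<Sum>j<n. ?g i j) = (\<Sum>i\<in>?A. \<Sum>j\<in>?A. if i = j then 0 else x i * x j)"
  proof -
    have "(\<Sum>j<n. ?g i j) = (if i \<in> ?A then \<Sum>j\<in>?A. if i = j then 0 else x i * x j else 0)" for i
    proof (cases "i \<in> ?A")
      case True
      have "(\<Sum>j<n. ?g i j) = (\<Sum>j\<in>?A. if i = j then 0 else x i * x j)"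
        by (rule sum.mono_neutral_cong_right) (use True in auto)
      then show ?thesis using True by simp
    qed auto
    then have "(\<Sum>i<n. \<Sum>j<n. ?g i j) = (\<Sum>i<n. if i \<in> ?A then \<Sum>j\<in>?A. if i = j then 0 else x i * x j else 0)"
      by (simp only:)
    also have "\<dots> = (\<Sum>i\<in>?A. \<Sum>j\<in>?A. if i = j then 0 else x i * x j)"
      by (rule sum.mono_neutral_cong_right) auto
    finally show ?thesis .
  qed
  also have "\<dots> = (\<Sum>i\<in>?A. x i)\<^sup>2 - (\<Sum>i\<in>?A. (x i)\<^sup>2)"
    by (simp add: sum_off_diagonal power2_eq_square sum_product)
  finally show ?thesis by simp
qed

text \<open>The two blocks live on complementary coordinates: the exchange of \<open>p\<close> and
  \<open>q\<close> has norm 1, and the other block is covered by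
  \<open>off_diagonal_form_bounds\<close>. The entries add up to -2 - (n - 2) = -n. For
  \<open>n = 3\<close> the second block is a single index and contributes nothing, which is the
  origin of the exceptional value 2.\<close>

lemma pair_form_bounds:
  assumes n: "3 \<le> n" and pq: "p < n" "q < n" "p \<noteq> q"
  shows "\<bar>\<Sum>i<n. \<Sum>j<n. pair_form n p q i j * (x i * x j)\<bar> \<le> (\<Sum>i<n. (x i)\<^sup>2)"
    and "(\<Sum>i<n. \<Sum>j<n. pair_form n p q i j) \<le> - (if n = 3 then 2 else real n)"
    and "pair_form n p q i j \<le> 0" "-1 \<le> pair_form n p q i j"
    and "pair_form n i j i j \<le> -1" "pair_form n j i i j \<le> -1"
proof -
  let ?A = "{..<n} - {p, q}"
  have fA: "finite ?A" by simp
  have c: "real (card ?A) - 1 = real n - 3" and A: "?A \<noteq> {}"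
  proof -
    have 1: "card ?A = n - 2" using pq by (simp add: card_Diff_subset)
    then show "real (card ?A) - 1 = real n - 3" using n by simp
    show "?A \<noteq> {}"
    proof
      assume "?A = {}"
      from 1[unfolded this] show False using n by simp
    qed
  qed
  have "(\<Sum>i<n. (x i)\<^sup>2) = (\<Sum>i\<in>?A. (x i)\<^sup>2) + (\<Sum>i\<in>{p, q}. (x i)\<^sup>2)"
    by (rule sum.subset_diff) (use pq in auto)
  then have S: "(\<Sum>i<n. (x i)\<^sup>2) = (\<Sum>i\<in>?A. (x i)\<^sup>2) + (x p)\<^sup>2 + (x q)\<^sup>2" using pq(3) by simp
  have a: "\<bar>2 * (x p * x q)\<bar> \<le> (x p)\<^sup>2 + (x q)\<^sup>2"
  proof -
    have "0 \<le> (x p + x q)\<^sup>2" "0 \<le> (x p - x q)\<^sup>2" by simp_all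
    then show ?thesis by (simp add: abs_le_iff power2_eq_square algebra_simps)
  qed
  show "\<bar>\<Sum>i<n. \<Sum>j<n. pair_form n p q i j * (x i * x j)\<bar> \<le> (\<Sum>i<n. (x i)\<^sup>2)"
    unfolding pair_form_quadratic[OF pq] S using off_diagonal_form_bounds[OF fA A, of x] a unfolding c by linarith
  \<comment> \<open>The quadratic form evaluated on the vector of ones.\<close>
  show "(\<Sum>i<n. \<Sum>j<n. pair_form n p q i j) \<le> - (if n = 3 then 2 else real n)"
  proof -
    have "(\<Sum>i<n. \<Sum>j<n. pair_form n p q i j) = - 2 - ((real (card ?A))\<^sup>2 - real (card ?A)) / (real n - 3)"
      using pair_form_quadratic[OF pq, of "\<lambda>_. 1"] by simp
    also have "(real (card ?A))\<^sup>2 - real (card ?A) = (real n - 2) * (real n - 3)"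
    proof -
      have cA: "real (card ?A) = real n - 2" using c by linarith
      show ?thesis unfolding cA by (simp add: power2_eq_square algebra_simps)
    qed
    finally have "(\<Sum>i<n. \<Sum>j<n. pair_form n p q i j) = - 2 - (real n - 2) * (real n - 3) / (real n - 3)" .
    then show ?thesis using n by (cases "n = 3") simp_all
  qed
  have d: "0 \<le> 1 / (real n - 3)" "1 / (real n - 3) \<le> 1"
    using n by (cases "n = 3"; simp)+
  show "pair_form n p q i j \<le> 0" "-1 \<le> pair_form n p q i j"
    using d pq(3) by (auto simp: pair_form_def)
  show "pair_form n i j i j \<le> -1" "pair_form n j i i j \<le> -1"
    by (auto simp: pair_form_def)
qed

lemma sum_pair_swap:
  "(\<Sum>i\<in>A. \<Sum>j\<in>B. \<Sum>p\<in>C. \<Sum>q\<in>D. f i j p q) = (\<Sum>p\<in>C. \<Sum>q\<in>D. \<Sum>i\<in>A. \<Sum>j\<in>B. f i j p q)"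
proof -
  have "(\<Sum>j\<in>B. \<Sum>p\<in>C. \<Sum>q\<in>D. f i j p q) = (\<Sum>p\<in>C. \<Sum>q\<in>D. \<Sum>j\<in>B. f i j p q)" for i
    by (rule trans[OF sum.swap], rule sum.cong[OF refl], rule sum.swap)
  then have "(\<Sum>i\<in>A. \<Sum>j\<in>B. \<Sum>p\<in>C. \<Sum>q\<in>D. f i j p q) = (\<Sum>i\<in>A. \<Sum>p\<in>C. \<Sum>q\<in>D. \<Sum>j\<in>B. f i j p q)"
    by (rule sum.cong[OF refl])
  also have "\<dots> = (\<Sum>p\<in>C. \<Sum>q\<in>D. \<Sum>i\<in>A. \<Sum>j\<in>B. f i j p q)"
    by (rule trans[OF sum.swap], rule sum.cong[OF refl], rule sum.swap)
  finally show ?thesis .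
qed

text \<open>The upper bound on \<open>t i j\<close> is critical for pairs whose square exceeds 1;
  for these \<open>pair_form n i j\<close> has an entry of at most -1 where it is needed. Giving
  each pair form its excess as weight therefore suffices, and the norm bound survives as long as the
  weights add up to at most 1. That is exactly what \<open>signless_laplacian_bound\<close>
  provides.\<close>

theorem transfer_weights:
  fixes \<mu> :: "nat \<Rightarrow> real"
  assumes n: "3 \<le> n" and \<mu>: "\<forall>i<n. 0 \<le> \<mu> i" "(\<Sum>i<n. (\<mu> i)\<^sup>2) = 1"
  shows "\<exists>t :: nat \<Rightarrow> nat \<Rightarrow> real. (\<forall>i j. i < n \<and> j < n \<and> i \<noteq> j \<longrightarrow> -1 \<le> t i j)
    \<and> (\<forall>i j. i < n \<and> j < n \<and> i \<noteq> j \<longrightarrow> t i j \<le> 1 - (\<mu> i + \<mu> j)\<^sup>2)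
    \<and> (\<forall>i<n. t i i = 0) \<and> (\<forall>x. \<bar>\<Sum>i<n. \<Sum>j<n. t i j * (x i * x j)\<bar> \<le> (\<Sum>i<n. (x i)\<^sup>2))
    \<and> (\<Sum>i<n. \<Sum>j<n. t i j) \<le> - (if n = 3 then 2 else real n)"
proof -
  \<comment> \<open>Half of the excess, because every pair occurs in both orders. The weight that is
    left over, \<open>1 - W\<close>, goes to the constant matrix \<open>T0\<close>.\<close>
  define w where "w p q = (if p = q then 0 else max 0 ((\<mu> p + \<mu> q)\<^sup>2 - 1)) / 2" for p q
  define W where "W = (\<Sum>p<n. \<Sum>q<n. w p q)"
  define T0 :: "nat \<Rightarrow> nat \<Rightarrow> real" where "T0 i j = (if i = j then 0 else - (1 / (real n - 1)))" for i j
  define t where "t i j = (\<Sum>p<n. \<Sum>q<n. w p q * pair_form n p q i j) + (1 - W) * T0 i j" for i j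
  have w: "0 \<le> w p q" "w p p = 0" "w p q = w q p" for p q by (auto simp: w_def add.commute)
  have W: "0 \<le> W" "W \<le> 1"
  proof -
    show "0 \<le> W" unfolding W_def by (intro sum_nonneg w)
    have "(\<Sum>p<n. \<Sum>q<n. if p = q then 0 else max 0 ((\<mu> p + \<mu> q)\<^sup>2 - 1)) \<le> 2"
      by (rule signless_laplacian_bound[OF _ \<mu>(2)]) (use \<mu>(1) in simp)
    then show "W \<le> 1" by (simp add: W_def w_def sum_divide_distrib[symmetric])
  qed
  have mono: "(\<Sum>p<n. \<Sum>q<n. w p q * f p q) \<le> W * M" if "\<And>p q. p < n \<Longrightarrow> q < n \<Longrightarrow> p \<noteq> q \<Longrightarrow> f p q \<le> M" for f M
  proof -
    have "(\<Sum>p<n. \<Sum>q<n. w p q * f p q) \<le> (\<Sum>p<n. \<Sum>q<n. w p q * M)"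
    proof (intro sum_mono)
      fix p q assume "p \<in> {..<n}" "q \<in> {..<n}"
      then show "w p q * f p q \<le> w p q * M"
        using that[of p q] w by (cases "p = q") (auto intro: mult_left_mono)
    qed
    then show ?thesis by (simp add: W_def sum_distrib_right)
  qed
  have T0: "0 \<le> 1 / (real n - 1)" "1 / (real n - 1) \<le> 1" using n by auto
  have sum_t: "(\<Sum>i<n. \<Sum>j<n. t i j * f i j)
    = (\<Sum>p<n. \<Sum>q<n. w p q * (\<Sum>i<n. \<Sum>j<n. pair_form n p q i j * f i j)) + (1 - W) * (\<Sum>i<n. \<Sum>j<n. T0 i j * f i j)" for f
  proof -
    have "(\<Sum>i<n. \<Sum>j<n. t i j * f i j) = (\<Sum>i<n. \<Sum>j<n. \<Sum>p<n. \<Sum>q<n. w p q * (pair_form n p q i j * f i j))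
      + (\<Sum>i<n. \<Sum>j<n. (1 - W) * (T0 i j * f i j))"
      unfolding t_def sum.distrib[symmetric]
      by (intro sum.cong refl) (simp add: distrib_right sum_distrib_right mult.assoc)
    also have "(\<Sum>i<n. \<Sum>j<n. \<Sum>p<n. \<Sum>q<n. w p q * (pair_form n p q i j * f i j))
      = (\<Sum>p<n. \<Sum>q<n. \<Sum>i<n. \<Sum>j<n. w p q * (pair_form n p q i j * f i j))" by (rule sum_pair_swap)
    finally show ?thesis by (simp add: sum_distrib_left)
  qed
  have sum_T0: "(\<Sum>i<n. \<Sum>j<n. T0 i j * (x i * x j)) = - (((\<Sum>i<n. x i)\<^sup>2 - (\<Sum>i<n. (x i)\<^sup>2)) / (real n - 1))" for x
  proof -
    have "(\<Sum>i<n. \<Sum>j<n. T0 i j * (x i * x j)) = (\<Sum>i<n. \<Sum>j<n. - ((if i = j then 0 else x i * x j) / (real n - 1)))"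
      by (intro sum.cong refl) (simp add: T0_def)
    also have "\<dots> = - ((\<Sum>i<n. \<Sum>j<n. if i = j then 0 else x i * x j) / (real n - 1))"
      by (simp only: sum_negf sum_divide_distrib)
    finally show ?thesis by (simp add: sum_off_diagonal power2_eq_square sum_product)
  qed
  show ?thesis
  proof (intro exI[of _ t] conjI allI impI)
    fix i j assume "i < n \<and> j < n \<and> i \<noteq> j"
    then have ij: "i < n" "j < n" "i \<noteq> j" by auto
    have "(\<Sum>p<n. \<Sum>q<n. w p q * (- pair_form n p q i j)) \<le> W * 1"
    proof (rule mono)
      fix p q assume "p < n" "q < n" "p \<noteq> q"
      from pair_form_bounds(4)[OF n this, of i j] show "- pair_form n p q i j \<le> 1" by linarith
    qed
    moreover have "(1 - W) * (- 1) \<le> (1 - W) * T0 i j"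
      by (rule mult_left_mono) (use T0 W in \<open>auto simp: T0_def\<close>)
    ultimately show "-1 \<le> t i j" unfolding t_def by (simp add: sum_negf)
  next
    fix i j assume "i < n \<and> j < n \<and> i \<noteq> j"
    then have ij: "i < n" "j < n" "i \<noteq> j" by auto
    have "(\<Sum>p<n. \<Sum>q<n. w p q * pair_form n p q i j) \<le> (\<Sum>p<n. \<Sum>q<n. - ((if p = i \<and> q = j then w p q else 0) + (if p = j \<and> q = i then w p q else 0)))"
    proof (intro sum_mono)
      fix p q assume "p \<in> {..<n}" "q \<in> {..<n}"
      then have pq: "p < n" "q < n" by auto
      show "w p q * pair_form n p q i j \<le> - ((if p = i \<and> q = j then w p q else 0) + (if p = j \<and> q = i then w p q else 0))"
      proof (cases "p = q")
        case True
        then show ?thesis using ij(3) w by auto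
      next
        case False
        have 1: "w p q * pair_form n p q i j \<le> w p q * 0"
          by (rule mult_left_mono[OF pair_form_bounds(3)[OF n pq False] w(1)])
        have 2: "w i j * pair_form n i j i j \<le> w i j * (-1)" "w j i * pair_form n j i i j \<le> w j i * (-1)"
          by (rule mult_left_mono[OF pair_form_bounds(5)[OF n pq False] w(1)])
             (rule mult_left_mono[OF pair_form_bounds(6)[OF n pq False] w(1)])
        show ?thesis using 1 2 ij(3) by auto
      qed
    qed
    also have "\<dots> = - (w i j + w j i)"
      unfolding sum_negf sum.distrib by (simp only: sum_single_pair[OF ij(1,2)] sum_single_pair[OF ij(2,1)])
    also have "\<dots> = - max 0 ((\<mu> i + \<mu> j)\<^sup>2 - 1)" using ij(3) by (simp add: w_def add.commute)
    finally have "(\<Sum>p<n. \<Sum>q<n. w p q * pair_form n p q i j) \<le> - max 0 ((\<mu> i + \<mu> j)\<^sup>2 - 1)" .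
    moreover have "(1 - W) * T0 i j \<le> 0"
      by (rule mult_nonneg_nonpos) (use T0 W in \<open>auto simp: T0_def\<close>)
    ultimately show "t i j \<le> 1 - (\<mu> i + \<mu> j)\<^sup>2" by (simp add: t_def)
  next
    fix i assume "i < n"
    have "w p q * pair_form n p q i i = 0" for p q by (auto simp: pair_form_def w)
    then have "(\<Sum>p<n. \<Sum>q<n. w p q * pair_form n p q i i) = 0" by (simp only: sum.neutral_const)
    then show "t i i = 0" by (simp add: t_def T0_def)
  next
    fix x :: "nat \<Rightarrow> real"
    let ?S = "\<Sum>i<n. (x i)\<^sup>2"
    have ne: "{..<n} \<noteq> {}" using n by (auto simp: lessThan_empty_iff bot_nat_def)
    have T: "\<bar>\<Sum>i<n. \<Sum>j<n. T0 i j * (x i * x j)\<bar> \<le> ?S"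
      unfolding sum_T0 using off_diagonal_form_bounds[of "{..<n}" x] ne by simp
    have P: "(\<Sum>i<n. \<Sum>j<n. pair_form n p q i j * (x i * x j)) \<le> ?S"
      "- (\<Sum>i<n. \<Sum>j<n. pair_form n p q i j * (x i * x j)) \<le> ?S" if "p < n" "q < n" "p \<noteq> q" for p q
      using pair_form_bounds(1)[OF n that, of x] by linarith+
    have u: "(\<Sum>p<n. \<Sum>q<n. w p q * (\<Sum>i<n. \<Sum>j<n. pair_form n p q i j * (x i * x j))) \<le> W * ?S"
      by (rule mono[OF P(1)])
    have "(\<Sum>p<n. \<Sum>q<n. w p q * - (\<Sum>i<n. \<Sum>j<n. pair_form n p q i j * (x i * x j))) \<le> W * ?S"
      by (rule mono[OF P(2)])
    then have l: "- (W * ?S) \<le> (\<Sum>p<n. \<Sum>q<n. w p q * (\<Sum>i<n. \<Sum>j<n. pair_form n p q i j * (x i * x j)))"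
      by (simp add: sum_negf)
    have "\<bar>(1 - W) * (\<Sum>i<n. \<Sum>j<n. T0 i j * (x i * x j))\<bar> \<le> (1 - W) * ?S"
      unfolding abs_mult using mult_left_mono[OF T, of "1 - W"] W by (simp only: abs_of_nonneg diff_ge_0_iff_ge)
    moreover have "W * ?S + (1 - W) * ?S = ?S" by (simp add: algebra_simps)
    ultimately show "\<bar>\<Sum>i<n. \<Sum>j<n. t i j * (x i * x j)\<bar> \<le> ?S"
      unfolding sum_t using u l by linarith
  next
    let ?m = "- (if n = 3 then 2 else real n)"
    have "(\<Sum>i<n. \<Sum>j<n. T0 i j) = - (((real n)\<^sup>2 - real n) / (real n - 1))" using sum_T0[of "\<lambda>_. 1"] by simp
    also have "\<dots> = - real n" using n by (simp add: power2_eq_square field_simps)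
    finally have "(\<Sum>i<n. \<Sum>j<n. T0 i j) \<le> ?m" by simp
    then have "(1 - W) * (\<Sum>i<n. \<Sum>j<n. T0 i j) \<le> (1 - W) * ?m" by (rule mult_left_mono) (use W in simp)
    moreover have "(\<Sum>p<n. \<Sum>q<n. w p q * (\<Sum>i<n. \<Sum>j<n. pair_form n p q i j)) \<le> W * ?m"
      by (rule mono[OF pair_form_bounds(2)[OF n]])
    moreover have "W * ?m + (1 - W) * ?m = ?m" by (simp add: algebra_simps)
    ultimately show "(\<Sum>i<n. \<Sum>j<n. t i j) \<le> ?m"
      using sum_t[of "\<lambda>_ _. 1"] by simp
  qed
qed

text \<open>\<open>r\<close> and \<open>s\<close> hold the real and imaginary matrix entries of the
  eigenvectors in a Takagi frame, and \<mu> the singular values. The expression is changed into one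
  with coefficients between 0 and 2 by trading diagonal products for off-diagonal squares as
  prescribed by \<open>t\<close>; the weighted total is the same by the Bianchi identity.\<close>

theorem symmetric_part_pos:
  fixes \<mu> :: "nat \<Rightarrow> real" and r s :: "nat \<Rightarrow> nat \<Rightarrow> nat \<Rightarrow> real"
  assumes n: "3 \<le> n" and \<mu>: "\<And>i. i < n \<Longrightarrow> 0 \<le> \<mu> i" "(\<Sum>i<n. (\<mu> i)\<^sup>2) = 1"
    and ls: "sorted ls" "(\<Sum>a<K. ls ! a) > 0"
    and K: "2 * real K \<le> (real n)\<^sup>2 - 2 * real n + 2 + (if n = 3 then 2 else real n)"
    and norm: "\<And>a. a < length ls \<Longrightarrow> (\<Sum>i<n. \<Sum>j<n. (r a i j)\<^sup>2 + (s a i j)\<^sup>2) = 1"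
    and r0: "\<And>a i. a < length ls \<Longrightarrow> i < n \<Longrightarrow> r a i i = 0"
    and trace: "\<And>i j. i < n \<Longrightarrow> j < n \<Longrightarrow> i \<noteq> j \<Longrightarrow> (\<Sum>a<length ls. (r a i j)\<^sup>2) = 1 / 2"
      "\<And>i j. i < n \<Longrightarrow> j < n \<Longrightarrow> i \<noteq> j \<Longrightarrow> (\<Sum>a<length ls. (s a i j)\<^sup>2) = 1 / 2"
      "\<And>i. i < n \<Longrightarrow> (\<Sum>a<length ls. (s a i i)\<^sup>2) = 1"
      "\<And>i j. i < n \<Longrightarrow> j < n \<Longrightarrow> i \<noteq> j \<Longrightarrow> (\<Sum>a<length ls. s a i i * s a j j) = 0"
    and bianchi: "\<And>i j. i < n \<Longrightarrow> j < n \<Longrightarrow> i \<noteq> j \<Longrightarrow>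
      (\<Sum>a<length ls. ls ! a * (s a i i * s a j j)) = (\<Sum>a<length ls. ls ! a * ((r a i j)\<^sup>2 + (s a i j)\<^sup>2))"
  shows "(\<Sum>a<length ls. ls ! a * ((\<Sum>i<n. (\<mu> i)\<^sup>2 * ((\<Sum>j<n. s a j j) - 2 * s a i i)\<^sup>2)
    + (\<Sum>i<n. \<Sum>j<n. if i = j then 0 else (\<mu> i - \<mu> j)\<^sup>2 * (r a i j)\<^sup>2 + (\<mu> i + \<mu> j)\<^sup>2 * (s a i j)\<^sup>2))) > 0"
proof -
  let ?m = "length ls"
  have "\<forall>i<n. 0 \<le> \<mu> i" using \<mu>(1) by simp
  from transfer_weights[OF n this \<mu>(2)]
  obtain t :: "nat \<Rightarrow> nat \<Rightarrow> real" where
    "\<forall>i j. i < n \<and> j < n \<and> i \<noteq> j \<longrightarrow> -1 \<le> t i j"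
    "\<forall>i j. i < n \<and> j < n \<and> i \<noteq> j \<longrightarrow> t i j \<le> 1 - (\<mu> i + \<mu> j)\<^sup>2"
    "\<forall>i<n. t i i = 0" "\<forall>x. \<bar>\<Sum>i<n. \<Sum>j<n. t i j * (x i * x j)\<bar> \<le> (\<Sum>i<n. (x i)\<^sup>2)"
    "(\<Sum>i<n. \<Sum>j<n. t i j) \<le> - (if n = 3 then 2 else real n)"
    by (elim exE conjE) (rule that)
  then have t: "\<And>i j. i < n \<Longrightarrow> j < n \<Longrightarrow> i \<noteq> j \<Longrightarrow> -1 \<le> t i j"
    "\<And>i j. i < n \<Longrightarrow> j < n \<Longrightarrow> i \<noteq> j \<Longrightarrow> t i j \<le> 1 - (\<mu> i + \<mu> j)\<^sup>2"
    "\<And>i. i < n \<Longrightarrow> t i i = 0"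
    "\<And>x. \<bar>\<Sum>i<n. \<Sum>j<n. t i j * (x i * x j)\<bar> \<le> (\<Sum>i<n. (x i)\<^sup>2)"
    "(\<Sum>i<n. \<Sum>j<n. t i j) \<le> - (if n = 3 then 2 else real n)"
    by simp_all
  \<comment> \<open>Expanding the squares gives the product of the diagonal entries \<open>i\<close>
    and \<open>j\<close>, after symmetrization, the coefficient
    \<open>1 - 2 * (\<mu> i)\<^sup>2 - 2 * (\<mu> j)\<^sup>2\<close>. Keeping \<open>t i j\<close>
    of it and trading the rest turns the coefficients of the squares into \<open>cr\<close> and
    \<open>cs\<close>.\<close>
  define cr where "cr i j = 1 - (\<mu> i + \<mu> j)\<^sup>2 - t i j" for i j
  define cs where "cs i j = 1 - (\<mu> i - \<mu> j)\<^sup>2 - t i j" for i j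
  define v where "v a = (\<Sum>i<n. (s a i i)\<^sup>2) + (\<Sum>i<n. \<Sum>j<n. t i j * (s a i i * s a j j))
    + (\<Sum>i<n. \<Sum>j<n. if i = j then 0 else cr i j * (r a i j)\<^sup>2 + cs i j * (s a i j)\<^sup>2)" for a
  define q where "q a = (\<Sum>i<n. (\<mu> i)\<^sup>2 * ((\<Sum>j<n. s a j j) - 2 * s a i i)\<^sup>2)
    + (\<Sum>i<n. \<Sum>j<n. if i = j then 0 else (\<mu> i - \<mu> j)\<^sup>2 * (r a i j)\<^sup>2 + (\<mu> i + \<mu> j)\<^sup>2 * (s a i j)\<^sup>2)" for a
  have c: "0 \<le> cr i j" "cr i j \<le> 2" "0 \<le> cs i j" "cs i j \<le> 2" if ij: "i < n" "j < n" "i \<noteq> j" for i j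
  proof -
    have "0 \<le> \<mu> i * \<mu> j" using \<mu>(1) ij by simp
    then have "(\<mu> i - \<mu> j)\<^sup>2 \<le> (\<mu> i + \<mu> j)\<^sup>2" by (simp add: power2_eq_square algebra_simps)
    moreover have "0 \<le> (\<mu> i - \<mu> j)\<^sup>2" by simp
    ultimately show "0 \<le> cr i j" "cr i j \<le> 2" "0 \<le> cs i j" "cs i j \<le> 2"
      using t(1,2)[OF ij] unfolding cr_def cs_def by linarith+
  qed
  have nrm: "(\<Sum>i<n. (s a i i)\<^sup>2) + (\<Sum>i<n. \<Sum>j<n. if i = j then 0 else (r a i j)\<^sup>2 + (s a i j)\<^sup>2) = 1"
    if a: "a < ?m" for a
  proof -
    have "(\<Sum>i<n. (r a i i)\<^sup>2 + (s a i i)\<^sup>2) = (\<Sum>i<n. (s a i i)\<^sup>2)"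
      by (rule sum.cong[OF refl]) (simp add: r0[OF a])
    then show ?thesis
      using sum_off_diagonal[of "{..<n}" "\<lambda>i j. (r a i j)\<^sup>2 + (s a i j)\<^sup>2"] norm[OF a] by simp
  qed
  \<comment> \<open>On the diagonal entries \<open>v\<close> is the identity plus a form of norm at
    most 1, hence between 0 and twice the identity. Off the diagonal the coefficients lie in [0, 2],
    and eigenvectors have norm 1.\<close>
  have v: "0 \<le> v a" "v a \<le> 2" if a: "a < ?m" for a
  proof -
    have "0 \<le> (\<Sum>i<n. \<Sum>j<n. if i = j then 0 else cr i j * (r a i j)\<^sup>2 + cs i j * (s a i j)\<^sup>2)"
      by (intro sum_nonneg) (auto intro!: add_nonneg_nonneg mult_nonneg_nonneg c)
    then show "0 \<le> v a" using t(4)[of "\<lambda>i. s a i i"] unfolding v_def by linarith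
    have "(\<Sum>i<n. \<Sum>j<n. if i = j then 0 else cr i j * (r a i j)\<^sup>2 + cs i j * (s a i j)\<^sup>2)
      \<le> (\<Sum>i<n. \<Sum>j<n. 2 * (if i = j then 0 else (r a i j)\<^sup>2 + (s a i j)\<^sup>2))"
    proof (intro sum_mono)
      fix i j assume "i \<in> {..<n}" "j \<in> {..<n}"
      then have ij: "i < n" "j < n" by auto
      show "(if i = j then 0 else cr i j * (r a i j)\<^sup>2 + cs i j * (s a i j)\<^sup>2)
        \<le> 2 * (if i = j then 0 else (r a i j)\<^sup>2 + (s a i j)\<^sup>2)"
      proof (cases "i = j")
        case False
        have "cr i j * (r a i j)\<^sup>2 \<le> 2 * (r a i j)\<^sup>2" "cs i j * (s a i j)\<^sup>2 \<le> 2 * (s a i j)\<^sup>2"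
          by (intro mult_right_mono c[OF ij False] zero_le_power2)+
        then show ?thesis using False by simp
      qed simp
    qed
    also have "\<dots> = 2 * (\<Sum>i<n. \<Sum>j<n. if i = j then 0 else (r a i j)\<^sup>2 + (s a i j)\<^sup>2)"
      by (simp only: sum_distrib_left)
    finally show "v a \<le> 2" using t(4)[of "\<lambda>i. s a i i"] nrm[OF a] unfolding v_def by linarith
  qed
  \<comment> \<open>Products of different diagonal entries sum to zero, so \<open>t\<close> enters
    only through \<open>cr\<close> and \<open>cs\<close>. The total is
    \<open>n\<^sup>2 - 2 * n + 2\<close> minus the sum of all \<open>t i j\<close>.\<close>
  have sum_v: "(\<Sum>a<?m. v a) \<ge> 2 * real K"
  proof -
    have "(\<Sum>a<?m. \<Sum>i<n. (s a i i)\<^sup>2) = (\<Sum>i<n. 1)"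
      by (rule trans[OF sum.swap], rule sum.cong[OF refl]) (simp add: trace)
    then have 1: "(\<Sum>a<?m. \<Sum>i<n. (s a i i)\<^sup>2) = real n" by simp
    have "(\<Sum>a<?m. \<Sum>i<n. \<Sum>j<n. t i j * (s a i i * s a j j)) = (\<Sum>i<n. \<Sum>j<n. \<Sum>a<?m. t i j * (s a i i * s a j j))"
      by (rule trans[OF sum.swap], rule sum.cong[OF refl], rule sum.swap)
    also have "\<dots> = (\<Sum>i<n. \<Sum>j<n. 0)"
    proof (intro sum.cong refl)
      fix i j assume "i \<in> {..<n}" "j \<in> {..<n}"
      then show "(\<Sum>a<?m. t i j * (s a i i * s a j j)) = 0"
        using t(3)[of i] trace(4)[of i j] by (cases "i = j") (simp_all add: sum_distrib_left[symmetric])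
    qed
    finally have 2: "(\<Sum>a<?m. \<Sum>i<n. \<Sum>j<n. t i j * (s a i i * s a j j)) = 0" by simp
    have "(\<Sum>a<?m. \<Sum>i<n. \<Sum>j<n. if i = j then 0 else cr i j * (r a i j)\<^sup>2 + cs i j * (s a i j)\<^sup>2)
      = (\<Sum>i<n. \<Sum>j<n. \<Sum>a<?m. if i = j then 0 else cr i j * (r a i j)\<^sup>2 + cs i j * (s a i j)\<^sup>2)"
      by (rule trans[OF sum.swap], rule sum.cong[OF refl], rule sum.swap)
    also have "\<dots> = (\<Sum>i<n. \<Sum>j<n. if i = j then 0 else 1 - (\<mu> i)\<^sup>2 - (\<mu> j)\<^sup>2 - t i j)"
    proof (intro sum.cong refl)
      fix i j assume "i \<in> {..<n}" "j \<in> {..<n}"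
      then have ij: "i < n" "j < n" by auto
      show "(\<Sum>a<?m. if i = j then 0 else cr i j * (r a i j)\<^sup>2 + cs i j * (s a i j)\<^sup>2)
        = (if i = j then 0 else 1 - (\<mu> i)\<^sup>2 - (\<mu> j)\<^sup>2 - t i j)"
      proof (cases "i = j")
        case False
        have "(\<Sum>a<?m. cr i j * (r a i j)\<^sup>2 + cs i j * (s a i j)\<^sup>2) = cr i j * (1 / 2) + cs i j * (1 / 2)"
          by (simp only: sum.distrib sum_distrib_left[symmetric] trace(1,2)[OF ij False])
        also have "\<dots> = 1 - (\<mu> i)\<^sup>2 - (\<mu> j)\<^sup>2 - t i j" by (simp add: cr_def cs_def power2_eq_square field_simps)
        finally show ?thesis using False by simp
      qed simp
    qed
    also have "\<dots> = (\<Sum>i<n. \<Sum>j<n. 1 - (\<mu> i)\<^sup>2 - (\<mu> j)\<^sup>2 - t i j) - (\<Sum>i<n. 1 - (\<mu> i)\<^sup>2 - (\<mu> i)\<^sup>2 - t i i)"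
      by (simp only: sum_off_diagonal finite_lessThan)
    also have "\<dots> = (real n)\<^sup>2 - real n - real n - (\<Sum>i<n. \<Sum>j<n. t i j) - (real n - 2)"
    proof -
      have "(\<Sum>i<n. \<Sum>j<n. 1 - (\<mu> i)\<^sup>2 - (\<mu> j)\<^sup>2 - t i j) = (real n)\<^sup>2 - real n - real n - (\<Sum>i<n. \<Sum>j<n. t i j)"
        by (simp only: sum_subtractf sum_constant card_lessThan sum_distrib_left[symmetric] \<mu>(2)) (simp add: \<mu>(2) algebra_simps power2_eq_square[of "real n"])
      moreover have "(\<Sum>i<n. 1 - (\<mu> i)\<^sup>2 - (\<mu> i)\<^sup>2 - t i i) = real n - 2"
        using t(3) by (simp add: sum_subtractf sum_distrib_left[symmetric] \<mu>(2))
      ultimately show ?thesis by simp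
    qed
    finally have 3: "(\<Sum>a<?m. \<Sum>i<n. \<Sum>j<n. if i = j then 0 else cr i j * (r a i j)\<^sup>2 + cs i j * (s a i j)\<^sup>2)
      = (real n)\<^sup>2 - real n - real n - (\<Sum>i<n. \<Sum>j<n. t i j) - (real n - 2)" .
    have "(\<Sum>a<?m. v a) = real n + ((real n)\<^sup>2 - real n - real n - (\<Sum>i<n. \<Sum>j<n. t i j) - (real n - 2))"
      unfolding v_def sum.distrib 1 2 3 by simp
    then show ?thesis using t(5) K by linarith
  qed
  have "0 < (\<Sum>a<?m. ls ! a * v a)"
    by (rule weighted_sum_pos[OF ls, of v 2]) (use v sum_v in auto)
  also have "(\<Sum>a<?m. ls ! a * v a) = (\<Sum>a<?m. ls ! a * q a)"
  proof -
    define B where "B i j = (\<Sum>a<?m. ls ! a * (s a i i * s a j j))" for i j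
    define R where "R i j = (\<Sum>a<?m. ls ! a * (r a i j)\<^sup>2)" for i j
    define S where "S i j = (\<Sum>a<?m. ls ! a * (s a i j)\<^sup>2)" for i j
    have BRS: "B i j = R i j + S i j" if "i < n" "j < n" "i \<noteq> j" for i j
      using bianchi[OF that] by (simp add: B_def R_def S_def sum.distrib distrib_left)
    have Bsym: "B i j = B j i" for i j by (simp add: B_def mult.commute)
    have sw: "(\<Sum>a<?m. ls ! a * (\<Sum>i<n. \<Sum>j<n. f a i j)) = (\<Sum>i<n. \<Sum>j<n. \<Sum>a<?m. ls ! a * f a i j)" for f
      unfolding sum_distrib_left by (rule trans[OF sum.swap], rule sum.cong[OF refl], rule sum.swap)
    have off: "(\<Sum>a<?m. ls ! a * (\<Sum>i<n. \<Sum>j<n. if i = j then 0 else x i j * (r a i j)\<^sup>2 + y i j * (s a i j)\<^sup>2))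
      = (\<Sum>i<n. \<Sum>j<n. if i = j then 0 else x i j * R i j + y i j * S i j)" for x y
      unfolding sw
    proof (intro sum.cong refl)
      fix i j
      show "(\<Sum>a<?m. ls ! a * (if i = j then 0 else x i j * (r a i j)\<^sup>2 + y i j * (s a i j)\<^sup>2))
        = (if i = j then 0 else x i j * R i j + y i j * S i j)"
        by (cases "i = j") (simp_all add: R_def S_def sum_distrib_left sum.distrib distrib_left algebra_simps)
    qed
    have diag: "(\<Sum>a<?m. ls ! a * (\<Sum>i<n. (s a i i)\<^sup>2)) = (\<Sum>i<n. B i i)"
      unfolding sum_distrib_left by (rule trans[OF sum.swap]) (simp add: B_def power2_eq_square)
    have "(\<Sum>a<?m. ls ! a * v a) = (\<Sum>i<n. B i i) + (\<Sum>i<n. \<Sum>j<n. t i j * B i j)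
      + (\<Sum>i<n. \<Sum>j<n. if i = j then 0 else cr i j * R i j + cs i j * S i j)"
    proof -
      have "(\<Sum>a<?m. ls ! a * (\<Sum>i<n. \<Sum>j<n. t i j * (s a i i * s a j j))) = (\<Sum>i<n. \<Sum>j<n. t i j * B i j)"
        unfolding sw by (simp add: B_def sum_distrib_left algebra_simps)
      then show ?thesis by (simp only: v_def distrib_left sum.distrib diag off)
    qed
    also have "\<dots> = (\<Sum>i<n. B i i) + ((\<Sum>i<n. \<Sum>j<n. if i = j then 0 else t i j * B i j)
      + (\<Sum>i<n. \<Sum>j<n. if i = j then 0 else cr i j * R i j + cs i j * S i j))"
    proof -
      have "(\<Sum>i<n. t i i * B i i) = 0" by (rule sum.neutral) (use t(3) in auto)
      then show ?thesis by (simp only: sum_off_diagonal finite_lessThan)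
    qed
    \<comment> \<open>By \<open>BRS\<close> the contribution of \<open>t\<close> cancels between the
      diagonal and the off-diagonal terms.\<close>
    also have "\<dots> = (\<Sum>i<n. B i i) + ((\<Sum>i<n. \<Sum>j<n. if i = j then 0 else (1 - 2 * (\<mu> i)\<^sup>2 - 2 * (\<mu> j)\<^sup>2) * B i j)
      + (\<Sum>i<n. \<Sum>j<n. if i = j then 0 else (\<mu> i - \<mu> j)\<^sup>2 * R i j + (\<mu> i + \<mu> j)\<^sup>2 * S i j))"
    proof -
      have "(\<Sum>i<n. \<Sum>j<n. (if i = j then 0 else t i j * B i j) + (if i = j then 0 else cr i j * R i j + cs i j * S i j))
        = (\<Sum>i<n. \<Sum>j<n. (if i = j then 0 else (1 - 2 * (\<mu> i)\<^sup>2 - 2 * (\<mu> j)\<^sup>2) * B i j)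
          + (if i = j then 0 else (\<mu> i - \<mu> j)\<^sup>2 * R i j + (\<mu> i + \<mu> j)\<^sup>2 * S i j))"
      proof (intro sum.cong refl)
        fix i j assume "i \<in> {..<n}" "j \<in> {..<n}"
        then show "(if i = j then 0 else t i j * B i j) + (if i = j then 0 else cr i j * R i j + cs i j * S i j)
          = (if i = j then 0 else (1 - 2 * (\<mu> i)\<^sup>2 - 2 * (\<mu> j)\<^sup>2) * B i j)
            + (if i = j then 0 else (\<mu> i - \<mu> j)\<^sup>2 * R i j + (\<mu> i + \<mu> j)\<^sup>2 * S i j)"
          using BRS[of i j] by (cases "i = j") (simp_all add: cr_def cs_def power2_eq_square algebra_simps)
      qed
      then show ?thesis by (simp only: sum.distrib)
    qed
    also have "\<dots> = (\<Sum>a<?m. ls ! a * q a)"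
    proof -
      have ex: "(\<Sum>i<n. (\<mu> i)\<^sup>2 * ((\<Sum>j<n. s a j j) - 2 * s a i i)\<^sup>2)
        = (\<Sum>i<n. \<Sum>j<n. (1 - 4 * (\<mu> i)\<^sup>2) * (s a i i * s a j j)) + 4 * (\<Sum>i<n. (\<mu> i)\<^sup>2 * (s a i i)\<^sup>2)" for a
      proof -
        let ?T = "\<Sum>j<n. s a j j"
        have "(\<mu> i)\<^sup>2 * (?T - 2 * s a i i)\<^sup>2 = (\<mu> i)\<^sup>2 * ?T\<^sup>2 - 4 * (\<mu> i)\<^sup>2 * (s a i i * ?T) + 4 * ((\<mu> i)\<^sup>2 * (s a i i)\<^sup>2)" for i
          by (simp add: power2_eq_square algebra_simps)
        then have "(\<Sum>i<n. (\<mu> i)\<^sup>2 * (?T - 2 * s a i i)\<^sup>2)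
          = (\<Sum>i<n. (\<mu> i)\<^sup>2) * ?T\<^sup>2 - (\<Sum>i<n. 4 * (\<mu> i)\<^sup>2 * (s a i i * ?T)) + 4 * (\<Sum>i<n. (\<mu> i)\<^sup>2 * (s a i i)\<^sup>2)"
          by (simp only: sum.distrib sum_subtractf sum_distrib_left sum_distrib_right)
        also have "(\<Sum>i<n. (\<mu> i)\<^sup>2) * ?T\<^sup>2 = (\<Sum>i<n. s a i i * ?T)"
          unfolding \<mu>(2) by (simp add: power2_eq_square sum_distrib_right)
        also have "(\<Sum>i<n. s a i i * ?T) - (\<Sum>i<n. 4 * (\<mu> i)\<^sup>2 * (s a i i * ?T))
          = (\<Sum>i<n. \<Sum>j<n. (1 - 4 * (\<mu> i)\<^sup>2) * (s a i i * s a j j))"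
          unfolding sum_subtractf[symmetric] by (intro sum.cong refl) (simp add: sum_distrib_left sum_subtractf algebra_simps)
        finally show ?thesis .
      qed
      have "(\<Sum>a<?m. ls ! a * (\<Sum>i<n. (\<mu> i)\<^sup>2 * ((\<Sum>j<n. s a j j) - 2 * s a i i)\<^sup>2))
        = (\<Sum>i<n. \<Sum>j<n. (1 - 4 * (\<mu> i)\<^sup>2) * B i j) + (\<Sum>a<?m. ls ! a * (4 * (\<Sum>i<n. (\<mu> i)\<^sup>2 * (s a i i)\<^sup>2)))"
        unfolding ex distrib_left sum.distrib sw by (simp add: B_def sum_distrib_left algebra_simps)
      also have "(\<Sum>a<?m. ls ! a * (4 * (\<Sum>i<n. (\<mu> i)\<^sup>2 * (s a i i)\<^sup>2))) = (\<Sum>i<n. 4 * (\<mu> i)\<^sup>2 * B i i)"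
        unfolding sum_distrib_left by (rule trans[OF sum.swap]) (simp add: B_def sum_distrib_left power2_eq_square algebra_simps)
      also have "(\<Sum>i<n. \<Sum>j<n. (1 - 4 * (\<mu> i)\<^sup>2) * B i j) + \<dots>
        = (\<Sum>i<n. \<Sum>j<n. if i = j then 0 else (1 - 4 * (\<mu> i)\<^sup>2) * B i j) + (\<Sum>i<n. B i i)"
        by (simp add: sum_off_diagonal sum.distrib[symmetric] left_diff_distrib sum_subtractf)
      also have "(\<Sum>i<n. \<Sum>j<n. if i = j then 0 else (1 - 4 * (\<mu> i)\<^sup>2) * B i j)
        = (\<Sum>i<n. \<Sum>j<n. if i = j then 0 else (1 - 2 * (\<mu> i)\<^sup>2 - 2 * (\<mu> j)\<^sup>2) * B i j)"
      proof -
        let ?f = "\<lambda>i j. if i = j then 0 else (1 - 4 * (\<mu> i)\<^sup>2) * B i j"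
        have "(\<Sum>i<n. \<Sum>j<n. ?f i j) = (\<Sum>i<n. \<Sum>j<n. ?f j i)" by (rule sum.swap)
        then have "(\<Sum>i<n. \<Sum>j<n. ?f i j) = ((\<Sum>i<n. \<Sum>j<n. ?f i j) + (\<Sum>i<n. \<Sum>j<n. ?f j i)) / 2" by simp
        also have "\<dots> = (\<Sum>i<n. \<Sum>j<n. (?f i j + ?f j i) / 2)"
          by (simp only: sum.distrib sum_divide_distrib add_divide_distrib)
        also have "\<dots> = (\<Sum>i<n. \<Sum>j<n. if i = j then 0 else (1 - 2 * (\<mu> i)\<^sup>2 - 2 * (\<mu> j)\<^sup>2) * B i j)"
          by (intro sum.cong refl) (auto simp: Bsym[of _ _] field_simps)
        finally show ?thesis .
      qed
      finally show ?thesis by (simp only: q_def distrib_left sum.distrib off)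
    qed
    finally show ?thesis .
  qed
  finally show ?thesis by (simp add: q_def)
qed

subsection \<open>The curvature term in a spectral frame\<close>

text \<open>The conclusions of \<open>curvature_spectral\<close>, so that the following arguments
  use an eigenframe through its algebraic relations only.\<close>

locale kahler_spectral = kahler_point S g x for S :: "(complex ^ 'n::finite) set" and g x +
  fixes \<Xi> :: "nat \<Rightarrow> complex ^ 'n \<Rightarrow> complex ^ 'n" and ls :: "real list"
  assumes sorted_ls: "sorted ls"
    and Xi_linear: "\<And>a. linear (\<Xi> a)"
    and Xi_skew: "\<And>a u v. a < length ls \<Longrightarrow> b (\<Xi> a u) v = - b u (\<Xi> a v)"
    and Xi_J: "\<And>a v. a < length ls \<Longrightarrow> \<Xi> a (J v) = J (\<Xi> a v)"
    and Xi_norm: "\<And>a e. a < length ls \<Longrightarrow> unitary_frame b CARD('n) e \<Longrightarrow> (\<Sum>j<CARD('n). b (\<Xi> a (e j)) (\<Xi> a (e j))) = 1"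
    and riem_Xi: "\<And>u v z w. riem g x u v z w = (\<Sum>a<length ls. ls ! a * (b (\<Xi> a u) v * b (\<Xi> a z) w))"
    and Xi_trace: "\<And>u v z w. (\<Sum>a<length ls. b (\<Xi> a u) v * b (\<Xi> a z) w)
      = (b u z * b v w - b v z * b u w + b (J u) z * b (J v) w - b (J v) z * b (J u) w) / 2"

section \<open>Bianchi, Ricci and Casimir identities\<close>

context kahler_point
begin

text \<open>The Bianchi identity for \<open>u\<close>, \<open>J u\<close>, \<open>J w\<close>,
  simplified by invariance under \<open>J\<close>. With \<open>z = w\<close> it is the splitting of
  bisectional curvature that permits the trading of terms in the symmetric part; summed over a frame
  it gives \<open>ricci_identity\<close>.\<close>

lemma riem_holomorphic: "riem g x u (J u) z (J w) = riem g x z u w u + riem g x z (J u) w (J u)"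
proof -
  have 1: "riem g x u (J u) z (J w) + riem g x (J u) (J w) z u + riem g x (J w) u z (J u) = 0"
    by (rule riem_bianchi[OF x])
  have "riem g x (J u) (J w) z u = riem g x u w z u" by (rule riem_J(2)[OF x])
  also have "\<dots> = - riem g x w u z u" by (rule riem_antisym(1)[OF x])
  also have "riem g x w u z u = riem g x z u w u" by (rule riem_pair_sym[OF x])
  finally have 2: "riem g x (J u) (J w) z u = - riem g x z u w u" .
  have "riem g x (J w) u z (J u) = riem g x (J (J w)) (J u) z (J u)" by (rule riem_J(2)[OF x, symmetric])
  also have "\<dots> = - riem g x w (J u) z (J u)" by (simp add: linear_neg[OF riem_lin(1)])
  also have "riem g x w (J u) z (J u) = riem g x z (J u) w (J u)" by (rule riem_pair_sym[OF x])
  finally show ?thesis using 1 2 by simp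
qed

lemma unitary_parseval:
  assumes e: "unitary_frame b CARD('n) e"
  shows "b u v = (\<Sum>i<CARD('n). b u (e i) * b v (e i) + b u (J (e i)) * b v (J (e i)))"
proof -
  have ex: "u = (\<Sum>i<CARD('n). b u (e i) *\<^sub>R e i + b u (J (e i)) *\<^sub>R J (e i))"
    using e unfolding unitary_frame_def by blast
  have "b v u = (\<Sum>i<CARD('n). b u (e i) * b v (e i) + b u (J (e i)) * b v (J (e i)))"
    using arg_cong[OF ex, of "b v"] by (simp only: linear_sum[OF b_lin] linear_add[OF b_lin] linear_cmul[OF b_lin] real_scaleR_def)
  then show ?thesis by (simp only: b_sym[of u v])
qed

lemma unitary_frameD:
  assumes e: "unitary_frame b CARD('n) e" and ij: "i < CARD('n)" "j < CARD('n)"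
  shows "b (e i) (e j) = (if i = j then 1 else 0)" "b (e i) (J (e j)) = 0" "b (J (e i)) (e j) = 0"
    "b (J (e i)) (J (e j)) = (if i = j then 1 else 0)"
  using e ij b_sym[of "J (e i)" "e j"] unfolding unitary_frame_def by (auto simp: b_J)

lemma frame_trace_adjoint:
  assumes \<beta>: "\<And>u. linear (\<beta> u)" "\<And>v. linear (\<lambda>u. \<beta> u v)" and A: "\<And>u v. b (A u) v = b u (B v)"
  shows "(\<Sum>i<2 * CARD('n). \<beta> (A (F i)) (F i)) = (\<Sum>i<2 * CARD('n). \<beta> (F i) (B (F i)) :: real)"
proof -
  have AB: "b (A u) v = b (B v) u" for u v using A[of u v] b_sym[of u "B v"] by simp
  have "(\<Sum>i<2 * CARD('n). \<beta> (A (F i)) (F i)) = (\<Sum>i<2 * CARD('n). \<Sum>k<2 * CARD('n). b (A (F i)) (F k) * \<beta> (F k) (F i))"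
    by (rule sum.cong[OF refl]) (simp only: F_linear[OF \<beta>(2), of "A _"] real_scaleR_def)
  also have "\<dots> = (\<Sum>k<2 * CARD('n). \<Sum>i<2 * CARD('n). b (B (F k)) (F i) * \<beta> (F k) (F i))"
    by (rule trans[OF sum.swap]) (simp only: AB)
  also have "\<dots> = (\<Sum>k<2 * CARD('n). \<beta> (F k) (B (F k)))"
    by (rule sum.cong[OF refl]) (simp only: F_linear[OF \<beta>(1), of _ "B _"] real_scaleR_def)
  finally show ?thesis .
qed

end

context kahler_spectral
begin

text \<open>Two expressions for the Ricci tensor: as complex trace of the curvature, and as its
  ordinary contraction.\<close>

lemma ricci_identity:
  assumes e: "unitary_frame b CARD('n) e"
  shows "(\<Sum>a<length ls. ls ! a * (tau e (\<Xi> a) * b (\<Xi> a u) (J v))) = (\<Sum>a<length ls. ls ! a * b (\<Xi> a u) (\<Xi> a v))"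
proof -
  have "(\<Sum>a<length ls. ls ! a * (b (\<Xi> a (e j)) (J (e j)) * b (\<Xi> a u) (J v)))
    = (\<Sum>a<length ls. ls ! a * (b (\<Xi> a u) (e j) * b (\<Xi> a v) (e j) + b (\<Xi> a u) (J (e j)) * b (\<Xi> a v) (J (e j))))" for j
    using riem_holomorphic[of "e j" u v] by (simp add: riem_Xi sum.distrib distrib_left)
  then have "(\<Sum>j<CARD('n). \<Sum>a<length ls. ls ! a * (b (\<Xi> a (e j)) (J (e j)) * b (\<Xi> a u) (J v)))
    = (\<Sum>j<CARD('n). \<Sum>a<length ls. ls ! a * (b (\<Xi> a u) (e j) * b (\<Xi> a v) (e j) + b (\<Xi> a u) (J (e j)) * b (\<Xi> a v) (J (e j))))"
    by (simp only:)
  then have "(\<Sum>a<length ls. \<Sum>j<CARD('n). ls ! a * (b (\<Xi> a (e j)) (J (e j)) * b (\<Xi> a u) (J v)))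
    = (\<Sum>a<length ls. \<Sum>j<CARD('n). ls ! a * (b (\<Xi> a u) (e j) * b (\<Xi> a v) (e j) + b (\<Xi> a u) (J (e j)) * b (\<Xi> a v) (J (e j))))"
    by (subst (1 2) sum.swap)
  then show ?thesis
    by (simp only: unitary_parseval[OF e, of "\<Xi> _ u" "\<Xi> _ v"] tau_def sum_distrib_left sum_distrib_right)
qed

text \<open>The Ricci contraction with every eigenvalue set to 1, in other words the Casimir
  operator of the unitary Lie algebra on its standard representation.\<close>

lemma casimir: "(\<Sum>a<length ls. b (\<Xi> a u) (\<Xi> a v)) = CARD('n) * b u v"
proof -
  have "(\<Sum>a<length ls. b (\<Xi> a u) (\<Xi> a v)) = (\<Sum>a<length ls. \<Sum>i<2 * CARD('n). b (\<Xi> a u) (F i) * b (\<Xi> a v) (F i))"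
    by (simp only: b_F_inner[of "\<Xi> _ u" "\<Xi> _ v"])
  also have "\<dots> = (\<Sum>i<2 * CARD('n). (b u v * b (F i) (F i) - b (F i) v * b u (F i) + b (J u) v * b (J (F i)) (F i) - b (J (F i)) v * b (J u) (F i)) / 2)"
    by (rule trans[OF sum.swap]) (simp only: Xi_trace)
  also have "\<dots> = (b u v * (\<Sum>i<2 * CARD('n). b (F i) (F i)) - (\<Sum>i<2 * CARD('n). b u (F i) * b v (F i)) + (\<Sum>i<2 * CARD('n). b (J u) (F i) * b (J v) (F i))) / 2"
  proof -
    have "b (J w) w = 0" for w using b_J_left[of w w] b_sym[of w "J w"] by simp
    moreover have "b (J (F i)) v = - b (J v) (F i)" for i using b_J_left[of "F i" v] b_sym by simp
    ultimately show ?thesis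
      by (simp add: sum_divide_distrib[symmetric] sum.distrib sum_subtractf sum_distrib_left b_sym[of _ v] algebra_simps)
  qed
  also have "(\<Sum>i<2 * CARD('n). b (F i) (F i)) = 2 * CARD('n)"
    using unitary_frameD(1,4)[OF unitary_frame_frame] by (simp add: sum_F[of "\<lambda>v. b v v"])
  finally show ?thesis by (simp add: b_F_inner[symmetric] b_J)
qed

text \<open>\<open>K\<close> has eigenvalue \<open>\<mu> j\<close> on \<open>e j\<close> and the
  negative on \<open>J (e j)\<close>. The commutator therefore multiplies real entries by
  differences and imaginary entries by sums; the trace term reaches only imaginary diagonal
  entries.\<close>

lemma curv_map_symmetric_components:
  assumes e: "unitary_frame b CARD('n) e" and a: "a < length ls"
    and K: "\<And>v. K (J v) = - J (K v)" "\<And>u v. b (K u) v = b u (K v)"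
    and \<mu>: "\<And>j. j < CARD('n) \<Longrightarrow> K (e j) = \<mu> j *\<^sub>R e j" and ij: "i < CARD('n)" "j < CARD('n)"
  shows "b (curv_map e (\<Xi> a) K (e j)) (e i) = (\<mu> i - \<mu> j) * b (\<Xi> a (e j)) (e i)"
    and "b (curv_map e (\<Xi> a) K (e j)) (J (e i)) = - (\<mu> i + \<mu> j) * b (\<Xi> a (e j)) (J (e i)) + (if i = j then tau e (\<Xi> a) * \<mu> j else 0)"
proof -
  show "b (curv_map e (\<Xi> a) K (e j)) (e i) = (\<mu> i - \<mu> j) * b (\<Xi> a (e j)) (e i)"
    by (simp add: curv_map_def linear_add[OF b_lin'] linear_diff[OF b_lin'] linear_cmul[OF b_lin'] K(2) \<mu> ij
      linear_cmul[OF Xi_linear] linear_cmul[OF b_lin] J_scaleR unitary_frameD[OF e] algebra_simps)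
  show "b (curv_map e (\<Xi> a) K (e j)) (J (e i)) = - (\<mu> i + \<mu> j) * b (\<Xi> a (e j)) (J (e i)) + (if i = j then tau e (\<Xi> a) * \<mu> j else 0)"
    by (simp add: curv_map_def linear_add[OF b_lin'] linear_diff[OF b_lin'] linear_cmul[OF b_lin'] K \<mu> ij linear_neg[OF b_lin]
      linear_cmul[OF Xi_linear] linear_cmul[OF b_lin] J_scaleR unitary_frameD[OF e] algebra_simps)
qed

text \<open>In the frame this is the expression of \<open>symmetric_part_pos\<close>, with trace
  constants supplied by \<open>Xi_trace\<close>. It is strictly positive unless all \<mu> vanish,
  which settles both claims.\<close>

lemma symmetric_curvature_term:
  assumes e: "unitary_frame b CARD('n) e"
    and K: "\<And>v. K (J v) = - J (K v)" "\<And>u v. b (K u) v = b u (K v)"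
    and \<mu>: "\<And>j. j < CARD('n) \<Longrightarrow> K (e j) = \<mu> j *\<^sub>R e j" "\<And>j. j < CARD('n) \<Longrightarrow> 0 \<le> \<mu> j"
    and n: "3 \<le> CARD('n)" and pos: "(\<Sum>a<k. ls ! a) > 0"
    and k: "2 * real k \<le> (real CARD('n))\<^sup>2 - 2 * real CARD('n) + 2 + (if CARD('n) = 3 then 2 else real CARD('n))"
  defines "T \<equiv> (\<Sum>a<length ls. ls ! a * (\<Sum>j<CARD('n). b (curv_map e (\<Xi> a) K (e j)) (curv_map e (\<Xi> a) K (e j))))"
  shows "0 \<le> T" and "T = 0 \<Longrightarrow> j < CARD('n) \<Longrightarrow> K (e j) = 0"
proof -
  define r where "r a i j = b (\<Xi> a (e j)) (e i)" for a i j
  define s where "s a i j = b (\<Xi> a (e j)) (J (e i))" for a i j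
  define q where "q \<nu> a = (\<Sum>i<CARD('n). (\<nu> i)\<^sup>2 * ((\<Sum>j<CARD('n). s a j j) - 2 * s a i i)\<^sup>2)
    + (\<Sum>i<CARD('n). \<Sum>j<CARD('n). if i = j then 0 else (\<nu> i - \<nu> j)\<^sup>2 * (r a i j)\<^sup>2 + (\<nu> i + \<nu> j)\<^sup>2 * (s a i j)\<^sup>2)" for \<nu> a
  define h where "h = (\<Sum>i<CARD('n). (\<mu> i)\<^sup>2)"
  have r0: "r a i i = 0" if "a < length ls" for a i
    using Xi_skew[OF that, of "e i" "e i"] b_sym[of "e i"] by (simp add: r_def)
  have q: "(\<Sum>j<CARD('n). b (curv_map e (\<Xi> a) K (e j)) (curv_map e (\<Xi> a) K (e j))) = q \<mu> a" if a: "a < length ls" for a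
  proof -
    let ?f = "\<lambda>i j. ((\<mu> i - \<mu> j) * r a i j)\<^sup>2 + (- (\<mu> i + \<mu> j) * s a i j + (if i = j then tau e (\<Xi> a) * \<mu> j else 0))\<^sup>2"
    have "(\<Sum>j<CARD('n). b (curv_map e (\<Xi> a) K (e j)) (curv_map e (\<Xi> a) K (e j))) = (\<Sum>j<CARD('n). \<Sum>i<CARD('n). ?f i j)"
    proof (intro sum.cong refl)
      fix j assume "j \<in> {..<CARD('n)}"
      then have j: "j < CARD('n)" by simp
      have "b (curv_map e (\<Xi> a) K (e j)) (curv_map e (\<Xi> a) K (e j))
        = (\<Sum>i<CARD('n). (b (curv_map e (\<Xi> a) K (e j)) (e i))\<^sup>2 + (b (curv_map e (\<Xi> a) K (e j)) (J (e i)))\<^sup>2)"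
        by (simp only: unitary_parseval[OF e, of "curv_map e (\<Xi> a) K (e j)" "curv_map e (\<Xi> a) K (e j)"] power2_eq_square)
      also have "\<dots> = (\<Sum>i<CARD('n). ?f i j)"
      proof (rule sum.cong[OF refl])
        fix i assume "i \<in> {..<CARD('n)}"
        then have i: "i < CARD('n)" by simp
        have "b (curv_map e (\<Xi> a) K (e j)) (e i) = (\<mu> i - \<mu> j) * b (\<Xi> a (e j)) (e i)"
          "b (curv_map e (\<Xi> a) K (e j)) (J (e i)) = - (\<mu> i + \<mu> j) * b (\<Xi> a (e j)) (J (e i)) + (if i = j then tau e (\<Xi> a) * \<mu> j else 0)"
          by (rule curv_map_symmetric_components[OF e a K(1) K(2) \<mu>(1) i j]; assumption)+
        then show "(b (curv_map e (\<Xi> a) K (e j)) (e i))\<^sup>2 + (b (curv_map e (\<Xi> a) K (e j)) (J (e i)))\<^sup>2 = ?f i j"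
          by (simp only: r_def s_def)
      qed
      finally show "b (curv_map e (\<Xi> a) K (e j)) (curv_map e (\<Xi> a) K (e j)) = (\<Sum>i<CARD('n). ?f i j)" .
    qed
    also have "\<dots> = (\<Sum>i<CARD('n). \<Sum>j<CARD('n). ?f i j)" by (rule sum.swap)
    also have "\<dots> = (\<Sum>i<CARD('n). \<Sum>j<CARD('n). if i = j then 0 else ?f i j) + (\<Sum>i<CARD('n). ?f i i)"
      by (simp only: sum_off_diagonal finite_lessThan diff_add_cancel)
    also have "\<dots> = q \<mu> a"
    proof -
      have "(\<Sum>i<CARD('n). ?f i i) = (\<Sum>i<CARD('n). (\<mu> i)\<^sup>2 * ((\<Sum>j<CARD('n). s a j j) - 2 * s a i i)\<^sup>2)"
        by (intro sum.cong refl) (simp add: r0[OF a] tau_def s_def power2_eq_square algebra_simps)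
      moreover have "(\<Sum>i<CARD('n). \<Sum>j<CARD('n). if i = j then 0 else ?f i j)
        = (\<Sum>i<CARD('n). \<Sum>j<CARD('n). if i = j then 0 else (\<mu> i - \<mu> j)\<^sup>2 * (r a i j)\<^sup>2 + (\<mu> i + \<mu> j)\<^sup>2 * (s a i j)\<^sup>2)"
        by (intro sum.cong refl) (simp add: power_mult_distrib, simp add: power2_eq_square algebra_simps)
      ultimately show ?thesis by (simp only: q_def add.commute)
    qed
    finally show ?thesis .
  qed
  have T: "T = (\<Sum>a<length ls. ls ! a * q \<mu> a)"
    unfolding T_def by (rule sum.cong[OF refl]) (simp add: q)
  have pos: "0 < T" if h: "h > 0"
  proof -
    \<comment> \<open>\<open>symmetric_part_pos\<close> wants unit length; \<open>q\<close> is
      homogeneous of degree two.\<close>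
    define \<nu> where "\<nu> i = \<mu> i / sqrt h" for i
    have qs: "q \<mu> a = h * q \<nu> a" for a
    proof -
      have \<mu>\<nu>: "\<mu> i = sqrt h * \<nu> i" for i using h by (simp add: \<nu>_def)
      have sq: "(\<mu> i)\<^sup>2 = h * (\<nu> i)\<^sup>2" "(\<mu> i - \<mu> j)\<^sup>2 = h * (\<nu> i - \<nu> j)\<^sup>2" "(\<mu> i + \<mu> j)\<^sup>2 = h * (\<nu> i + \<nu> j)\<^sup>2" for i j
        using h by (simp_all add: \<mu>\<nu> power_mult_distrib left_diff_distrib[symmetric] right_diff_distrib[symmetric] distrib_left[symmetric])
      have A: "(\<Sum>i<CARD('n). (\<mu> i)\<^sup>2 * ((\<Sum>j<CARD('n). s a j j) - 2 * s a i i)\<^sup>2)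
        = h * (\<Sum>i<CARD('n). (\<nu> i)\<^sup>2 * ((\<Sum>j<CARD('n). s a j j) - 2 * s a i i)\<^sup>2)"
        by (simp only: sq sum_distrib_left mult.assoc)
      have B: "(\<Sum>i<CARD('n). \<Sum>j<CARD('n). if i = j then 0 else (\<mu> i - \<mu> j)\<^sup>2 * (r a i j)\<^sup>2 + (\<mu> i + \<mu> j)\<^sup>2 * (s a i j)\<^sup>2)
        = h * (\<Sum>i<CARD('n). \<Sum>j<CARD('n). if i = j then 0 else (\<nu> i - \<nu> j)\<^sup>2 * (r a i j)\<^sup>2 + (\<nu> i + \<nu> j)\<^sup>2 * (s a i j)\<^sup>2)"
        unfolding sum_distrib_left by (intro sum.cong refl) (simp only: sq distrib_left mult.assoc mult_zero_right split: if_split, simp)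
      show ?thesis unfolding q_def A B by (simp only: distrib_left)
    qed
    have "0 < (\<Sum>a<length ls. ls ! a * q \<nu> a)"
      unfolding q_def
    proof (rule symmetric_part_pos[OF n _ _ sorted_ls pos k])
      show "0 \<le> \<nu> i" if "i < CARD('n)" for i using \<mu>(2)[OF that] h by (simp add: \<nu>_def)
      show "(\<Sum>i<CARD('n). (\<nu> i)\<^sup>2) = 1"
        using h by (simp add: \<nu>_def power_divide sum_divide_distrib[symmetric] h_def[symmetric])
      show "(\<Sum>i<CARD('n). \<Sum>j<CARD('n). (r a i j)\<^sup>2 + (s a i j)\<^sup>2) = 1" if a: "a < length ls" for a
      proof -
        have "(\<Sum>i<CARD('n). \<Sum>j<CARD('n). (r a i j)\<^sup>2 + (s a i j)\<^sup>2) = (\<Sum>j<CARD('n). \<Sum>i<CARD('n). (r a i j)\<^sup>2 + (s a i j)\<^sup>2)"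
          by (rule sum.swap)
        also have "\<dots> = (\<Sum>j<CARD('n). b (\<Xi> a (e j)) (\<Xi> a (e j)))"
          unfolding r_def s_def power2_eq_square by (simp only: unitary_parseval[OF e, symmetric])
        also have "\<dots> = 1" by (rule Xi_norm[OF a e])
        finally show ?thesis .
      qed
      show "r a i i = 0" if "a < length ls" "i < CARD('n)" for a i by (rule r0[OF that(1)])
      show "(\<Sum>a<length ls. (r a i j)\<^sup>2) = 1 / 2" "(\<Sum>a<length ls. (s a i j)\<^sup>2) = 1 / 2" "(\<Sum>a<length ls. s a i i * s a j j) = 0"
        if "i < CARD('n)" "j < CARD('n)" "i \<noteq> j" for i j
        using that by (simp_all add: r_def s_def power2_eq_square Xi_trace unitary_frameD[OF e] linear_neg[OF b_lin'])
      show "(\<Sum>a<length ls. (s a i i)\<^sup>2) = 1" if "i < CARD('n)" for i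
        using that by (simp add: s_def power2_eq_square Xi_trace unitary_frameD[OF e] linear_neg[OF b_lin'])
      show "(\<Sum>a<length ls. ls ! a * (s a i i * s a j j)) = (\<Sum>a<length ls. ls ! a * ((r a i j)\<^sup>2 + (s a i j)\<^sup>2))"
        if "i < CARD('n)" "j < CARD('n)" "i \<noteq> j" for i j
        using riem_holomorphic[of "e i" "e j" "e j"]
        by (simp add: riem_Xi r_def s_def power2_eq_square distrib_left sum.distrib)
    qed
    then have "0 < h * (\<Sum>a<length ls. ls ! a * q \<nu> a)" using h by simp
    also have "\<dots> = T" by (simp add: T qs sum_distrib_left algebra_simps)
    finally show ?thesis .
  qed
  have h0: "0 \<le> h" unfolding h_def by (intro sum_nonneg) simp
  have z: "\<mu> i = 0" if "h = 0" "i < CARD('n)" for i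
    using that sum_nonneg_eq_0_iff[of "{..<CARD('n)}" "\<lambda>i. (\<mu> i)\<^sup>2"] by (simp add: h_def)
  show "0 \<le> T"
  proof (cases "h = 0")
    case True
    have "q \<mu> a = 0" for a
    proof -
      have "(\<Sum>i<CARD('n). \<Sum>j<CARD('n). if i = j then 0 else (\<mu> i - \<mu> j)\<^sup>2 * (r a i j)\<^sup>2 + (\<mu> i + \<mu> j)\<^sup>2 * (s a i j)\<^sup>2) = 0"
        by (intro sum.neutral ballI) (simp add: z[OF True])
      then show ?thesis unfolding q_def by (simp add: z[OF True])
    qed
    then show ?thesis by (simp add: T)
  next
    case False
    then show ?thesis using pos h0 by simp
  qed
  show "K (e j) = 0" if "T = 0" "j < CARD('n)"
  proof -
    have "h = 0" using pos h0 that(1) by fastforce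
    then show ?thesis using \<mu>(1)[OF that(2)] z[OF _ that(2)] by simp
  qed
qed

end

section \<open>Antilinear skew endomorphisms\<close>

context kahler_point
begin

lemma b_nonneg: "0 \<le> b w w"
proof (cases "w = 0")
  case True
  then show ?thesis by (simp add: linear_0[OF b_lin])
next
  case False
  from g_pos[OF x this] show ?thesis by simp
qed

text \<open>An antilinear skew map is a complex skew-symmetric matrix. Its singular values come in
  pairs, and each complex dimension counts as two real ones, so every singular value accounts for
  four equal terms of the full trace.\<close>

lemma antilinear_skew_bound:
  assumes H: "linear H" "\<And>v. H (J v) = - J (H v)" and skew: "\<And>u v. b (H u) v = - b u (H v)"
  shows "4 * b (H u) (H u) \<le> (\<Sum>i<2 * CARD('n). b (H (F i)) (H (F i))) * b u u"
proof -
  let ?h = "\<Sum>i<2 * CARD('n). b (H (F i)) (H (F i))"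
  have unit: "4 * b (H v) (H v) \<le> ?h" if v: "b v v = 1" for v
  proof -
    define y where "y = H v"
    define p where "p = b y y"
    \<comment> \<open>The candidate for the block of \<open>H\<close> on the span of
      \<open>v\<close>, \<open>y\<close>, \<open>J v\<close>, \<open>J y\<close>. Its product with
      \<open>H\<close> equals its own squared norm \<open>4 * p\<close>, so nonnegativity of the
      squared norm of \<open>H - G\<close> is the claim.\<close>
    define G where "G z = b z v *\<^sub>R y - b z y *\<^sub>R v - b z (J v) *\<^sub>R J y + b z (J y) *\<^sub>R J v" for z
    have J0: "b (J z) z = 0" "b z (J z) = 0" for z using b_J_left[of z z] b_sym[of z "J z"] by simp_all
    have vy: "b v y = 0" "b y v = 0" using skew[of v v] b_sym[of v y] by (simp_all add: y_def)
    have vJy: "b v (J y) = 0" "b (J y) v = 0" "b (J v) y = 0" "b y (J v) = 0"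
    proof -
      have "b v (J y) = - b v (H (J v))" by (simp add: H(2) y_def linear_neg[OF b_lin])
      also have "\<dots> = b y (J v)" by (simp add: skew y_def)
      also have "\<dots> = - b (J y) v" by (simp add: b_J_left)
      finally show "b v (J y) = 0" "b (J y) v = 0" using b_sym[of v "J y"] by simp_all
      then show "b (J v) y = 0" "b y (J v) = 0" using b_J_left[of v y] b_sym[of y "J v"] by simp_all
    qed
    have ip: "(\<Sum>i<2 * CARD('n). b (F i) w * b (H (F i)) z) = b (H w) z" for w z
    proof -
      have "linear (\<lambda>t. b (H t) z)" using linear_compose[OF H(1) b_lin'] by (simp add: o_def)
      from F_linear[OF this, of w] show ?thesis by (simp only: b_sym[of "F _" w] real_scaleR_def)
    qed
    have HG: "(\<Sum>i<2 * CARD('n). b (H (F i)) (G (F i))) = 4 * p"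
    proof -
      have "(\<Sum>i<2 * CARD('n). b (H (F i)) (G (F i))) = b (H v) y - b (H y) v - b (H (J v)) (J y) + b (H (J y)) (J v)"
        unfolding G_def by (simp only: linear_add[OF b_lin] linear_diff[OF b_lin] linear_cmul[OF b_lin] real_scaleR_def sum.distrib sum_subtractf ip)
      moreover have "b (H y) v = - p" by (simp only: skew[of y v] y_def[symmetric] p_def)
      moreover have "b (H (J v)) (J y) = - p" by (simp only: H(2) linear_neg[OF b_lin'] b_J y_def[symmetric] p_def)
      moreover have "b (H (J y)) (J v) = p"
        by (simp only: H(2) linear_neg[OF b_lin'] b_J skew[of y v] y_def[symmetric] p_def minus_minus)
      ultimately show ?thesis by (simp only: y_def[symmetric] p_def[symmetric])
    qed
    have sq: "(\<Sum>i<2 * CARD('n). b (F i) w * b (F i) w) = b w w" for w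
      by (simp only: b_sym[of "F _" w] b_F_inner[of w w, symmetric])
    have GG: "(\<Sum>i<2 * CARD('n). b (G (F i)) (G (F i))) = 4 * p"
    proof -
      have "b (G z) (G z) = p * (b z v * b z v) + b z y * b z y + p * (b z (J v) * b z (J v)) + b z (J y) * b z (J y)" for z
        by (simp add: G_def linear_add[OF b_lin] linear_diff[OF b_lin] linear_cmul[OF b_lin] linear_add[OF b_lin'] linear_diff[OF b_lin']
          linear_cmul[OF b_lin'] vy vJy J0 b_J v p_def[symmetric])
      then show ?thesis by (simp add: sum.distrib sum_distrib_left[symmetric] sq v b_J p_def[symmetric])
    qed
    have "0 \<le> (\<Sum>i<2 * CARD('n). b (H (F i) - G (F i)) (H (F i) - G (F i)))"
      by (intro sum_nonneg) (rule b_nonneg)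
    also have "\<dots> = ?h - 2 * (\<Sum>i<2 * CARD('n). b (H (F i)) (G (F i))) + (\<Sum>i<2 * CARD('n). b (G (F i)) (G (F i)))"
      by (simp add: linear_diff[OF b_lin] linear_diff[OF b_lin'] sum.distrib sum_subtractf b_sym[of "G _" "H _"] sum_distrib_left)
    finally show ?thesis by (simp add: HG GG p_def y_def)
  qed
  show ?thesis
  proof (cases "u = 0")
    case True
    then show ?thesis by (simp add: linear_0[OF H(1)] linear_0[OF b_lin])
  next
    case False
    then have p: "0 < b u u" by (rule g_pos[OF x])
    define v where "v = (1 / sqrt (b u u)) *\<^sub>R u"
    have u: "u = sqrt (b u u) *\<^sub>R v" using p by (simp add: v_def)
    have "b v v = 1" using p by (simp add: v_def linear_cmul[OF b_lin] linear_cmul[OF b_lin'] field_simps)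
    from unit[OF this] have "4 * b (H v) (H v) * b u u \<le> ?h * b u u" using p by (simp add: mult_right_mono)
    moreover have "b (H u) (H u) = b (H v) (H v) * b u u"
    proof -
      have "b (H v) (H v) = b (H u) (H u) / b u u"
        using p by (simp add: v_def linear_cmul[OF H(1)] linear_cmul[OF b_lin] linear_cmul[OF b_lin'] field_simps)
      then show ?thesis using p by simp
    qed
    ultimately show ?thesis by simp
  qed
qed

text \<open>Trace the Bianchi identity. Two of its terms have equal traces because \<open>H\<close>
  is skew; the third changes sign when \<open>F\<close> is replaced by its image under
  \<open>J\<close>, so its trace vanishes.\<close>

lemma riem_antilinear_skew_trace:
  assumes H: "linear H" "\<And>v. H (J v) = - J (H v)" and skew: "\<And>u v. b (H u) v = - b u (H v)"
  shows "(\<Sum>i<2 * CARD('n). riem g x (F i) l (H (F i)) m) = 0"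
proof -
  let ?s = "\<lambda>f. \<Sum>i<2 * CARD('n). f (F i) :: real"
  have B: "riem g x u l (H u) m + riem g x l (H u) u m + riem g x (H u) u l m = 0" for u
    using riem_bianchi[OF x, of u l m "H u"] riem_antisym(2)[OF x, of u l m "H u"]
      riem_antisym(2)[OF x, of l "H u" m u] riem_antisym(2)[OF x, of "H u" u m l] by linarith
  have 1: "?s (\<lambda>u. riem g x l (H u) u m) = ?s (\<lambda>u. riem g x u l (H u) m)"
  proof -
    have "?s (\<lambda>u. riem g x l (H u) u m) = ?s (\<lambda>u. riem g x l u (- H u) m)"
      by (rule frame_trace_adjoint[where \<beta> = "\<lambda>u v. riem g x l u v m" and A = H and B = "\<lambda>u. - H u"])
        (simp_all add: riem_lin skew linear_neg[OF b_lin])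
    then show ?thesis
      by (simp add: linear_neg[OF riem_lin(3)] riem_antisym(1)[OF x, of l])
  qed
  have 2: "?s (\<lambda>u. riem g x (H u) u l m) = 0"
  proof -
    have "riem g x (H (J u)) (J u) l m = - riem g x (H u) u l m" for u
      by (simp add: H(2) linear_neg[OF riem_lin(1)] riem_J(2)[OF x])
    then show ?thesis by (simp add: sum_F[of "\<lambda>u. riem g x (H u) u l m"])
  qed
  have "?s (\<lambda>u. riem g x u l (H u) m + riem g x l (H u) u m + riem g x (H u) u l m) = 0" by (simp add: B)
  then show ?thesis using 1 2 by (simp add: sum.distrib)
qed

text \<open>Cyclicity of the trace, where moving a skew map to the other argument costs a
  sign.\<close>

lemma skew_commuting_trace:
  assumes H: "linear H" and A: "linear A" and skew: "\<And>u v. b (H u) v = - b u (H v)" "\<And>u v. b (A u) v = - b u (A v)"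
  shows "(\<Sum>i<2 * CARD('n). b (A (F i)) (A (H (H (F i))))) = - (\<Sum>i<2 * CARD('n). b (H (A (F i))) (H (A (F i))))"
    and "(\<Sum>i<2 * CARD('n). b (A (H (F i))) (A (H (F i)))) = (\<Sum>i<2 * CARD('n). b (H (A (F i))) (H (A (F i))))"
proof -
  have lin: "linear (\<lambda>v. b u (A (H v)))" "linear (\<lambda>v. b u (H (A v)))" "linear (\<lambda>v. b (A v) u)" "linear (\<lambda>v. b (H v) u)" for u
    using linear_compose[OF linear_compose[OF H A] b_lin] linear_compose[OF linear_compose[OF A H] b_lin]
      linear_compose[OF A b_lin'] linear_compose[OF H b_lin'] by (simp_all add: o_def)
  have 1: "(\<Sum>i<2 * CARD('n). b (A (H (F i))) (A (H (F i)))) = (\<Sum>i<2 * CARD('n). b (A (F i)) (A (H (- H (F i)))))"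
    by (rule frame_trace_adjoint[where \<beta> = "\<lambda>u v. b (A u) (A (H v))" and A = H and B = "\<lambda>u. - H u"])
      (simp_all add: lin A H skew(1) linear_neg[OF b_lin])
  have 2: "(\<Sum>i<2 * CARD('n). b (H (A (F i))) (H (A (F i)))) = (\<Sum>i<2 * CARD('n). b (H (F i)) (H (A (- A (F i)))))"
    by (rule frame_trace_adjoint[where \<beta> = "\<lambda>u v. b (H u) (H (A v))" and A = A and B = "\<lambda>u. - A u"])
      (simp_all add: lin A H skew(2) linear_neg[OF b_lin])
  have 3: "b (A v) (A (H (H v))) = b (H v) (H (A (A v)))" for v
    using skew(2)[of "A v" "H (H v)"] skew(1)[of "A (A v)" "H v"] b_sym[of "H v"] by simp
  show "(\<Sum>i<2 * CARD('n). b (A (F i)) (A (H (H (F i))))) = - (\<Sum>i<2 * CARD('n). b (H (A (F i))) (H (A (F i))))"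
    unfolding 2 by (simp add: 3 linear_neg[OF A] linear_neg[OF H] linear_neg[OF b_lin] sum_negf)
  then show "(\<Sum>i<2 * CARD('n). b (A (H (F i))) (A (H (F i)))) = (\<Sum>i<2 * CARD('n). b (H (A (F i))) (H (A (F i))))"
    unfolding 1 by (simp add: linear_neg[OF A] linear_neg[OF H] linear_neg[OF b_lin] sum_negf)
qed

lemma symmetric_skew_orthogonal:
  assumes N: "linear N" "\<And>u v. b (N u) v = b u (N v)" "\<And>v. N (J v) = - J (N v)"
    and M: "linear M" "\<And>u v. b (M u) v = - b u (M v)" "\<And>v. M (J v) = - J (M v)" and e: "unitary_frame b CARD('n) e"
  shows "(\<Sum>j<CARD('n). b (N (e j)) (M (e j))) = 0"
proof -
  have lin: "linear (\<lambda>v. b (N v) u)" for u using linear_compose[OF N(1) b_lin'] by (simp add: o_def)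
  have "(\<Sum>i<2 * CARD('n). b (N (F i)) (M (F i))) = (\<Sum>i<2 * CARD('n). b (N (- M (F i))) (F i))"
    by (rule frame_trace_adjoint[where \<beta> = "\<lambda>u v. b (N v) u" and A = M and B = "\<lambda>u. - M u"])
      (simp_all add: lin b_lin M(2) linear_neg[OF b_lin])
  also have "\<dots> = - (\<Sum>i<2 * CARD('n). b (N (F i)) (M (F i)))"
    by (simp add: linear_neg[OF N(1)] linear_neg[OF b_lin'] sum_negf N(2) b_sym[of "M _" "N _"])
  finally have "(\<Sum>i<2 * CARD('n). b (N (F i)) (M (F i))) = 0" by simp
  moreover have "2 * (\<Sum>j<CARD('n). b (N (e j)) (M (e j))) = (\<Sum>i<2 * CARD('n). b (N (F i)) (M (F i)))"
    by (rule sum_unitary_frame[OF e N(1) M(1)]) (simp add: N(3) M(3) linear_neg[OF b_lin] linear_neg[OF b_lin'] b_J)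
  ultimately show ?thesis by simp
qed

end

context kahler_spectral
begin

text \<open>\<open>ricci_identity\<close> traced over the frame: both sides are half of the scalar
  curvature. Under the weights \<open>ls\<close> the square of \<open>tau\<close> may thus be
  replaced by 1.\<close>

lemma ricci_tau:
  assumes e: "unitary_frame b CARD('n) e"
  shows "(\<Sum>a<length ls. ls ! a * (tau e (\<Xi> a) * tau e (\<Xi> a))) = (\<Sum>a<length ls. ls ! a)"
proof -
  have "(\<Sum>a<length ls. ls ! a * (tau e (\<Xi> a) * tau e (\<Xi> a)))
    = (\<Sum>a<length ls. \<Sum>j<CARD('n). ls ! a * (tau e (\<Xi> a) * b (\<Xi> a (e j)) (J (e j))))"
    by (simp only: tau_def[of e "\<Xi> _"] sum_distrib_left[symmetric])
  also have "\<dots> = (\<Sum>j<CARD('n). \<Sum>a<length ls. ls ! a * b (\<Xi> a (e j)) (\<Xi> a (e j)))"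
    by (rule trans[OF sum.swap]) (simp only: ricci_identity[OF e])
  also have "\<dots> = (\<Sum>a<length ls. ls ! a * (\<Sum>j<CARD('n). b (\<Xi> a (e j)) (\<Xi> a (e j))))"
    unfolding sum_distrib_left by (rule sum.swap)
  also have "\<dots> = (\<Sum>a<length ls. ls ! a)" by (rule sum.cong[OF refl]) (simp add: Xi_norm[OF _ e])
  finally show ?thesis .
qed

lemma length_ls: "length ls = CARD('n) * CARD('n)"
proof -
  have "real (length ls) = (\<Sum>a<length ls. \<Sum>j<CARD('n). b (\<Xi> a (frame j)) (\<Xi> a (frame j)))"
    using Xi_norm[OF _ unitary_frame_frame] by simp
  also have "\<dots> = (\<Sum>j<CARD('n). CARD('n) * b (frame j) (frame j))"
    by (rule trans[OF sum.swap]) (simp only: casimir)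
  also have "\<dots> = real (CARD('n) * CARD('n))" by (simp add: unitary_frameD[OF unitary_frame_frame])
  finally show ?thesis by (simp only: of_nat_eq_iff)
qed

text \<open>Undoing the spectral expansion, the weighted mixed term is the curvature trace that
  vanishes by \<open>riem_antilinear_skew_trace\<close>.\<close>

lemma riem_mixed_trace:
  assumes H: "linear H" "\<And>v. H (J v) = - J (H v)" and skew: "\<And>u v. b (H u) v = - b u (H v)"
  shows "(\<Sum>a<length ls. ls ! a * (\<Sum>i<2 * CARD('n). b (H (\<Xi> a (F i))) (\<Xi> a (H (F i))))) = 0"
proof -
  have "b (H (\<Xi> a u)) (\<Xi> a (H u)) = (\<Sum>l<2 * CARD('n). b (\<Xi> a u) (F l) * b (\<Xi> a (H u)) (H (F l)))" for a u
  proof -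
    have "b (H (\<Xi> a u)) (\<Xi> a (H u)) = (\<Sum>l<2 * CARD('n). - (b (\<Xi> a u) (F l) * b (H (\<Xi> a (H u))) (F l)))"
      unfolding skew[of "\<Xi> a u"] b_F_inner[of "\<Xi> a u" "H _"] by (simp only: sum_negf)
    then show ?thesis by (simp add: skew)
  qed
  then have "(\<Sum>a<length ls. ls ! a * (\<Sum>i<2 * CARD('n). b (H (\<Xi> a (F i))) (\<Xi> a (H (F i)))))
    = (\<Sum>a<length ls. \<Sum>i<2 * CARD('n). \<Sum>l<2 * CARD('n). ls ! a * (b (\<Xi> a (F i)) (F l) * b (\<Xi> a (H (F i))) (H (F l))))"
    by (simp only: sum_distrib_left)
  also have "\<dots> = (\<Sum>i<2 * CARD('n). \<Sum>l<2 * CARD('n). \<Sum>a<length ls. ls ! a * (b (\<Xi> a (F i)) (F l) * b (\<Xi> a (H (F i))) (H (F l))))"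
    by (rule trans[OF sum.swap], rule sum.cong[OF refl], rule sum.swap)
  also have "\<dots> = (\<Sum>i<2 * CARD('n). \<Sum>l<2 * CARD('n). riem g x (F i) (F l) (H (F i)) (H (F l)))"
    by (simp only: riem_Xi)
  also have "\<dots> = (\<Sum>l<2 * CARD('n). \<Sum>i<2 * CARD('n). riem g x (F i) (F l) (H (F i)) (H (F l)))" by (rule sum.swap)
  also have "\<dots> = 0" by (simp add: riem_antilinear_skew_trace[OF H skew])
  finally show ?thesis .
qed

text \<open>No choice of weights is needed here: the curvature identities turn the weighted norm
  into weights \<open>h - 2 * X a\<close> between 0 and \<open>h\<close>. Since the
  \<open>X a\<close> add up to \<open>n * h\<close> by \<open>casimir\<close>, the total is
  \<open>h * n * (n - 2)\<close>, the origin of the bound on \<open>k\<close>.\<close>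

lemma antisymmetric_curvature_term:
  assumes e: "unitary_frame b CARD('n) e"
    and H: "linear H" "\<And>v. H (J v) = - J (H v)" and skew: "\<And>u v. b (H u) v = - b u (H v)"
    and pos: "(\<Sum>a<k. ls ! a) > 0" and k: "real k \<le> real CARD('n) * (real CARD('n) - 2)"
  defines "T \<equiv> (\<Sum>a<length ls. ls ! a * (\<Sum>j<CARD('n). b (curv_map e (\<Xi> a) H (e j)) (curv_map e (\<Xi> a) H (e j))))"
  shows "0 \<le> T" and "T = 0 \<Longrightarrow> H v = 0"
proof -
  define h where "h = (\<Sum>i<2 * CARD('n). b (H (F i)) (H (F i)))"
  define X where "X a = (\<Sum>i<2 * CARD('n). b (H (\<Xi> a (F i))) (H (\<Xi> a (F i))))" for a
  define Z where "Z a = (\<Sum>i<2 * CARD('n). b (H (\<Xi> a (F i))) (\<Xi> a (H (F i))))" for a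
  let ?t = "\<lambda>a. tau e (\<Xi> a)"
  have tr: "(\<Sum>i<2 * CARD('n). b (\<Xi> a (F i)) (\<Xi> a (H (H (F i))))) = - X a"
    "(\<Sum>i<2 * CARD('n). b (\<Xi> a (H (F i))) (\<Xi> a (H (F i)))) = X a" if a: "a < length ls" for a
    unfolding X_def by (rule skew_commuting_trace[OF H(1) Xi_linear skew Xi_skew[OF a]])+
  have N: "2 * (\<Sum>j<CARD('n). b (curv_map e (\<Xi> a) H (e j)) (curv_map e (\<Xi> a) H (e j)))
    = 2 * X a + h * (?t a * ?t a) - 2 * Z a + 2 * (?t a * (\<Sum>i<2 * CARD('n). b (\<Xi> a (F i)) (J (H (H (F i))))))
      - 2 * (?t a * (\<Sum>i<2 * CARD('n). b (\<Xi> a (H (F i))) (J (H (F i)))))" if a: "a < length ls" for a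
  proof -
    note cm = curv_map_props[OF H Xi_linear Xi_J[OF a], of e]
    have "2 * (\<Sum>j<CARD('n). b (curv_map e (\<Xi> a) H (e j)) (curv_map e (\<Xi> a) H (e j)))
      = (\<Sum>i<2 * CARD('n). b (curv_map e (\<Xi> a) H (F i)) (curv_map e (\<Xi> a) H (F i)))"
      by (rule sum_unitary_frame[OF e cm(1) cm(1)]) (simp add: cm(2) linear_neg[OF b_lin] linear_neg[OF b_lin'] b_J)
    also have "\<dots> = (\<Sum>i<2 * CARD('n). b (H (\<Xi> a (F i))) (H (\<Xi> a (F i))) + b (\<Xi> a (H (F i))) (\<Xi> a (H (F i)))
      + (?t a * ?t a) * b (H (F i)) (H (F i)) - 2 * b (H (\<Xi> a (F i))) (\<Xi> a (H (F i)))
      + 2 * (?t a * b (\<Xi> a (F i)) (J (H (H (F i))))) - 2 * (?t a * b (\<Xi> a (H (F i))) (J (H (F i)))))"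
    proof (rule sum.cong[OF refl])
      fix i
      have "b (H (\<Xi> a (F i))) (J (H (F i))) = b (\<Xi> a (F i)) (J (H (H (F i))))"
        by (simp add: skew H(2) linear_neg[OF b_lin])
      then show "b (curv_map e (\<Xi> a) H (F i)) (curv_map e (\<Xi> a) H (F i)) = b (H (\<Xi> a (F i))) (H (\<Xi> a (F i))) + b (\<Xi> a (H (F i))) (\<Xi> a (H (F i)))
      + (?t a * ?t a) * b (H (F i)) (H (F i)) - 2 * b (H (\<Xi> a (F i))) (\<Xi> a (H (F i)))
      + 2 * (?t a * b (\<Xi> a (F i)) (J (H (H (F i))))) - 2 * (?t a * b (\<Xi> a (H (F i))) (J (H (F i))))"
        unfolding curv_map_def
        by (simp only: linear_add[OF b_lin] linear_add[OF b_lin'] linear_diff[OF b_lin] linear_diff[OF b_lin'] linear_cmul[OF b_lin]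
          linear_cmul[OF b_lin'] b_J real_scaleR_def b_sym[of "\<Xi> a (H (F i))" "H (\<Xi> a (F i))"]
          b_sym[of "J (H (F i))" "H (\<Xi> a (F i))"] b_sym[of "J (H (F i))" "\<Xi> a (H (F i))"]) (simp add: algebra_simps)
    qed
    also have "\<dots> = X a + X a + (?t a * ?t a) * h - 2 * Z a + 2 * (?t a * (\<Sum>i<2 * CARD('n). b (\<Xi> a (F i)) (J (H (H (F i))))))
      - 2 * (?t a * (\<Sum>i<2 * CARD('n). b (\<Xi> a (H (F i))) (J (H (F i)))))"
      by (simp only: sum.distrib sum_subtractf sum_distrib_left[symmetric] tr(2)[OF a] X_def[symmetric] Z_def[symmetric] h_def[symmetric])
    finally show ?thesis by (simp add: algebra_simps)
  qed
  have ric: "(\<Sum>a<length ls. ls ! a * (?t a * (\<Sum>i<2 * CARD('n). b (\<Xi> a (f i)) (J (h i)))))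
    = (\<Sum>a<length ls. ls ! a * (\<Sum>i<2 * CARD('n). b (\<Xi> a (f i)) (\<Xi> a (h i))))" for f h
  proof -
    have "(\<Sum>a<length ls. ls ! a * (?t a * (\<Sum>i<2 * CARD('n). b (\<Xi> a (f i)) (J (h i)))))
      = (\<Sum>i<2 * CARD('n). \<Sum>a<length ls. ls ! a * (?t a * b (\<Xi> a (f i)) (J (h i))))"
      unfolding sum_distrib_left by (rule sum.swap)
    also have "\<dots> = (\<Sum>i<2 * CARD('n). \<Sum>a<length ls. ls ! a * b (\<Xi> a (f i)) (\<Xi> a (h i)))"
      by (simp only: ricci_identity[OF e])
    also have "\<dots> = (\<Sum>a<length ls. ls ! a * (\<Sum>i<2 * CARD('n). b (\<Xi> a (f i)) (\<Xi> a (h i))))"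
      unfolding sum_distrib_left by (rule sum.swap)
    finally show ?thesis .
  qed
  \<comment> \<open>Under the weights \<open>ls\<close>, the mixed terms \<open>Z\<close> vanish,
    the square of \<open>tau\<close> becomes 1, and each of the two remaining terms with
    \<open>tau\<close> contributes \<open>- 2 * X a\<close>. The squares supply
    \<open>2 * X a\<close>, so \<open>h - 2 * X a\<close> is left.\<close>
  have T: "2 * T = (\<Sum>a<length ls. ls ! a * (h - 2 * X a))"
  proof -
    have "2 * T = (\<Sum>a<length ls. ls ! a * (2 * (\<Sum>j<CARD('n). b (curv_map e (\<Xi> a) H (e j)) (curv_map e (\<Xi> a) H (e j)))))"
      by (simp add: T_def sum_distrib_left mult.left_commute)
    also have "\<dots> = (\<Sum>a<length ls. 2 * (ls ! a * X a) + h * (ls ! a * (?t a * ?t a)) - 2 * (ls ! a * Z a)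
        + 2 * (ls ! a * (?t a * (\<Sum>i<2 * CARD('n). b (\<Xi> a (F i)) (J (H (H (F i)))))))
        - 2 * (ls ! a * (?t a * (\<Sum>i<2 * CARD('n). b (\<Xi> a (H (F i))) (J (H (F i)))))))"
    proof (rule sum.cong[OF refl])
      fix a assume "a \<in> {..<length ls}"
      then have a: "a < length ls" by simp
      show "ls ! a * (2 * (\<Sum>j<CARD('n). b (curv_map e (\<Xi> a) H (e j)) (curv_map e (\<Xi> a) H (e j))))
        = 2 * (ls ! a * X a) + h * (ls ! a * (?t a * ?t a)) - 2 * (ls ! a * Z a)
        + 2 * (ls ! a * (?t a * (\<Sum>i<2 * CARD('n). b (\<Xi> a (F i)) (J (H (H (F i)))))))
        - 2 * (ls ! a * (?t a * (\<Sum>i<2 * CARD('n). b (\<Xi> a (H (F i))) (J (H (F i))))))"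
        unfolding N[OF a] by (simp only: distrib_left right_diff_distrib mult.left_commute[of "ls ! a"])
    qed
    also have "\<dots> = 2 * (\<Sum>a<length ls. ls ! a * X a) + h * (\<Sum>a<length ls. ls ! a)
        + 2 * (\<Sum>a<length ls. ls ! a * (\<Sum>i<2 * CARD('n). b (\<Xi> a (F i)) (\<Xi> a (H (H (F i))))))
        - 2 * (\<Sum>a<length ls. ls ! a * (\<Sum>i<2 * CARD('n). b (\<Xi> a (H (F i))) (\<Xi> a (H (F i)))))"
      using riem_mixed_trace[OF H skew]
      by (simp only: sum.distrib sum_subtractf sum_distrib_left[symmetric] ric ricci_tau[OF e] Z_def mult_zero_right diff_zero)
    also have "(\<Sum>a<length ls. ls ! a * (\<Sum>i<2 * CARD('n). b (\<Xi> a (F i)) (\<Xi> a (H (H (F i)))))) = (\<Sum>a<length ls. ls ! a * (- X a))"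
      by (rule sum.cong[OF refl]) (simp add: tr)
    also have "(\<Sum>a<length ls. ls ! a * (\<Sum>i<2 * CARD('n). b (\<Xi> a (H (F i))) (\<Xi> a (H (F i))))) = (\<Sum>a<length ls. ls ! a * X a)"
      by (rule sum.cong[OF refl]) (simp add: tr)
    finally show ?thesis by (simp add: sum_distrib_left sum_subtractf sum_negf algebra_simps)
  qed
  have bound: "0 \<le> X a" "2 * X a \<le> h" if a: "a < length ls" for a
  proof -
    show "0 \<le> X a" unfolding X_def by (intro sum_nonneg b_nonneg)
    have "2 * (\<Sum>j<CARD('n). b (\<Xi> a (frame j)) (\<Xi> a (frame j))) = (\<Sum>i<2 * CARD('n). b (\<Xi> a (F i)) (\<Xi> a (F i)))"
      by (rule sum_unitary_frame[OF unitary_frame_frame Xi_linear Xi_linear]) (simp add: Xi_J[OF a] b_J)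
    \<comment> \<open>Norm 1 as a bivector is 2 in the full real trace; together with the factor 4
      of \<open>antilinear_skew_bound\<close> this yields \<open>2 * X a \<le> h\<close>.\<close>
    then have S: "(\<Sum>i<2 * CARD('n). b (\<Xi> a (F i)) (\<Xi> a (F i))) = 2" by (simp add: Xi_norm[OF a unitary_frame_frame])
    have "4 * X a = (\<Sum>i<2 * CARD('n). 4 * b (H (\<Xi> a (F i))) (H (\<Xi> a (F i))))" by (simp add: X_def sum_distrib_left)
    also have "\<dots> \<le> (\<Sum>i<2 * CARD('n). h * b (\<Xi> a (F i)) (\<Xi> a (F i)))"
      unfolding h_def by (intro sum_mono antilinear_skew_bound[OF H skew])
    also have "\<dots> = h * 2" by (simp only: sum_distrib_left[symmetric] S)
    finally show "2 * X a \<le> h" by simp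
  qed
  have h0: "0 \<le> h" unfolding h_def by (intro sum_nonneg b_nonneg)
  have p: "0 < 2 * T" if h: "0 < h"
    unfolding T
  proof (rule weighted_sum_pos[OF sorted_ls pos, of "\<lambda>a. h - 2 * X a" h])
    fix a assume a: "a < length ls"
    show "0 \<le> h - 2 * X a" "h - 2 * X a \<le> h" using bound[OF a] by simp_all
  next
    have "(\<Sum>a<length ls. X a) = (\<Sum>a<length ls. \<Sum>i<2 * CARD('n). b (\<Xi> a (H (F i))) (\<Xi> a (H (F i))))"
      by (rule sum.cong[OF refl]) (simp add: tr)
    also have "\<dots> = CARD('n) * h" by (rule trans[OF sum.swap]) (simp only: casimir h_def sum_distrib_left)
    finally have "(\<Sum>a<length ls. X a) = CARD('n) * h" .
    moreover have "(\<Sum>a<length ls. h - 2 * X a) = real (length ls) * h - 2 * (\<Sum>a<length ls. X a)"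
      by (simp add: sum_subtractf sum_distrib_left)
    ultimately have "(\<Sum>a<length ls. h - 2 * X a) = h * (real CARD('n) * (real CARD('n) - 2))"
      by (simp add: length_ls algebra_simps)
    then show "h * real k \<le> (\<Sum>a<length ls. h - 2 * X a)" using k h by simp
  qed (rule h)
  show "0 \<le> T"
  proof (cases "h = 0")
    case True
    have "X a = 0" if "a < length ls" for a using bound[OF that] True by simp
    then have "2 * T = 0" unfolding T using True by simp
    then show ?thesis by simp
  next
    case False
    then show ?thesis using p h0 by simp
  qed
  show "H v = 0" if "T = 0"
  proof -
    have "h = 0" using p h0 that by fastforce
    then have "b (H (F i)) (H (F i)) = 0" if "i < 2 * CARD('n)" for i
      using sum_nonneg_eq_0_iff[of "{..<2 * CARD('n)}" "\<lambda>i. b (H (F i)) (H (F i))"] b_nonneg that by (simp add: h_def)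
    then have "H (F i) = 0" if "i < 2 * CARD('n)" for i using g_pos[OF x, of "H (F i)"] that by fastforce
    then show ?thesis using F_linear[OF H(1), of v] by simp
  qed
qed

end

section \<open>Vanishing at the maximum\<close>

context kahler_spectral
begin

text \<open>The norm splits into a symmetric and a skew contribution. Both are nonnegative and their
  sum is not positive, so both vanish. The last hypothesis is stated for all unitary frames because
  the Takagi frame depends on \<open>H\<close>.\<close>

theorem antilinear_zero:
  assumes H: "linear H" "\<And>v. H (J v) = - J (H v)"
    and n: "3 \<le> CARD('n)" and pos: "(\<Sum>a<k. ls ! a) > 0"
    and k: "2 * real k \<le> (real CARD('n))\<^sup>2 - 2 * real CARD('n) + 2 + (if CARD('n) = 3 then 2 else real CARD('n))"
      "real k \<le> real CARD('n) * (real CARD('n) - 2)"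
    and le: "\<And>e. unitary_frame b CARD('n) e \<Longrightarrow>
      (\<Sum>a<length ls. ls ! a * (\<Sum>j<CARD('n). b (curv_map e (\<Xi> a) (adjoint_map H) (e j)) (curv_map e (\<Xi> a) (adjoint_map H) (e j)))) \<le> 0"
  shows "H v = 0"
proof -
  define K where "K = adjoint_map H"
  define Ks where "Ks u = (1 / 2) *\<^sub>R (K u + H u)" for u
  define Ka where "Ka u = (1 / 2) *\<^sub>R (K u - H u)" for u
  have K: "linear K" "K (J u) = - J (K u)" for u
    unfolding K_def by (rule adjoint_map(3)[OF H(1)]) (rule adjoint_map_antilinear[OF H])
  have adj: "b (K u) w = b u (H w)" "b (H u) w = b u (K w)" for u w
    unfolding K_def using adjoint_map(1)[OF H(1), of u w] adjoint_map(2)[OF H(1), of u w] by simp_all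
  have Ks: "linear Ks" "Ks (J u) = - J (Ks u)" "b (Ks u) w = b u (Ks w)" for u w
  proof -
    show "linear Ks" unfolding Ks_def by (rule linearI) (simp_all add: linear_add[OF H(1)] linear_add[OF K(1)] linear_cmul[OF H(1)]
      linear_cmul[OF K(1)] algebra_simps)
    show "Ks (J u) = - J (Ks u)" by (simp add: Ks_def H(2) K(2) J_add J_scaleR algebra_simps)
    show "b (Ks u) w = b u (Ks w)"
      by (simp add: Ks_def linear_cmul[OF b_lin] linear_cmul[OF b_lin'] linear_add[OF b_lin] linear_add[OF b_lin'] adj)
  qed
  have Ka: "linear Ka" "Ka (J u) = - J (Ka u)" "b (Ka u) w = - b u (Ka w)" for u w
  proof -
    show "linear Ka" unfolding Ka_def by (rule linearI) (simp_all add: linear_add[OF H(1)] linear_add[OF K(1)] linear_cmul[OF H(1)]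
      linear_cmul[OF K(1)] algebra_simps)
    show "Ka (J u) = - J (Ka u)" by (simp add: Ka_def H(2) K(2) J_diff J_scaleR algebra_simps)
    show "b (Ka u) w = - b u (Ka w)"
      by (simp add: Ka_def linear_cmul[OF b_lin] linear_cmul[OF b_lin'] linear_diff[OF b_lin] linear_diff[OF b_lin'] adj field_simps)
  qed
  have split: "curv_map e (\<Xi> a) K u = curv_map e (\<Xi> a) Ks u + curv_map e (\<Xi> a) Ka u" for e a u
  proof -
    have s: "K z = Ks z + Ka z" for z by (simp add: Ks_def Ka_def scaleR_add_right[symmetric] scaleR_2[symmetric] del: scaleR_add_right)
    show ?thesis by (simp add: curv_map_def s linear_add[OF Xi_linear] J_add scaleR_add_right)
  qed
  \<comment> \<open>\<open>Ks\<close> is symmetric and antilinear, so \<open>P\<close> is the real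
    part of a complex symmetric form, as required by \<open>takagi_frame\<close>.\<close>
  define P where "P u w = b (Ks u) w" for u w
  obtain e where e: "unitary_frame b CARD('n) e"
    and P1: "\<And>i j. i < CARD('n) \<Longrightarrow> j < CARD('n) \<Longrightarrow> i \<noteq> j \<Longrightarrow> P (e i) (e j) = 0"
    and P2: "\<And>i j. i < CARD('n) \<Longrightarrow> j < CARD('n) \<Longrightarrow> P (e i) (J (e j)) = 0"
    and P3: "\<And>i. i < CARD('n) \<Longrightarrow> P (e i) (e i) \<ge> 0"
  proof (rule takagi_frame[where P = P, OF inner_b b_J])
    show "linear (P u)" for u unfolding P_def[abs_def] by (rule b_lin)
    show "linear (\<lambda>u. P u w)" for w unfolding P_def using linear_compose[OF Ks(1) b_lin'] by (simp add: o_def)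
    show "P u w = P w u" for u w using Ks(3)[of w u] b_sym[of "Ks u" w] by (simp add: P_def)
    show "P (J u) (J w) = - P u w" for u w by (simp add: P_def Ks(2) linear_neg[OF b_lin'] b_J)
    fix e assume *: "unitary_frame b CARD('n) e" "\<And>i j. i < CARD('n) \<Longrightarrow> j < CARD('n) \<Longrightarrow> i \<noteq> j \<Longrightarrow> P (e i) (e j) = 0"
      "\<And>i j. i < CARD('n) \<Longrightarrow> j < CARD('n) \<Longrightarrow> P (e i) (J (e j)) = 0" "\<And>i. i < CARD('n) \<Longrightarrow> P (e i) (e i) \<ge> 0"
    show thesis by (rule that[of e]) (rule *; assumption)+
  qed
  define \<mu> where "\<mu> i = P (e i) (e i)" for i
  have \<mu>: "Ks (e i) = \<mu> i *\<^sub>R e i" if i: "i < CARD('n)" for i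
  proof -
    have "Ks (e i) = (\<Sum>j<CARD('n). P (e i) (e j) *\<^sub>R e j + P (e i) (J (e j)) *\<^sub>R J (e j))"
      using e unfolding unitary_frame_def P_def by blast
    also have "\<dots> = (\<Sum>j<CARD('n). if j = i then \<mu> i *\<^sub>R e i else 0)"
      by (rule sum.cong[OF refl]) (use i in \<open>auto simp: P1 P2 \<mu>_def\<close>)
    finally show ?thesis using i by simp
  qed
  define Ts where "Ts = (\<Sum>a<length ls. ls ! a * (\<Sum>j<CARD('n). b (curv_map e (\<Xi> a) Ks (e j)) (curv_map e (\<Xi> a) Ks (e j))))"
  define Ta where "Ta = (\<Sum>a<length ls. ls ! a * (\<Sum>j<CARD('n). b (curv_map e (\<Xi> a) Ka (e j)) (curv_map e (\<Xi> a) Ka (e j))))"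
  have "(\<Sum>a<length ls. ls ! a * (\<Sum>j<CARD('n). b (curv_map e (\<Xi> a) K (e j)) (curv_map e (\<Xi> a) K (e j)))) = Ts + Ta"
    unfolding Ts_def Ta_def sum.distrib[symmetric]
  proof (intro sum.cong refl)
    fix a assume "a \<in> {..<length ls}"
    then have a: "a < length ls" by simp
    \<comment> \<open>\<open>curv_map\<close> preserves symmetry and skewness: commuting with a skew
      map does, and so does composing an antilinear map with \<open>J\<close>. The cross terms in
      the norm of the sum therefore vanish.\<close>
    let ?N = "curv_map e (\<Xi> a) Ks" and ?M = "curv_map e (\<Xi> a) Ka"
    note ps = curv_map_props[OF Ks(1,2) Xi_linear Xi_J[OF a], of e] and pa = curv_map_props[OF Ka(1,2) Xi_linear Xi_J[OF a], of e]
    have "b (?N u) w = b u (?N w)" for u w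
    proof -
      have "b u (J (Ks w)) = b (J (Ks u)) w"
        by (simp add: b_J_left Ks(2,3) linear_neg[OF b_lin])
      then show ?thesis
        by (simp add: curv_map_def linear_add[OF b_lin'] linear_diff[OF b_lin'] linear_cmul[OF b_lin'] linear_add[OF b_lin]
          linear_diff[OF b_lin] linear_cmul[OF b_lin] Ks(3) Xi_skew[OF a])
    qed
    moreover have "b (?M u) w = - b u (?M w)" for u w
    proof -
      have "b u (J (Ka w)) = - b (J (Ka u)) w"
        by (simp add: b_J_left Ka(2,3) linear_neg[OF b_lin])
      then show ?thesis
        by (simp add: curv_map_def linear_add[OF b_lin'] linear_diff[OF b_lin'] linear_cmul[OF b_lin'] linear_add[OF b_lin]
          linear_diff[OF b_lin] linear_cmul[OF b_lin] Ka(3) Xi_skew[OF a])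
    qed
    ultimately have "(\<Sum>j<CARD('n). b (?N (e j)) (?M (e j))) = 0"
      by (intro symmetric_skew_orthogonal[OF _ _ _ _ _ _ e] ps pa)
    then have "ls ! a * (\<Sum>j<CARD('n). b (curv_map e (\<Xi> a) K (e j)) (curv_map e (\<Xi> a) K (e j)))
      = ls ! a * ((\<Sum>j<CARD('n). b (?N (e j)) (?N (e j))) + (\<Sum>j<CARD('n). b (?M (e j)) (?M (e j))))"
      by (simp add: split linear_add[OF b_lin] linear_add[OF b_lin'] sum.distrib sum_distrib_left[symmetric] b_sym[of "curv_map e (\<Xi> a) Ka _" "curv_map e (\<Xi> a) Ks _"])
    then show "ls ! a * (\<Sum>j<CARD('n). b (curv_map e (\<Xi> a) K (e j)) (curv_map e (\<Xi> a) K (e j)))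
      = ls ! a * (\<Sum>j<CARD('n). b (?N (e j)) (?N (e j))) + ls ! a * (\<Sum>j<CARD('n). b (?M (e j)) (?M (e j)))"
      by (simp only: distrib_left)
  qed
  then have "Ts + Ta \<le> 0" using le[OF e] by (simp add: K_def)
  moreover have s: "0 \<le> Ts" "Ts = 0 \<Longrightarrow> j < CARD('n) \<Longrightarrow> Ks (e j) = 0" for j
    unfolding Ts_def using symmetric_curvature_term[OF e Ks(2,3) \<mu> P3[folded \<mu>_def] n pos k(1)] by blast+
  moreover have t: "0 \<le> Ta" "Ta = 0 \<Longrightarrow> Ka u = 0" for u
    unfolding Ta_def using antisymmetric_curvature_term[OF e Ka pos k(2)] by blast+
  ultimately have 0: "Ts = 0" "Ta = 0" by linarith+
  have "Ks v = 0"
  proof -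
    have z: "Ks (e j) = 0" "Ks (J (e j)) = 0" if "j < CARD('n)" for j using s(2)[OF 0(1) that] by (simp_all add: Ks(2) linear_0[OF linear_J])
    have "v = (\<Sum>j<CARD('n). b v (e j) *\<^sub>R e j + b v (J (e j)) *\<^sub>R J (e j))"
      using e unfolding unitary_frame_def by blast
    from arg_cong[OF this, of Ks] show ?thesis
      by (simp add: linear_sum[OF Ks(1)] linear_add[OF Ks(1)] linear_cmul[OF Ks(1)] z)
  qed
  moreover have "Ka v = 0" by (rule t(2)[OF 0(2)])
  ultimately have "K v + H v = 0" "K v = H v" by (simp_all add: Ks_def Ka_def)
  then have "2 *\<^sub>R H v = 0" by (simp only: scaleR_2)
  then show "H v = 0" by simp
qed

end

context kahler_point
begin

theorem harmonic_zero_at_max: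
  assumes alt: "\<And>y. y \<in> S \<Longrightarrow> alternating CARD('n) (w y)" and w: "smooth_tensor CARD('n) w"
    and harm: "\<And>vs. hodge_laplacian g w x vs = 0" and type: "w x \<in> pq_covectors (CARD('n) - 1) 1"
    and max: "\<And>y. y \<in> S \<Longrightarrow> Re (tensor_ip (g y) CARD('n) (w y) (w y)) \<le> Re (tensor_ip b CARD('n) (w x) (w x))"
    and n: "3 \<le> CARD('n)" and pos: "(\<Sum>a<k. kahler_eigenvalues g x ! a) > 0"
    and k: "2 * real k \<le> (real CARD('n))\<^sup>2 - 2 * real CARD('n) + 2 + (if CARD('n) = 3 then 2 else real CARD('n))"
      "real k \<le> real CARD('n) * (real CARD('n) - 2)"
  shows "w x vs = 0"
proof -
  let ?ls = "kahler_eigenvalues g x"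
  have a: "alternating CARD('n) (w x)" by (rule alt[OF x])
  obtain \<Xi> where sp: "kahler_spectral S g x \<Xi> ?ls"
  proof (rule curvature_spectral)
    fix \<Xi> :: "nat \<Rightarrow> complex ^ 'n \<Rightarrow> complex ^ 'n"
    assume *: "sorted ?ls" "\<And>i. linear (\<Xi> i)"
      "\<And>i u v. i < length ?ls \<Longrightarrow> b (\<Xi> i u) v = - b u (\<Xi> i v)"
      "\<And>i v. i < length ?ls \<Longrightarrow> \<Xi> i (J v) = J (\<Xi> i v)"
      "\<And>i e. i < length ?ls \<Longrightarrow> unitary_frame b CARD('n) e \<Longrightarrow> (\<Sum>j<CARD('n). b (\<Xi> i (e j)) (\<Xi> i (e j))) = 1"
      "\<And>u v z w. riem g x u v z w = (\<Sum>i<length ?ls. ?ls ! i * (b (\<Xi> i u) v * b (\<Xi> i z) w))"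
      "\<And>u v z w. (\<Sum>i<length ?ls. b (\<Xi> i u) v * b (\<Xi> i z) w)
         = (b u z * b v w - b v z * b u w + b (J u) z * b (J v) w - b (J v) z * b (J u) w) / 2"
    show thesis
      by (rule that, rule kahler_spectral.intro[OF kahler_point_axioms], rule kahler_spectral_axioms.intro) (rule *; assumption)+
  qed
  interpret kahler_spectral S g x \<Xi> ?ls by (rule sp)
  note e0 = unitary_frame_frame
  obtain D where D: "cform CARD('n) D" "D (map frame [0..<CARD('n)]) = 1"
    by (rule volume_form_exists[OF inner_b b_J e0])
  have Dn: "D (map frame [0..<CARD('n)]) \<noteq> 0" using D(2) by simp
  have ty: "type_n1_1 CARD('n) (w x)" by (rule pq_covectors_type[OF type]) simp
  obtain H where H: "linear H" "\<And>v. H (J v) = - J (H v)" "\<And>vs. length vs = CARD('n) \<Longrightarrow> w x vs = act CARD('n) H D vs"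
  proof (rule antilinear_representation[OF inner_b b_J e0 a ty D(1) Dn])
    fix H assume *: "linear H" "\<And>v. H (J v) = - J (H v)" "\<And>vs. length vs = CARD('n) \<Longrightarrow> w x vs = act CARD('n) H D vs"
    show thesis by (rule that[of H]) (rule *; assumption)+
  qed
  have mD: "multilinear CARD('n) D" using D(1) by (simp add: cform_def)
  have Dpos: "0 < Re (tensor_ip b CARD('n) D D)"
  proof -
    have "Re (tensor_ip b CARD('n) D D) \<noteq> 0"
    proof
      assume "Re (tensor_ip b CARD('n) D D) = 0"
      from tensor_ip_eq_0[OF inner_b e0 mD this, of "map frame [0..<CARD('n)]"] Dn show False by simp
    qed
    then show ?thesis using tensor_ip_nonneg[OF inner_b e0 mD] by simp
  qed
  have bc: "(\<Sum>a<length ?ls. ?ls ! a * Re (tensor_ip b CARD('n) (act CARD('n) (\<Xi> a) (w x)) (act CARD('n) (\<Xi> a) (w x)))) \<le> 0"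
    by (rule bochner_curvature_term[OF alt w _ harm max Xi_linear Xi_skew riem_Xi]) (use n in simp_all)
  have "H v = 0" for v
  proof (rule antilinear_zero[OF H(1,2) n pos k])
    fix e assume e: "unitary_frame b CARD('n) e"
    \<comment> \<open>The volume form is normalized on the fixed frame, but the norm formula is
      applied in the frame \<open>e\<close>; a volume form that vanished there would vanish
      identically.\<close>
    have De: "D (map e [0..<CARD('n)]) \<noteq> 0"
    proof
      assume z: "D (map e [0..<CARD('n)]) = 0"
      have span: "\<exists>c. v = (\<Sum>i<CARD('n). c i *s e i)" for v by (rule exI[of _ "\<lambda>i. frame_coord b (e i) v"]) (rule frame_coord_expand[OF e])
      have "D (map frame [0..<CARD('n)]) = 0"
        by (rule cform_zero[OF D(1) z span]) simp
      then show False using Dn by simp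
    qed
    let ?N = "\<lambda>a. \<Sum>j<CARD('n). b (curv_map e (\<Xi> a) (adjoint_map H) (e j)) (curv_map e (\<Xi> a) (adjoint_map H) (e j))"
    have "(\<Sum>a<length ?ls. ?ls ! a * Re (tensor_ip b CARD('n) (act CARD('n) (\<Xi> a) (w x)) (act CARD('n) (\<Xi> a) (w x))))
      = (\<Sum>a<length ?ls. ?ls ! a * ?N a) * Re (tensor_ip b CARD('n) D D)"
      unfolding sum_distrib_right
    proof (rule sum.cong[OF refl])
      fix a assume "a \<in> {..<length ?ls}"
      then have a: "a < length ?ls" by simp
      have "Re (tensor_ip b CARD('n) (act CARD('n) (\<Xi> a) (w x)) (act CARD('n) (\<Xi> a) (w x))) = ?N a * Re (tensor_ip b CARD('n) D D)"
        by (rule act_norm[OF e D(1) De H(1,2) Xi_linear Xi_J[OF a] Xi_skew[OF a] H(3)])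
      then show "?ls ! a * Re (tensor_ip b CARD('n) (act CARD('n) (\<Xi> a) (w x)) (act CARD('n) (\<Xi> a) (w x)))
        = ?ls ! a * ?N a * Re (tensor_ip b CARD('n) D D)" by simp
    qed
    then show "(\<Sum>a<length ?ls. ?ls ! a * ?N a) \<le> 0"
      using bc Dpos by (simp add: mult_le_0_iff)
  qed
  then have "w x vs = 0" if "length vs = CARD('n)" for vs
    using that linear_0[OF multilinearD[OF mD that]] by (simp add: H(3) act_def)
  then show ?thesis using alternating_zero[OF a, of vs] by (cases "length vs = CARD('n)") auto
qed

end

subsection \<open>Globalization\<close>

lemma unitary_frame_image:
  fixes b b' :: "complex ^ 'n::finite \<Rightarrow> complex ^ 'n \<Rightarrow> real"
  assumes b: "inner_product b" "inner_product b'" and e: "unitary_frame b m e"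
    and L: "linear L" "\<And>v. L (J v) = J (L v)" "\<And>u v. b u v = b' (L u) (L v)"
  shows "unitary_frame b' m (\<lambda>i. L (e i))"
proof -
  have inj: "inj L"
    unfolding linear_injective_0[OF L(1)]
  proof (intro allI impI)
    fix v assume "L v = 0"
    then have "b v v = 0" using L(3)[of v v] linear_0[OF inner_productD(1)[OF b(2)]] by simp
    then show "v = 0" using inner_productD(4)[OF b(1), of v] by force
  qed
  have "v = (\<Sum>i<m. b' v (L (e i)) *\<^sub>R L (e i) + b' v (J (L (e i))) *\<^sub>R J (L (e i)))" for v
  proof -
    obtain u where v: "v = L u" using linear_inj_imp_surj[OF L(1) inj] by (metis surjD)
    have "u = (\<Sum>i<m. b u (e i) *\<^sub>R e i + b u (J (e i)) *\<^sub>R J (e i))"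
      using e unfolding unitary_frame_def by blast
    from arg_cong[OF this, of L] show ?thesis
      by (simp add: v linear_sum[OF L(1)] linear_add[OF L(1)] linear_cmul[OF L(1)] L(2,3))
  qed
  then show ?thesis using e unfolding unitary_frame_def L(3) L(2) by blast
qed

text \<open>An isometry commuting with \<open>J\<close> carries unitary frames to unitary frames,
  and in these the inner product is a plain sum.\<close>

lemma tensor_ip_pullback:
  fixes b b' :: "complex ^ 'n::finite \<Rightarrow> complex ^ 'n \<Rightarrow> real"
  assumes b: "inner_product b" "inner_product b'" and e: "unitary_frame b m e"
    and L: "linear L" "\<And>v. L (J v) = J (L v)" "\<And>u v. b u v = b' (L u) (L v)"
  shows "multilinear k w \<Longrightarrow> multilinear k w' \<Longrightarrow>
    tensor_ip b k (\<lambda>vs. w (map L vs)) (\<lambda>vs. w' (map L vs)) = tensor_ip b' k w w'"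
proof (induction k arbitrary: w w')
  case 0
  then show ?case by simp
next
  case (Suc k)
  have pb: "multilinear (Suc k) (\<lambda>vs. v (map L vs))" if v: "multilinear (Suc k) v" for v
    unfolding multilinear_def
  proof (intro allI impI)
    fix vs :: "(complex ^ 'n) list" and i assume "length vs = Suc k \<and> i < Suc k"
    then show "linear (\<lambda>u. v (map L (vs[i := u])))"
      using linear_compose[OF L(1) multilinearD[OF v, of "map L vs" i]] by (simp add: map_update o_def)
  qed
  have "tensor_ip b k (\<lambda>vs. w (L a # map L vs)) (\<lambda>vs. w' (L a # map L vs))
     = tensor_ip b' k (\<lambda>vs. w (L a # vs)) (\<lambda>vs. w' (L a # vs))" for a
    by (rule Suc.IH) (rule multilinear_tail, rule Suc.prems)+
  from this[of "e _"] this[of "J (e _)"] show ?case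
    unfolding tensor_ip_frame[OF b(1) e pb[OF Suc.prems(1)] pb[OF Suc.prems(2)]]
      tensor_ip_frame[OF b(2) unitary_frame_image[OF b e L] Suc.prems]
    by (simp add: L(2))
qed

lemma atlas_chart:
  fixes \<A> :: "('a, 'n::finite) chart set"
  assumes A: "complex_atlas X \<A>" and c: "c \<in> \<A>"
  shows "openin X (fst c)" "open (chart_image c)" "inj_on (snd c) (fst c)"
    "continuous_map (subtopology X (fst c)) (top_of_set (chart_image c)) (snd c)"
proof -
  show o: "openin X (fst c)" "open (chart_image c)" using A c unfolding complex_atlas_def by blast+
  have h: "homeomorphic_map (subtopology X (fst c)) (top_of_set (chart_image c)) (snd c)"
    using A c unfolding complex_atlas_def by blast
  have "topspace (subtopology X (fst c)) = fst c" using openin_subset[OF o(1)] by (simp add: inf_absorb2)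
  then show "inj_on (snd c) (fst c)" using homeomorphic_imp_injective_map[OF h] by simp
  show "continuous_map (subtopology X (fst c)) (top_of_set (chart_image c)) (snd c)"
    by (rule homeomorphic_imp_continuous_map[OF h])
qed

lemma kahler_chart_of_metric:
  assumes A: "complex_atlas X \<A>" and g: "kahler_metric \<A> g" and c: "c \<in> \<A>"
  shows "kahler_chart (chart_image c) (g c)"
proof
  have r: "riemannian_metric \<A> g" using g by (simp add: kahler_metric_def)
  show "open (chart_image c)" by (rule atlas_chart(2)[OF A c])
  show "inner_product (g c x)" if "x \<in> chart_image c" for x
    using r c that unfolding riemannian_metric_def by blast
  show "smooth_on_open (chart_image c) (\<lambda>x. g c x u v)" for u v
    using r c unfolding riemannian_metric_def by blast
  show "g c x (J u) (J v) = g c x u v" if "x \<in> chart_image c" for x u v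
    using g c that unfolding kahler_metric_def by blast
  show "ext_deriv (kahler_form (g c)) x [u, v, w] = 0" if "x \<in> chart_image c" for x u v w
    using g c that unfolding kahler_metric_def by blast
qed

text \<open>The derivative of a holomorphic transition map is such an isometry, by the
  transformation rule of the metric.\<close>

lemma norm_chart_independent:
  assumes A: "complex_atlas X \<A>" and g: "kahler_metric \<A> g" and w: "differential_form \<A> k \<omega>"
    and c: "c \<in> \<A>" "d \<in> \<A>" and p: "p \<in> fst c" "p \<in> fst d"
  shows "tensor_ip (g c (snd c p)) k (\<omega> c (snd c p)) (\<omega> c (snd c p)) = tensor_ip (g d (snd d p)) k (\<omega> d (snd d p)) (\<omega> d (snd d p))"
proof -
  let ?x = "snd c p" and ?y = "snd d p"
  define L where "L = dir_deriv (transition c d) ?x"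
  have x: "?x \<in> overlap c d" "?x \<in> chart_image c" "?y \<in> chart_image d" using p by (auto simp: overlap_def chart_image_def)
  have y: "transition c d ?x = ?y" using atlas_chart(3)[OF A c(1)] p by (simp add: transition_def)
  interpret C: kahler_point "chart_image c" "g c" ?x
    using kahler_chart_of_metric[OF A g c(1)] x(2) by (simp add: kahler_point_def kahler_point_axioms_def)
  interpret D: kahler_point "chart_image d" "g d" ?y
    using kahler_chart_of_metric[OF A g c(2)] x(3) by (simp add: kahler_point_def kahler_point_axioms_def)
  have "holomorphic_map_on (overlap c d) (transition c d)" using A c unfolding complex_atlas_def by blast
  then obtain M where M: "(transition c d has_derivative M) (at ?x)" "\<And>a v. M (a *s v) = a *s M v"
    using x(1) unfolding holomorphic_map_on_def by blast
  have "L = M" unfolding L_def dir_deriv_def[abs_def] frechet_derivative_at[OF M(1)] ..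
  then have L: "linear L" "L (J v) = J (L v)" for v
    using has_derivative_linear[OF M(1)] M(2) by (simp_all add: J_def)
  have ip: "g c ?x u v = g d ?y (L u) (L v)" for u v
  proof -
    have "\<forall>c\<in>\<A>. \<forall>d\<in>\<A>. \<forall>x\<in>overlap c d. \<forall>u v. g c x u v = g d (transition c d x)
          (dir_deriv (transition c d) x u) (dir_deriv (transition c d) x v)"
      using g unfolding kahler_metric_def riemannian_metric_def by (elim conjE)
    from bspec[OF bspec[OF bspec[OF this c(1)] c(2)] x(1)] show ?thesis by (simp add: y L_def)
  qed
  have w': "\<omega> c ?x vs = \<omega> d ?y (map L vs)" for vs
  proof -
    have "\<forall>c\<in>\<A>. \<forall>d\<in>\<A>. \<forall>x\<in>overlap c d. \<forall>vs.
        \<omega> c x vs = \<omega> d (transition c d x) (map (dir_deriv (transition c d) x) vs)"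
      using w unfolding differential_form_def by (elim conjE)
    from bspec[OF bspec[OF bspec[OF this c(1)] c(2)] x(1)] show ?thesis by (simp add: y L_def)
  qed
  have m: "multilinear k (\<omega> d ?y)"
    using w c(2) x(3) alternating_multilinear unfolding differential_form_def by blast
  have "\<omega> c ?x = (\<lambda>vs. \<omega> d ?y (map L vs))" using w' by (simp add: fun_eq_iff)
  then show ?thesis
    using tensor_ip_pullback[OF C.inner_b D.inner_b C.unitary_frame_frame L ip m m] by simp
qed

theorem harmonic_form_zero:
  fixes \<A> :: "('a, 'n::finite) chart set"
  assumes M: "closed_kahler_manifold X \<A> g" and w: "\<omega> \<in> harmonic_pq_forms \<A> g (CARD('n) - 1) 1"
    and n: "3 \<le> CARD('n)" and pos: "\<And>c x. c \<in> \<A> \<Longrightarrow> x \<in> chart_image c \<Longrightarrow> (\<Sum>a<k. kahler_eigenvalues (g c) x ! a) > 0"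
    and k: "2 * real k \<le> (real CARD('n))\<^sup>2 - 2 * real CARD('n) + 2 + (if CARD('n) = 3 then 2 else real CARD('n))"
      "real k \<le> real CARD('n) * (real CARD('n) - 2)"
  shows "\<omega> = 0"
proof -
  have A: "complex_atlas X \<A>" and g: "kahler_metric \<A> g" and cpt: "compact_space X"
    using M by (auto simp: closed_kahler_manifold_def kahler_manifold_def)
  have N: "CARD('n) - 1 + 1 = CARD('n)" using n by simp
  have df: "differential_form \<A> CARD('n) \<omega>"
    and type: "\<And>c x. c \<in> \<A> \<Longrightarrow> x \<in> chart_image c \<Longrightarrow> \<omega> c x \<in> pq_covectors (CARD('n) - 1) 1"
    and harm: "\<And>c x vs. c \<in> \<A> \<Longrightarrow> x \<in> chart_image c \<Longrightarrow> hodge_laplacian (g c) (\<omega> c) x vs = 0"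
    using w unfolding harmonic_pq_forms_def pq_form_def N by auto
  have alt: "alternating CARD('n) (\<omega> c x)" if "c \<in> \<A>" "x \<in> chart_image c" for c x
    using df that unfolding differential_form_def by blast
  have sm: "smooth_on_open (chart_image c) (\<lambda>x. \<omega> c x vs)" if "c \<in> \<A>" for c vs
    using df that unfolding differential_form_def by blast
  define f where "f c x = Re (tensor_ip (g c x) CARD('n) (\<omega> c x) (\<omega> c x))" for c x
  have pt: "kahler_point (chart_image c) (g c) x" if "c \<in> \<A>" "x \<in> chart_image c" for c x
    using kahler_chart_of_metric[OF A g that(1)] that(2) by (simp add: kahler_point_def kahler_point_axioms_def)
  have st: "metric_chart.smooth_tensor (chart_image c) CARD('n) (\<omega> c)" if c: "c \<in> \<A>" for c
  proof -
    interpret kahler_chart "chart_image c" "g c" by (rule kahler_chart_of_metric[OF A g c])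
    show ?thesis unfolding smooth_tensor_def using sm[OF c] alternating_multilinear[OF alt[OF c]] by blast
  qed
  \<comment> \<open>The squared norm is nonnegative, so it suffices to bound it by zero from
    above.\<close>
  have zero: "\<omega> c x vs = 0" if c: "c \<in> \<A>" "x \<in> chart_image c" and f0: "f c x \<le> 0" for c x vs
  proof -
    interpret kahler_point "chart_image c" "g c" x by (rule pt[OF c])
    note m = alternating_multilinear[OF alt[OF c]]
    have "f c x = 0" using f0 tensor_ip_nonneg[OF inner_b unitary_frame_frame m] by (simp add: f_def)
    then show ?thesis
      using tensor_ip_eq_0[OF inner_b unitary_frame_frame m, of vs] alternating_zero[OF alt[OF c], of vs]
      by (cases "length vs = CARD('n)") (simp_all add: f_def)
  qed
  have "f c x \<le> 0" if cx: "c \<in> \<A>" "x \<in> chart_image c" for c x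
  proof -
    have cm: "continuous_map (subtopology X (fst c)) euclideanreal (\<lambda>p. f c (snd c p))" if c: "c \<in> \<A>" for c
    proof -
      interpret kahler_chart "chart_image c" "g c" by (rule kahler_chart_of_metric[OF A g c])
      have "continuous_on (chart_image c) (f c)"
      proof (rule continuous_at_imp_continuous_on, rule ballI)
        fix x assume x: "x \<in> chart_image c"
        have "(\<lambda>y. tensor_ip (g c y) CARD('n) (\<omega> c y) (\<omega> c y)) differentiable (at x)"
          using tensor_ip_derivative[OF smooth_tensor_field[OF st[OF c]] smooth_tensor_field[OF st[OF c]] x] by blast
        then show "isCont (f c) x" unfolding f_def by (intro isCont_Re differentiable_imp_continuous_within)
      qed
      then have "continuous_map (top_of_set (chart_image c)) euclideanreal (f c)" by simp
      from continuous_map_compose[OF atlas_chart(4)[OF A c] this] show ?thesis by (simp add: o_def)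
    qed
    have cov: "topspace X \<subseteq> (\<Union>c\<in>\<A>. fst c)" using A unfolding complex_atlas_def by blast
    have ind: "f c (snd c p) = f d (snd d p)" if "c \<in> \<A>" "d \<in> \<A>" "p \<in> topspace X \<inter> fst c \<inter> fst d" for c d p
      using norm_chart_independent[OF A g df that(1,2)] that(3) by (simp add: f_def)
    \<comment> \<open>The squared norms in the charts glue to a continuous function on the compact
      space. Its global maximum is in particular a maximum within one chart, where the local
      argument applies.\<close>
    obtain G where G: "continuous_map X euclideanreal G"
      and Gf: "\<And>p c. c \<in> \<A> \<Longrightarrow> p \<in> topspace X \<inter> fst c \<Longrightarrow> G p = f c (snd c p)"
    proof (rule pasting_lemma_exists[where X = X and I = \<A> and T = fst and Y = euclideanreal and f = "\<lambda>c p. f c (snd c p)"])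
      show "topspace X \<subseteq> (\<Union>c\<in>\<A>. fst c)" by (rule cov)
      show "openin X (fst c)" if "c \<in> \<A>" for c by (rule atlas_chart(1)[OF A that])
      show "continuous_map (subtopology X (fst c)) euclideanreal (\<lambda>p. f c (snd c p))" if "c \<in> \<A>" for c by (rule cm[OF that])
      show "f c (snd c p) = f d (snd d p)" if "c \<in> \<A>" "d \<in> \<A>" "p \<in> topspace X \<inter> fst c \<inter> fst d" for c d p
        by (rule ind[OF that])
      fix G assume *: "continuous_map X euclideanreal G" "\<And>p c. c \<in> \<A> \<Longrightarrow> p \<in> topspace X \<inter> fst c \<Longrightarrow> G p = f c (snd c p)"
      show thesis by (rule that[of G]) (rule *; assumption)+
    qed
    have sub: "fst c \<subseteq> topspace X" if "c \<in> \<A>" for c by (rule openin_subset[OF atlas_chart(1)[OF A that]])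
    obtain p0 where p0: "p0 \<in> fst c" "x = snd c p0" using cx(2) unfolding chart_image_def by blast
    have "compact (G ` topspace X)"
      using image_compactin[OF _ G, of "topspace X"] cpt by (simp add: compact_space_def)
    moreover have "G ` topspace X \<noteq> {}" using p0(1) sub[OF cx(1)] by blast
    ultimately obtain p where p: "p \<in> topspace X" "\<And>q. q \<in> topspace X \<Longrightarrow> G q \<le> G p"
      using compact_attains_sup[of "G ` topspace X"] by blast
    obtain d where d: "d \<in> \<A>" "p \<in> fst d" using A p(1) unfolding complex_atlas_def by blast
    let ?y = "snd d p"
    have y: "?y \<in> chart_image d" using d(2) by (simp add: chart_image_def)
    interpret kahler_point "chart_image d" "g d" ?y by (rule pt[OF d(1) y])
    have "\<omega> d ?y vs = 0" for vs
    proof (rule harmonic_zero_at_max[OF alt[OF d(1)] st[OF d(1)] harm[OF d(1) y] type[OF d(1) y] _ n pos[OF d(1) y] k])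
      fix z assume "z \<in> chart_image d"
      then obtain q where q: "q \<in> fst d" "z = snd d q" unfolding chart_image_def by blast
      have "f d z \<le> f d ?y"
      proof -
        have "q \<in> topspace X" using q(1) sub[OF d(1)] by blast
        then show ?thesis using p(2)[of q] Gf[OF d(1), of q] Gf[OF d(1), of p] q d(2) p(1) by simp
      qed
      then show "Re (tensor_ip (g d z) CARD('n) (\<omega> d z) (\<omega> d z)) \<le> Re (tensor_ip (g d ?y) CARD('n) (\<omega> d ?y) (\<omega> d ?y))"
        by (simp add: f_def)
    qed
    then have "\<omega> d ?y = (\<lambda>vs. 0)" by (simp add: fun_eq_iff)
    then have "f d ?y = 0" by (simp add: f_def tensor_ip_zero)
    then have "G p = 0" using Gf[OF d(1), of p] d(2) p(1) by simp
    then have "G p0 \<le> 0" using p(2)[of p0] p0(1) sub[OF cx(1)] by auto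
    then show ?thesis using Gf[OF cx(1), of p0] p0 sub[OF cx(1)] by auto
  qed
  then have in_chart: "\<omega> c x vs = 0" if "c \<in> \<A>" "x \<in> chart_image c" for c x vs using zero[OF that] that by blast
  have "\<omega> c x vs = 0" for c x vs
  proof (cases "c \<in> \<A> \<and> x \<in> chart_image c")
    case True
    then show ?thesis using in_chart by blast
  next
    case False
    then show ?thesis using df unfolding differential_form_def by blast
  qed
  then show ?thesis by (simp add: fun_eq_iff)
qed

text \<open>A linearly independent set does not contain zero, so the supremum runs over the empty
  set alone.\<close>

lemma hodge_number_eq_0:
  assumes "\<And>\<omega>. \<omega> \<in> harmonic_pq_forms \<A> g p q \<Longrightarrow> \<omega> = 0"
  shows "hodge_number \<A> g p q = 0"
proof -
  interpret vector_space "form_scale :: complex \<Rightarrow> ('a, 'b) form \<Rightarrow> _" by (rule vector_space_form_scale)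
  have "B = {}" if "B \<subseteq> harmonic_pq_forms \<A> g p q" "\<not> dependent B" for B
    using that assms dependent_zero[of B] by blast
  then have "(\<lambda>B. enat (card B)) B \<le> 0" if "B \<in> {B. finite B \<and> B \<subseteq> harmonic_pq_forms \<A> g p q \<and> \<not> dependent B}" for B
    using that by (auto simp: zero_enat_def)
  then have "hodge_number \<A> g p q \<le> 0" unfolding hodge_number_def by (intro SUP_least)
  then show ?thesis by simp
qed

theorem theoremA:
  fixes X :: "'a topology"
    and \<A> :: "('a, 'n::finite) chart set"
    and g :: "('a, 'n) chart \<Rightarrow> (complex ^ 'n) metric"
    and n :: nat
  assumes "n = CARD('n)"
    and "closed_kahler_manifold X \<A> g"
  shows "(n \<ge> 4 \<and> kahler_curvature_positive \<A> g (((real n)^2 - real n + 2) / 2)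
            \<longrightarrow> hodge_number \<A> g (n - 1) 1 = 0)
       \<and> (n = 3 \<and> kahler_curvature_positive \<A> g 3
            \<longrightarrow> hodge_number \<A> g 2 1 = 0)"
proof (intro conjI impI; elim conjE)
  assume n: "n \<ge> 4" and pos: "kahler_curvature_positive \<A> g (((real n)^2 - real n + 2) / 2)"
  \<comment> \<open>The threshold is the integer \<open>j + 1\<close>, so the fractional term in
    \<open>kahler_curvature_positive\<close> has coefficient zero.\<close>
  have "even (n * (n - 1))" by (cases "even n") simp_all
  then obtain j where j: "n * (n - 1) = 2 * j" by blast
  have k: "((real n)^2 - real n + 2) / 2 = real (j + 1)"
  proof -
    have "real n * (real n - 1) = 2 * real j"
      using arg_cong[OF j, of real] n by (simp add: of_nat_diff)
    then show ?thesis by (simp add: power2_eq_square field_simps)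
  qed
  then have k2: "2 * real (j + 1) = (real n)\<^sup>2 - real n + 2" by simp
  have sq: "4 * real n \<le> (real n)\<^sup>2" using n by (simp add: power2_eq_square)
  have fl: "\<lfloor>real (j + 1)\<rfloor> = int (j + 1)" by (rule floor_of_nat)
  show "hodge_number \<A> g (n - 1) 1 = 0"
  proof (rule hodge_number_eq_0)
    fix \<omega> assume "\<omega> \<in> harmonic_pq_forms \<A> g (n - 1) 1"
    then show "\<omega> = 0"
      unfolding assms(1)
    proof (rule harmonic_form_zero[OF assms(2), where k = "j + 1"])
      show "3 \<le> CARD('n)" using n assms(1) by simp
      show "(\<Sum>a<j + 1. kahler_eigenvalues (g c) x ! a) > 0" if "c \<in> \<A>" "x \<in> chart_image c" for c x
        using pos that unfolding kahler_curvature_positive_def k fl by (simp del: of_nat_Suc of_nat_add)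
      show "2 * real (j + 1) \<le> (real CARD('n))\<^sup>2 - 2 * real CARD('n) + 2 + (if CARD('n) = 3 then 2 else real CARD('n))"
        using n unfolding k2 assms(1)[symmetric] by simp
      show "real (j + 1) \<le> real CARD('n) * (real CARD('n) - 2)"
      proof -
        \<comment> \<open>The skew bound amounts to \<open>3 * n + 2 \<le> n\<^sup>2\<close>, which
          holds from dimension 4 on and fails in dimension 3.\<close>
        have eq: "real n * (real n - 2) = (real n)\<^sup>2 - 2 * real n" by (simp add: power2_eq_square algebra_simps)
        have "4 \<le> real n" using n by simp
        have "a \<le> s - 2 * m" if "2 * a = s - m + 2" "4 * m \<le> s" "4 \<le> m" for a s m :: real using that by linarith
        from this[OF k2 sq \<open>4 \<le> real n\<close>] show ?thesis unfolding assms(1)[symmetric] eq .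
      qed
    qed
  qed
next
  assume n: "n = 3" and pos: "kahler_curvature_positive \<A> g 3"
  show "hodge_number \<A> g 2 1 = 0"
  proof (rule hodge_number_eq_0)
    fix \<omega> assume w: "\<omega> \<in> harmonic_pq_forms \<A> g 2 1"
    show "\<omega> = 0"
    \<comment> \<open>Here the symmetric bound reads 6 \<le> 7, while the skew bound 3 \<le> 3 is
      attained.\<close>
    proof (rule harmonic_form_zero[OF assms(2), where k = 3])
      show "\<omega> \<in> harmonic_pq_forms \<A> g (CARD('n) - 1) 1" using w n assms(1) by simp
      show "(\<Sum>a<3. kahler_eigenvalues (g c) x ! a) > 0" if "c \<in> \<A>" "x \<in> chart_image c" for c x
        using pos that unfolding kahler_curvature_positive_def by simp
    qed (use n assms(1) in simp_all)
  qed
qed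

end
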